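(* Let $\alpha>-\frac12$, let $k\ge2$ and $n\ge 1$ be integers, and let $F\in\mathrm{IGFR}(\alpha)$ have finite mean $\mu$ and finite variance $\sigma^2>0$. (i) Let $n=1$ and let $-\frac12<\alpha\le0$ or $0<\alpha\le 2k-1$. Put $$\beta^*=\begin{cases}\frac1{k(k-1)},&\alpha=0,\\ \frac1\alpha\left(1-\exp\left(-\frac{\alpha}{k(k-1)}\right)\right),&\alpha\ne0.\end{cases}$$ Then $$\mathbb{E}\frac{R^{(k)}_1-\mu}{\sigma}\le B_{\alpha,0}(\beta^* ),$$ where $B_{\alpha,0}\ge0$ and $$B^2_{\alpha,0}(\beta)=\frac{2k^4}{(2k-1)^3}\hat G^{(2k-1)}_2(\beta)-2\hat G^{(k)}_1(\beta)+W_\alpha(\beta)+(1-W_\alpha(\beta))\left[\hat g^{(k)}_1(\beta)-1\right]^2.$$ Equality is attained for the $\mathrm{IGFR}(\alpha)$ distribution function $F$ given by $$F^{-1}(W_\alpha(x))=\begin{cases}\dfrac{\sigma}{B_{\alpha,0}(\beta^* )}(\hat g^{(k)}_1(x)-1)+\mu,&0\le x<\beta^*,\\[2mm] \dfrac{\sigma}{B_{\alpha,0}(\beta^* )}(\hat g^{(k)}_1(\beta^* )-1)+\mu,&\beta^*\le x\le d.\end{cases}$$ (ii) Let either $-\frac12<\alpha\le0$ and $n\ge2$; or $\alpha>0$ and $n=1$ with $2\le k<\frac\alpha2+1$; or $\alpha>0$ and $n\ge2$. If $T_\alpha(b)<0$ and the set $\mathcal Y_\alpha=\{y\in(b,\beta_*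 ):\ Y_\alpha(y)\ge0,\ Z_\alpha(y)=0\}$ is nonempty, then with $y_*=\inf\mathcal Y_\alpha$ we have $$\mathbb{E}\frac{R^{(k)}_n-\mu}{\sigma}\le B_{\alpha,1}(y_*,\beta_* ),$$ where $B_{\alpha,1}\ge0$ and $$B^2_{\alpha,1}(y,\beta)=W_\alpha(y)\left[\hat g^{(k)}_n(y)-1\right]^2+(1-W_\alpha(\beta))\left[\hat g^{(k)}_n(\beta)-1\right]^2-2\lambda_\alpha(y)[\hat g^{(k)}_n(y)-1]\int_0^yW_\alpha(x)\,dx$$ $$+2\lambda^2_\alpha(y)\left[y\int_0^yW_\alpha(x)\,dx-\int_0^yxW_\alpha(x)\,dx\right]+\frac{k^{2(n+1)}(2n)!}{(n!)^2(2k-1)^{2n+1}}\left[\hat G^{(2k-1)}_{2n}(\beta)-\hat G^{(2k-1)}_{2n}(y)\right]$$ $$-2\left[\hat G^{(k)}_n(\beta)-\hat G^{(k)}_n(y)\right]+W_\alpha(\beta)-W_\alpha(y).$$ Equality is attained for the distributions $F\in\mathrm{IGFR}(\alpha)$ satisfying $$F^{-1}(W_\alpha(x))=\begin{cases}\dfrac{\sigma}{B_{\alpha,1}(y_*,\beta_* )}\left[\hat g^{(k)}_n(y_* )-1+\lambda_\alpha(y_* )(x-y_* )\right]+\mu,&0\le x<y_*,\\[2mm] \dfrac{\sigma}{B_{\alpha,1}(y_*,\beta_* )}\left(\hat g^{(k)}_n(x)-1\right)+\mu,&y_*\le x<\beta_*,\\[2mm] \dfrac{\sigma}{B_{\alpha,1}(y_*,\beta_*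 )}\left(\hat g^{(k)}_n(\beta_* )-1\right)+\mu,&\beta_*\le x<d.\end{cases}$$ Otherwise define, for $\beta_*\le y<d$, $$P_yh_\alpha(x)=\begin{cases}\dfrac{W_\alpha(y)-\hat G^{(k)}_n(y)}{1-W_\alpha(y)}\left(\dfrac{x-y}{\int_0^yW_\alpha(t)\,dt}+1\right),&0\le x<y,\\[2mm] \dfrac{W_\alpha(y)-\hat G^{(k)}_n(y)}{1-W_\alpha(y)},&y\le x<d,\end{cases}$$ with $$\|P_yh_\alpha\|^2_{W_\alpha}=\left(\frac{W_\alpha(y)-\hat G^{(k)}_n(y)}{(1-W_\alpha(y))\int_0^yW_\alpha(x)\,dx}\right)^2\left(2y\int_0^yW_\alpha(x)\,dx-2\int_0^yxW_\alpha(x)\,dx-\left(\int_0^yW_\alpha(x)\,dx\right)^2\right).$$ Let $\mathcal Z$ be the set of arguments $y\ge\beta_*$ satisfying $$\hat G^{(k)}_n(y)=W_\alpha(y)-(1-W_\alpha(y))\frac{\int_0^yW_\alpha(x)\,dx\left(\int_0^yW_\alpha(x)\,dx-\int_0^y\hat G^{(k)}_n(x)\,dx\right)}{\left(2y-\int_0^yW_\alpha(x)\,dx\right)\int_0^yW_\alpha(x)\,dx-2\int_0^yxW_\alpha(x)\,dx}.$$ Then $\mathcal Z$ is nonempty, the projection satisfies $P_\alpha h_\alpha(x)=P_{y^*}h_\alpha(x)$ for the unique $y^*=\arg\max_{y\in\mathcal Z}\|P_yh_\alpha\|_{W_\alpha}$, and $$\mathbb{E}\frac{R^{(k)}_n-\mu}{\sigma}\le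 B_{\alpha,2}(y^* ),$$ where $$B_{\alpha,2}(y^* )=\|P_{y^*}h_\alpha\|_{W_\alpha}=\frac{W_\alpha(y^* )-\hat G^{(k)}_n(y^* )}{(1-W_\alpha(y^* ))\int_0^{y^*}W_\alpha(x)\,dx}\sqrt{2y^*\int_0^{y^*}W_\alpha(x)\,dx-2\int_0^{y^*}xW_\alpha(x)\,dx-\left(\int_0^{y^*}W_\alpha(x)\,dx\right)^2}.$$ Equality is attained for the distributions $F\in\mathrm{IGFR}(\alpha)$ satisfying $$F^{-1}(W_\alpha(x))=\begin{cases}\dfrac{\sigma(W_\alpha(y^* )-\hat G^{(k)}_n(y^* ))}{(1-W_\alpha(y^* ))B_{\alpha,2}(y^* )}\left(\dfrac{x-y^*}{\int_0^{y^*}W_\alpha(t)\,dt}+1\right)+\mu,&0\le x<y^*,\\[2mm] \dfrac{\sigma(W_\alpha(y^* )-\hat G^{(k)}_n(y^* ))}{(1-W_\alpha(y^* ))B_{\alpha,2}(y^* )}+\mu,&y^*\le x<d.\end{cases}$$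
   Context: Records. Let $X_1,X_2,\dots$ be i.i.d. with distribution function $F$, mean $\mu$ and variance $\sigma^2$, and let $X_{1:j}\le\dots\le X_{j:j}$ be the order statistics of $X_1,\dots,X_j$. The $k$th record times are $T^{(k)}_0=k$, $T^{(k)}_n=\min\{j>T^{(k)}_{n-1}: X_j>X_{T^{(k)}_{n-1}+1-k:T^{(k)}_{n-1}}\}$, and the $k$th record values are $R^{(k)}_n=X_{T^{(k)}_n+1-k:T^{(k)}_n}$, $n=0,1,\dots$. With $F^{-1}$ the quantile function of $F$, the expectation of the record is evaluated by $\mathbb{E}R^{(k)}_n=\int_0^1F^{-1}(u)g^{(k)}_n(u)\,du$, where $$g^{(k)}_n(u)=\frac{k^{n+1}}{n!}[-\ln(1-u)]^n(1-u)^{k-1},\qquad G^{(k)}_n(u)=1-(1-u)^k\sum_{i=0}^n\frac{k^i}{i!}[-\ln(1-u)]^i,\quad 0<u<1.$$ Generalized Pareto distribution: for $\alpha\neq0$, $W_\alpha(x)=1-(1-\alpha x)^{1/\alpha}$, on $x\ge0$ if $\alpha<0$ and on $0\le x\le1/\alpha$ if $\alpha>0$; $W_0(x)=1-e^{-x}$, $x\ge0$. Put $d=\infty$ if $\alpha\le0$ and $d=1/\alpha$ if $\alpha>0$. The density of $W_\alpha$ is $w_\alpha$. $\mathrm{IGFR}(\alpha)$ is the class of distribution functions $F$ such that $F^{-1}\circ W_\alpha$ is concave on the support of $W_\alpha$. Notation: $\hat g^{(k)}_n=g^{(k)}_n\circ W_\alpha$, $\hat G^{(k)}_n=G^{(k)}_n\circ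 W_\alpha$, $h_\alpha=\hat g^{(k)}_n-1$. $\|f\|_{W_\alpha}=(\int_0^d|f(x)|^2w_\alpha(x)\,dx)^{1/2}$ is the norm of $L^2_{W_\alpha}$, the space of functions on $[0,d)$ square integrable with respect to $w_\alpha$, and $P_\alpha h_\alpha$ is the projection of $h_\alpha$ in $L^2_{W_\alpha}$ onto the convex cone of nondecreasing concave functions in $L^2_{W_\alpha}$. Further, $$\lambda_\alpha(y)=\frac{\hat g^{(k)}_n(y)\int_0^yW_\alpha(x)\,dx-\int_0^y\hat G^{(k)}_n(x)\,dx}{2y\int_0^yW_\alpha(x)\,dx-2\int_0^yxW_\alpha(x)\,dx},$$ $$Y_\alpha(y)=\lambda_\alpha(y)-h_\alpha'(y)=\lambda_\alpha(y)-w_\alpha(y)\frac{k^{n+1}}{(k-1)^n}\left(\hat g^{(k-1)}_{n-1}(y)-\hat g^{(k-1)}_n(y)\right),$$ $$Z_\alpha(y)=\hat G^{(k)}_n(y)-W_\alpha(y)\hat g^{(k)}_n(y)+\lambda_\alpha(y)\int_0^yW_\alpha(x)\,dx,$$ $$T_\alpha(\beta)=(1-W_\alpha(\beta))\left[-\frac1k\sum_{i=0}^{n-1}\hat g^{(k)}_i(\beta)+\left(1-\frac1k\right)\hat g^{(k)}_n(\beta)\right],\quad\beta\in(0,d).$$ In case (ii), there are $0<b<c<d$ such that $h_\alpha$ is strictly convex increasing on $(0,b)$, strictly concave increasing on $(b,c)$ and strictly decreasing on $(c,d)$; $b$ and $c$ denote these points, and $\beta_*$ denotes the unique zero of $T_\alpha$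 in $(0,c)$.
   Formalization: In (i), for 2k-2<α≤2k-1 the extremal F is not in IGFR(α), so its membership is claimed only for α≤2k-2 (bound and attainment by that F are kept). In (ii), y* is the argmax over those y in Z for which P_y h is nondecreasing and concave, as the argmax over all of Z can fail to give the projection. *)

theory Defs
  imports "HOL-Probability.Probability"
begin

section \<open>Order statistics and $k$th records\<close>

definition order_stat :: "(nat \<Rightarrow> real) \<Rightarrow> nat \<Rightarrow> nat \<Rightarrow> real" where
  "order_stat x i j = sort (map x [1..<Suc j]) ! (i - 1)"

text \<open>
  If the present \<open>k\<close>th record value is never exceeded again, the record time stays where it is, and
  so does the record value.  Distribution functions with an atom at the right end of the support
  (in particular the extremal ones below) make this happen with positive probability.  The record
  value is then the right end of the support, which is the value in agreement with the formula
  \<open>E R = \<integral>\<^sub>0\<^sup>1 F\<^sup>-\<^sup>1(u) g(u) du\<close>.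
\<close>

primrec record_time :: "nat \<Rightarrow> (nat \<Rightarrow> real) \<Rightarrow> nat \<Rightarrow> nat" where
  "record_time k x 0 = k"
| "record_time k x (Suc n) =
    (let t = record_time k x n; S = {j. t < j \<and> order_stat x (t + 1 - k) t < x j}
     in if S = {} then t else (LEAST j. j \<in> S))"

definition record_value :: "nat \<Rightarrow> nat \<Rightarrow> (nat \<Rightarrow> real) \<Rightarrow> real" where
  "record_value k n x = order_stat x (record_time k x n + 1 - k) (record_time k x n)"

definition iid_sequence :: "'a measure \<Rightarrow> (nat \<Rightarrow> 'a \<Rightarrow> real) \<Rightarrow> (real \<Rightarrow> real) \<Rightarrow> bool" where
  "iid_sequence M X F \<longleftrightarrow> prob_space M \<and> prob_space.indep_vars M (\<lambda>_. borel) X {1..} \<and>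
     (\<forall>i\<ge>1. cdf (distr M borel (X i)) = F)"

definition has_mean_variance :: "'a measure \<Rightarrow> ('a \<Rightarrow> real) \<Rightarrow> real \<Rightarrow> real \<Rightarrow> bool" where
  "has_mean_variance M Z m v \<longleftrightarrow> integrable M Z \<and> integrable M (\<lambda>\<omega>. (Z \<omega>)\<^sup>2) \<and>
     prob_space.expectation M Z = m \<and> prob_space.variance M Z = v"

definition standardized_record ::
  "'a measure \<Rightarrow> (nat \<Rightarrow> 'a \<Rightarrow> real) \<Rightarrow> nat \<Rightarrow> nat \<Rightarrow> real \<Rightarrow> real \<Rightarrow> real" where
  "standardized_record M X k n \<mu> \<sigma> =
     prob_space.expectation M (\<lambda>\<omega>. (record_value k n (\<lambda>i. X i \<omega>) - \<mu>) / \<sigma>)"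

definition rec_dens :: "nat \<Rightarrow> nat \<Rightarrow> real \<Rightarrow> real" where
  "rec_dens k n u = real k ^ (n + 1) / fact n * (- ln (1 - u)) ^ n * (1 - u) ^ (k - 1)"

definition rec_cdf :: "nat \<Rightarrow> nat \<Rightarrow> real \<Rightarrow> real" where
  "rec_cdf k n u = 1 - (1 - u) ^ k * (\<Sum>i\<le>n. real k ^ i / fact i * (- ln (1 - u)) ^ i)"


section \<open>Generalized Pareto distributions and the classes IGFR\<close>

definition gp_cdf :: "real \<Rightarrow> real \<Rightarrow> real" where
  "gp_cdf \<alpha> x = (if \<alpha> = 0 then 1 - exp (- x) else 1 - (1 - \<alpha> * x) powr (1 / \<alpha>))"

definition gp_dens :: "real \<Rightarrow> real \<Rightarrow> real" where
  "gp_dens \<alpha> x = (if \<alpha> = 0 then exp (- x) else (1 - \<alpha> * x) powr (1 / \<alpha> - 1))"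

definition gp_end :: "real \<Rightarrow> ereal" where
  "gp_end \<alpha> = (if \<alpha> \<le> 0 then \<infinity> else ereal (1 / \<alpha>))"

definition gp_supp :: "real \<Rightarrow> real set" where
  "gp_supp \<alpha> = {x. 0 \<le> x \<and> ereal x \<le> gp_end \<alpha>}"

definition gp_dom :: "real \<Rightarrow> real set" where
  "gp_dom \<alpha> = {x. 0 \<le> x \<and> ereal x < gp_end \<alpha>}"

definition gp_int :: "real \<Rightarrow> real set" where
  "gp_int \<alpha> = {x. 0 < x \<and> ereal x < gp_end \<alpha>}"

text \<open>
  The condition \<open>0 < F x\<close> is redundant for \<open>u > 0\<close>.  At \<open>u = 0\<close> it gives the left end of the
  support, i.e. the right limit of the quantile function, if that is finite.
\<close>

definition quantile :: "(real \<Rightarrow> real) \<Rightarrow> real \<Rightarrow> real" where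
  "quantile F u = Inf {x. 0 < F x \<and> u \<le> F x}"

text \<open>
  Concavity is required in the interior of the support of the generalized Pareto distribution.
  The quantile function is monotone, so this is the same as concavity of the extended real valued
  function on the whole support; the value at \<open>0\<close> may be \<open>-\<infinity>\<close>.
\<close>

definition IGFR :: "real \<Rightarrow> (real \<Rightarrow> real) set" where
  "IGFR \<alpha> = {F. (\<exists>D. real_distribution D \<and> F = cdf D) \<and>
                 concave_on (gp_int \<alpha>) (quantile F \<circ> gp_cdf \<alpha>)}"


section \<open>Projection in the weighted \<open>L\<^sup>2\<close> space\<close>

definition gp_L2 :: "real \<Rightarrow> (real \<Rightarrow> real) set" where
  "gp_L2 \<alpha> = {f. set_borel_measurable lborel (gp_dom \<alpha>) f \<and>
                 set_integrable lborel (gp_dom \<alpha>) (\<lambda>x. \<bar>f x\<bar>\<^sup>2 * gp_dens \<alpha> x)}"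

definition gp_norm :: "real \<Rightarrow> (real \<Rightarrow> real) \<Rightarrow> real" where
  "gp_norm \<alpha> f = sqrt (LINT x:gp_dom \<alpha>|lborel. \<bar>f x\<bar>\<^sup>2 * gp_dens \<alpha> x)"

text \<open>The value at \<open>0\<close> plays no role in \<open>L\<^sup>2\<close>, hence monotonicity and concavity in the interior.\<close>

definition gp_cone :: "real \<Rightarrow> (real \<Rightarrow> real) set" where
  "gp_cone \<alpha> = {f \<in> gp_L2 \<alpha>. mono_on (gp_int \<alpha>) f \<and> concave_on (gp_int \<alpha>) f}"

definition is_gp_projection :: "real \<Rightarrow> (real \<Rightarrow> real) \<Rightarrow> (real \<Rightarrow> real) \<Rightarrow> bool" where
  "is_gp_projection \<alpha> f p \<longleftrightarrow> p \<in> gp_cone \<alpha> \<and>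
     (\<forall>q\<in>gp_cone \<alpha>. gp_norm \<alpha> (\<lambda>x. f x - p x) \<le> gp_norm \<alpha> (\<lambda>x. f x - q x))"


section \<open>Auxiliary functions\<close>

definition ghat :: "real \<Rightarrow> nat \<Rightarrow> nat \<Rightarrow> real \<Rightarrow> real" where
  "ghat \<alpha> k n x = rec_dens k n (gp_cdf \<alpha> x)"

definition Ghat :: "real \<Rightarrow> nat \<Rightarrow> nat \<Rightarrow> real \<Rightarrow> real" where
  "Ghat \<alpha> k n x = rec_cdf k n (gp_cdf \<alpha> x)"

definition hfun :: "real \<Rightarrow> nat \<Rightarrow> nat \<Rightarrow> real \<Rightarrow> real" where
  "hfun \<alpha> k n x = ghat \<alpha> k n x - 1"

definition intW :: "real \<Rightarrow> real \<Rightarrow> real" where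
  "intW \<alpha> y = integral {0..y} (gp_cdf \<alpha>)"

definition intxW :: "real \<Rightarrow> real \<Rightarrow> real" where
  "intxW \<alpha> y = integral {0..y} (\<lambda>x. x * gp_cdf \<alpha> x)"

definition intG :: "real \<Rightarrow> nat \<Rightarrow> nat \<Rightarrow> real \<Rightarrow> real" where
  "intG \<alpha> k n y = integral {0..y} (Ghat \<alpha> k n)"

definition lam :: "real \<Rightarrow> nat \<Rightarrow> nat \<Rightarrow> real \<Rightarrow> real" where
  "lam \<alpha> k n y = (ghat \<alpha> k n y * intW \<alpha> y - intG \<alpha> k n y) / (2 * y * intW \<alpha> y - 2 * intxW \<alpha> y)"

definition Yfun :: "real \<Rightarrow> nat \<Rightarrow> nat \<Rightarrow> real \<Rightarrow> real" where
  "Yfun \<alpha> k n y = lam \<alpha> k n y - deriv (hfun \<alpha> k n) y"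

definition Zfun :: "real \<Rightarrow> nat \<Rightarrow> nat \<Rightarrow> real \<Rightarrow> real" where
  "Zfun \<alpha> k n y = Ghat \<alpha> k n y - gp_cdf \<alpha> y * ghat \<alpha> k n y + lam \<alpha> k n y * intW \<alpha> y"

definition Tfun :: "real \<Rightarrow> nat \<Rightarrow> nat \<Rightarrow> real \<Rightarrow> real" where
  "Tfun \<alpha> k n \<beta> = (1 - gp_cdf \<alpha> \<beta>) *
     (- (1 / real k) * (\<Sum>i<n. ghat \<alpha> k i \<beta>) + (1 - 1 / real k) * ghat \<alpha> k n \<beta>)"

definition strictly_convex_on :: "real set \<Rightarrow> (real \<Rightarrow> real) \<Rightarrow> bool" where
  "strictly_convex_on S f \<longleftrightarrow> (\<forall>x\<in>S. \<forall>y\<in>S. \<forall>t. x \<noteq> y \<longrightarrow> 0 < t \<longrightarrow> t < 1 \<longrightarrow>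
     f ((1 - t) * x + t * y) < (1 - t) * f x + t * f y)"

definition strictly_concave_on :: "real set \<Rightarrow> (real \<Rightarrow> real) \<Rightarrow> bool" where
  "strictly_concave_on S f \<longleftrightarrow> strictly_convex_on S (\<lambda>x. - f x)"

text \<open>These conditions determine \<open>b\<close> and \<open>c\<close> uniquely.\<close>

definition shape_points :: "real \<Rightarrow> nat \<Rightarrow> nat \<Rightarrow> real \<Rightarrow> real \<Rightarrow> bool" where
  "shape_points \<alpha> k n b c \<longleftrightarrow> 0 < b \<and> b < c \<and> ereal c < gp_end \<alpha> \<and>
     strictly_convex_on {0<..<b} (hfun \<alpha> k n) \<and> strict_mono_on {0<..<b} (hfun \<alpha> k n) \<and>
     strictly_concave_on {b<..<c} (hfun \<alpha> k n) \<and> strict_mono_on {b<..<c} (hfun \<alpha> k n) \<and>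
     strict_antimono_on {x. c < x \<and> ereal x < gp_end \<alpha>} (hfun \<alpha> k n)"


section \<open>The bounds and the extremal functions\<close>

definition beta0 :: "real \<Rightarrow> nat \<Rightarrow> real" where
  "beta0 \<alpha> k = (if \<alpha> = 0 then 1 / (real k * (real k - 1))
                 else 1 / \<alpha> * (1 - exp (- (\<alpha> / (real k * (real k - 1))))))"

definition B0 :: "real \<Rightarrow> nat \<Rightarrow> real \<Rightarrow> real" where
  "B0 \<alpha> k \<beta> = sqrt (2 * real k ^ 4 / (2 * real k - 1) ^ 3 * Ghat \<alpha> (2 * k - 1) 2 \<beta>
     - 2 * Ghat \<alpha> k 1 \<beta> + gp_cdf \<alpha> \<beta> + (1 - gp_cdf \<alpha> \<beta>) * (ghat \<alpha> k 1 \<beta> - 1)\<^sup>2)"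

definition phi0 :: "real \<Rightarrow> nat \<Rightarrow> real \<Rightarrow> real \<Rightarrow> real" where
  "phi0 \<alpha> k \<beta> x = (if x < \<beta> then ghat \<alpha> k 1 x - 1 else ghat \<alpha> k 1 \<beta> - 1)"

definition Yset :: "real \<Rightarrow> nat \<Rightarrow> nat \<Rightarrow> real \<Rightarrow> real \<Rightarrow> real set" where
  "Yset \<alpha> k n b \<beta> = {y \<in> {b<..<\<beta>}. Yfun \<alpha> k n y \<ge> 0 \<and> Zfun \<alpha> k n y = 0}"

definition B1 :: "real \<Rightarrow> nat \<Rightarrow> nat \<Rightarrow> real \<Rightarrow> real \<Rightarrow> real" where
  "B1 \<alpha> k n y \<beta> = sqrt (
       gp_cdf \<alpha> y * (ghat \<alpha> k n y - 1)\<^sup>2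
     + (1 - gp_cdf \<alpha> \<beta>) * (ghat \<alpha> k n \<beta> - 1)\<^sup>2
     - 2 * lam \<alpha> k n y * (ghat \<alpha> k n y - 1) * intW \<alpha> y
     + 2 * (lam \<alpha> k n y)\<^sup>2 * (y * intW \<alpha> y - intxW \<alpha> y)
     + real k ^ (2 * (n + 1)) * fact (2 * n) / ((fact n)\<^sup>2 * (2 * real k - 1) ^ (2 * n + 1))
         * (Ghat \<alpha> (2 * k - 1) (2 * n) \<beta> - Ghat \<alpha> (2 * k - 1) (2 * n) y)
     - 2 * (Ghat \<alpha> k n \<beta> - Ghat \<alpha> k n y)
     + gp_cdf \<alpha> \<beta> - gp_cdf \<alpha> y)"

definition phi1 :: "real \<Rightarrow> nat \<Rightarrow> nat \<Rightarrow> real \<Rightarrow> real \<Rightarrow> real \<Rightarrow> real" where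
  "phi1 \<alpha> k n y \<beta> x =
     (if x < y then ghat \<alpha> k n y - 1 + lam \<alpha> k n y * (x - y)
      else if x < \<beta> then ghat \<alpha> k n x - 1
      else ghat \<alpha> k n \<beta> - 1)"

definition Pfun :: "real \<Rightarrow> nat \<Rightarrow> nat \<Rightarrow> real \<Rightarrow> real \<Rightarrow> real" where
  "Pfun \<alpha> k n y x =
     (if x < y then (gp_cdf \<alpha> y - Ghat \<alpha> k n y) / (1 - gp_cdf \<alpha> y) * ((x - y) / intW \<alpha> y + 1)
      else (gp_cdf \<alpha> y - Ghat \<alpha> k n y) / (1 - gp_cdf \<alpha> y))"

text \<open>
  The equation says that the ray of \<open>Pfun y\<close> carries the least squares fit.  It may also have
  solutions with \<open>gp_cdf y < Ghat y\<close>, where \<open>Pfun y\<close> is decreasing and so not in the cone.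
\<close>

definition Zset :: "real \<Rightarrow> nat \<Rightarrow> nat \<Rightarrow> real \<Rightarrow> real set" where
  "Zset \<alpha> k n \<beta> = {y. \<beta> \<le> y \<and> ereal y < gp_end \<alpha> \<and>
     Ghat \<alpha> k n y = gp_cdf \<alpha> y - (1 - gp_cdf \<alpha> y) *
       (intW \<alpha> y * (intW \<alpha> y - intG \<alpha> k n y) / ((2 * y - intW \<alpha> y) * intW \<alpha> y - 2 * intxW \<alpha> y))}"

definition B2 :: "real \<Rightarrow> nat \<Rightarrow> nat \<Rightarrow> real \<Rightarrow> real" where
  "B2 \<alpha> k n y = (gp_cdf \<alpha> y - Ghat \<alpha> k n y) / ((1 - gp_cdf \<alpha> y) * intW \<alpha> y) *
     sqrt (2 * y * intW \<alpha> y - 2 * intxW \<alpha> y - (intW \<alpha> y)\<^sup>2)"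

definition extremal_on ::
  "real set \<Rightarrow> real \<Rightarrow> real \<Rightarrow> real \<Rightarrow> real \<Rightarrow> (real \<Rightarrow> real) \<Rightarrow> (real \<Rightarrow> real) \<Rightarrow> bool" where
  "extremal_on S \<alpha> \<mu> \<sigma> B \<phi> F \<longleftrightarrow> (\<forall>x\<in>S. quantile F (gp_cdf \<alpha> x) = \<sigma> / B * \<phi> x + \<mu>)"

text \<open>
  The class is a parameter since for \<open>n = 1\<close> and \<open>2 k - 2 < \<alpha> \<le> 2 k - 1\<close> the extremal distribution
  exists but is not IGFR: \<open>hfun\<close> is then strictly convex in a right neighbourhood of \<open>0\<close>.
\<close>

definition bound_attained ::
  "(real \<Rightarrow> real) set \<Rightarrow> real set \<Rightarrow> real \<Rightarrow> nat \<Rightarrow> nat \<Rightarrow> real \<Rightarrow> real \<Rightarrow> real \<Rightarrow> (real \<Rightarrow> real) \<Rightarrow> bool"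
  where
  "bound_attained \<F> S \<alpha> k n \<mu> \<sigma> B \<phi> \<longleftrightarrow>
     (\<exists>F\<in>\<F>. \<exists>(N :: (nat \<Rightarrow> real) measure) Y.
        iid_sequence N Y F \<and> has_mean_variance N (Y 1) \<mu> (\<sigma>\<^sup>2) \<and> extremal_on S \<alpha> \<mu> \<sigma> B \<phi> F \<and>
        integrable N (\<lambda>\<omega>. record_value k n (\<lambda>i. Y i \<omega>)) \<and> standardized_record N Y k n \<mu> \<sigma> = B)"

end

theory Submission
  imports Defs "HOL-Real_Asymp.Real_Asymp"
begin

text \<open>
  The indicator of a jump at time \<open>j + 1\<close> is, given the last observation, symmetric in the first
  \<open>j\<close> observations, so by exchangeability the number of earlier jumps is independent of the
  order statistics.  Summing the densities of the \<open>k\<close>th largest observations over the possible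
  record times gives a power series in \<open>u\<close>, which is that of the record density; its total mass
  \<open>1\<close> shows that uniform records never end.  A sequence with distribution function \<open>F\<close> is a
  monotone transform of a uniform one, hence \<open>(E R - \<mu>) / \<sigma>\<close> is the inner product of \<open>h\<close> with the
  standardized quantile function composed with \<open>W\<close>, an element of norm \<open>1\<close> of the cone.

  If \<open>p\<close> is in the cone, \<open>h - p\<close> is orthogonal to \<open>p\<close>, and \<open>h - p\<close> has nonpositive inner products
  with the cone, then \<open>\<parallel>p\<parallel>\<close> is the sharp bound, and \<open>p\<close> is the projection.  The last property
  follows from sign changes of \<open>h - p\<close>: beyond \<open>\<beta>\<close> the residual has mean \<open>0\<close> and is first positive,
  then negative, and on \<open>{0..y}\<close> it is orthogonal to affine functions and negative exactly on an
  interval.  If there is no such \<open>p\<close> with three pieces, the intermediate value theorem yields one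
  with two pieces.
\<close>

section \<open>Laws of records\<close>

subsection \<open>Record times and jumps\<close>

text \<open>An extremal distribution has an atom at its right end, so a record may never be
  exceeded. Passing from uniform variables to \<open>F\<close> therefore requires that a quantile
  function which is flat on an interval stays flat; concavity gives this for IGFR laws, the
  construction gives it for extremal ones. Shape questions are asked in the hazard coordinate s,
  where \<open>ghat\<close> is a multiple of s^n exp(-(k - 1) s) and d/dx is exp(\<alpha> s) d/ds. A
  line through (y, h y) with residual orthogonal to affine functions on (0, y] obeys two equations:
  one gives the slope \<open>lam\<close>, the other is \<open>Zfun\<close> = 0; \<open>Yfun\<close>
  \<ge> 0 makes the joint at y concave. If the line ends at the tail mean instead, one equation
  gives the slope and the other defines \<open>Zset\<close>. At y = \<beta> both families meet:
  without a solution of the first kind \<open>Zfun\<close> is nonpositive there, which starts the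
  intermediate value argument for the second. For n = 1 the projection is onto the larger cone of
  nondecreasing functions; this gives the bound even where the extremal law is not IGFR.\<close>

lemma sorted_nth_less_iff:
  fixes ys :: "real list"
  assumes "sorted ys" "i < length ys"
  shows "ys ! i < v \<longleftrightarrow> length (filter (\<lambda>x. v \<le> x) ys) < length ys - i"
proof -
  have fin: "finite {l. l < length ys \<and> v \<le> ys ! l}" by simp
  show ?thesis
  proof
    assume "ys ! i < v"
    then have "{l. l < length ys \<and> v \<le> ys ! l} \<subseteq> {i<..<length ys}"
      using assms sorted_nth_mono[of ys] by (force simp: not_less[symmetric])
    then have "card {l. l < length ys \<and> v \<le> ys ! l} \<le> card {i<..<length ys}"
      by (intro card_mono) auto
    then show "length (filter (\<lambda>x. v \<le> x) ys) < length ys - i"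
      using assms by (simp add: length_filter_conv_card)
  next
    assume *: "length (filter (\<lambda>x. v \<le> x) ys) < length ys - i"
    show "ys ! i < v"
    proof (rule ccontr)
      assume "\<not> ys ! i < v"
      then have "{i..<length ys} \<subseteq> {l. l < length ys \<and> v \<le> ys ! l}"
        using assms sorted_nth_mono[of ys i] by (auto simp: not_less intro: order_trans[of v])
      then have "card {i..<length ys} \<le> card {l. l < length ys \<and> v \<le> ys ! l}"
        by (intro card_mono fin)
      with * show False by (simp add: length_filter_conv_card)
    qed
  qed
qed

text \<open>The \<open>k\<close>th largest of the first \<open>t\<close> observations; a record
  value is this quantity at the record time.\<close>

definition kmax :: "nat \<Rightarrow> nat \<Rightarrow> (nat \<Rightarrow> real) \<Rightarrow> real" where
  "kmax k t x = order_stat x (t + 1 - k) t"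

text \<open>Counting exceedances replaces sorting: measurability, symmetry and the effect of one
  more observation are all read off from this equivalence.\<close>

lemma kmax_less_iff:
  assumes "1 \<le> k" "k \<le> t"
  shows "kmax k t x < v \<longleftrightarrow> card {l\<in>{1..t}. v \<le> x l} < k"
proof -
  have "length (filter (\<lambda>y. v \<le> y) (sort (map x [1..<Suc t]))) = length (filter (\<lambda>l. v \<le> x l) [1..<Suc t])"
    by (simp add: filter_sort filter_map o_def)
  also have "\<dots> = card {l\<in>{1..t}. v \<le> x l}"
    by (subst distinct_length_filter) (auto intro!: arg_cong[where f=card])
  finally show ?thesis
    unfolding kmax_def order_stat_def using assms
    by (subst sorted_nth_less_iff) auto
qed

text \<open>A real number is determined by the set of reals above it; testing with each of the two
  values gives both inequalities.\<close>

lemma kmax_eqI: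
  assumes "1 \<le> k" "k \<le> t" "k \<le> s"
    and "\<And>v. card {l\<in>{1..t}. v \<le> x l} < k \<longleftrightarrow> card {l\<in>{1..s}. v \<le> y l} < k"
  shows "kmax k t x = kmax k s y"
proof -
  have "kmax k t x < v \<longleftrightarrow> kmax k s y < v" for v
    unfolding kmax_less_iff[OF assms(1,2)] kmax_less_iff[OF assms(1,3)] by (rule assms(4))
  from this[of "kmax k t x"] this[of "kmax k s y"] show ?thesis by simp
qed

lemma kmax_permute:
  assumes "1 \<le> k" "k \<le> t" "\<pi> permutes {1..t}"
  shows "kmax k t (x \<circ> \<pi>) = kmax k t x"
proof (rule kmax_eqI)
  fix v
  have "bij_betw \<pi> {l\<in>{1..t}. v \<le> (x \<circ> \<pi>) l} {l\<in>{1..t}. v \<le> x l}"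
  proof (rule bij_betwI')
    fix y assume y: "y \<in> {l\<in>{1..t}. v \<le> x l}"
    then show "\<exists>z\<in>{l\<in>{1..t}. v \<le> (x \<circ> \<pi>) l}. y = \<pi> z"
      using permutes_inverses[OF assms(3)] permutes_in_image[OF permutes_inv[OF assms(3)], of y]
      by (intro bexI[of _ "inv \<pi> y"]) auto
  qed (use assms(3) permutes_in_image[OF assms(3)] in \<open>auto simp: permutes_inj inj_eq\<close>)
  then show "card {l\<in>{1..t}. v \<le> (x \<circ> \<pi>) l} < k \<longleftrightarrow> card {l\<in>{1..t}. v \<le> x l} < k"
    by (simp add: bij_betw_same_card)
qed (use assms in auto)

lemma kmax_cong:
  assumes "\<And>l. 1 \<le> l \<Longrightarrow> l \<le> t \<Longrightarrow> x l = y l"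
  shows "kmax k t x = kmax k t y"
proof -
  have "map x [1..<Suc t] = map y [1..<Suc t]" using assms by auto
  then show ?thesis unfolding kmax_def order_stat_def by (simp only:)
qed

text \<open>Sorting commutes with a monotone map: the image of the sorted list is sorted and has the
  right multiset.\<close>

lemma kmax_compose_mono:
  assumes "1 \<le> k" "k \<le> t" "mono_on S Q" "\<And>l. 1 \<le> l \<Longrightarrow> l \<le> t \<Longrightarrow> x l \<in> S"
  shows "kmax k t (Q \<circ> x) = Q (kmax k t x)" "kmax k t x \<in> S"
proof -
  let ?xs = "map x [1..<Suc t]"
  have set: "set ?xs \<subseteq> S" using assms(4) by auto
  then have "sorted (map Q (sort ?xs))"
    using assms(3) unfolding sorted_map
    by (intro sorted_wrt_mono_rel[OF _ sorted_sort]) (auto simp: mono_on_def subset_eq simp del: upt_Suc)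
  moreover have "mset (map Q (sort ?xs)) = mset (map Q ?xs)" by (simp only: mset_map mset_sort)
  ultimately have "sort (map Q ?xs) = map Q (sort ?xs)"
    by (metis properties_for_sort)
  moreover have "t - k < length ?xs" using assms by simp
  ultimately show "kmax k t (Q \<circ> x) = Q (kmax k t x)"
    unfolding kmax_def order_stat_def using assms(1,2) by (simp del: upt_Suc)
  have "sort ?xs ! (t - k) \<in> set (sort ?xs)" using assms by (intro nth_mem) simp
  then show "kmax k t x \<in> S" using set assms(1,2) unfolding kmax_def order_stat_def by auto
qed

text \<open>The level is that of the preceding \<open>i - 1\<close> observations, without reference
  to record times. Since \<open>kmax\<close> is frozen between records, the jumps are the times of
  new records.\<close>

definition jump :: "nat \<Rightarrow> (nat \<Rightarrow> real) \<Rightarrow> nat \<Rightarrow> bool" where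
  "jump k x i \<longleftrightarrow> kmax k (i - 1) x < x i"

definition jumps :: "nat \<Rightarrow> (nat \<Rightarrow> real) \<Rightarrow> nat \<Rightarrow> nat" where
  "jumps k x j = card {i\<in>{k<..j}. jump k x i}"

lemma jump_cong:
  assumes "\<And>l. 1 \<le> l \<Longrightarrow> l \<le> i \<Longrightarrow> x l = y l" "1 \<le> i"
  shows "jump k x i = jump k y i"
proof -
  have "kmax k (i - 1) x = kmax k (i - 1) y" using assms by (intro kmax_cong) auto
  then show ?thesis unfolding jump_def using assms by auto
qed

lemma jumps_cong:
  assumes "\<And>l. 1 \<le> l \<Longrightarrow> l \<le> j \<Longrightarrow> x l = y l" "1 \<le> k"
  shows "jumps k x j = jumps k y j"
proof -
  have "jump k x i = jump k y i" if "i \<in> {k<..j}" for i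
    using that assms by (intro jump_cong) auto
  then show ?thesis unfolding jumps_def by (intro arg_cong[where f=card]) auto
qed

lemma jumps_Suc:
  assumes "k \<le> j"
  shows "jumps k x (Suc j) = jumps k x j + (if jump k x (Suc j) then 1 else 0)"
proof -
  have "{i\<in>{k<..Suc j}. jump k x i} =
     (if jump k x (Suc j) then insert (Suc j) {i\<in>{k<..j}. jump k x i} else {i\<in>{k<..j}. jump k x i})"
    using assms by (auto simp: le_Suc_eq)
  then show ?thesis unfolding jumps_def by simp
qed

lemma jumps_self [simp]: "jumps k x k = 0"
  unfolding jumps_def by simp

text \<open>An observation not above the \<open>k\<close>th largest adds an exceedance only at
  levels that already had at least \<open>k\<close> of them.\<close>

lemma kmax_no_jump:
  assumes "1 \<le> k" "k < i" "\<not> jump k x i"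
  shows "kmax k i x = kmax k (i - 1) x"
proof (rule kmax_eqI)
  fix v
  obtain j where j: "i = Suc j" using assms by (cases i) auto
  let ?A = "{l\<in>{1..j}. v \<le> x l}"
  have eq: "{l\<in>{1..i}. v \<le> x l} = (if v \<le> x i then insert i ?A else ?A)"
    unfolding j by (auto simp: le_Suc_eq)
  have "card ?A \<ge> k" if "v \<le> x i"
    using assms that kmax_less_iff[of k j x v] unfolding jump_def j by auto
  then show "card {l\<in>{1..i}. v \<le> x l} < k \<longleftrightarrow> card {l\<in>{1..i-1}. v \<le> x l} < k"
    unfolding eq unfolding j by auto
qed (use assms in auto)

lemma kmax_no_jumps:
  assumes "1 \<le> k" "k \<le> t" "t \<le> j" "\<And>i. t < i \<Longrightarrow> i \<le> j \<Longrightarrow> \<not> jump k x i"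
  shows "kmax k j x = kmax k t x"
  using assms(3,4)
proof (induction j rule: dec_induct)
  case (step j)
  then show ?case using kmax_no_jump[of k "Suc j" x] assms by simp
qed simp

lemma record_time_ge: "k \<le> record_time k x n"
proof (induction n)
  case (Suc n)
  let ?t = "record_time k x n"
  let ?S = "{j. ?t < j \<and> order_stat x (?t + 1 - k) ?t < x j}"
  show ?case
  proof (cases "?S = {}")
    case False
    then obtain j where "j \<in> ?S" by blast
    then have "(LEAST j. j \<in> ?S) \<in> ?S" by (rule LeastI)
    then have "?t < (LEAST j. j \<in> ?S)" by simp
    then show ?thesis using Suc False by (simp add: Let_def)
  qed (use Suc in \<open>simp add: Let_def\<close>)
qed simp

lemma record_time_next:
  assumes "1 \<le> k" and t: "record_time k x n = t" "t < j" "jump k x j"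
    and no: "\<And>i. t < i \<Longrightarrow> i < j \<Longrightarrow> \<not> jump k x i"
  shows "record_time k x (Suc n) = j"
proof -
  let ?S = "{j. t < j \<and> kmax k t x < x j}"
  have kt: "k \<le> t" using record_time_ge t by metis
  have const: "kmax k (i - 1) x = kmax k t x" if "t < i" "i \<le> j" for i
    using that by (intro kmax_no_jumps assms(1) kt no) auto
  have "j \<in> ?S" using const[of j] t unfolding jump_def by simp
  moreover have "j \<le> i" if "i \<in> ?S" for i
    using that const[of i] no[of i] unfolding jump_def by (metis (no_types, lifting) linorder_not_less mem_Collect_eq less_imp_le_nat)
  ultimately have "(LEAST j. j \<in> ?S) = j" "?S \<noteq> {}" by (blast intro!: Least_equality)+
  then show ?thesis unfolding kmax_def record_time.simps t(1) Let_def by (simp only: if_False)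
qed

text \<open>Induction on the number of earlier jumps; the latest of them is the preceding record
  time.\<close>

lemma record_time_jump:
  assumes "1 \<le> k" "k < j" "jump k x j" "jumps k x (j - 1) = n"
  shows "record_time k x (Suc n) = j"
  using assms(2-)
proof (induction n arbitrary: j)
  case 0
  then have "{i\<in>{k<..j-1}. jump k x i} = {}" unfolding jumps_def by simp
  then show ?case using 0 assms(1) by (intro record_time_next[of k x 0 k]) auto
next
  case (Suc n)
  let ?J = "{i\<in>{k<..j-1}. jump k x i}"
  have ne: "?J \<noteq> {}" "finite ?J" using Suc.prems unfolding jumps_def by (auto simp del: Collect_empty_eq)
  define i where "i = Max ?J"
  have i: "i \<in> ?J" unfolding i_def using ne by (intro Max_in)
  have "?J = insert i {l\<in>{k<..i-1}. jump k x l}"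
  proof (intro equalityI subsetI)
    fix l assume l: "l \<in> ?J"
    then have "l \<le> i" unfolding i_def using ne by (intro Max_ge)
    then show "l \<in> insert i {l\<in>{k<..i-1}. jump k x l}" using l by auto
  qed (use i in auto)
  moreover have "card (insert i {l\<in>{k<..i-1}. jump k x l}) = Suc (jumps k x (i - 1))"
    unfolding jumps_def using i by (intro card_insert_disjoint) auto
  ultimately have "card ?J = Suc (jumps k x (i - 1))" by (simp only:)
  then have "jumps k x (i - 1) = n" using Suc.prems unfolding jumps_def by simp
  then have "record_time k x (Suc n) = i" using i by (intro Suc.IH) auto
  moreover have "\<not> jump k x l" if "i < l" "l < j" for l
  proof
    assume "jump k x l"
    then have "l \<in> ?J" using that i by auto
    then have "l \<le> i" unfolding i_def using ne by (intro Max_ge)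
    with that show False by simp
  qed
  ultimately show ?case using Suc.prems i assms(1) by (intro record_time_next[of k x "Suc n" i]) auto
qed

text \<open>Without a further exceedance the record time stays put, so the record value of the transformed
  sequence agrees with the transformed record value even after the maximum has been reached.\<close>

lemma record_value_compose_mono:
  assumes k: "1 \<le> k" and Q: "mono_on S Q" and x: "\<And>l. 1 \<le> l \<Longrightarrow> x l \<in> S"
    and flat: "\<And>u v w. u \<in> S \<Longrightarrow> v \<in> S \<Longrightarrow> w \<in> S \<Longrightarrow> u < v \<Longrightarrow> Q u = Q v \<Longrightarrow> u \<le> w \<Longrightarrow> Q w = Q u"
  shows "record_value k n (Q \<circ> x) = Q (record_value k n x)"
proof -
  define t s where "t = record_time k x" and "s = record_time k (Q \<circ> x)"
  \<comment> \<open>\<open>top y\<close> means that no transformed observation can exceed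
    \<open>y\<close>.\<close>
  define top where "top y \<longleftrightarrow> (\<forall>w\<in>S. Q w \<le> y)" for y
  have ts: "k \<le> t n" "k \<le> s n" for n unfolding t_def s_def by (rule record_time_ge)+
  have kQ: "kmax k j (Q \<circ> x) = Q (kmax k j x)" "kmax k j x \<in> S" if "k \<le> j" for j
    using kmax_compose_mono[OF k that Q] x by auto
  have step: "f (Suc n) = (let S = {j. f n < j \<and> kmax k (f n) y < y j} in if S = {} then f n else (LEAST j. j \<in> S))"
    if "f = record_time k y" for f y n unfolding that kmax_def by (simp add: Let_def)
  \<comment> \<open>The record times agree until both record values have reached the largest value
    of \<open>Q\<close>. Afterwards the times may drift apart, but the values stay equal.\<close>
  have "(s n = t n \<or> (top (kmax k (s n) (Q \<circ> x)) \<and> top (Q (kmax k (t n) x))))" for n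
  proof (induction n)
    case 0 show ?case by (simp add: s_def t_def)
  next
    case (Suc n)
    have mono: "kmax k (f n) y \<le> kmax k (f (Suc n)) y" if f: "f = record_time k y" for f y n
    proof -
      let ?A = "{j. f n < j \<and> kmax k (f n) y < y j}"
      have "f n \<le> f (Suc n)" 
      proof (cases "?A = {}")
        case False
        then have "(LEAST j. j \<in> ?A) \<in> ?A" by (metis LeastI ex_in_conv)
        then have "f n < (LEAST j. j \<in> ?A)" by simp
        then show ?thesis using False unfolding step[OF f] Let_def by auto
      qed (simp add: step[OF f] Let_def)
      moreover have "k \<le> f n" unfolding f by (rule record_time_ge)
      ultimately have "\<not> kmax k (f (Suc n)) y < kmax k (f n) y"
        using kmax_less_iff[of k "f n" y "kmax k (f n) y"] kmax_less_iff[of k "f (Suc n)" y "kmax k (f n) y"] k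
        using card_mono[of "{l \<in> {1..f (Suc n)}. kmax k (f n) y \<le> y l}" "{l \<in> {1..f n}. kmax k (f n) y \<le> y l}"]
        by fastforce
      then show ?thesis by simp
    qed
    show ?case
    proof (cases "top (kmax k (s n) (Q \<circ> x)) \<and> top (Q (kmax k (t n) x))")
      case True
      have "kmax k (s n) (Q \<circ> x) \<le> kmax k (s (Suc n)) (Q \<circ> x)" using mono s_def by blast
      moreover have "Q (kmax k (t n) x) \<le> Q (kmax k (t (Suc n)) x)"
        using mono[OF t_def, of n] kQ(2)[OF ts(1)] Q by (meson monotone_onD)
      moreover have up: "top b" if "top a" "a \<le> b" for a b using that unfolding top_def by (blast intro: order.trans)
      ultimately show ?thesis using True up[of "kmax k (s n) (Q \<circ> x)" "kmax k (s (Suc n)) (Q \<circ> x)"]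
          up[of "Q (kmax k (t n) x)" "Q (kmax k (t (Suc n)) x)"] by blast
    next
      case False
      then have eq: "s n = t n" using Suc by blast
      let ?u = "kmax k (t n) x"
      have uS: "?u \<in> S" using kQ(2)[OF ts(1)] .
      have nt: "\<not> top (Q ?u)" using False kQ(1)[OF ts(1), of n] eq by auto
      \<comment> \<open>Below the top, \<open>flat\<close> excludes \<open>Q ?u = Q (x j)\<close>
        for \<open>?u < x j\<close>, so \<open>Q\<close> preserves and reflects exceedances of the
        current level.\<close>
      have "Q ?u < Q (x j) \<longleftrightarrow> ?u < x j" if "t n < j" for j
      proof -
        have xS: "x j \<in> S" using ts(1)[of n] that by (intro x) auto
        have "Q ?u \<noteq> Q (x j)" if "?u < x j"
        proof
          assume e: "Q ?u = Q (x j)"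
          have "Q w \<le> Q ?u" if "w \<in> S" for w
          proof (cases "?u \<le> w")
            case True then show ?thesis using flat[OF uS xS \<open>w \<in> S\<close> \<open>?u < x j\<close> e] by simp
          next
            case False then show ?thesis using Q uS that by (auto simp: mono_on_def)
          qed
          then show False using nt unfolding top_def by blast
        qed
        moreover have "?u \<le> x j \<Longrightarrow> Q ?u \<le> Q (x j)" "x j \<le> ?u \<Longrightarrow> Q (x j) \<le> Q ?u"
          using Q uS xS by (auto simp: mono_on_def)
        ultimately show ?thesis by (metis linorder_not_less order_le_less)
      qed
      then have "{j. t n < j \<and> Q ?u < Q (x j)} = {j. t n < j \<and> ?u < x j}" by blast
      then have "s (Suc n) = t (Suc n)"
        unfolding step[OF s_def] step[OF t_def] eq using kQ(1)[OF ts(1), of n] by simp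
      then show ?thesis by simp
    qed
  qed
  then consider "s n = t n" | "top (kmax k (s n) (Q \<circ> x))" "top (Q (kmax k (t n) x))" by blast
  then have "kmax k (s n) (Q \<circ> x) = Q (kmax k (t n) x)"
  proof cases
    case 1 then show ?thesis using kQ(1)[OF ts(1)] by simp
  next
    case 2 then show ?thesis unfolding kQ(1)[OF ts(2)] top_def using kQ(2)[OF ts(1)] kQ(2)[OF ts(2)]
      by (blast intro: order.antisym)
  qed
  then show ?thesis unfolding record_value_def s_def t_def kmax_def by simp
qed

section \<open>Uniform samples: null sets and measurability\<close>

definition unif :: "real measure" where
  "unif = uniform_measure lborel {0<..<1}"

lemma sets_unif [simp, measurable_cong]: "sets unif = sets borel"
  and space_unif [simp]: "space unif = UNIV"
  unfolding unif_def by simp_all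

lemma prob_space_unif: "prob_space unif"
  unfolding unif_def by (rule prob_space_uniform_measure) auto

interpretation unif: prob_space unif
  by (rule prob_space_unif)

interpretation unif_prod: product_prob_space "\<lambda>_. unif" I for I :: "nat set"
  by standard

lemma nn_integral_unif:
  "f \<in> borel_measurable borel \<Longrightarrow> (\<integral>\<^sup>+x. f x \<partial>unif) = (\<integral>\<^sup>+x\<in>{0<..<1}. f x \<partial>lborel)"
  unfolding unif_def by (subst nn_integral_uniform_measure) (auto simp: divide_ennreal_def)

lemma AE_unif: "AE x in unif. 0 < x \<and> x < 1"
  unfolding unif_def by (rule AE_uniform_measureI) auto

lemma emeasure_unif_single: "emeasure unif {a} = 0"
proof -
  have "emeasure lborel ({0<..<1} \<inter> {a}) \<le> emeasure lborel {a}" by (intro emeasure_mono) auto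
  then have "emeasure lborel ({0<..<1} \<inter> {a}) = 0" by simp
  then show ?thesis unfolding unif_def by (subst emeasure_uniform_measure) auto
qed

lemma emeasure_unif_atLeast: "0 < u \<Longrightarrow> u < 1 \<Longrightarrow> emeasure unif {u..} = ennreal (1 - u)"
proof -
  assume "0 < u" "u < 1"
  then have "{0<..<1} \<inter> {u..} = {u..<1}" by auto
  then show ?thesis using \<open>u < 1\<close> unfolding unif_def
    by (subst emeasure_uniform_measure) (auto simp: divide_ennreal_def)
qed

lemma emeasure_unif_lessThan: "0 < u \<Longrightarrow> u < 1 \<Longrightarrow> emeasure unif {..<u} = ennreal u"
proof -
  assume "0 < u" "u < 1"
  then have "{0<..<1} \<inter> {..<u} = {0<..<u}" by auto
  then show ?thesis using \<open>0 < u\<close> unfolding unif_def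
    by (subst emeasure_uniform_measure) (auto simp: divide_ennreal_def)
qed

abbreviation unif_pow :: "nat \<Rightarrow> (nat \<Rightarrow> real) measure" where
  "unif_pow j \<equiv> Pi\<^sub>M {1..j} (\<lambda>_. unif)"

lemma sets_PiM_unif [measurable_cong]: "sets (Pi\<^sub>M I (\<lambda>_::nat. unif)) = sets (Pi\<^sub>M I (\<lambda>_. borel))"
  by (intro sets_PiM_cong) auto

text \<open>Cardinalities written as sums of indicators are accessible to measurability
  reasoning.\<close>

lemma card_filter_sum: "finite A \<Longrightarrow> of_nat (card {l\<in>A. P l}) = (\<Sum>l\<in>A. if P l then 1 else 0 :: 'b :: semiring_1)"
  by (simp add: sum.If_cases Int_def)

lemma measurable_kmax [measurable]:
  assumes "1 \<le> k" "k \<le> t" "{1..t} \<subseteq> I"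
  shows "kmax k t \<in> borel_measurable (Pi\<^sub>M I (\<lambda>_. borel))"
proof (subst borel_measurable_iff_less, intro allI)
  fix v
  have [measurable]: "(\<lambda>x. x l) \<in> borel_measurable (Pi\<^sub>M I (\<lambda>_. borel))" if "l \<in> {1..t}" for l
    using that assms by (intro measurable_component_singleton) auto
  have "{x\<in>space (Pi\<^sub>M I (\<lambda>_. borel)). kmax k t x < v} =
      {x\<in>space (Pi\<^sub>M I (\<lambda>_. borel)). (\<Sum>l\<in>{1..t}. if v \<le> x l then 1 else 0) < real k}"
    by (simp add: kmax_less_iff[OF assms(1,2)] card_filter_sum[symmetric])
  also have "\<dots> \<in> sets (Pi\<^sub>M I (\<lambda>_. borel))" by measurable
  finally show "{x\<in>space (Pi\<^sub>M I (\<lambda>_. borel)). kmax k t x < v} \<in> sets (Pi\<^sub>M I (\<lambda>_. borel))" .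
qed

lemma measurable_jump [measurable]:
  assumes "1 \<le> k" "k < i" "{1..i} \<subseteq> I"
  shows "Measurable.pred (Pi\<^sub>M I (\<lambda>_. borel)) (\<lambda>x. jump k x i)"
proof -
  have "{1..i - 1} \<subseteq> {1..i}" by auto
  then have [measurable]: "kmax k (i - 1) \<in> borel_measurable (Pi\<^sub>M I (\<lambda>_. borel))"
    using assms by (intro measurable_kmax) (simp, simp, blast)
  have [measurable]: "(\<lambda>x. x i) \<in> borel_measurable (Pi\<^sub>M I (\<lambda>_. borel))"
    using assms by (intro measurable_component_singleton) auto
  show ?thesis unfolding jump_def by measurable
qed

lemma measurable_jumps [measurable]:
  assumes "1 \<le> k" "{1..j} \<subseteq> I"
  shows "Measurable.pred (Pi\<^sub>M I (\<lambda>_. borel)) (\<lambda>x. jumps k x j = m)"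
proof (cases "k \<le> j")
  case True
  then show ?thesis using assms(2)
  proof (induction j arbitrary: m rule: dec_induct)
    case (step j)
    have [measurable]: "Measurable.pred (Pi\<^sub>M I (\<lambda>_. borel)) (\<lambda>x. jump k x (Suc j))"
      using step assms by (intro measurable_jump) auto
    have [measurable]: "Measurable.pred (Pi\<^sub>M I (\<lambda>_. borel)) (\<lambda>x. jumps k x j = m)" for m
      using step.prems by (intro step.IH) auto
    have "(jumps k x (Suc j) = m) \<longleftrightarrow>
       (jump k x (Suc j) \<and> 0 < m \<and> jumps k x j = m - 1) \<or> (\<not> jump k x (Suc j) \<and> jumps k x j = m)" for x
      unfolding jumps_Suc[OF step.hyps(1)] by auto
    then show ?case by simp
  qed simp
next
  case False
  then show ?thesis unfolding jumps_def by simp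
qed

lemma measurable_record_time [measurable]:
  assumes "1 \<le> k"
  shows "(\<lambda>x. record_time k x n) \<in> measurable (Pi\<^sub>M {1..} (\<lambda>_. borel)) (count_space UNIV)"
proof (induction n)
  case (Suc n)
  note Suc [measurable]
  let ?M = "Pi\<^sub>M {1..} (\<lambda>_::nat. borel :: real measure)"
  \<comment> \<open>Coordinates start at 1 and \<open>kmax\<close> is known to be measurable only
    from time \<open>k\<close> on. The maxima here and below make both expressions total and change
    nothing at the arguments that occur.\<close>
  have comp [measurable]: "(\<lambda>x. x (max 1 l)) \<in> borel_measurable ?M" for l
    by (intro measurable_component_singleton) auto
  have km [measurable]: "kmax k (max k t) \<in> borel_measurable ?M" for t
    using assms by (intro measurable_kmax) auto
  have eq: "record_time k x (Suc n) =
     (let t = max k (record_time k x n); Q = (\<lambda>j. t < j \<and> kmax k (max k t) x < x (max 1 j))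
      in if \<exists>j. Q j then (LEAST j. Q j) else t)" for x
  proof -
    have "max k (record_time k x n) = record_time k x n"
      using record_time_ge[of k x n] by simp
    moreover have "(t < j \<and> y < x (max 1 j)) = (t < j \<and> y < x j)" for t j y
      by (cases j) auto
    ultimately show ?thesis
      using record_time_ge[of k x n] by (auto simp: Let_def kmax_def)
  qed
  have "(\<lambda>x. let Q = (\<lambda>j. t < j \<and> kmax k (max k t) x < x (max 1 j))
      in if \<exists>j. Q j then (LEAST j. Q j) else t) \<in> measurable ?M (count_space UNIV)" for t
    unfolding Let_def by measurable
  then show ?case unfolding eq Let_def by (rule measurable_compose_countable) measurable
qed simp

lemma measurable_record_value [measurable]:
  assumes "1 \<le> k"
  shows "record_value k n \<in> borel_measurable (Pi\<^sub>M {1..} (\<lambda>_. borel))"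
proof -
  have km [measurable]: "kmax k (max k t) \<in> borel_measurable (Pi\<^sub>M {1..} (\<lambda>_. borel))" for t
    using assms by (intro measurable_kmax) auto
  have "record_value k n x = kmax k (max k (record_time k x n)) x" for x
    using record_time_ge[of k x n] by (simp add: record_value_def kmax_def)
  then have eq: "record_value k n = (\<lambda>x. kmax k (max k (record_time k x n)) x)" by blast
  show ?thesis unfolding eq
    by (rule measurable_compose_countable[where g="\<lambda>x. record_time k x n"])
      (use assms in measurable)
qed

subsection \<open>Exchangeability\<close>

lemma nn_integral_permute:
  assumes "\<pi> permutes {1..j}" "f \<in> borel_measurable (unif_pow j)"
  shows "(\<integral>\<^sup>+x. f (x \<circ> \<pi>) \<partial>unif_pow j) = (\<integral>\<^sup>+x. f x \<partial>unif_pow j)"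
proof -
  have *: "distr (unif_pow j) (unif_pow j) (\<lambda>\<omega>. \<lambda>n\<in>{1..j}. \<omega> (\<pi> n)) = unif_pow j"
    using distr_PiM_reindex[of "{1..j}" "\<lambda>_. unif" \<pi> "{1..j}"] assms(1) permutes_in_image[OF assms(1)]
    by (auto simp: prob_space_unif permutes_inj_on)
  have m: "(\<lambda>\<omega>. \<lambda>n\<in>{1..j}. \<omega> (\<pi> n)) \<in> measurable (unif_pow j) (unif_pow j)"
  proof (rule measurable_restrict)
    fix i assume "i \<in> {1..j}"
    then have "\<pi> i \<in> {1..j}" using permutes_in_image[OF assms(1)] by blast
    then show "(\<lambda>\<omega>. \<omega> (\<pi> i)) \<in> measurable (unif_pow j) unif" by (rule measurable_component_singleton)
  qed
  have "(\<integral>\<^sup>+x. f x \<partial>unif_pow j) = (\<integral>\<^sup>+x. f (\<lambda>n\<in>{1..j}. x (\<pi> n)) \<partial>unif_pow j)"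
    using assms(2) m by (subst *[symmetric], subst nn_integral_distr) simp_all
  also have "\<dots> = (\<integral>\<^sup>+x. f (x \<circ> \<pi>) \<partial>unif_pow j)"
  proof (rule nn_integral_cong)
    fix x assume "x \<in> space (unif_pow j)"
    then have "(\<lambda>n\<in>{1..j}. x (\<pi> n)) = x \<circ> \<pi>"
      using permutes_not_in[OF assms(1)]
      by (auto simp: space_PiM PiE_def extensional_def restrict_def fun_eq_iff)
    then show "f (\<lambda>n\<in>{1..j}. x (\<pi> n)) = f (x \<circ> \<pi>)" by simp
  qed
  finally show ?thesis by simp
qed

lemma insert_interval: "insert (Suc j) {1..j} = {1..Suc j}" "Suc j \<notin> {1..j}"
  by auto

lemma measurable_proj_unif: "l \<in> I \<Longrightarrow> (\<lambda>x. x l) \<in> borel_measurable (Pi\<^sub>M I (\<lambda>_. unif))"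
  using measurable_component_singleton[of l I "\<lambda>_. unif"]
  by (subst measurable_cong_sets[OF refl sets_unif[symmetric]])

text \<open>Integrating out one of the two coordinates first leaves the mass of a single point,
  which is 0.\<close>

lemma AE_unif_pow_distinct: "AE x in unif_pow j. inj_on x {1..j}"
proof -
  have "AE x in unif_pow j. x i \<noteq> x l" if il: "i \<in> {1..j}" "l \<in> {1..j}" "i \<noteq> l" for i l
  proof -
    have [measurable]: "Measurable.pred (unif_pow j) (\<lambda>x. x i = x l)" unfolding pred_def
      by (rule borel_measurable_eq[OF measurable_proj_unif[OF il(1)] measurable_proj_unif[OF il(2)]])
    have ins: "insert i ({1..j} - {i}) = {1..j}" using il by auto
    have mf [measurable]: "(\<lambda>x. of_bool (x i = x l) :: ennreal) \<in> borel_measurable (unif_pow j)"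
      by measurable
    have "(\<integral>\<^sup>+x. of_bool (x i = x l) \<partial>unif_pow j) =
       (\<integral>\<^sup>+x. (\<integral>\<^sup>+y. of_bool ((x(i:=y)) i = (x(i:=y)) l) \<partial>unif) \<partial>(Pi\<^sub>M ({1..j} - {i}) (\<lambda>_. unif)))"
      using unif_prod.product_nn_integral_insert[of "{1..j} - {i}" i "\<lambda>x. of_bool (x i = x l)"] mf
      unfolding ins by simp
    also have "\<dots> = (\<integral>\<^sup>+x. (\<integral>\<^sup>+y. indicator {x l} y \<partial>unif) \<partial>(Pi\<^sub>M ({1..j} - {i}) (\<lambda>_. unif)))"
      using il by (intro nn_integral_cong) (auto simp: indicator_def of_bool_def)
    also have "\<dots> = 0" by (simp add: emeasure_unif_single)
    finally have "AE x in unif_pow j. of_bool (x i = x l) = (0::ennreal)"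
      by (simp only: nn_integral_0_iff_AE[OF mf])
    then show ?thesis by eventually_elim auto
  qed
  then have "AE x in unif_pow j. \<forall>i\<in>{1..j}. \<forall>l\<in>{1..j}. i \<noteq> l \<longrightarrow> x i \<noteq> x l"
    by (intro AE_finite_allI) auto
  then show ?thesis by eventually_elim (auto simp: inj_on_def)
qed

text \<open>The rank counted from the largest value, the observation itself included. For distinct
  values the ranks form a permutation.\<close>

definition rk :: "nat \<Rightarrow> nat \<Rightarrow> (nat \<Rightarrow> real) \<Rightarrow> nat" where
  "rk j i x = card {l\<in>{1..j}. x i \<le> x l}"

lemma bij_betw_rk:
  assumes "inj_on x {1..j}"
  shows "bij_betw (\<lambda>i. rk j i x) {1..j} {1..j}"
proof -
  have less: "rk j i' x < rk j i x" if "x i < x i'" "i \<in> {1..j}" "i' \<in> {1..j}" for i i'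
  proof -
    have "i \<in> {l\<in>{1..j}. x i \<le> x l}" "i \<notin> {l\<in>{1..j}. x i' \<le> x l}" using that by auto
    moreover have "{l\<in>{1..j}. x i' \<le> x l} \<subseteq> {l\<in>{1..j}. x i \<le> x l}" using that by auto
    ultimately have "{l\<in>{1..j}. x i' \<le> x l} \<subset> {l\<in>{1..j}. x i \<le> x l}" by blast
    then show ?thesis unfolding rk_def by (intro psubset_card_mono) simp_all
  qed
  have inj: "inj_on (\<lambda>i. rk j i x) {1..j}"
  proof (rule inj_onI, rule ccontr)
    fix i i' assume i: "i \<in> {1..j}" "i' \<in> {1..j}" "rk j i x = rk j i' x" "i \<noteq> i'"
    then have "x i \<noteq> x i'" using inj_on_eq_iff[OF assms] by blast
    then have "x i < x i' \<or> x i' < x i" by linarith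
    then show False using less[OF _ i(1,2)] less[OF _ i(2,1)] i(3) by linarith
  qed
  have sub: "(\<lambda>i. rk j i x) ` {1..j} \<subseteq> {1..j}"
  proof safe
    fix i assume i: "i \<in> {1..j}"
    have "card {i} \<le> rk j i x" unfolding rk_def using i by (intro card_mono) auto
    moreover have "rk j i x \<le> card {1..j}" unfolding rk_def by (intro card_mono) auto
    ultimately show "rk j i x \<in> {1..j}" by simp
  qed
  have "(\<lambda>i. rk j i x) ` {1..j} = {1..j}"
    using sub inj by (intro endo_inj_surj) auto
  with inj show ?thesis by (simp add: bij_betw_def)
qed

lemma measurable_rk:
  assumes "i \<in> {1..j}"
  shows "(\<lambda>x. rk j i x) \<in> measurable (unif_pow j) (count_space UNIV)"
proof -
  have [measurable]: "(\<lambda>x. x l) \<in> borel_measurable (unif_pow j)" if "l \<in> {1..j}" for l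
    using that by (rule measurable_proj_unif)
  have "(\<lambda>x. \<Sum>l\<in>{1..j}. if x i \<le> x l then 1 else 0 :: nat) \<in> measurable (unif_pow j) (count_space UNIV)"
    using assms by measurable
  moreover have "rk j i x = (\<Sum>l\<in>{1..j}. if x i \<le> x l then 1 else 0)" for x
    unfolding rk_def using card_filter_sum[of "{1..j}" "\<lambda>l. x i \<le> x l", where 'b=nat] unfolding of_nat_id by simp
  ultimately show ?thesis by presburger
qed

definition symmetric_upto :: "nat \<Rightarrow> ((nat \<Rightarrow> real) \<Rightarrow> 'b) \<Rightarrow> bool" where
  "symmetric_upto j S \<longleftrightarrow> (\<forall>\<pi> x. \<pi> permutes {1..j} \<longrightarrow> S (x \<circ> \<pi>) = S x)"

text \<open>The rank of the last observation is uniform on \<open>{1..j}\<close> and independent of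
  every symmetric \<open>S\<close>. Swapping coordinates \<open>i\<close> and \<open>j\<close> shows
  that each \<open>rk j i\<close> has the same joint law with \<open>S\<close>, and the sum over
  \<open>i\<close> runs almost surely through every rank once.\<close>

lemma nn_integral_rk:
  fixes g :: "nat \<Rightarrow> ennreal"
  assumes "1 \<le> j" "symmetric_upto j S" and [measurable]: "S \<in> borel_measurable (unif_pow j)"
  shows "of_nat j * (\<integral>\<^sup>+x. g (rk j j x) * S x \<partial>unif_pow j) = (\<Sum>r\<in>{1..j}. g r) * (\<integral>\<^sup>+x. S x \<partial>unif_pow j)"
proof -
  have mg [measurable]: "(\<lambda>x. g (rk j i x)) \<in> borel_measurable (unif_pow j)" if "i \<in> {1..j}" for i
    by (rule measurable_compose[OF measurable_rk[OF that]]) simp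
  have meas: "(\<lambda>x. g (rk j j x) * S x) \<in> borel_measurable (unif_pow j)"
    using assms(1) by (intro borel_measurable_times_ennreal assms(3) mg) auto
  have *: "(\<integral>\<^sup>+x. g (rk j i x) * S x \<partial>unif_pow j) = (\<integral>\<^sup>+x. g (rk j j x) * S x \<partial>unif_pow j)"
    if i: "i \<in> {1..j}" for i
  proof -
    define \<pi> where "\<pi> = Transposition.transpose i j"
    have \<pi>: "\<pi> permutes {1..j}" unfolding \<pi>_def using i by (intro permutes_swap_id) auto
    have "rk j j (x \<circ> \<pi>) = rk j i x" for x
    proof -
      have "bij_betw \<pi> {l\<in>{1..j}. (x \<circ> \<pi>) j \<le> (x \<circ> \<pi>) l} {l\<in>{1..j}. x i \<le> x l}"
      proof (rule bij_betwI')
        fix y assume y: "y \<in> {l\<in>{1..j}. x i \<le> x l}"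
        then show "\<exists>z\<in>{l\<in>{1..j}. (x \<circ> \<pi>) j \<le> (x \<circ> \<pi>) l}. y = \<pi> z"
          using permutes_in_image[OF \<pi>, of y] by (intro bexI[of _ "\<pi> y"]) (auto simp: \<pi>_def)
      qed (use permutes_in_image[OF \<pi>] permutes_inj[OF \<pi>] in \<open>auto simp: inj_eq \<pi>_def\<close>)
      then show ?thesis unfolding rk_def by (rule bij_betw_same_card)
    qed
    moreover have "S (x \<circ> \<pi>) = S x" for x
      using assms(2) \<pi> unfolding symmetric_upto_def by blast
    ultimately show ?thesis
      using nn_integral_permute[OF \<pi>, of "\<lambda>x. g (rk j j x) * S x"] meas by simp
  qed
  have "of_nat j * (\<integral>\<^sup>+x. g (rk j j x) * S x \<partial>unif_pow j) = (\<Sum>i\<in>{1..j}. (\<integral>\<^sup>+x. g (rk j i x) * S x \<partial>unif_pow j))"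
  proof -
    have "(\<Sum>i\<in>{1..j}. (\<integral>\<^sup>+x. g (rk j i x) * S x \<partial>unif_pow j)) =
        (\<Sum>i\<in>{1..j}. (\<integral>\<^sup>+x. g (rk j j x) * S x \<partial>unif_pow j))" by (intro sum.cong refl *)
    then show ?thesis by simp
  qed
  also have "\<dots> = (\<integral>\<^sup>+x. (\<Sum>i\<in>{1..j}. g (rk j i x) * S x) \<partial>unif_pow j)"
    by (rule nn_integral_sum[symmetric]) measurable
  also have "\<dots> = (\<integral>\<^sup>+x. (\<Sum>r\<in>{1..j}. g r) * S x \<partial>unif_pow j)"
  proof (rule nn_integral_cong_AE)
    show "AE x in unif_pow j. (\<Sum>i\<in>{1..j}. g (rk j i x) * S x) = (\<Sum>r\<in>{1..j}. g r) * S x"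
      using AE_unif_pow_distinct
    proof eventually_elim
      case (elim x)
      have "(\<Sum>i\<in>{1..j}. g (rk j i x)) = (\<Sum>r\<in>{1..j}. g r)"
        by (rule sum.reindex_bij_betw[OF bij_betw_rk[OF elim]])
      then show ?case by (simp add: sum_distrib_right[symmetric])
    qed
  qed
  finally show ?thesis by (simp only: nn_integral_cmult[OF assms(3)])
qed

text \<open>The observation counts itself in its rank, so fewer than \<open>k\<close> exceedances
  among the first \<open>j\<close> means rank at most \<open>k\<close>.\<close>

lemma jump_iff_rk:
  assumes "1 \<le> k" "k \<le> j"
  shows "jump k x (Suc j) \<longleftrightarrow> rk (Suc j) (Suc j) x \<le> k"
proof -
  have "{l\<in>{1..Suc j}. x (Suc j) \<le> x l} = insert (Suc j) {l\<in>{1..j}. x (Suc j) \<le> x l}"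
    by (auto simp: le_Suc_eq)
  then have "rk (Suc j) (Suc j) x = Suc (card {l\<in>{1..j}. x (Suc j) \<le> x l})"
    unfolding rk_def by simp
  then show ?thesis unfolding jump_def using kmax_less_iff[OF assms] by auto
qed

text \<open>The distribution of the number of jumps among the times \<open>k + 1\<close> to
  \<open>k + i\<close>: time \<open>k + i + 1\<close> is a jump with probability
  \<open>k / (k + i + 1)\<close>, independently of the past.\<close>

primrec jump_prob :: "nat \<Rightarrow> nat \<Rightarrow> nat \<Rightarrow> real" where
  "jump_prob k 0 m = of_bool (m = 0)"
| "jump_prob k (Suc i) m = (1 - real k / real (Suc (k + i))) * jump_prob k i m
     + real k / real (Suc (k + i)) * (if m = 0 then 0 else jump_prob k i (m - 1))"

lemma jump_prob_nonneg: "0 \<le> jump_prob k i m"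
proof (induction i arbitrary: m)
  case (Suc i)
  have "real k / real (Suc (k + i)) \<le> 1" by (simp add: field_simps)
  then show ?case using Suc by simp
qed simp

lemma ennreal_of_nat_mult_cancel:
  assumes "1 \<le> j" "of_nat j * a = ennreal c * b" "0 \<le> c"
  shows "a = ennreal (c / real j) * b"
proof -
  have "a = ennreal (1 / real j) * (of_nat j * a)"
    using assms(1) by (simp add: mult.assoc[symmetric] ennreal_of_nat_eq_real_of_nat ennreal_mult[symmetric])
  also have "\<dots> = ennreal (c / real j) * b"
    unfolding assms(2) using assms(3) by (simp add: mult.assoc[symmetric] ennreal_mult[symmetric])
  finally show ?thesis .
qed

text \<open>Of the \<open>j + 1\<close> equally likely ranks of the last observation exactly
  \<open>k\<close> make it a jump.\<close>

lemma nn_integral_jump: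
  assumes k: "1 \<le> k" "k \<le> j" and S: "symmetric_upto (Suc j) S" "S \<in> borel_measurable (unif_pow (Suc j))"
  shows "(\<integral>\<^sup>+x. of_bool (jump k x (Suc j)) * S x \<partial>unif_pow (Suc j))
       = ennreal (real k / real (Suc j)) * (\<integral>\<^sup>+x. S x \<partial>unif_pow (Suc j))"
    and "(\<integral>\<^sup>+x. of_bool (\<not> jump k x (Suc j)) * S x \<partial>unif_pow (Suc j))
       = ennreal (1 - real k / real (Suc j)) * (\<integral>\<^sup>+x. S x \<partial>unif_pow (Suc j))"
proof -
  have 1: "(\<Sum>r\<in>{1..Suc j}. of_bool (r \<le> k) :: ennreal) = ennreal (real k)"
  proof -
    have "{r\<in>{1..Suc j}. r \<le> k} = {1..k}" using k by auto
    then show ?thesis using card_filter_sum[of "{1..Suc j}" "\<lambda>r. r \<le> k", where 'b=ennreal]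
      by (simp only: of_bool_def) (simp add: ennreal_of_nat_eq_real_of_nat)
  qed
  have 2: "(\<Sum>r\<in>{1..Suc j}. of_bool (\<not> r \<le> k) :: ennreal) = ennreal (real (Suc j - k))"
  proof -
    have "{r\<in>{1..Suc j}. \<not> r \<le> k} = {Suc k..Suc j}" using k by auto
    then show ?thesis using card_filter_sum[of "{1..Suc j}" "\<lambda>r. \<not> r \<le> k", where 'b=ennreal]
      by (simp only: of_bool_def) (simp add: ennreal_of_nat_eq_real_of_nat del: of_nat_Suc)
  qed
  show "(\<integral>\<^sup>+x. of_bool (jump k x (Suc j)) * S x \<partial>unif_pow (Suc j))
       = ennreal (real k / real (Suc j)) * (\<integral>\<^sup>+x. S x \<partial>unif_pow (Suc j))"
    using ennreal_of_nat_mult_cancel[OF _ nn_integral_rk[OF _ S, of "\<lambda>r. of_bool (r \<le> k)", unfolded 1]]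
    unfolding jump_iff_rk[OF k] by simp
  have "1 - real k / real (Suc j) = real (Suc j - k) / real (Suc j)"
    using k by (simp add: of_nat_diff field_simps)
  then show "(\<integral>\<^sup>+x. of_bool (\<not> jump k x (Suc j)) * S x \<partial>unif_pow (Suc j))
       = ennreal (1 - real k / real (Suc j)) * (\<integral>\<^sup>+x. S x \<partial>unif_pow (Suc j))"
    using ennreal_of_nat_mult_cancel[OF _ nn_integral_rk[OF _ S, of "\<lambda>r. of_bool (\<not> r \<le> k)", unfolded 2]]
    unfolding jump_iff_rk[OF k] by simp
qed

lemma nn_integral_unif_pow_Suc:
  assumes "f \<in> borel_measurable (unif_pow (Suc j))"
  shows "(\<integral>\<^sup>+x. f x \<partial>unif_pow (Suc j)) = (\<integral>\<^sup>+u. (\<integral>\<^sup>+x. f (x(Suc j := u)) \<partial>unif_pow j) \<partial>unif)"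
  using unif_prod.product_nn_integral_insert_rev[of "{1..j}" "Suc j" f] assms
  unfolding insert_interval(1) by simp

lemma measurable_fun_upd_unif:
  assumes "f \<in> borel_measurable (unif_pow (Suc j))"
  shows "(\<lambda>x. f (x(Suc j := u))) \<in> borel_measurable (unif_pow j)"
proof -
  have "(\<lambda>x. x(Suc j := u)) \<in> measurable (unif_pow j) (unif_pow (Suc j))"
  proof (rule measurable_PiM_single')
    fix i assume i: "i \<in> {1..Suc j}"
    show "(\<lambda>x. (x(Suc j := u)) i) \<in> measurable (unif_pow j) unif"
    proof (cases "i = Suc j")
      case False
      then show ?thesis using i measurable_component_singleton[of i "{1..j}" "\<lambda>_. unif"] by simp
    qed simp
  qed (auto simp: space_PiM PiE_def extensional_def)
  from measurable_compose[OF this assms] show ?thesis .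
qed

lemma measurable_jumps_unif:
  assumes "1 \<le> k" "j \<le> l"
  shows "(\<lambda>x. of_bool (jumps k x j = m) :: ennreal) \<in> borel_measurable (unif_pow l)"
proof -
  have "Measurable.pred (Pi\<^sub>M {1..l} (\<lambda>_. borel)) (\<lambda>x. jumps k x j = m)"
    using assms by (intro measurable_jumps) auto
  from measurable_compose[OF this, of of_bool borel] show ?thesis
    by (subst measurable_cong_sets[OF sets_PiM_unif refl]) simp
qed

lemma measurable_jump_unif:
  assumes "1 \<le> k" "k < i" "i \<le> l"
  shows "Measurable.pred (unif_pow l) (\<lambda>x. jump k x i)"
proof -
  have "Measurable.pred (Pi\<^sub>M {1..l} (\<lambda>_. borel)) (\<lambda>x. jump k x i)"
    using assms by (intro measurable_jump) auto
  then show ?thesis by (subst measurable_cong_sets[OF sets_PiM_unif refl])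
qed

lemma symmetric_upto_mult:
  fixes f g :: "(nat \<Rightarrow> real) \<Rightarrow> ennreal"
  assumes "symmetric_upto j f" "symmetric_upto j g"
  shows "symmetric_upto j (\<lambda>x. f x * g x)"
  using assms unfolding symmetric_upto_def by metis

lemma symmetric_upto_mono: "symmetric_upto j f \<Longrightarrow> i \<le> j \<Longrightarrow> symmetric_upto i f"
  unfolding symmetric_upto_def by (meson Icc_subset_Iic_iff atLeastatMost_subset_iff order_refl permutes_subset)

lemma symmetric_jump:
  assumes "1 \<le> k" "k \<le> j"
  shows "symmetric_upto j (\<lambda>x. jump k x (Suc j))"
  unfolding symmetric_upto_def jump_def
  by (auto simp: kmax_permute[OF assms] permutes_not_in)

lemma symmetric_upto_compose: "symmetric_upto j f \<Longrightarrow> symmetric_upto j (\<lambda>x. g (f x))"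
  unfolding symmetric_upto_def by auto

text \<open>Conditionally on the last coordinate the indicator of a jump at time \<open>j + 1\<close> is a symmetric
  function of the first \<open>j\<close> coordinates; this makes the induction over the time work.\<close>

lemma nn_integral_jumps_step:
  assumes IH: "\<And>S m. symmetric_upto j S \<Longrightarrow> S \<in> borel_measurable (unif_pow j) \<Longrightarrow>
     (\<integral>\<^sup>+x. of_bool (jumps k x j = m) * S x \<partial>unif_pow j) = ennreal (p m) * (\<integral>\<^sup>+x. S x \<partial>unif_pow j)"
    and k: "1 \<le> k" "k \<le> j"
    and S: "symmetric_upto j S" "S \<in> borel_measurable (unif_pow (Suc j))"
  shows "(\<integral>\<^sup>+x. of_bool (jumps k x j = m) * S x \<partial>unif_pow (Suc j))
       = ennreal (p m) * (\<integral>\<^sup>+x. S x \<partial>unif_pow (Suc j))"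
proof -
  have mj: "(\<lambda>x. of_bool (jumps k x j = m) * S x) \<in> borel_measurable (unif_pow (Suc j))"
    by (intro borel_measurable_times_ennreal S measurable_jumps_unif k) simp
  have "(\<integral>\<^sup>+x. of_bool (jumps k x j = m) * S x \<partial>unif_pow (Suc j))
     = (\<integral>\<^sup>+u. (\<integral>\<^sup>+x. of_bool (jumps k (x(Suc j := u)) j = m) * S (x(Suc j := u)) \<partial>unif_pow j) \<partial>unif)"
    by (rule nn_integral_unif_pow_Suc[OF mj])
  also have "\<dots> = (\<integral>\<^sup>+u. ennreal (p m) * (\<integral>\<^sup>+x. S (x(Suc j := u)) \<partial>unif_pow j) \<partial>unif)"
  proof (rule nn_integral_cong)
    fix u
    have "jumps k (x(Suc j := u)) j = jumps k x j" for x
      using k by (intro jumps_cong) auto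
    moreover have "symmetric_upto j (\<lambda>x. S (x(Suc j := u)))"
      unfolding symmetric_upto_def
    proof (intro allI impI)
      fix \<pi> :: "nat \<Rightarrow> nat" and x :: "nat \<Rightarrow> real" assume \<pi>: "\<pi> permutes {1..j}"
      have "(x \<circ> \<pi>)(Suc j := u) = x(Suc j := u) \<circ> \<pi>"
      proof (rule ext)
        fix i
        show "((x \<circ> \<pi>)(Suc j := u)) i = (x(Suc j := u) \<circ> \<pi>) i"
        proof (cases "i = Suc j")
          case True then show ?thesis using permutes_not_in[OF \<pi>, of i] by simp
        next
          case False
          then have "\<pi> i \<noteq> Suc j" using permutes_not_in[OF \<pi>, of "Suc j"] permutes_inj[OF \<pi>]
            by (metis atLeastAtMost_iff injD not_less_eq_eq order_refl)
          with False show ?thesis by simp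
        qed
      qed
      then show "S ((x \<circ> \<pi>)(Suc j := u)) = S (x(Suc j := u))"
        using S(1) \<pi> unfolding symmetric_upto_def by simp
    qed
    ultimately show "(\<integral>\<^sup>+x. of_bool (jumps k (x(Suc j := u)) j = m) * S (x(Suc j := u)) \<partial>unif_pow j)
        = ennreal (p m) * (\<integral>\<^sup>+x. S (x(Suc j := u)) \<partial>unif_pow j)"
      using IH[of "\<lambda>x. S (x(Suc j := u))" m] measurable_fun_upd_unif[OF S(2)] by simp
  qed
  also have "\<dots> = ennreal (p m) * (\<integral>\<^sup>+u. (\<integral>\<^sup>+x. S (x(Suc j := u)) \<partial>unif_pow j) \<partial>unif)"
  proof (rule nn_integral_cmult)
    have "(\<lambda>(u, x). S (x(Suc j := u))) \<in> borel_measurable (unif \<Otimes>\<^sub>M unif_pow j)"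
    proof -
      have "(\<lambda>(u, x). x(Suc j := u)) \<in> measurable (unif \<Otimes>\<^sub>M unif_pow j) (unif_pow (Suc j))"
        using measurable_add_dim[of "Suc j" "{1..j}" "\<lambda>_. unif"] unfolding insert_interval(1)
        by (subst measurable_pair_swap_iff) (simp add: case_prod_beta)
      from measurable_compose[OF this S(2)] show ?thesis by (simp add: case_prod_beta)
    qed
    then show "(\<lambda>u. \<integral>\<^sup>+x. S (x(Suc j := u)) \<partial>unif_pow j) \<in> borel_measurable unif"
      by (rule sigma_finite_measure.borel_measurable_nn_integral[OF prob_space_imp_sigma_finite[OF prob_space_PiM[OF prob_space_unif]]])
  qed
  also have "\<dots> = ennreal (p m) * (\<integral>\<^sup>+x. S x \<partial>unif_pow (Suc j))"
    by (simp only: nn_integral_unif_pow_Suc[OF S(2)])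
  finally show ?thesis .
qed

text \<open>The number of jumps is independent of the order statistics. Split by whether the last
  time is a jump: this indicator times \<open>S\<close> is symmetric only in the earlier
  coordinates, which is what \<open>nn_integral_jumps_step\<close> asks for;
  \<open>nn_integral_jump\<close> then removes the indicator by the full symmetry of
  \<open>S\<close>.\<close>

lemma nn_integral_jumps:
  assumes "1 \<le> k" "symmetric_upto (k + i) S" "S \<in> borel_measurable (unif_pow (k + i))"
  shows "(\<integral>\<^sup>+x. of_bool (jumps k x (k + i) = m) * S x \<partial>unif_pow (k + i))
       = ennreal (jump_prob k i m) * (\<integral>\<^sup>+x. S x \<partial>unif_pow (k + i))"
  using assms(2,3)
proof (induction i arbitrary: m S)
  case 0
  then show ?case by (cases "m = 0") simp_all
next
  case (Suc i)
  let ?j = "k + i" and ?N = "unif_pow (Suc (k + i))"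
  have S: "symmetric_upto (Suc ?j) S" "S \<in> borel_measurable ?N" using Suc.prems by simp_all
  have kj: "k \<le> ?j" by simp
  have J: "symmetric_upto ?j (\<lambda>x. of_bool (jump k x (Suc ?j)) * S x)"
    by (intro symmetric_upto_mult symmetric_upto_compose[OF symmetric_jump[OF assms(1) kj]] symmetric_upto_mono[OF S(1)]) simp
  have nJ: "symmetric_upto ?j (\<lambda>x. of_bool (\<not> jump k x (Suc ?j)) * S x)"
    by (intro symmetric_upto_mult symmetric_upto_compose[OF symmetric_jump[OF assms(1) kj]] symmetric_upto_mono[OF S(1)]) simp
  have pj: "Measurable.pred ?N (\<lambda>x. jump k x (Suc ?j))"
    using assms(1) by (intro measurable_jump_unif) auto
  have mJ: "(\<lambda>x. of_bool (jump k x (Suc ?j)) * S x) \<in> borel_measurable ?N"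
    "(\<lambda>x. of_bool (\<not> jump k x (Suc ?j)) * S x) \<in> borel_measurable ?N"
    using S(2) pj by measurable
  have step: "(\<integral>\<^sup>+x. of_bool (jumps k x ?j = m) * S x \<partial>?N) = ennreal (jump_prob k i m) * (\<integral>\<^sup>+x. S x \<partial>?N)"
    if "symmetric_upto ?j S" "S \<in> borel_measurable ?N" for S m
    by (rule nn_integral_jumps_step[OF _ assms(1) kj that]) (rule Suc.IH)
  have mB: "(\<lambda>x. of_bool (jumps k x ?j = m) :: ennreal) \<in> borel_measurable ?N" for m
    using assms(1) by (intro measurable_jumps_unif) auto
  have "(\<integral>\<^sup>+x. of_bool (jumps k x (Suc ?j) = m) * S x \<partial>?N) =
     (\<integral>\<^sup>+x. of_bool (jumps k x ?j = m) * (of_bool (\<not> jump k x (Suc ?j)) * S x) +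
        of_bool (m \<noteq> 0) * (of_bool (jumps k x ?j = m - 1) * (of_bool (jump k x (Suc ?j)) * S x)) \<partial>?N)"
    unfolding jumps_Suc[OF kj] by (intro nn_integral_cong) auto
  also have "\<dots> = (\<integral>\<^sup>+x. of_bool (jumps k x ?j = m) * (of_bool (\<not> jump k x (Suc ?j)) * S x) \<partial>?N) +
      of_bool (m \<noteq> 0) * (\<integral>\<^sup>+x. of_bool (jumps k x ?j = m - 1) * (of_bool (jump k x (Suc ?j)) * S x) \<partial>?N)"
    using mB mJ by (subst nn_integral_add) (auto intro!: nn_integral_cmult borel_measurable_times_ennreal simp del: One_nat_def)
  also have "\<dots> = ennreal (jump_prob k i m) * (ennreal (1 - real k / real (Suc ?j)) * (\<integral>\<^sup>+x. S x \<partial>?N)) +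
      of_bool (m \<noteq> 0) * (ennreal (jump_prob k i (m - 1)) * (ennreal (real k / real (Suc ?j)) * (\<integral>\<^sup>+x. S x \<partial>?N)))"
    by (simp only: step[OF nJ mJ(2)] step[OF J mJ(1)] nn_integral_jump[OF assms(1) kj S])
  also have "\<dots> = ennreal (jump_prob k (Suc i) m) * (\<integral>\<^sup>+x. S x \<partial>?N)"
  proof -
    have le: "real k / real (Suc (k + i)) \<le> 1" by (simp add: field_simps)
    have "ennreal (jump_prob k (Suc i) m) = ennreal (jump_prob k i m) * ennreal (1 - real k / real (Suc ?j))
        + of_bool (m \<noteq> 0) * (ennreal (jump_prob k i (m - 1)) * ennreal (real k / real (Suc ?j)))"
      using jump_prob_nonneg[of k i] le
      by (cases "m = 0") (simp_all add: ennreal_mult[symmetric] ennreal_plus[symmetric] mult.commute add_ac del: ennreal_plus)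
    then show ?thesis by (simp add: distrib_right mult.assoc)
  qed
  finally show ?case by simp
qed

text \<open>The binomial law; integrating over the last coordinate gives Pascal's recursion.\<close>

lemma nn_integral_exceed:
  assumes u: "0 < u" "u < 1"
  shows "(\<integral>\<^sup>+x. of_bool (card {l\<in>{1..j}. u \<le> x l} = m) \<partial>unif_pow j)
       = ennreal (real (j choose m) * (1 - u) ^ m * u ^ (j - m))"
proof (induction j arbitrary: m)
  case 0
  show ?case by (cases m) (simp_all add: PiM_empty emeasure_count_space)
next
  case (Suc j)
  have mm: "(\<lambda>x. of_bool (card {l\<in>{1..i}. u \<le> x l} = m) :: ennreal) \<in> borel_measurable (unif_pow i)" for i m
  proof -
    have "(\<lambda>x. x l) \<in> borel_measurable (unif_pow i)" if "l \<in> {1..i}" for l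
      using that by (rule measurable_proj_unif)
    then have "(\<lambda>x. of_bool ((\<Sum>l\<in>{1..i}. if u \<le> x l then 1 else 0 :: nat) = m) :: ennreal) \<in> borel_measurable (unif_pow i)"
      by measurable
    then show ?thesis using card_filter_sum[of "{1..i}", where 'b=nat] by simp
  qed
  have ins: "card {l\<in>{1..Suc j}. u \<le> (x(Suc j := v)) l} =
       card {l\<in>{1..j}. u \<le> x l} + (if u \<le> v then 1 else 0)" for x :: "nat \<Rightarrow> real" and v
  proof -
    have "{l\<in>{1..Suc j}. u \<le> (x(Suc j := v)) l} =
        (if u \<le> v then insert (Suc j) {l\<in>{1..j}. u \<le> x l} else {l\<in>{1..j}. u \<le> x l})"
      by (auto simp: le_Suc_eq)
    then show ?thesis by simp
  qed
  let ?b = "\<lambda>m. (\<integral>\<^sup>+x. of_bool (card {l\<in>{1..j}. u \<le> x l} = m) \<partial>unif_pow j)"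
  have "(\<integral>\<^sup>+x. of_bool (card {l\<in>{1..Suc j}. u \<le> x l} = m) \<partial>unif_pow (Suc j)) =
     (\<integral>\<^sup>+v. (\<integral>\<^sup>+x. of_bool (card {l\<in>{1..Suc j}. u \<le> (x(Suc j := v)) l} = m) \<partial>unif_pow j) \<partial>unif)"
    by (rule nn_integral_unif_pow_Suc[OF mm])
  also have "\<dots> = (\<integral>\<^sup>+v. indicator {u..} v * (of_bool (0 < m) * ?b (m - 1)) + indicator {..<u} v * ?b m \<partial>unif)"
    unfolding ins
  proof (rule nn_integral_cong)
    fix v
    show "(\<integral>\<^sup>+x. of_bool (card {l\<in>{1..j}. u \<le> x l} + (if u \<le> v then 1 else 0) = m) \<partial>unif_pow j) =
       indicator {u..} v * (of_bool (0 < m) * ?b (m - 1)) + indicator {..<u} v * ?b m"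
      by (cases m; cases "u \<le> v") simp_all
  qed
  also have "\<dots> = emeasure unif {u..} * (of_bool (0 < m) * ?b (m - 1)) + emeasure unif {..<u} * ?b m"
    by (subst nn_integral_add) (simp_all add: nn_integral_multc)
  also have "\<dots> = ennreal (1 - u) * (of_bool (0 < m) * ?b (m - 1)) + ennreal u * ?b m"
    unfolding emeasure_unif_atLeast[OF u] emeasure_unif_lessThan[OF u] ..
  also have "\<dots> = ennreal (real (Suc j choose m) * (1 - u) ^ m * u ^ (Suc j - m))"
  proof (cases m)
    case 0
    then show ?thesis unfolding Suc.IH using u by (simp add: ennreal_mult[symmetric])
  next
    case (Suc m')
    have "real (Suc j choose m) * (1 - u) ^ m * u ^ (Suc j - m) =
      (1 - u) * (real (j choose m') * (1 - u) ^ m' * u ^ (j - m')) + u * (real (j choose m) * (1 - u) ^ m * u ^ (j - m))"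
    proof (cases "m \<le> j")
      case True
      then have "u ^ (j - m') = u * u ^ (j - m)" using Suc by (metis Suc_diff_le diff_Suc_Suc power_Suc)
      then show ?thesis using Suc by (simp add: algebra_simps)
    next
      case False
      then show ?thesis using Suc by (simp add: binomial_eq_0)
    qed
    then show ?thesis unfolding Suc.IH using u Suc
      by (simp add: ennreal_mult[symmetric] ennreal_plus[symmetric] del: ennreal_plus binomial_Suc_Suc)
  qed
  finally show ?case .
qed

text \<open>The factor \<open>Suc j\<close> pays for the restriction to the event that the last
  observation has rank \<open>k\<close>. There \<open>kmax\<close> is that observation, and exactly
  \<open>k - 1\<close> of the other \<open>j\<close> are at least as large.\<close>

lemma nn_integral_kmax:
  assumes k: "1 \<le> k" "k \<le> Suc j" and [measurable]: "\<phi> \<in> borel_measurable borel"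
  shows "(\<integral>\<^sup>+x. \<phi> (kmax k (Suc j) x) \<partial>unif_pow (Suc j)) =
     (\<integral>\<^sup>+u. ennreal (real (Suc j) * real (j choose (k - 1)) * (1 - u) ^ (k - 1) * u ^ (Suc j - k)) * \<phi> u \<partial>unif)"
proof -
  let ?N = "unif_pow (Suc j)"
  have km: "kmax k (Suc j) \<in> borel_measurable ?N"
    using measurable_kmax[OF k, of "{1..Suc j}"] by (subst measurable_cong_sets[OF sets_PiM_unif refl]) auto
  have S: "symmetric_upto (Suc j) (\<lambda>x. \<phi> (kmax k (Suc j) x))" "(\<lambda>x. \<phi> (kmax k (Suc j) x)) \<in> borel_measurable ?N"
    using kmax_permute[OF k] measurable_compose[OF km assms(3)] unfolding symmetric_upto_def by auto
  have last: "(\<lambda>x. x (Suc j)) \<in> borel_measurable ?N" by (intro measurable_proj_unif) auto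
  have rkm: "(\<lambda>x. rk (Suc j) (Suc j) x) \<in> measurable ?N (count_space UNIV)"
    by (rule measurable_rk) auto
  have "(\<Sum>r\<in>{1..Suc j}. of_bool (r = k) :: ennreal) = 1"
    using k by (simp add: of_bool_def)
  then have "(\<integral>\<^sup>+x. \<phi> (kmax k (Suc j) x) \<partial>?N) =
      of_nat (Suc j) * (\<integral>\<^sup>+x. of_bool (rk (Suc j) (Suc j) x = k) * \<phi> (kmax k (Suc j) x) \<partial>?N)"
    using nn_integral_rk[OF _ S, of "\<lambda>r. of_bool (r = k)"] by simp
  also have "\<dots> = of_nat (Suc j) * (\<integral>\<^sup>+x. of_bool (rk (Suc j) (Suc j) x = k) * \<phi> (x (Suc j)) \<partial>?N)"
  proof (intro arg_cong[where f="\<lambda>y. of_nat (Suc j) * y"] nn_integral_cong)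
    fix x
    show "of_bool (rk (Suc j) (Suc j) x = k) * \<phi> (kmax k (Suc j) x) =
      of_bool (rk (Suc j) (Suc j) x = k) * \<phi> (x (Suc j))"
    proof (cases "rk (Suc j) (Suc j) x = k")
      case True
      then have c: "card {l\<in>{1..Suc j}. x (Suc j) \<le> x l} = k" unfolding rk_def .
      have "kmax k (Suc j) x < v" if "x (Suc j) < v" for v
      proof -
        have "{l\<in>{1..Suc j}. v \<le> x l} \<subset> {l\<in>{1..Suc j}. x (Suc j) \<le> x l}"
        proof
          show "{l\<in>{1..Suc j}. v \<le> x l} \<subseteq> {l\<in>{1..Suc j}. x (Suc j) \<le> x l}" using that by auto
          have "Suc j \<in> {l\<in>{1..Suc j}. x (Suc j) \<le> x l}" "Suc j \<notin> {l\<in>{1..Suc j}. v \<le> x l}" using that by auto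
          then show "{l\<in>{1..Suc j}. v \<le> x l} \<noteq> {l\<in>{1..Suc j}. x (Suc j) \<le> x l}" by blast
        qed
        then have "card {l\<in>{1..Suc j}. v \<le> x l} < k" unfolding c[symmetric] by (intro psubset_card_mono) simp_all
        then show ?thesis using kmax_less_iff[OF k] by blast
      qed
      moreover have "\<not> kmax k (Suc j) x < x (Suc j)" using c kmax_less_iff[OF k] by simp
      ultimately have "kmax k (Suc j) x = x (Suc j)" by (meson linorder_neqE_linordered_idom order_less_irrefl)
      then show ?thesis by simp
    qed simp
  qed
  also have "(\<integral>\<^sup>+x. of_bool (rk (Suc j) (Suc j) x = k) * \<phi> (x (Suc j)) \<partial>?N) =
      (\<integral>\<^sup>+u. (\<integral>\<^sup>+x. of_bool (rk (Suc j) (Suc j) (x(Suc j := u)) = k) * \<phi> ((x(Suc j := u)) (Suc j)) \<partial>unif_pow j) \<partial>unif)"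
    by (rule nn_integral_unif_pow_Suc) (use rkm measurable_compose[OF last assms(3)] in measurable)
  also have "\<dots> = (\<integral>\<^sup>+u. ennreal (real (j choose (k - 1)) * (1 - u) ^ (k - 1) * u ^ (Suc j - k)) * \<phi> u \<partial>unif)"
  proof (rule nn_integral_cong_AE)
    show "AE u in unif. (\<integral>\<^sup>+x. of_bool (rk (Suc j) (Suc j) (x(Suc j := u)) = k) * \<phi> ((x(Suc j := u)) (Suc j)) \<partial>unif_pow j)
       = ennreal (real (j choose (k - 1)) * (1 - u) ^ (k - 1) * u ^ (Suc j - k)) * \<phi> u"
      using AE_unif
    proof eventually_elim
      case (elim u)
      have "{l\<in>{1..Suc j}. u \<le> (x(Suc j := u)) l} = insert (Suc j) {l\<in>{1..j}. u \<le> x l}" for x :: "nat \<Rightarrow> real"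
        by (auto simp: le_Suc_eq)
      then have "rk (Suc j) (Suc j) (x(Suc j := u)) = Suc (card {l\<in>{1..j}. u \<le> x l})" for x :: "nat \<Rightarrow> real"
        unfolding rk_def by simp
      then have "of_bool (rk (Suc j) (Suc j) (x(Suc j := u)) = k) = (of_bool (card {l\<in>{1..j}. u \<le> x l} = k - 1) :: ennreal)"
        for x :: "nat \<Rightarrow> real" using k by auto
      moreover have "(\<lambda>x. of_bool (card {l\<in>{1..j}. u \<le> x l} = k - 1) :: ennreal) \<in> borel_measurable (unif_pow j)"
      proof -
        have "(\<lambda>x. x l) \<in> borel_measurable (unif_pow j)" if "l \<in> {1..j}" for l
          using that by (rule measurable_proj_unif)
        then have "(\<lambda>x. of_bool ((\<Sum>l\<in>{1..j}. if u \<le> x l then 1 else 0 :: nat) = k - 1) :: ennreal) \<in> borel_measurable (unif_pow j)"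
          by measurable
        then show ?thesis using card_filter_sum[of "{1..j}", where 'b=nat] by simp
      qed
      ultimately show ?case using nn_integral_exceed[of u j "k - 1"] elim k
        by (simp add: nn_integral_multc)
    qed
  qed
  finally show ?thesis
    by (simp add: nn_integral_cmult[symmetric] mult.assoc[symmetric] ennreal_of_nat_eq_real_of_nat ennreal_mult'[symmetric]
        del: of_nat_Suc)
qed

declare One_nat_def [simp del]

subsection \<open>The law of the record values of uniform variables\<close>

text \<open>The generating function of \<open>log_coeff k n\<close> is \<open>(- k ln (1 - u)) ^ n / n!\<close>, the one of
  \<open>jump_coeff k n\<close> is its quotient by \<open>1 - u\<close>.\<close>

definition jump_coeff :: "nat \<Rightarrow> nat \<Rightarrow> nat \<Rightarrow> real" where
  "jump_coeff k n i = jump_prob k i n * real (k + i choose i)"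

lemma jump_coeff_nonneg: "0 \<le> jump_coeff k n i"
  unfolding jump_coeff_def by (simp add: jump_prob_nonneg)

text \<open>The binomial weight cancels the denominators in \<open>jump_prob\<close>: no jump
  contributes the factor 1, a jump the factor \<open>k / (i + 1)\<close>. The recursion thereby
  becomes one for power series.\<close>

lemma jump_coeff_Suc:
  "jump_coeff k n (Suc i) = jump_coeff k n i + (if n = 0 then 0 else real k / real (Suc i) * jump_coeff k (n - 1) i)"
proof -
  have "Suc i * (k + Suc i choose Suc i) = (k + Suc i) * (k + i choose i)"
    using Suc_times_binomial_eq[of "k + i" i] by (simp add: mult.commute)
  then have b: "real (k + Suc i choose Suc i) = real (Suc (k + i)) * real (k + i choose i) / real (Suc i)"
    by (simp add: field_simps flip: of_nat_mult of_nat_Suc)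
  have 1: "(1 - real k / real (Suc (k + i))) * real (k + Suc i choose Suc i) = real (k + i choose i)"
  proof -
    have "1 - real k / real (Suc (k + i)) = real (Suc i) / real (Suc (k + i))" by (simp add: field_simps)
    then show ?thesis unfolding b by (simp del: of_nat_Suc)
  qed
  have 2: "real k / real (Suc (k + i)) * real (k + Suc i choose Suc i) = real k / real (Suc i) * real (k + i choose i)"
    unfolding b by (simp del: of_nat_Suc)
  have "jump_coeff k n (Suc i) =
      jump_prob k i n * ((1 - real k / real (Suc (k + i))) * real (k + Suc i choose Suc i)) +
      (if n = 0 then 0 else jump_prob k i (n - 1)) * (real k / real (Suc (k + i)) * real (k + Suc i choose Suc i))"
    unfolding jump_coeff_def jump_prob.simps by (simp only: ring_distribs) (simp only: mult_ac)
  then show ?thesis unfolding 1 2 by (simp add: jump_coeff_def)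
qed

definition log_coeff :: "nat \<Rightarrow> nat \<Rightarrow> nat \<Rightarrow> real" where
  "log_coeff k n i = (case i of 0 \<Rightarrow> of_bool (n = 0)
     | Suc i \<Rightarrow> if n = 0 then 0 else real k / real (Suc i) * jump_coeff k (n - 1) i)"

lemma log_coeff_nonneg: "0 \<le> log_coeff k n i"
  unfolding log_coeff_def by (simp add: jump_coeff_nonneg split: nat.split)

text \<open>Taking partial sums of the coefficients is the factor \<open>1 / (1 - u)\<close> of the
  generating function.\<close>

lemma sum_log_coeff: "(\<Sum>l\<le>i. log_coeff k n l) = jump_coeff k n i"
proof (induction i)
  case 0 show ?case by (simp add: log_coeff_def jump_coeff_def)
next
  case (Suc i)
  have "log_coeff k n (Suc i) = (if n = 0 then 0 else real k / real (Suc i) * jump_coeff k (n - 1) i)"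
    by (simp add: log_coeff_def)
  then show ?case unfolding sum.atMost_Suc Suc.IH jump_coeff_Suc by simp
qed

text \<open>Induction on \<open>n\<close>. The Cauchy product with the geometric series gives the
  series of the quotient by \<open>1 - u\<close>. Up to the factor \<open>k\<close> this is the
  derivative of the next normalised power of the logarithm, and both sides vanish at 0.\<close>

lemma log_coeff_sums:
  assumes "\<bar>u\<bar> < 1"
  shows "(\<lambda>i. log_coeff k n i * u ^ i) sums ((real k * - ln (1 - u)) ^ n / fact n)"
  using assms
proof (induction n arbitrary: u)
  case 0
  have "(\<lambda>i. log_coeff k 0 i * u ^ i) = (\<lambda>i. if i = 0 then 1 else 0)"
    by (auto simp: log_coeff_def fun_eq_iff split: nat.split)
  then show ?case using sums_single[of 0 "\<lambda>_. 1::real"] by simp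
next
  case (Suc n)
  let ?H = "\<lambda>n u. (real k * - ln (1 - u)) ^ n / fact n"
  have A: "(\<lambda>i. jump_coeff k n i * u ^ i) sums (?H n u * (1 / (1 - u)))" if u: "\<bar>u\<bar> < 1" for u
  proof -
    have "summable (\<lambda>i. norm (log_coeff k n i * u ^ i))"
      using Suc.IH[of "\<bar>u\<bar>"] u by (simp add: sums_iff abs_mult log_coeff_nonneg power_abs)
    moreover have "summable (\<lambda>i. norm (u ^ i))" using u by (simp add: power_abs)
    ultimately have "(\<lambda>m. \<Sum>i\<le>m. (log_coeff k n i * u ^ i) * u ^ (m - i)) sums ((\<Sum>i. log_coeff k n i * u ^ i) * (\<Sum>i. u ^ i))"
      by (rule Cauchy_product_sums)
    moreover have "(\<Sum>i\<le>m. (log_coeff k n i * u ^ i) * u ^ (m - i)) = jump_coeff k n m * u ^ m" for m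
      unfolding sum_log_coeff[symmetric] sum_distrib_right
      by (intro sum.cong refl) (simp add: mult.assoc power_add[symmetric])
    moreover have "(\<Sum>i. log_coeff k n i * u ^ i) = ?H n u" using Suc.IH[OF u] by (simp add: sums_iff)
    moreover have "(\<Sum>i. u ^ i) = 1 / (1 - u)" using u by (simp add: suminf_geometric)
    ultimately show ?thesis by simp
  qed
  have diffs: "diffs (log_coeff k (Suc n)) i = real k * jump_coeff k n i" for i
    unfolding diffs_def by (simp add: log_coeff_def del: of_nat_Suc)
  have sm: "summable (\<lambda>i. log_coeff k (Suc n) i * u ^ i)" if u: "\<bar>u\<bar> < 1" for u
  proof -
    have g: "summable (\<lambda>i. real k * (\<bar>u\<bar> * (jump_coeff k n i * \<bar>u\<bar> ^ i)))"
      using A[of "\<bar>u\<bar>"] u by (intro summable_mult) (auto simp: sums_iff)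
    have le: "norm (log_coeff k (Suc n) (Suc i) * u ^ Suc i) \<le> real k * (\<bar>u\<bar> * (jump_coeff k n i * \<bar>u\<bar> ^ i))" for i
    proof -
      have "log_coeff k (Suc n) (Suc i) = real k / real (Suc i) * jump_coeff k n i" by (simp add: log_coeff_def)
      moreover have "real k / real (Suc i) * jump_coeff k n i \<le> real k * jump_coeff k n i"
        by (intro mult_right_mono jump_coeff_nonneg) (simp add: field_simps)
      ultimately have "log_coeff k (Suc n) (Suc i) * (\<bar>u\<bar> * \<bar>u\<bar> ^ i) \<le> real k * jump_coeff k n i * (\<bar>u\<bar> * \<bar>u\<bar> ^ i)"
        by (intro mult_right_mono) auto
      then show ?thesis by (simp add: abs_mult power_abs log_coeff_nonneg mult_ac)
    qed
    have "summable (\<lambda>i. log_coeff k (Suc n) (Suc i) * u ^ Suc i)"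
      by (rule summable_comparison_test'[OF g, where N=0]) (rule le)
    then show ?thesis by (subst (asm) summable_Suc_iff)
  qed
  define f where "f u = (\<Sum>i. log_coeff k (Suc n) i * u ^ i)" for u :: real
  have "\<exists>c. \<forall>u\<in>{-1<..<1}. f u - ?H (Suc n) u = c"
  proof (rule has_field_derivative_zero_constant)
    fix u :: real assume u: "u \<in> {-1<..<1}"
    have "(f has_field_derivative (\<Sum>i. diffs (log_coeff k (Suc n)) i * u ^ i)) (at u)"
      unfolding f_def using u sm by (intro termdiffs_strong'[where K=1]) auto
    also have "(\<Sum>i. diffs (log_coeff k (Suc n)) i * u ^ i) = real k * (?H n u * (1 / (1 - u)))"
      unfolding diffs mult.assoc using sums_mult[OF A[of u], of "real k"] u by (simp add: sums_iff abs_less_iff)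
    finally have 1: "(f has_field_derivative real k * (?H n u * (1 / (1 - u)))) (at u)" .
    have "((\<lambda>u. ?H (Suc n) u) has_field_derivative
        (real (Suc n) * (real k * - ln (1 - u)) ^ n * (real k * (1 / (1 - u)))) / fact (Suc n)) (at u)"
      using u by (auto intro!: derivative_eq_intros simp del: fact_Suc power_Suc simp: field_simps)
    also have "(real (Suc n) * (real k * - ln (1 - u)) ^ n * (real k * (1 / (1 - u)))) / fact (Suc n) = real k * (?H n u * (1 / (1 - u)))"
      using u by (simp add: field_simps del: of_nat_Suc)
    finally have "((\<lambda>u. f u - ?H (Suc n) u) has_field_derivative 0) (at u)"
      using DERIV_diff[OF 1] by fastforce
    then show "((\<lambda>u. f u - ?H (Suc n) u) has_field_derivative 0) (at u within {-1<..<1})"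
      by (rule DERIV_subset) simp
  qed simp
  then obtain c where c: "\<And>u. u \<in> {-1<..<1} \<Longrightarrow> f u - ?H (Suc n) u = c" by blast
  have "f 0 = 0" unfolding f_def by (subst powser_zero) (simp add: log_coeff_def)
  then have "c = 0" using c[of 0] by simp
  then have "f u = ?H (Suc n) u" using c[of u] Suc.prems by (simp add: abs_less_iff)
  then show ?case using sm[OF Suc.prems] unfolding f_def by (simp add: sums_iff)
qed

text \<open>The identity \<open>(i + 1) * (k + i choose (k - 1)) = k * (k + i choose i)\<close>
  matches the order statistic densities with \<open>log_coeff\<close>, whose index is shifted by
  one; its coefficient at 0 vanishes.\<close>

lemma rec_dens_sums:
  assumes k: "1 \<le> k" and u: "0 < u" "u < 1"
  shows "(\<lambda>i. jump_prob k i n * (real k / real (Suc (k + i))) * (real (Suc (k + i)) * real (k + i choose (k - 1))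
      * (1 - u) ^ (k - 1) * u ^ (Suc (k + i) - k))) sums rec_dens k (Suc n) u"
proof -
  have eq: "jump_prob k i n * (real k / real (Suc (k + i))) * (real (Suc (k + i)) * real (k + i choose (k - 1))
      * (1 - u) ^ (k - 1) * u ^ (Suc (k + i) - k)) = real k * (1 - u) ^ (k - 1) * (log_coeff k (Suc n) (Suc i) * u ^ Suc i)" for i
  proof -
    have "k + i choose (k - 1) = (k + i choose Suc i)"
      using binomial_symmetric[of "k - 1" "k + i"] k by (simp add: One_nat_def)
    moreover have "Suc i * (k + i choose Suc i) = k * (k + i choose i)"
      using binomial_absorb_comp[of "k + i" i] binomial_absorption[of i "k + i"] k
      by (metis (no_types, lifting) Suc_times_binomial_eq add.commute add_diff_cancel_left' binomial_absorb_comp diff_Suc_1 mult.commute times_binomial_minus1_eq zero_less_Suc)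
    ultimately have "real (Suc i) * real (k + i choose (k - 1)) = real k * real (k + i choose i)"
      by (metis of_nat_mult)
    then have b: "real (k + i choose (k - 1)) = real k * real (k + i choose i) / real (Suc i)"
      by (simp add: field_simps del: of_nat_Suc)
    show ?thesis unfolding b by (simp add: log_coeff_def jump_coeff_def field_simps del: of_nat_Suc)
  qed
  have "(\<lambda>i. log_coeff k (Suc n) (Suc i) * u ^ Suc i) sums ((real k * - ln (1 - u)) ^ Suc n / fact (Suc n))"
    using log_coeff_sums[of u k "Suc n"] u by (subst sums_Suc_iff) (simp add: log_coeff_def)
  from sums_mult[OF this, of "real k * (1 - u) ^ (k - 1)"] show ?thesis
    unfolding eq rec_dens_def power_mult_distrib[of "real k"]
    using power_add[of "real k" "Suc n" 1] by (simp add: mult_ac del: fact_Suc power_Suc)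
qed

text \<open>The derivative telescopes: that of the new summand cancels the density for
  \<open>n\<close> and leaves the one for \<open>Suc n\<close>.\<close>

lemma DERIV_rec_cdf:
  assumes "1 \<le> k" "u < 1"
  shows "(rec_cdf k n has_real_derivative rec_dens k n u) (at u)"
proof (induction n)
  case 0
  have "(rec_cdf k 0 has_real_derivative - (real k * (1 - u) ^ (k - 1) * - 1)) (at u)"
    unfolding rec_cdf_def by (cases k) (auto intro!: derivative_eq_intros simp: algebra_simps simp del: power_Suc)
  then show ?case by (simp add: rec_dens_def)
next
  case (Suc n)
  let ?c = "real k ^ Suc n / fact (Suc n)"
  have p: "(1 - u) ^ k = (1 - u) ^ (k - 1) * (1 - u)" using assms(1) by (metis power_minus_mult less_eq_Suc_le One_nat_def)
  have "((\<lambda>u. rec_cdf k n u - (1 - u) ^ k * (?c * (- ln (1 - u)) ^ Suc n)) has_real_derivative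
     rec_dens k n u - (- real k * (1 - u) ^ (k - 1) * (?c * (- ln (1 - u)) ^ Suc n) +
      (1 - u) ^ k * (?c * (real (Suc n) * (- ln (1 - u)) ^ n * (1 / (1 - u)))))) (at u)"
  proof -
    have 1: "((\<lambda>u. (1 - u) ^ k) has_real_derivative - real k * (1 - u) ^ (k - 1)) (at u)"
      by (cases k) (auto intro!: derivative_eq_intros simp: algebra_simps simp del: power_Suc)
    have 2: "((\<lambda>u. ?c * (- ln (1 - u)) ^ Suc n) has_real_derivative ?c * (real (Suc n) * (- ln (1 - u)) ^ n * (1 / (1 - u)))) (at u)"
      using assms by (intro DERIV_cmult) (auto intro!: derivative_eq_intros simp del: power_Suc of_nat_Suc)
    show ?thesis by (rule DERIV_diff[OF Suc DERIV_cong[OF DERIV_mult[OF 1 2]]]) (simp only: mult_ac add_ac)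
  qed
  moreover have "rec_cdf k (Suc n) = (\<lambda>u. rec_cdf k n u - (1 - u) ^ k * (?c * (- ln (1 - u)) ^ Suc n))"
    unfolding rec_cdf_def by (auto simp: algebra_simps fun_eq_iff simp del: fact_Suc power_Suc)
  moreover have "(1 - u) ^ k * (?c * (real (Suc n) * (- ln (1 - u)) ^ n * (1 / (1 - u)))) = rec_dens k n u"
    unfolding p rec_dens_def using assms by (simp add: field_simps power_add del: of_nat_Suc)
  moreover have "- real k * (1 - u) ^ (k - 1) * (?c * (- ln (1 - u)) ^ Suc n) = - rec_dens k (Suc n) u"
    unfolding rec_dens_def by (simp add: field_simps power_add del: fact_Suc)
  ultimately show ?case by simp
qed

lemma rec_dens_nonneg: "0 \<le> u \<Longrightarrow> u < 1 \<Longrightarrow> 0 \<le> rec_dens k n u"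
  unfolding rec_dens_def by (intro mult_nonneg_nonneg divide_nonneg_nonneg zero_le_power) (auto simp: ln_le_zero_iff)

lemma tendsto_power_mult_exp:
  fixes c :: real
  assumes "0 < c"
  shows "((\<lambda>s. s ^ i * exp (- c * s)) \<longlongrightarrow> 0) at_top"
proof -
  have "((\<lambda>s. (c * s) ^ i / exp (c * s)) \<longlongrightarrow> 0) at_top"
    using filterlim_compose[OF tendsto_power_div_exp_0[of i] filterlim_tendsto_pos_mult_at_top[OF tendsto_const assms filterlim_ident]] .
  then have "((\<lambda>s. (c * s) ^ i / exp (c * s) / c ^ i) \<longlongrightarrow> 0 / c ^ i) at_top"
    using assms by (intro tendsto_divide tendsto_const) auto
  then show ?thesis using assms by (simp add: power_mult_distrib exp_minus field_simps)
qed

lemma rec_cdf_eq_exp: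
  assumes "u < 1"
  shows "rec_cdf k n u = 1 - (\<Sum>i\<le>n. real k ^ i / fact i * ((- ln (1 - u)) ^ i * exp (- real k * (- ln (1 - u)))))"
proof -
  have "(1 - u) ^ k = exp (- real k * (- ln (1 - u)))"
    using assms by (simp add: exp_of_nat_mult)
  then show ?thesis unfolding rec_cdf_def by (simp add: sum_distrib_left mult_ac)
qed

lemma rec_cdf_0 [simp]: "rec_cdf k n 0 = 0"
proof -
  have "(\<Sum>i\<le>n. real k ^ i / fact i * 0 ^ i) = (\<Sum>i\<le>n. if i = 0 then 1 else 0 :: real)"
    by (intro sum.cong) auto
  then show ?thesis unfolding rec_cdf_def by simp
qed

lemma rec_cdf_tendsto_1:
  assumes "1 \<le> k"
  shows "(rec_cdf k n \<longlongrightarrow> 1) (at_left 1)"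
proof -
  have l: "filterlim (\<lambda>u::real. - ln (1 - u)) at_top (at_left 1)"
    by real_asymp
  have "((\<lambda>u. 1 - (\<Sum>i\<le>n. real k ^ i / fact i * ((- ln (1 - u)) ^ i * exp (- real k * (- ln (1 - u)))))) \<longlongrightarrow>
     1 - (\<Sum>i\<le>n. real k ^ i / fact i * 0)) (at_left 1)"
    using assms by (intro tendsto_intros filterlim_compose[OF tendsto_power_mult_exp l]) auto
  moreover have "eventually (\<lambda>u. u < (1::real)) (at_left 1)"
    by (simp add: eventually_at_left_field) (use lt_ex in blast)
  ultimately show ?thesis
    by (subst tendsto_cong[where g="\<lambda>u. 1 - (\<Sum>i\<le>n. real k ^ i / fact i * ((- ln (1 - u)) ^ i * exp (- real k * (- ln (1 - u)))))"])
      (auto simp: rec_cdf_eq_exp elim!: eventually_mono)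
qed

lemma nn_integral_rec_dens:
  assumes "1 \<le> k"
  shows "(\<integral>\<^sup>+u. ennreal (rec_dens k n u) \<partial>unif) = 1"
proof -
  have cont: "isCont (rec_dens k n) u" if "u < 1" for u
    unfolding rec_dens_def using that by (intro continuous_intros) auto
  have int: "set_integrable lborel (einterval 0 1) (rec_dens k n)" "(LBINT u=0..1. rec_dens k n u) = 1 - 0"
  proof -
    have 0: "((rec_cdf k n \<circ> real_of_ereal) \<longlongrightarrow> 0) (at_right (0::ereal))"
    proof -
      have "(rec_cdf k n \<longlongrightarrow> rec_cdf k n 0) (at 0)"
        using DERIV_isCont[OF DERIV_rec_cdf[OF assms, of 0]] by (simp add: isCont_def)
      then show ?thesis unfolding zero_ereal_def ereal_tendsto_simps
        by (auto intro: filterlim_mono at_le)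
    qed
    have 1: "((rec_cdf k n \<circ> real_of_ereal) \<longlongrightarrow> 1) (at_left (1::ereal))"
      unfolding one_ereal_def ereal_tendsto_simps by (rule rec_cdf_tendsto_1[OF assms])
    have nn: "AE x in lborel. 0 < ereal x \<longrightarrow> ereal x < 1 \<longrightarrow> 0 \<le> rec_dens k n x"
      by (auto intro!: rec_dens_nonneg)
    show "set_integrable lborel (einterval 0 1) (rec_dens k n)" "(LBINT u=0..1. rec_dens k n u) = 1 - 0"
      using interval_integral_FTC_nonneg[of 0 1 "rec_cdf k n" "rec_dens k n" 0 1] DERIV_rec_cdf[OF assms] cont nn 0 1
      by (auto simp: one_ereal_def)
  qed
  have e: "einterval 0 1 = {0<..<1::real}" by (auto simp: einterval_def)
  have "(\<integral>\<^sup>+u\<in>{0<..<1}. ennreal (rec_dens k n u) \<partial>lborel) = ennreal (LINT u:{0<..<1}|lborel. rec_dens k n u)"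
    using int(1) rec_dens_nonneg[of _ k n] unfolding e set_integrable_def set_lebesgue_integral_def
    by (subst nn_integral_eq_integral[symmetric])
      (auto intro!: nn_integral_cong simp: indicator_def)
  also have "(LINT u:{0<..<1}|lborel. rec_dens k n u) = 1"
    using int(2) by (simp add: interval_lebesgue_integral_def e)
  finally show ?thesis
    by (subst nn_integral_unif) (auto simp: rec_dens_def)
qed

abbreviation unif_seq :: "(nat \<Rightarrow> real) measure" where
  "unif_seq \<equiv> Pi\<^sub>M {1..} (\<lambda>_. unif)"

lemma nn_integral_unif_seq_restrict:
  assumes f: "f \<in> borel_measurable (unif_pow j)" "\<And>x. f (restrict x {1..j}) = f x"
  shows "(\<integral>\<^sup>+x. f x \<partial>unif_seq) = (\<integral>\<^sup>+x. f x \<partial>unif_pow j)"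
proof -
  have *: "distr unif_seq (unif_pow j) (\<lambda>\<omega>. \<lambda>n\<in>{1..j}. \<omega> n) = unif_pow j"
    using distr_PiM_reindex[of "{1..}" "\<lambda>_. unif" "\<lambda>n. n" "{1..j}"] by (auto simp: prob_space_unif)
  have "(\<integral>\<^sup>+x. f x \<partial>distr unif_seq (unif_pow j) (\<lambda>\<omega>. \<lambda>n\<in>{1..j}. \<omega> n)) = (\<integral>\<^sup>+x. f (restrict x {1..j}) \<partial>unif_seq)"
    by (rule nn_integral_distr) (auto intro!: measurable_restrict_subset f(1))
  then have "(\<integral>\<^sup>+x. f x \<partial>unif_pow j) = (\<integral>\<^sup>+x. f (restrict x {1..j}) \<partial>unif_seq)"
    unfolding * .
  then show ?thesis unfolding f(2) by simp
qed

text \<open>The part of the law of record number \<open>n + 1\<close> on the event that it occurs at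
  time \<open>k + i + 1\<close>, that is, after exactly \<open>n\<close> jumps. On this event the
  record value is \<open>kmax\<close> at that time.\<close>

lemma nn_integral_record_jump:
  assumes k: "1 \<le> k" and [measurable]: "\<phi> \<in> borel_measurable borel"
  shows "(\<integral>\<^sup>+x. of_bool (jumps k x (k + i) = n) * (of_bool (jump k x (Suc (k + i))) * \<phi> (kmax k (Suc (k + i)) x)) \<partial>unif_seq)
    = (\<integral>\<^sup>+u. ennreal (jump_prob k i n * (real k / real (Suc (k + i))) * (real (Suc (k + i)) * real (k + i choose (k - 1))
      * (1 - u) ^ (k - 1) * u ^ (Suc (k + i) - k))) * \<phi> u \<partial>unif)"
proof -
  let ?j = "k + i" and ?N = "unif_pow (Suc (k + i))"
  let ?S = "\<lambda>x. of_bool (jump k x (Suc ?j)) * \<phi> (kmax k (Suc ?j) x)"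
  let ?f = "\<lambda>x. of_bool (jumps k x ?j = n) * ?S x"
  have kj: "k \<le> ?j" "k \<le> Suc ?j" by auto
  have km: "kmax k (Suc ?j) \<in> borel_measurable ?N"
    using measurable_kmax[OF k kj(2), of "{1..Suc ?j}"] by (subst measurable_cong_sets[OF sets_PiM_unif refl]) auto
  have S0: "symmetric_upto (Suc ?j) (\<lambda>x. \<phi> (kmax k (Suc ?j) x))" "(\<lambda>x. \<phi> (kmax k (Suc ?j) x)) \<in> borel_measurable ?N"
    using kmax_permute[OF k kj(2)] measurable_compose[OF km assms(2)] unfolding symmetric_upto_def by auto
  have pj: "Measurable.pred ?N (\<lambda>x. jump k x (Suc ?j))"
    using k by (intro measurable_jump_unif) auto
  have S: "symmetric_upto ?j ?S" "?S \<in> borel_measurable ?N"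
    using S0(2) pj by (auto intro!: symmetric_upto_mult symmetric_upto_compose[OF symmetric_jump[OF k kj(1)]] symmetric_upto_mono[OF S0(1)])
  have m: "?f \<in> borel_measurable ?N"
    using k by (intro borel_measurable_times_ennreal S measurable_jumps_unif) auto
  have r: "?f (restrict x {1..Suc ?j}) = ?f x" for x
  proof -
    have "jumps k (restrict x {1..Suc ?j}) ?j = jumps k x ?j" using k by (intro jumps_cong) auto
    moreover have "jump k (restrict x {1..Suc ?j}) (Suc ?j) = jump k x (Suc ?j)" by (intro jump_cong) auto
    moreover have "kmax k (Suc ?j) (restrict x {1..Suc ?j}) = kmax k (Suc ?j) x" by (intro kmax_cong) auto
    ultimately show ?thesis by simp
  qed
  have "(\<integral>\<^sup>+x. ?f x \<partial>unif_seq) = (\<integral>\<^sup>+x. ?f x \<partial>?N)"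
    by (rule nn_integral_unif_seq_restrict[OF m r])
  also have "\<dots> = ennreal (jump_prob k i n) * (\<integral>\<^sup>+x. ?S x \<partial>?N)"
    by (rule nn_integral_jumps_step[OF _ k kj(1) S]) (rule nn_integral_jumps[OF k])
  also have "\<dots> = ennreal (jump_prob k i n) * (ennreal (real k / real (Suc ?j)) *
     (\<integral>\<^sup>+u. ennreal (real (Suc ?j) * real (?j choose (k - 1)) * (1 - u) ^ (k - 1) * u ^ (Suc ?j - k)) * \<phi> u \<partial>unif))"
    unfolding nn_integral_jump(1)[OF k kj(1) S0] nn_integral_kmax[OF k kj(2) assms(2)] ..
  also have "\<dots> = (\<integral>\<^sup>+u. ennreal (jump_prob k i n * (real k / real (Suc (k + i)))) *
     (ennreal (real (Suc ?j) * real (?j choose (k - 1)) * (1 - u) ^ (k - 1) * u ^ (Suc ?j - k)) * \<phi> u) \<partial>unif)"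
    by (subst nn_integral_cmult) (measurable, simp add: mult.assoc[symmetric] ennreal_mult'[symmetric] jump_prob_nonneg del: of_nat_Suc)
  also have "\<dots> = (\<integral>\<^sup>+u. ennreal (jump_prob k i n * (real k / real (Suc (k + i))) * (real (Suc (k + i)) * real (k + i choose (k - 1))
      * (1 - u) ^ (k - 1) * u ^ (Suc (k + i) - k))) * \<phi> u \<partial>unif)"
    by (simp add: mult.assoc[symmetric] ennreal_mult'[symmetric] jump_prob_nonneg del: of_nat_Suc)
  finally show ?thesis .
qed

theorem nn_integral_record_unif:
  assumes k: "1 \<le> k" and \<phi>: "\<phi> \<in> borel_measurable borel"
  shows "(\<integral>\<^sup>+x. \<phi> (record_value k (Suc n) x) \<partial>unif_seq) = (\<integral>\<^sup>+u. ennreal (rec_dens k (Suc n) u) * \<phi> u \<partial>unif)"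
proof -
  \<comment> \<open>Record number \<open>n + 1\<close> occurs at time \<open>k + i + 1\<close>.
    These events are disjoint; that they exhaust the space follows only from the total mass in
    \<open>AEE\<close>.\<close>
  define E where "E i x \<longleftrightarrow> jumps k x (k + i) = n \<and> jump k x (Suc (k + i))" for i x
  have Et: "record_time k x (Suc n) = Suc (k + i)" if "E i x" for i x
    using record_time_jump[of k "Suc (k + i)" x n] that k unfolding E_def by simp
  have Er: "record_value k (Suc n) x = kmax k (Suc (k + i)) x" if "E i x" for i x
    unfolding record_value_def kmax_def Et[OF that] ..
  have Eu: "i = i'" if "E i x" "E i' x" for i i' x
    using Et[OF that(1)] Et[OF that(2)] by simp
  have mE: "Measurable.pred unif_seq (E i)" for i
  proof -
    have "Measurable.pred (Pi\<^sub>M {1..} (\<lambda>_. borel)) (\<lambda>x. jumps k x (k + i) = n)"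
       "Measurable.pred (Pi\<^sub>M {1..} (\<lambda>_. borel)) (\<lambda>x. jump k x (Suc (k + i)))"
      using k by (auto intro!: measurable_jumps measurable_jump)
    then have "Measurable.pred (Pi\<^sub>M {1..} (\<lambda>_. borel)) (E i)" unfolding E_def by measurable
    then show ?thesis by (subst measurable_cong_sets[OF sets_PiM_unif refl])
  qed
  have sum: "(\<Sum>i. (\<integral>\<^sup>+x. of_bool (E i x) * \<phi> (kmax k (Suc (k + i)) x) \<partial>unif_seq)) =
     (\<integral>\<^sup>+u. ennreal (rec_dens k (Suc n) u) * \<phi> u \<partial>unif)" if [measurable]: "\<phi> \<in> borel_measurable borel" for \<phi>
  proof -
    let ?c = "\<lambda>i u. jump_prob k i n * (real k / real (Suc (k + i))) * (real (Suc (k + i)) * real (k + i choose (k - 1))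
      * (1 - u) ^ (k - 1) * u ^ (Suc (k + i) - k))"
    have "(\<Sum>i. (\<integral>\<^sup>+x. of_bool (E i x) * \<phi> (kmax k (Suc (k + i)) x) \<partial>unif_seq)) = (\<Sum>i. (\<integral>\<^sup>+u. ennreal (?c i u) * \<phi> u \<partial>unif))"
      unfolding nn_integral_record_jump[OF k that, symmetric] E_def
      by (intro suminf_cong nn_integral_cong) auto
    also have "\<dots> = (\<integral>\<^sup>+u. (\<Sum>i. ennreal (?c i u) * \<phi> u) \<partial>unif)"
      by (rule nn_integral_suminf[symmetric]) measurable
    also have "\<dots> = (\<integral>\<^sup>+u. ennreal (rec_dens k (Suc n) u) * \<phi> u \<partial>unif)"
    proof (rule nn_integral_cong_AE)
      show "AE u in unif. (\<Sum>i. ennreal (?c i u) * \<phi> u) = ennreal (rec_dens k (Suc n) u) * \<phi> u"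
        using AE_unif
      proof eventually_elim
        case (elim u)
        have "(\<Sum>i. ennreal (?c i u)) = ennreal (rec_dens k (Suc n) u)"
          using rec_dens_sums[OF k, of u n] elim
          by (intro suminf_ennreal_eq) (auto intro!: mult_nonneg_nonneg jump_prob_nonneg)
        then show ?case by (simp add: ennreal_suminf_multc)
      qed
    qed
    finally show ?thesis .
  qed
  have km: "kmax k (Suc (k + i)) \<in> borel_measurable unif_seq" for i
    using measurable_kmax[of k "Suc (k + i)" "{1..}"] k by (subst measurable_cong_sets[OF sets_PiM_unif refl]) auto
  have m: "(\<lambda>x. of_bool (E i x) * \<phi> (kmax k (Suc (k + i)) x)) \<in> borel_measurable unif_seq"
    if "\<phi> \<in> borel_measurable borel" for i and \<phi> :: "real \<Rightarrow> ennreal"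
    using mE[of i] measurable_compose[OF km that] by measurable
  have comb: "(\<Sum>i. of_bool (E i x) * \<phi> (kmax k (Suc (k + i)) x)) = of_bool (\<exists>i. E i x) * \<phi> (record_value k (Suc n) x)"
    for x and \<phi> :: "real \<Rightarrow> ennreal"
  proof (cases "\<exists>i. E i x")
    case True
    then obtain i where i: "E i x" by blast
    have "(\<Sum>i. of_bool (E i x) * \<phi> (kmax k (Suc (k + i)) x)) = (\<Sum>l\<in>{i}. of_bool (E l x) * \<phi> (kmax k (Suc (k + l)) x))"
      by (rule suminf_finite) (use i Eu in auto)
    then show ?thesis using i True Er[OF i] by simp
  qed simp
  have tot: "(\<integral>\<^sup>+x. of_bool (\<exists>i. E i x) * \<phi> (record_value k (Suc n) x) \<partial>unif_seq) =
     (\<integral>\<^sup>+u. ennreal (rec_dens k (Suc n) u) * \<phi> u \<partial>unif)" if "\<phi> \<in> borel_measurable borel" for \<phi>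
    unfolding sum[OF that, symmetric] comb[symmetric]
    by (rule nn_integral_suminf[OF m[OF that]])
  \<comment> \<open>With the test function 1 the pieces add up to the integral of
    \<open>rec_dens\<close>, which is 1.\<close>
  have AEE: "AE x in unif_seq. \<exists>i. E i x"
  proof -
    have pE: "Measurable.pred unif_seq (\<lambda>x. \<exists>i. E i x)" using mE by measurable
    have "emeasure unif_seq {x\<in>space unif_seq. \<exists>i. E i x} = (\<integral>\<^sup>+x. of_bool (\<exists>i. E i x) * 1 \<partial>unif_seq)"
    proof -
      have "emeasure unif_seq {x\<in>space unif_seq. \<exists>i. E i x} = (\<integral>\<^sup>+x. indicator {x\<in>space unif_seq. \<exists>i. E i x} x \<partial>unif_seq)"
        using pE unfolding pred_def by (rule nn_integral_indicator[symmetric])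
      then show ?thesis by (auto intro!: nn_integral_cong simp: indicator_def)
    qed
    also have "\<dots> = 1" using tot[of "\<lambda>_. 1"] nn_integral_rec_dens[OF k] by simp
    finally have "measure unif_seq {x\<in>space unif_seq. \<exists>i. E i x} = 1" by (simp add: measure_def)
    then show ?thesis using pE by (subst prob_space.prob_Collect_eq_1[OF prob_space_PiM[OF prob_space_unif], symmetric]) auto
  qed
  have "(\<integral>\<^sup>+x. \<phi> (record_value k (Suc n) x) \<partial>unif_seq) = (\<integral>\<^sup>+x. of_bool (\<exists>i. E i x) * \<phi> (record_value k (Suc n) x) \<partial>unif_seq)"
    by (rule nn_integral_cong_AE) (use AEE in eventually_elim, simp)
  with tot[OF \<phi>] show ?thesis by simp
qed

subsection \<open>Records of a general sequence\<close>

lemma record_value_cong: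
  assumes "1 \<le> k" "\<And>l. 1 \<le> l \<Longrightarrow> x l = y l"
  shows "record_value k n x = record_value k n y"
proof -
  have os: "order_stat x i j = order_stat y i j" for i j
  proof -
    have "map x [1..<Suc j] = map y [1..<Suc j]" using assms(2) by auto
    then show ?thesis unfolding order_stat_def by (simp only:)
  qed
  have "record_time k x n = record_time k y n"
  proof (induction n)
    case (Suc n)
    have "1 \<le> j" if "record_time k y n < j" for j using that by (simp add: One_nat_def)
    then have "{j. record_time k y n < j \<and> order_stat y (record_time k y n + 1 - k) (record_time k y n) < x j} =
       {j. record_time k y n < j \<and> order_stat y (record_time k y n + 1 - k) (record_time k y n) < y j}"
      using assms(2) by auto
    then show ?case unfolding record_time.simps Suc os Let_def by (simp only:)
  qed simp
  then show ?thesis unfolding record_value_def os by simp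
qed

section \<open>Quantile functions and inverse transforms\<close>

lemma real_distribution_distr_unif:
  "f \<in> borel_measurable borel \<Longrightarrow> real_distribution (distr unif borel f)"
  by (intro unif.real_distribution_distr) (simp add: measurable_cong_sets[OF sets_unif refl])

lemma emeasure_unif_atMost:
  assumes "0 \<le> c" "c \<le> 1"
  shows "emeasure unif {..c} = ennreal c"
proof -
  have "emeasure unif {..c} = (\<integral>\<^sup>+u. indicator {..c} u \<partial>unif)" by simp
  also have "\<dots> = (\<integral>\<^sup>+u\<in>{0<..<1}. indicator {..c} u \<partial>lborel)" by (rule nn_integral_unif) simp
  also have "\<dots> = (\<integral>\<^sup>+u. indicator {0<..c} u \<partial>lborel)"
    using AE_lborel_singleton[of 1] assms
    by (intro nn_integral_cong_AE) (auto elim!: eventually_mono simp: indicator_def)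
  also have "\<dots> = ennreal c" using assms by simp
  finally show ?thesis .
qed

lemma measure_unif_atMost: "0 \<le> c \<Longrightarrow> c \<le> 1 \<Longrightarrow> measure unif {..c} = c"
  by (simp add: measure_def emeasure_unif_atMost)

context
  fixes D :: "real measure" and F :: "real \<Rightarrow> real"
  assumes D: "real_distribution D" and F: "F = cdf D"
begin

interpretation D: cdf_distribution D
  unfolding cdf_distribution_def by (rule D)

lemma quantile_eq_Inf: "0 < u \<Longrightarrow> quantile F u = Inf {x. u \<le> F x}"
  unfolding quantile_def by (intro arg_cong[where f=Inf]) auto

lemma quantile_le_iff: "0 < u \<Longrightarrow> u < 1 \<Longrightarrow> quantile F u \<le> x \<longleftrightarrow> u \<le> F x"
  using D.pseudoinverse[of u x] quantile_eq_Inf[of u] by (auto simp: F)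

lemma mono_on_quantile: "mono_on {0<..<1} (quantile F)"
proof (rule mono_onI)
  fix r s :: real assume rs: "r \<in> {0<..<1}" "s \<in> {0<..<1}" "r \<le> s"
  then have "r \<le> F (quantile F s)" using quantile_le_iff[of s "quantile F s"] by simp
  then show "quantile F r \<le> quantile F s" using quantile_le_iff[of r] rs by simp
qed

lemma measurable_quantile:
  "(\<lambda>u. if 0 < u \<and> u < 1 then quantile F u else 0) \<in> borel_measurable borel"
proof -
  have "quantile F \<in> borel_measurable (restrict_space borel {0<..<1})"
    by (intro borel_measurable_mono_on_fnc mono_on_quantile)
  then have "(\<lambda>u. indicator {0<..<1} u * quantile F u) \<in> borel_measurable borel"
    by (subst (asm) borel_measurable_restrict_space_iff) (auto simp: scaleR_conv_of_real)
  also have "(\<lambda>u. indicator {0<..<1} u * quantile F u) = (\<lambda>u. if 0 < u \<and> u < 1 then quantile F u else 0)"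
    by (auto simp: indicator_def)
  finally show ?thesis .
qed

lemma distr_quantile: "distr unif borel (\<lambda>u. if 0 < u \<and> u < 1 then quantile F u else 0) = D"
proof (intro cdf_unique ext)
  let ?Q = "\<lambda>u. if 0 < u \<and> u < 1 then quantile F u else 0"
  show "real_distribution (distr unif borel ?Q)"
    by (intro real_distribution_distr_unif measurable_quantile)
  have m: "?Q \<in> borel_measurable unif"
    using measurable_quantile by (simp add: measurable_cong_sets[OF sets_unif refl])
  fix x
  have "emeasure unif (?Q -` {..x} \<inter> space unif) = emeasure unif {..F x}"
  proof (rule emeasure_eq_AE)
    show "AE u in unif. (u \<in> ?Q -` {..x} \<inter> space unif) = (u \<in> {..F x})"
      using AE_unif by eventually_elim (simp add: quantile_le_iff)
    show "?Q -` {..x} \<inter> space unif \<in> sets unif" by (rule measurable_sets[OF m]) simp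
  qed simp
  also have "\<dots> = ennreal (F x)"
    unfolding F by (intro emeasure_unif_atMost D.cdf_nonneg D.cdf_bounded_prob)
  finally have "cdf (distr unif borel ?Q) x = F x"
    using m by (simp add: cdf_def measure_distr) (simp add: measure_def F D.cdf_nonneg)
  then show "cdf (distr unif borel ?Q) x = cdf D x" by (simp add: F)
qed (rule D)

end

text \<open>Continuity of \<open>\<psi>\<close> yields the identity also at 0 and 1; at 0 the
  condition \<open>0 < F x\<close> in \<open>quantile\<close> picks the left end of the support.
  Both arguments occur as values of \<open>gp_cdf\<close> at the ends of its support.\<close>

lemma quantile_distr_unif:
  assumes \<psi>: "mono \<psi>" "continuous_on UNIV \<psi>" and u: "0 \<le> u" "u \<le> 1"
  shows "quantile (cdf (distr unif borel \<psi>)) u = \<psi> u"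
proof -
  let ?F = "cdf (distr unif borel \<psi>)"
  have m: "\<psi> \<in> borel_measurable unif"
    using borel_measurable_continuous_onI[OF \<psi>(2)] by (simp add: measurable_cong_sets[OF sets_unif refl])
  have F: "?F x = measure unif {v. \<psi> v \<le> x}" for x
    using m by (simp add: cdf_def measure_distr vimage_def)
  have sets: "{v. \<psi> v \<le> x} \<in> sets unif" for x
    using measurable_sets[OF m, of "{..x}"] by (simp add: vimage_def)
  have ge: "v \<le> ?F x" if "\<psi> v \<le> x" "0 \<le> v" "v \<le> 1" for v x
  proof -
    have "{..v} \<subseteq> {v. \<psi> v \<le> x}" using that \<psi>(1) by (auto simp: mono_def intro: order_trans)
    then have "measure unif {..v} \<le> ?F x" unfolding F by (intro unif.finite_measure_mono sets)
    then show ?thesis using that by (simp add: measure_unif_atMost)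
  qed
  have le: "?F x \<le> v" if "x < \<psi> v" "0 \<le> v" "v \<le> 1" for v x
  proof -
    have "{v. \<psi> v \<le> x} \<subseteq> {..v}" using that \<psi>(1) by (auto simp: mono_def not_le[symmetric]) (meson less_le_not_le nle_le order_trans)
    then have "?F x \<le> measure unif {..v}" unfolding F by (intro unif.finite_measure_mono) auto
    then show ?thesis using that by (simp add: measure_unif_atMost)
  qed
  have cont: "isCont \<psi> v" for v using \<psi>(2) by (simp add: continuous_on_eq_continuous_at)
  have lower: "\<psi> u \<le> x" if x: "0 < ?F x" "u \<le> ?F x" for x
  proof (rule ccontr)
    assume "\<not> \<psi> u \<le> x"
    then have lt: "x < \<psi> u" by simp
    show False
    proof (cases "u = 0")
      case True then show False using le[OF lt u] x by simp
    next
      case False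
      have "eventually (\<lambda>v. x < \<psi> v) (at_left u)"
        using order_tendstoD(1)[OF _ lt, of \<psi>] cont[of u] unfolding isCont_def
        by (meson filterlim_at_split)
      moreover have "eventually (\<lambda>v. v \<in> {0<..<u}) (at_left u)"
        using False u by (intro eventually_at_left_real) auto
      ultimately have "eventually (\<lambda>v. x < \<psi> v \<and> v \<in> {0<..<u}) (at_left u)" by (rule eventually_conj)
      then obtain v where "x < \<psi> v" "0 < v" "v < u"
        using eventually_happens'[OF trivial_limit_at_left_real] by fastforce
      then show False using le[of x v] x u by simp
    qed
  qed
  have upper: "0 < ?F x \<and> u \<le> ?F x" if lt: "\<psi> u < x" for x
  proof (cases "u = 1")
    case True then show ?thesis using ge[of u x] lt by simp
  next
    case False
    have "eventually (\<lambda>v. \<psi> v < x) (at_right u)"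
      using order_tendstoD(2)[OF _ lt, of \<psi>] cont[of u] unfolding isCont_def
      by (meson filterlim_at_split)
    moreover have "eventually (\<lambda>v. v \<in> {u<..<1}) (at_right u)"
      using False u by (intro eventually_at_right_real) auto
    ultimately have "eventually (\<lambda>v. \<psi> v < x \<and> v \<in> {u<..<1}) (at_right u)" by (rule eventually_conj)
    then obtain v where "\<psi> v < x" "u < v" "v < 1"
      using eventually_happens'[OF trivial_limit_at_right_real] by fastforce
    then show ?thesis using ge[of v x] u by simp
  qed
  show ?thesis unfolding quantile_def
  proof (rule cInf_eq_non_empty)
    show "{x. 0 < ?F x \<and> u \<le> ?F x} \<noteq> {}" using upper[of "\<psi> u + 1"] by auto
    fix y assume y: "\<And>x. x \<in> {x. 0 < ?F x \<and> u \<le> ?F x} \<Longrightarrow> y \<le> x"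
    show "y \<le> \<psi> u"
      by (rule dense_ge) (use y upper in auto)
  qed (use lower in auto)
qed

lemma indep_vars_PiM_coordinates:
  assumes "\<And>i. i \<in> I \<Longrightarrow> prob_space (N i)" "I \<noteq> {}"
  shows "prob_space.indep_vars (Pi\<^sub>M I N) N (\<lambda>i x. x i) I"
proof -
  interpret prob_space "Pi\<^sub>M I N" by (rule prob_space_PiM[OF assms(1)])
  have "distr (Pi\<^sub>M I N) (Pi\<^sub>M I N) (\<lambda>x. \<lambda>i\<in>I. x i) = distr (Pi\<^sub>M I N) (Pi\<^sub>M I N) (\<lambda>x. x)"
    by (intro distr_cong refl) (auto simp: space_PiM extensional_restrict PiE_def)
  also have "\<dots> = (\<Pi>\<^sub>M i\<in>I. distr (Pi\<^sub>M I N) (N i) (\<lambda>x. x i))"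
  proof -
    have "(\<Pi>\<^sub>M i\<in>I. distr (Pi\<^sub>M I N) (N i) (\<lambda>x. x i)) = Pi\<^sub>M I N"
      by (intro PiM_cong refl distr_PiM_component assms(1))
    then show ?thesis by simp
  qed
  finally show ?thesis using assms(2) by (subst indep_vars_iff_distr_eq_PiM') auto
qed

lemma iid_sequence_PiM:
  assumes "real_distribution D"
  shows "iid_sequence (Pi\<^sub>M {1..} (\<lambda>_. D)) (\<lambda>i x. x i) (cdf D)"
proof -
  interpret D: real_distribution D by fact
  have p: "prob_space D" by (rule D.prob_space_axioms)
  have s: "sets D = sets borel" by simp
  interpret P: prob_space "Pi\<^sub>M {1..} (\<lambda>_::nat. D)" by (intro prob_space_PiM p)
  have i: "P.indep_vars (\<lambda>_. D) (\<lambda>i x. x i) {1..}"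
    using indep_vars_PiM_coordinates[of "{1..}" "\<lambda>_. D"] p by auto
  have "P.indep_vars (\<lambda>_. borel) (\<lambda>i x. x i) {1..}"
    using P.indep_vars_compose2[OF i, of "\<lambda>_ x. x" "\<lambda>_. borel"] by (simp add: measurable_ident_sets)
  moreover have "distr (Pi\<^sub>M {1..} (\<lambda>_. D)) borel (\<lambda>x. x i) = D" if "1 \<le> i" for i
  proof -
    have "distr (Pi\<^sub>M {1..} (\<lambda>_. D)) borel (\<lambda>x. x i) = distr (Pi\<^sub>M {1..} (\<lambda>_. D)) D (\<lambda>x. x i)"
      by (intro distr_cong) auto
    then show ?thesis using distr_PiM_component[of "{1..}" "\<lambda>_. D" i] p that by simp
  qed
  ultimately show ?thesis unfolding iid_sequence_def using P.prob_space_axioms by metis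
qed

text \<open>\<open>X\<close> and the image under \<open>Q\<close> of a uniform sequence have the
  same joint law, a product of copies of \<open>D\<close>, hence record values with the same law.
  \<open>flat\<close> is what allows \<open>Q\<close> to be moved outside of the record
  value.\<close>

theorem record_law:
  assumes X: "iid_sequence M X F" and D: "real_distribution D" "F = cdf D" and k: "1 \<le> k"
    and Q: "mono_on {0<..<1} Q" "(\<lambda>u. if 0 < u \<and> u < 1 then Q u else 0) \<in> borel_measurable borel"
      "distr unif borel (\<lambda>u. if 0 < u \<and> u < 1 then Q u else 0) = D"
    and flat: "\<And>u v w. 0 < u \<Longrightarrow> u < v \<Longrightarrow> v < 1 \<Longrightarrow> Q u = Q v \<Longrightarrow> u \<le> w \<Longrightarrow> w < 1 \<Longrightarrow> Q w = Q u"
  shows "(\<lambda>\<omega>. record_value k (Suc n) (\<lambda>i. X i \<omega>)) \<in> borel_measurable M"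
    and "distr M borel (\<lambda>\<omega>. record_value k (Suc n) (\<lambda>i. X i \<omega>)) =
      distr (density unif (\<lambda>u. ennreal (rec_dens k (Suc n) u))) borel (\<lambda>u. if 0 < u \<and> u < 1 then Q u else 0)"
    and "X 1 \<in> borel_measurable M" "distr M borel (X 1) = D"
proof -
  let ?Q = "\<lambda>u. if 0 < u \<and> u < 1 then Q u else 0" and ?R = "record_value k (Suc n)"
  let ?B = "Pi\<^sub>M {1..} (\<lambda>_::nat. borel :: real measure)"
  interpret M: prob_space M using X unfolding iid_sequence_def by blast
  interpret D: real_distribution D by fact
  have ind: "M.indep_vars (\<lambda>_. borel) X {1..}" using X unfolding iid_sequence_def by blast
  have Xm: "X i \<in> borel_measurable M" if "1 \<le> i" for i
    using ind that unfolding M.indep_vars_def by auto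
  have Xd: "distr M borel (X i) = D" if "1 \<le> i" for i
    using X that D Xm[OF that] unfolding iid_sequence_def
    by (intro cdf_unique M.real_distribution_distr) auto
  show "X 1 \<in> borel_measurable M" "distr M borel (X 1) = D" using Xm Xd by auto
  have XD: "distr M ?B (\<lambda>\<omega>. \<lambda>i\<in>{1..}. X i \<omega>) = Pi\<^sub>M {1..} (\<lambda>_. D)"
  proof -
    have "(\<Pi>\<^sub>M i\<in>{1..}. distr M borel (X i)) = Pi\<^sub>M {1..} (\<lambda>_. D)" using Xd by (intro PiM_cong) auto
    then show ?thesis
      using M.indep_vars_iff_distr_eq_PiM'[of "{1..}" X "\<lambda>_. borel"] ind Xm by auto
  qed
  have Qm: "?Q \<in> borel_measurable unif" using Q(2) by (simp add: measurable_cong_sets[OF sets_unif refl])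
  have psU: "prob_space unif_seq" by (rule prob_space_PiM[OF prob_space_unif])
  have indU: "prob_space.indep_vars unif_seq (\<lambda>_. unif) (\<lambda>i x. x i) {1..}"
    using indep_vars_PiM_coordinates[of "{1..}" "\<lambda>_. unif"] prob_space_unif by auto
  have indQ: "prob_space.indep_vars unif_seq (\<lambda>_. borel) (\<lambda>i x. ?Q (x i)) {1..}"
    by (rule prob_space.indep_vars_compose2[OF psU indU]) (rule Qm)
  have Um: "(\<lambda>x. x i) \<in> measurable unif_seq unif" if "1 \<le> i" for i
    using that by (intro measurable_component_singleton) auto
  have QUm: "(\<lambda>x. ?Q (x i)) \<in> borel_measurable unif_seq" if "1 \<le> i" for i
    by (rule measurable_compose[OF Um[OF that] Qm])
  have QUd: "distr unif_seq borel (\<lambda>x. ?Q (x i)) = D" if "1 \<le> i" for i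
  proof -
    have "distr unif_seq borel (?Q \<circ> (\<lambda>x. x i)) = distr (distr unif_seq unif (\<lambda>x. x i)) borel ?Q"
      by (rule distr_distr[OF Qm Um[OF that], symmetric])
    also have "distr unif_seq unif (\<lambda>x. x i) = unif"
      using distr_PiM_component[of "{1..}" "\<lambda>_. unif" i] prob_space_unif that by simp
    finally show ?thesis unfolding Q(3) by (simp add: o_def)
  qed
  have UD: "distr unif_seq ?B (\<lambda>x. \<lambda>i\<in>{1..}. ?Q (x i)) = Pi\<^sub>M {1..} (\<lambda>_. D)"
  proof -
    have "(\<Pi>\<^sub>M i\<in>{1..}. distr unif_seq borel (\<lambda>x. ?Q (x i))) = Pi\<^sub>M {1..} (\<lambda>_. D)" using QUd by (intro PiM_cong) auto
    then show ?thesis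
      using prob_space.indep_vars_iff_distr_eq_PiM'[OF psU, of "{1..}" "\<lambda>i x. ?Q (x i)" "\<lambda>_. borel"] indQ QUm by auto
  qed
  have Rm: "?R \<in> borel_measurable ?B" by (rule measurable_record_value[OF k])
  have XB: "(\<lambda>\<omega>. \<lambda>i\<in>{1..}. X i \<omega>) \<in> measurable M ?B" using Xm by (intro measurable_restrict) auto
  have UB: "(\<lambda>x. \<lambda>i\<in>{1..}. ?Q (x i)) \<in> measurable unif_seq ?B" using QUm by (intro measurable_restrict) auto
  have RX: "?R (\<lambda>i\<in>{1..}. X i \<omega>) = ?R (\<lambda>i. X i \<omega>)" for \<omega> by (rule record_value_cong[OF k]) simp
  have RQ: "?R (\<lambda>i\<in>{1..}. ?Q (x i)) = ?R (?Q \<circ> x)" for x by (rule record_value_cong[OF k]) simp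
  show Rmeas: "(\<lambda>\<omega>. ?R (\<lambda>i. X i \<omega>)) \<in> borel_measurable M"
    using measurable_compose[OF XB Rm] unfolding RX .
  have RU: "?R \<in> borel_measurable unif_seq"
    using Rm by (subst measurable_cong_sets[OF sets_PiM_unif refl])
  have lawU: "distr unif_seq borel ?R = density unif (\<lambda>u. ennreal (rec_dens k (Suc n) u))"
  proof (rule measure_eqI)
    fix A assume A: "A \<in> sets (distr unif_seq borel ?R)"
    then have A': "A \<in> sets borel" by simp
    have "emeasure (distr unif_seq borel ?R) A = (\<integral>\<^sup>+x. indicator A (?R x) \<partial>unif_seq)"
      using nn_integral_indicator[OF A] nn_integral_distr[OF RU, of "indicator A"] A' by simp
    also have "\<dots> = (\<integral>\<^sup>+u. ennreal (rec_dens k (Suc n) u) * indicator A u \<partial>unif)"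
      using A' by (intro nn_integral_record_unif[OF k]) simp
    also have "\<dots> = emeasure (density unif (\<lambda>u. ennreal (rec_dens k (Suc n) u))) A"
      using A' by (intro emeasure_density[symmetric]) (auto simp: rec_dens_def)
    finally show "emeasure (distr unif_seq borel ?R) A = emeasure (density unif (\<lambda>u. ennreal (rec_dens k (Suc n) u))) A" .
  qed simp
  have "distr M borel (\<lambda>\<omega>. ?R (\<lambda>i. X i \<omega>)) = distr (distr M ?B (\<lambda>\<omega>. \<lambda>i\<in>{1..}. X i \<omega>)) borel ?R"
    unfolding distr_distr[OF Rm XB] by (simp add: o_def RX)
  also have "\<dots> = distr (distr unif_seq ?B (\<lambda>x. \<lambda>i\<in>{1..}. ?Q (x i))) borel ?R" unfolding XD UD ..
  also have "\<dots> = distr unif_seq borel (\<lambda>x. ?R (?Q \<circ> x))"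
    unfolding distr_distr[OF Rm UB] by (simp only: comp_def RQ[unfolded comp_def])
  also have "\<dots> = distr unif_seq borel (\<lambda>x. ?Q (?R x))"
  proof (rule distr_cong_AE[OF refl refl])
    have "AE x in unif_seq. \<forall>i\<in>{1..}. 0 < x i \<and> x i < 1"
      by (intro AE_ball_countable[THEN iffD2] ballI AE_PiM_component[OF prob_space_unif _ AE_unif]) auto
    then show "AE x in unif_seq. ?R (?Q \<circ> x) = ?Q (?R x)"
    proof eventually_elim
      case (elim x)
      have m: "mono_on {0<..<1} ?Q" using Q(1) by (auto simp: mono_on_def)
      have fl: "?Q w = ?Q u" if "u \<in> {0<..<1}" "v \<in> {0<..<1}" "w \<in> {0<..<1}" "u < v" "?Q u = ?Q v" "u \<le> w" for u v w
        using flat[of u v w] that by auto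
      show ?case by (rule record_value_compose_mono[OF k m _ fl]) (use elim in auto)
    qed
    show "(\<lambda>x. ?R (?Q \<circ> x)) \<in> borel_measurable unif_seq"
      using measurable_compose[OF UB Rm] unfolding RQ .
    show "(\<lambda>x. ?Q (?R x)) \<in> borel_measurable unif_seq"
      by (rule measurable_compose[OF RU Q(2)])
  qed
  also have "\<dots> = distr (distr unif_seq borel ?R) borel ?Q"
    using distr_distr[OF Q(2) RU] by (simp add: o_def)
  finally show "distr M borel (\<lambda>\<omega>. ?R (\<lambda>i. X i \<omega>)) =
      distr (density unif (\<lambda>u. ennreal (rec_dens k (Suc n) u))) borel ?Q" unfolding lawU .
qed

section \<open>Generalized Pareto distributions\<close>

text \<open>The cumulative hazard. In this coordinate \<open>ghat\<close> is a multiple of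
  \<open>s ^ n * exp (- (k - 1) * s)\<close>, whatever \<open>\<alpha>\<close> is.\<close>

definition gp_haz :: "real \<Rightarrow> real \<Rightarrow> real" where
  "gp_haz \<alpha> x = - ln (1 - gp_cdf \<alpha> x)"

text \<open>The inverse of \<open>gp_haz\<close>, strictly increasing and continuous on the whole
  line for every sign of \<open>\<alpha>\<close>.\<close>

definition gp_inv :: "real \<Rightarrow> real \<Rightarrow> real" where
  "gp_inv \<alpha> s = (if \<alpha> = 0 then s else (1 - exp (- \<alpha> * s)) / \<alpha>)"

text \<open>The condition \<open>0 < 1 - \<alpha> * x\<close> describes the right end for every sign
  of \<open>\<alpha>\<close>, so that later arguments avoid the cases of
  \<open>gp_end\<close>.\<close>

lemma gp_dom_iff: "x \<in> gp_dom \<alpha> \<longleftrightarrow> 0 \<le> x \<and> 0 < 1 - \<alpha> * x"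
proof (cases "\<alpha> \<le> 0")
  case True
  then have "0 \<le> x \<Longrightarrow> \<alpha> * x \<le> 0" by (rule mult_nonpos_nonneg)
  then have "0 \<le> x \<Longrightarrow> 0 < 1 - \<alpha> * x" by linarith
  then show ?thesis using True by (auto simp: gp_dom_def gp_end_def)
qed (auto simp: gp_dom_def gp_end_def field_simps)

lemma gp_int_iff: "x \<in> gp_int \<alpha> \<longleftrightarrow> 0 < x \<and> 0 < 1 - \<alpha> * x"
proof -
  have "x \<in> gp_int \<alpha> \<longleftrightarrow> 0 < x \<and> x \<in> gp_dom \<alpha>" by (auto simp: gp_int_def gp_dom_def)
  then show ?thesis by (auto simp: gp_dom_iff)
qed

lemma gp_int_subset_dom: "gp_int \<alpha> \<subseteq> gp_dom \<alpha>"
  by (auto simp: gp_int_iff gp_dom_iff)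

lemma less_gp_end_iff: "0 \<le> x \<Longrightarrow> ereal x < gp_end \<alpha> \<longleftrightarrow> 0 < 1 - \<alpha> * x"
  using gp_dom_iff[of x \<alpha>] by (auto simp: gp_dom_def)

lemma gp_pos_below: "0 \<le> x \<Longrightarrow> x \<le> y \<Longrightarrow> 0 < 1 - \<alpha> * y \<Longrightarrow> 0 < 1 - \<alpha> * (x::real)"
proof (cases "\<alpha> \<le> 0")
  case True
  assume "0 \<le> x"
  with True have "\<alpha> * x \<le> 0" by (rule mult_nonpos_nonneg)
  then show ?thesis by linarith
next
  case False
  assume "x \<le> y" "0 < 1 - \<alpha> * y"
  moreover have "\<alpha> * x \<le> \<alpha> * y" using \<open>x \<le> y\<close> False by (intro mult_left_mono) auto
  ultimately show ?thesis by linarith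
qed

lemma open_gp_int: "open (gp_int \<alpha>)"
proof -
  have "gp_int \<alpha> = {x. 0 < x} \<inter> {x. 0 < 1 - \<alpha> * x}" by (auto simp: gp_int_iff)
  also have "open \<dots>" by (intro open_Int open_Collect_less continuous_intros)
  finally show ?thesis .
qed

lemma sets_gp_int [measurable]: "gp_int \<alpha> \<in> sets borel"
  by (intro borel_open open_gp_int)

lemma convex_gp_int: "convex (gp_int \<alpha>)"
proof (rule is_interval_convex)
  show "is_interval (gp_int \<alpha>)"
    unfolding is_interval_1
  proof (intro ballI allI impI)
    fix a b x assume "a \<in> gp_int \<alpha>" "b \<in> gp_int \<alpha>" "a \<le> x \<and> x \<le> b"
    then show "x \<in> gp_int \<alpha>" using gp_pos_below[of x b \<alpha>] unfolding gp_int_iff by linarith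
  qed
qed

context
  fixes \<alpha> :: real
begin

lemma one_minus_gp_cdf:
  assumes "0 < 1 - \<alpha> * x"
  shows "1 - gp_cdf \<alpha> x = exp (- gp_haz \<alpha> x)"
proof -
  have "0 < 1 - gp_cdf \<alpha> x" using assms by (simp add: gp_cdf_def)
  then show ?thesis by (simp add: gp_haz_def)
qed

lemma gp_cdf_eq: "0 < 1 - \<alpha> * x \<Longrightarrow> gp_cdf \<alpha> x = 1 - exp (- gp_haz \<alpha> x)"
  using one_minus_gp_cdf[of x] by simp

lemma gp_haz_eq: "0 < 1 - \<alpha> * x \<Longrightarrow> gp_haz \<alpha> x = (if \<alpha> = 0 then x else - ln (1 - \<alpha> * x) / \<alpha>)"
  by (simp add: gp_haz_def gp_cdf_def ln_powr)

lemma exp_gp_haz: "0 < 1 - \<alpha> * x \<Longrightarrow> exp (- \<alpha> * gp_haz \<alpha> x) = 1 - \<alpha> * x"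
  by (simp add: gp_haz_eq)

lemma gp_dens_eq: "0 < 1 - \<alpha> * x \<Longrightarrow> gp_dens \<alpha> x = exp (- gp_haz \<alpha> x) / (1 - \<alpha> * x)"
  by (simp add: gp_haz_eq gp_dens_def powr_def exp_diff[symmetric] diff_divide_distrib left_diff_distrib exp_diff)

lemma gp_dens_pos: "0 < 1 - \<alpha> * x \<Longrightarrow> 0 < gp_dens \<alpha> x"
  by (simp add: gp_dens_eq)

lemma DERIV_gp_haz:
  assumes "0 < 1 - \<alpha> * x"
  shows "(gp_haz \<alpha> has_real_derivative 1 / (1 - \<alpha> * x)) (at x)"
proof -
  have "((\<lambda>x. if \<alpha> = 0 then x else - ln (1 - \<alpha> * x) / \<alpha>) has_real_derivative 1 / (1 - \<alpha> * x)) (at x)"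
    using assms by (cases "\<alpha> = 0") (auto intro!: derivative_eq_intros)
  moreover have "eventually (\<lambda>y. 0 < 1 - \<alpha> * y) (nhds x)"
    using assms by (intro order_tendstoD(1)[of _ "1 - \<alpha> * x"] tendsto_intros) (auto simp: filterlim_ident)
  then have "eventually (\<lambda>y. gp_haz \<alpha> y = (if \<alpha> = 0 then y else - ln (1 - \<alpha> * y) / \<alpha>)) (nhds x)"
    by eventually_elim (simp add: gp_haz_eq)
  ultimately show ?thesis by (subst DERIV_cong_ev[OF refl _ refl])
qed

lemma gp_haz_0 [simp]: "gp_haz \<alpha> 0 = 0" by (simp add: gp_haz_eq)

lemma gp_cdf_0 [simp]: "gp_cdf \<alpha> 0 = 0" by (simp add: gp_cdf_def)

lemma gp_haz_strict_mono:
  assumes "0 \<le> x" "x < y" "0 < 1 - \<alpha> * y"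
  shows "gp_haz \<alpha> x < gp_haz \<alpha> y"
proof (rule DERIV_pos_imp_increasing[OF assms(2)])
  fix z assume "x \<le> z" "z \<le> y"
  then have "0 < 1 - \<alpha> * z" using assms by (intro gp_pos_below[of z y]) auto
  then show "\<exists>d. DERIV (gp_haz \<alpha>) z :> d \<and> 0 < d" using DERIV_gp_haz[of z] by auto
qed

lemma gp_haz_pos: "0 < x \<Longrightarrow> 0 < 1 - \<alpha> * x \<Longrightarrow> 0 < gp_haz \<alpha> x"
  using gp_haz_strict_mono[of 0 x] by simp

lemma gp_haz_nonneg: "x \<in> gp_dom \<alpha> \<Longrightarrow> 0 \<le> gp_haz \<alpha> x"
  using gp_haz_pos[of x] by (cases "x = 0") (auto simp: gp_dom_iff)

lemma one_minus_gp_inv: "1 - \<alpha> * gp_inv \<alpha> s = exp (- \<alpha> * s)"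
  by (simp add: gp_inv_def)

lemma gp_haz_inv [simp]: "gp_haz \<alpha> (gp_inv \<alpha> s) = s"
  using one_minus_gp_inv[of s] by (subst gp_haz_eq) (auto simp: gp_inv_def)

lemma gp_inv_haz: "0 < 1 - \<alpha> * x \<Longrightarrow> gp_inv \<alpha> (gp_haz \<alpha> x) = x"
  using exp_gp_haz[of x] by (auto simp: gp_inv_def gp_haz_eq)

lemma gp_inv_0 [simp]: "gp_inv \<alpha> 0 = 0" by (simp add: gp_inv_def)

lemma strict_mono_gp_inv: "strict_mono (gp_inv \<alpha>)"
proof (rule strict_monoI)
  fix s t :: real assume "s < t"
  then show "gp_inv \<alpha> s < gp_inv \<alpha> t"
    by (cases "\<alpha> > 0") (auto simp: gp_inv_def divide_strict_right_mono divide_strict_right_mono_neg)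
qed

lemma gp_inv_dom: "0 \<le> s \<Longrightarrow> gp_inv \<alpha> s \<in> gp_dom \<alpha>"
  using one_minus_gp_inv[of s] strict_mono_less_eq[OF strict_mono_gp_inv, of 0 s] by (simp add: gp_dom_iff)

lemma gp_inv_int: "0 < s \<Longrightarrow> gp_inv \<alpha> s \<in> gp_int \<alpha>"
  using one_minus_gp_inv[of s] strict_mono_less[OF strict_mono_gp_inv, of 0 s] by (simp add: gp_int_iff)

lemma isCont_gp_inv: "isCont (gp_inv \<alpha>) s"
  unfolding gp_inv_def[abs_def] by (cases "\<alpha> = 0") (auto intro!: continuous_intros)

lemma gp_haz_less_iff: "x \<in> gp_dom \<alpha> \<Longrightarrow> y \<in> gp_dom \<alpha> \<Longrightarrow> gp_haz \<alpha> x < gp_haz \<alpha> y \<longleftrightarrow> x < y"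
  using gp_haz_strict_mono[of x y] gp_haz_strict_mono[of y x]
  by (cases x y rule: linorder_cases) (auto simp: gp_dom_iff)

lemma gp_haz_le_iff: "x \<in> gp_dom \<alpha> \<Longrightarrow> y \<in> gp_dom \<alpha> \<Longrightarrow> gp_haz \<alpha> x \<le> gp_haz \<alpha> y \<longleftrightarrow> x \<le> y"
  using gp_haz_less_iff[of y x] by (auto simp: not_less[symmetric])

lemma DERIV_gp_cdf:
  assumes "0 < 1 - \<alpha> * x"
  shows "(gp_cdf \<alpha> has_real_derivative gp_dens \<alpha> x) (at x)"
proof -
  have "((\<lambda>x. 1 - exp (- gp_haz \<alpha> x)) has_real_derivative gp_dens \<alpha> x) (at x)"
    using assms by (auto intro!: derivative_eq_intros DERIV_gp_haz simp: gp_dens_eq)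
  moreover have "eventually (\<lambda>y. 0 < 1 - \<alpha> * y) (nhds x)"
    using assms by (intro order_tendstoD(1)[of _ "1 - \<alpha> * x"] tendsto_intros) (auto simp: filterlim_ident)
  then have "eventually (\<lambda>y. gp_cdf \<alpha> y = 1 - exp (- gp_haz \<alpha> y)) (nhds x)"
    by eventually_elim (simp add: gp_cdf_eq)
  ultimately show ?thesis by (subst DERIV_cong_ev[OF refl _ refl])
qed

lemma gp_cdf_less_1: "0 < 1 - \<alpha> * x \<Longrightarrow> gp_cdf \<alpha> x < 1"
  by (simp add: gp_cdf_eq)

lemma gp_cdf_nonneg: "x \<in> gp_dom \<alpha> \<Longrightarrow> 0 \<le> gp_cdf \<alpha> x"
  using gp_haz_nonneg[of x] by (simp add: gp_dom_iff gp_cdf_eq)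

lemma gp_cdf_pos: "x \<in> gp_int \<alpha> \<Longrightarrow> 0 < gp_cdf \<alpha> x"
  using gp_haz_pos[of x] by (simp add: gp_int_iff gp_cdf_eq)

lemma gp_cdf_le_iff: "x \<in> gp_dom \<alpha> \<Longrightarrow> y \<in> gp_dom \<alpha> \<Longrightarrow> gp_cdf \<alpha> x \<le> gp_cdf \<alpha> y \<longleftrightarrow> x \<le> y"
  using gp_haz_le_iff[of x y] by (simp add: gp_dom_iff gp_cdf_eq)

lemma gp_inv_cdf: "0 < 1 - \<alpha> * x \<Longrightarrow> gp_inv \<alpha> (- ln (1 - gp_cdf \<alpha> x)) = x"
  using gp_inv_haz[of x] by (simp add: gp_haz_def)

lemma gp_cdf_inv: "u < 1 \<Longrightarrow> gp_cdf \<alpha> (gp_inv \<alpha> (- ln (1 - u))) = u"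
  using gp_haz_inv[of "- ln (1 - u)"] one_minus_gp_inv[of "- ln (1 - u)"]
  by (subst gp_cdf_eq) auto

lemma isCont_gp_dens: "0 < 1 - \<alpha> * x \<Longrightarrow> isCont (gp_dens \<alpha>) x"
  unfolding gp_dens_def[abs_def] by (cases "\<alpha> = 0") (auto intro!: continuous_intros)

lemma isCont_gp_cdf: "0 < 1 - \<alpha> * x \<Longrightarrow> isCont (gp_cdf \<alpha>) x"
  by (rule DERIV_isCont[OF DERIV_gp_cdf])

lemma measurable_gp_cdf [measurable]: "gp_cdf \<alpha> \<in> borel_measurable borel"
  unfolding gp_cdf_def[abs_def] by measurable

lemma measurable_gp_dens [measurable]: "gp_dens \<alpha> \<in> borel_measurable borel"
  unfolding gp_dens_def[abs_def] by measurable

lemma measurable_ghat [measurable]: "ghat \<alpha> k n \<in> borel_measurable borel"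
  unfolding ghat_def[abs_def] rec_dens_def by measurable

lemma ghat_eq:
  assumes "0 < 1 - \<alpha> * x" "1 \<le> k"
  shows "ghat \<alpha> k n x = real k ^ (n + 1) / fact n * (gp_haz \<alpha> x ^ n * exp (- (real k - 1) * gp_haz \<alpha> x))"
proof -
  have "exp (- gp_haz \<alpha> x) ^ (k - 1) = exp (- (real k - 1) * gp_haz \<alpha> x)"
    using assms(2) by (simp add: exp_of_nat_mult[symmetric] of_nat_diff algebra_simps)
  then show ?thesis
    unfolding ghat_def rec_dens_def one_minus_gp_cdf[OF assms(1)] by simp
qed

lemma ghat_nonneg: "x \<in> gp_dom \<alpha> \<Longrightarrow> 1 \<le> k \<Longrightarrow> 0 \<le> ghat \<alpha> k n x"
  using gp_haz_nonneg[of x] by (simp add: gp_dom_iff ghat_eq)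

lemma Ghat_eq:
  assumes "0 < 1 - \<alpha> * x"
  shows "Ghat \<alpha> k n x = 1 - exp (- real k * gp_haz \<alpha> x) * (\<Sum>i\<le>n. (real k * gp_haz \<alpha> x) ^ i / fact i)"
proof -
  have "exp (- gp_haz \<alpha> x) ^ k = exp (- real k * gp_haz \<alpha> x)"
    by (simp add: exp_of_nat_mult[symmetric])
  then show ?thesis
    unfolding Ghat_def rec_cdf_def one_minus_gp_cdf[OF assms(1)] by (simp add: power_mult_distrib)
qed

lemma DERIV_Ghat:
  assumes "0 < 1 - \<alpha> * x" "1 \<le> k"
  shows "(Ghat \<alpha> k n has_real_derivative ghat \<alpha> k n x * gp_dens \<alpha> x) (at x)"
  unfolding Ghat_def[abs_def] ghat_def
  by (rule DERIV_chain2[OF DERIV_rec_cdf[OF assms(2) gp_cdf_less_1[OF assms(1)]] DERIV_gp_cdf[OF assms(1)]])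

lemma Ghat_0 [simp]: "Ghat \<alpha> k n 0 = 0" by (simp add: Ghat_def)

lemma isCont_Ghat: "0 < 1 - \<alpha> * x \<Longrightarrow> 1 \<le> k \<Longrightarrow> isCont (Ghat \<alpha> k n) x"
  by (rule DERIV_isCont[OF DERIV_Ghat])

lemma isCont_ghat: "0 < 1 - \<alpha> * x \<Longrightarrow> isCont (ghat \<alpha> k n) x"
  unfolding ghat_def[abs_def] rec_dens_def
  using gp_cdf_less_1[of x] by (intro continuous_intros isCont_gp_cdf) auto

end

text \<open>A single term of the exponential series is at most its sum.\<close>

lemma power_exp_bound:
  assumes "0 \<le> s" "1 \<le> (c::real)"
  shows "s ^ n * exp (- c * s) \<le> fact n"
proof -
  have "(\<Sum>m\<in>{n}. s ^ m /\<^sub>R fact m) \<le> exp s"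
    unfolding exp_def using assms by (intro sum_le_suminf summable_exp_generic) auto
  then have "s ^ n \<le> fact n * exp s" by (simp add: field_simps)
  also have "exp s \<le> exp (c * s)" using assms by (simp add: mult_left_le mult_le_cancel_right1)
  finally have "s ^ n \<le> fact n * exp (c * s)" by simp
  then show ?thesis by (simp add: exp_minus field_simps)
qed

text \<open>For \<open>k\<close> at least 2 the exponential decay dominates the powers of the
  hazard. Boundedness makes the product of \<open>h\<close> with any integrable function
  integrable.\<close>

lemma ghat_bounded:
  assumes "2 \<le> k" "x \<in> gp_dom \<alpha>"
  shows "\<bar>ghat \<alpha> k n x\<bar> \<le> real k ^ (n + 1)"
proof -
  have "ghat \<alpha> k n x \<le> real k ^ (n + 1) / fact n * fact n"
    using assms gp_haz_nonneg[of x \<alpha>] unfolding gp_dom_iff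
    by (subst ghat_eq, simp, simp) (intro mult_left_mono power_exp_bound, auto)
  then show ?thesis using ghat_nonneg[of x \<alpha> k n] assms by simp
qed

section \<open>The generalized Pareto measure\<close>

text \<open>The weight is restricted to the open interval \<open>gp_int\<close>, the set on which
  monotonicity and concavity are required.\<close>

definition gp_meas :: "real \<Rightarrow> real measure" where
  "gp_meas \<alpha> = density lborel (\<lambda>x. ennreal (indicator (gp_int \<alpha>) x * gp_dens \<alpha> x))"

lemma sets_gp_meas [simp, measurable_cong]: "sets (gp_meas \<alpha>) = sets borel"
  and space_gp_meas [simp]: "space (gp_meas \<alpha>) = UNIV"
  by (simp_all add: gp_meas_def)

context
  fixes \<alpha> :: real
begin

lemma weight_nonneg: "0 \<le> indicator (gp_int \<alpha>) x * gp_dens \<alpha> x"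
  using gp_dens_pos[of \<alpha> x] by (auto simp: indicator_def gp_int_iff less_imp_le)

lemma AE_gp_meas: "AE x in gp_meas \<alpha>. x \<in> gp_int \<alpha>"
  unfolding gp_meas_def by (subst AE_density) (auto simp: indicator_def)

lemma integrable_gp_meas_iff:
  "f \<in> borel_measurable borel \<Longrightarrow> integrable (gp_meas \<alpha>) f \<longleftrightarrow> integrable lborel (\<lambda>x. indicator (gp_int \<alpha>) x * gp_dens \<alpha> x * f x)"
  for f :: "real \<Rightarrow> real"
  unfolding gp_meas_def by (subst integrable_density) (auto simp: weight_nonneg)

lemma integral_gp_meas:
  "f \<in> borel_measurable borel \<Longrightarrow> integral\<^sup>L (gp_meas \<alpha>) f = (\<integral>x. indicator (gp_int \<alpha>) x * gp_dens \<alpha> x * f x \<partial>lborel)"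
  for f :: "real \<Rightarrow> real"
  unfolding gp_meas_def by (subst integral_density) (auto simp: weight_nonneg)

text \<open>The explicit integrals over bounded pieces are evaluated by exhibiting an antiderivative
  of the integrand times the density.\<close>

lemma gp_meas_FTC:
  fixes f \<Phi> :: "real \<Rightarrow> real"
  assumes y: "0 \<le> a" "a \<le> y" "0 < 1 - \<alpha> * y" and [measurable]: "f \<in> borel_measurable borel"
    and f: "continuous_on {a..y} f"
    and \<Phi>: "\<And>x. a \<le> x \<Longrightarrow> x \<le> y \<Longrightarrow> (\<Phi> has_real_derivative f x * gp_dens \<alpha> x) (at x within {a..y})"
  shows "integrable (gp_meas \<alpha>) (\<lambda>x. indicator {a<..y} x * f x)"
    and "(\<integral>x. indicator {a<..y} x * f x \<partial>gp_meas \<alpha>) = \<Phi> y - \<Phi> a"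
proof -
  have pos: "0 < 1 - \<alpha> * x" if "a \<le> x" "x \<le> y" for x using gp_pos_below[of x y \<alpha>] that y by auto
  have c: "continuous_on {a..y} (\<lambda>x. f x * gp_dens \<alpha> x)"
    by (intro continuous_intros f continuous_at_imp_continuous_on ballI isCont_gp_dens pos) auto
  then have i: "set_integrable lborel {a..y} (\<lambda>x. f x * gp_dens \<alpha> x)"
    by (rule borel_integrable_atLeastAtMost')
  have "((\<lambda>x. f x * gp_dens \<alpha> x) has_integral \<Phi> y - \<Phi> a) {a..y}"
    using \<Phi> y by (intro fundamental_theorem_of_calculus) (auto simp: has_real_derivative_iff_has_vector_derivative[symmetric])
  then have v: "(LINT x:{a..y}|lborel. f x * gp_dens \<alpha> x) = \<Phi> y - \<Phi> a"
    using set_borel_integral_eq_integral(2)[OF i] by (simp add: integral_unique)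
  have ae: "AE x in lborel. indicator {a..y} x *\<^sub>R (f x * gp_dens \<alpha> x) =
      indicator (gp_int \<alpha>) x * gp_dens \<alpha> x * (indicator {a<..y} x * f x)"
    using AE_lborel_singleton[of a]
    by eventually_elim (use pos y in \<open>auto simp: indicator_def gp_int_iff\<close>)
  show "integrable (gp_meas \<alpha>) (\<lambda>x. indicator {a<..y} x * f x)"
    using i ae unfolding set_integrable_def
    by (subst integrable_gp_meas_iff) (auto elim!: integrable_cong_AE_imp)
  show "(\<integral>x. indicator {a<..y} x * f x \<partial>gp_meas \<alpha>) = \<Phi> y - \<Phi> a"
    unfolding v[symmetric] set_lebesgue_integral_def
    using ae by (subst integral_gp_meas, simp, intro integral_cong_AE) auto
qed

lemma emeasure_gp_meas_atMost:
  assumes "y \<in> gp_dom \<alpha>"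
  shows "emeasure (gp_meas \<alpha>) {..y} = ennreal (gp_cdf \<alpha> y)"
proof -
  have y: "0 \<le> y" "0 < 1 - \<alpha> * y" using assms by (auto simp: gp_dom_iff)
  have "integrable (gp_meas \<alpha>) (\<lambda>x. indicator {0<..y} x * (1::real))"
    "(\<integral>x. indicator {0<..y} x * (1::real) \<partial>gp_meas \<alpha>) = gp_cdf \<alpha> y - gp_cdf \<alpha> 0"
    using gp_pos_below[of _ y \<alpha>] y
    by (intro gp_meas_FTC; force intro: DERIV_subset[OF DERIV_gp_cdf])+
  then have *: "integrable (gp_meas \<alpha>) (indicator {0<..y} :: real \<Rightarrow> real)"
    "(\<integral>x. indicator {0<..y} x \<partial>gp_meas \<alpha>) = gp_cdf \<alpha> y" by simp_all
  have "emeasure (gp_meas \<alpha>) {..y} = emeasure (gp_meas \<alpha>) {0<..y}"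
    using AE_gp_meas by (intro emeasure_eq_AE) (auto simp: gp_int_iff)
  also have "\<dots> = ennreal (\<integral>x. indicator {0<..y} x \<partial>gp_meas \<alpha>)"
    using * by (subst nn_integral_eq_integral[symmetric]) (auto simp: ennreal_indicator)
  finally show ?thesis using * by simp
qed

text \<open>The points of hazard \<open>i\<close> exhaust the interval, and the mass up to such a
  point is \<open>1 - exp (- i)\<close>.\<close>

lemma prob_space_gp_meas: "prob_space (gp_meas \<alpha>)"
proof
  let ?A = "\<lambda>i. {..gp_inv \<alpha> (real i)}"
  have inc: "incseq ?A"
    using strict_mono_less_eq[OF strict_mono_gp_inv[of \<alpha>]] by (auto simp: incseq_def)
  have "AE x in gp_meas \<alpha>. x \<in> (\<Union>i. ?A i)"
    using AE_gp_meas
  proof eventually_elim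
    case (elim x)
    then have x: "0 < 1 - \<alpha> * x" by (simp add: gp_int_iff)
    obtain i where "gp_haz \<alpha> x \<le> real i" using real_arch_simple by blast
    then have "gp_inv \<alpha> (gp_haz \<alpha> x) \<le> gp_inv \<alpha> (real i)"
      using strict_mono_less_eq[OF strict_mono_gp_inv[of \<alpha>]] by blast
    then show ?case using gp_inv_haz[OF x] by auto
  qed
  then have "emeasure (gp_meas \<alpha>) (space (gp_meas \<alpha>)) = emeasure (gp_meas \<alpha>) (\<Union>i. ?A i)"
    by (intro emeasure_eq_AE) auto
  also have "\<dots> = (SUP i. emeasure (gp_meas \<alpha>) (?A i))"
    using inc by (intro SUP_emeasure_incseq[symmetric]) auto
  also have "(\<lambda>i. emeasure (gp_meas \<alpha>) (?A i)) = (\<lambda>i. ennreal (1 - exp (- real i)))"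
    using one_minus_gp_inv[of \<alpha>] gp_inv_dom[of _ \<alpha>] by (auto simp: emeasure_gp_meas_atMost gp_cdf_eq)
  also have "(SUP i. ennreal (1 - exp (- real i))) = ennreal 1"
  proof (rule LIMSEQ_unique[OF LIMSEQ_SUP])
    show "incseq (\<lambda>i. ennreal (1 - exp (- real i)))" by (auto simp: incseq_def intro!: ennreal_leI)
    show "(\<lambda>i. ennreal (1 - exp (- real i))) \<longlonglongrightarrow> ennreal 1"
      by (intro tendsto_ennrealI) real_asymp
  qed
  finally show "emeasure (gp_meas \<alpha>) (space (gp_meas \<alpha>)) = 1" by simp
qed

interpretation gp: prob_space "gp_meas \<alpha>"
  by (rule prob_space_gp_meas)

lemma integrable_gp_meas_bounded:
  fixes f :: "real \<Rightarrow> real"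
  assumes "f \<in> borel_measurable borel" "\<And>x. x \<in> gp_int \<alpha> \<Longrightarrow> \<bar>f x\<bar> \<le> B"
  shows "integrable (gp_meas \<alpha>) f"
  using AE_gp_meas assms by (intro gp.integrable_const_bound[of _ B]) (auto elim!: eventually_mono)

text \<open>The probability integral transform; it carries expectations over a uniform variable to
  the weighted space.\<close>

lemma distr_gp_cdf: "distr (gp_meas \<alpha>) borel (gp_cdf \<alpha>) = unif"
proof (intro cdf_unique ext)
  show "real_distribution (distr (gp_meas \<alpha>) borel (gp_cdf \<alpha>))"
    by (intro gp.real_distribution_distr) simp
  show "real_distribution unif"
    by (simp add: real_distribution_def real_distribution_axioms_def prob_space_unif)
  fix u :: real
  have "emeasure (gp_meas \<alpha>) {x. gp_cdf \<alpha> x \<le> u} = emeasure unif {..u}"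
  proof -
    have W: "0 < gp_cdf \<alpha> x \<and> gp_cdf \<alpha> x < 1" if "x \<in> gp_int \<alpha>" for x
      using gp_cdf_pos[OF that] gp_cdf_less_1[of \<alpha> x] that by (simp add: gp_int_iff)
    consider "u \<le> 0" | "1 \<le> u" | "0 < u" "u < 1" by linarith
    then show ?thesis
    proof cases
      case 1
      have "emeasure (gp_meas \<alpha>) {x. gp_cdf \<alpha> x \<le> u} = emeasure (gp_meas \<alpha>) {}"
        by (intro emeasure_eq_AE eventually_mono[OF AE_gp_meas]) (use W 1 in force)+
      moreover have "emeasure unif {..u} = emeasure unif {}"
        by (intro emeasure_eq_AE eventually_mono[OF AE_unif]) (use 1 in auto)
      ultimately show ?thesis by simp
    next
      case 2
      have "emeasure (gp_meas \<alpha>) {x. gp_cdf \<alpha> x \<le> u} = emeasure (gp_meas \<alpha>) UNIV"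
        by (intro emeasure_eq_AE eventually_mono[OF AE_gp_meas]) (use W 2 in force)+
      moreover have "emeasure unif {..u} = emeasure unif UNIV"
        by (intro emeasure_eq_AE eventually_mono[OF AE_unif]) (use 2 in auto)
      ultimately show ?thesis using gp.emeasure_space_1 unif.emeasure_space_1 by simp
    next
      case 3
      let ?x = "gp_inv \<alpha> (- ln (1 - u))"
      have x: "?x \<in> gp_dom \<alpha>" using 3 by (intro gp_inv_dom) simp
      have "emeasure (gp_meas \<alpha>) {x. gp_cdf \<alpha> x \<le> u} = emeasure (gp_meas \<alpha>) {..?x}"
      proof (intro emeasure_eq_AE eventually_mono[OF AE_gp_meas])
        fix y assume "y \<in> gp_int \<alpha>"
        then show "(y \<in> {x. gp_cdf \<alpha> x \<le> u}) = (y \<in> {..?x})"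
          using gp_cdf_le_iff[of y \<alpha> ?x] x gp_int_subset_dom gp_cdf_inv[of u \<alpha>] 3 by auto
      qed auto
      then show ?thesis
        using emeasure_gp_meas_atMost[OF x] emeasure_unif_atMost[of u] gp_cdf_inv[of u \<alpha>] 3 by simp
    qed
  qed
  then show "cdf (distr (gp_meas \<alpha>) borel (gp_cdf \<alpha>)) u = cdf unif u"
    by (simp add: cdf_def measure_distr vimage_def) (simp add: measure_def)
qed

end

section \<open>Shape of the transformed record density\<close>

lemma strictly_convex_onI_deriv:
  fixes f :: "real \<Rightarrow> real"
  assumes S: "is_interval S" and f: "\<And>x. x \<in> S \<Longrightarrow> (f has_real_derivative f' x) (at x)"
    and f': "strict_mono_on S f'"
  shows "strictly_convex_on S f"
proof -
  have aux: "f ((1 - t) * x + t * y) < (1 - t) * f x + t * f y"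
    if xy: "x \<in> S" "y \<in> S" "x < y" and t: "0 < t" "t < 1" for x y t
  proof -
    define z where "z = (1 - t) * x + t * y"
    have z: "z - x = t * (y - x)" "y - z = (1 - t) * (y - x)" by (simp_all add: z_def algebra_simps)
    have "0 < z - x" "0 < y - z" unfolding z using xy(3) t by simp_all
    then have xz: "x < z" "z < y" by linarith+
    have mem: "u \<in> S" if "x \<le> u" "u \<le> y" for u
      using S xy(1,2) that unfolding is_interval_1 by blast
    obtain u where u: "x < u" "u < z" "f z - f x = (z - x) * f' u"
      using MVT2[OF xz(1), of f f'] f mem xz by (meson less_imp_le order_trans)
    obtain v where v: "z < v" "v < y" "f y - f z = (y - z) * f' v"
      using MVT2[OF xz(2), of f f'] f mem xz by (meson less_imp_le order_trans)
    have "f' u < f' v"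
      using f' u v xz by (intro strict_mono_onD[OF f'] mem) auto
    then have "t * (1 - t) * (y - x) * f' u < t * (1 - t) * (y - x) * f' v"
      using t xy(3) by (intro mult_strict_left_mono mult_pos_pos) auto
    then have "(1 - t) * (f z - f x) < t * (f y - f z)"
      unfolding u(3) v(3) z by (simp add: mult_ac)
    then show ?thesis unfolding z_def[symmetric] by (simp add: algebra_simps)
  qed
  show ?thesis unfolding strictly_convex_on_def
  proof (intro ballI allI impI)
    fix x y t assume *: "x \<in> S" "y \<in> S" "x \<noteq> y" "0 < t" "t < (1::real)"
    show "f ((1 - t) * x + t * y) < (1 - t) * f x + t * f y"
    proof (cases "x < y")
      case True then show ?thesis using aux * by blast
    next
      case False
      then show ?thesis using aux[of y x "1 - t"] * by (simp add: add.commute)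
    qed
  qed
qed

locale gp_record =
  fixes \<alpha> :: real and k n :: nat
  assumes k2: "2 \<le> k" and n1: "1 \<le> n"
begin

lemma k1: "1 \<le> k" using k2 by simp

text \<open>In terms of the cumulative hazard \<open>s = - ln (1 - W x)\<close> the derivative of \<open>h\<close> at \<open>x\<close> is \<open>slope s\<close>,
  the second derivative has the sign of \<open>curv s\<close>, \<open>T x\<close> has the sign of \<open>tau s\<close>, the mean of \<open>h\<close>
  beyond \<open>x\<close> is \<open>tailavg s - 1\<close>, and \<open>h\<close> is maximal at \<open>crit\<close>.\<close>

definition kappa :: real where "kappa = real k - 1"

lemma kappa_ge: "1 \<le> kappa" using k2 by (simp add: kappa_def)

definition crit :: real where "crit = real n / kappa"

lemma crit_pos: "0 < crit" using kappa_ge n1 by (simp add: crit_def)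

definition slope :: "real \<Rightarrow> real" where
  "slope s = real k ^ (n + 1) / fact n * (exp ((\<alpha> - kappa) * s) * (s ^ (n - 1) * (real n - kappa * s)))"

definition curv :: "real \<Rightarrow> real" where
  "curv s = ((\<alpha> - kappa) * s + (real n - 1)) * (real n - kappa * s) - kappa * s"

lemma isCont_hfun: "0 < 1 - \<alpha> * x \<Longrightarrow> isCont (hfun \<alpha> k n) x"
  unfolding hfun_def[abs_def] by (intro continuous_intros isCont_ghat)

lemma measurable_hfun [measurable]: "hfun \<alpha> k n \<in> borel_measurable borel"
  unfolding hfun_def[abs_def] by measurable

text \<open>The derivative \<open>1 / (1 - \<alpha> * x)\<close> of the hazard equals
  \<open>exp (\<alpha> * s)\<close>, which shifts the exponent from \<open>- kappa\<close> to
  \<open>\<alpha> - kappa\<close>.\<close>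

lemma DERIV_hfun:
  assumes x: "0 < 1 - \<alpha> * x"
  shows "(hfun \<alpha> k n has_real_derivative slope (gp_haz \<alpha> x)) (at x)"
proof -
  let ?s = "gp_haz \<alpha> x" and ?K = "real k ^ (n + 1) / fact n"
  have n: "?s ^ n = ?s ^ (n - 1) * ?s" using n1 by (metis power_minus_mult less_le_trans zero_less_one)
  have "((\<lambda>s. ?K * (s ^ n * exp (- kappa * s)) - 1) has_real_derivative
      ?K * (real n * ?s ^ (n - 1) * exp (- kappa * ?s) + ?s ^ n * (exp (- kappa * ?s) * (- kappa)))) (at ?s)"
    by (auto intro!: derivative_eq_intros simp: One_nat_def)
  then have "((\<lambda>x. ?K * (gp_haz \<alpha> x ^ n * exp (- kappa * gp_haz \<alpha> x)) - 1) has_real_derivative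
      ?K * (real n * ?s ^ (n - 1) * exp (- kappa * ?s) + ?s ^ n * (exp (- kappa * ?s) * (- kappa))) * (1 / (1 - \<alpha> * x))) (at x)"
    by (rule DERIV_chain2[OF _ DERIV_gp_haz[OF x]])
  also have "?K * (real n * ?s ^ (n - 1) * exp (- kappa * ?s) + ?s ^ n * (exp (- kappa * ?s) * (- kappa))) * (1 / (1 - \<alpha> * x)) = slope ?s"
  proof -
    have "exp ((\<alpha> - kappa) * ?s) = exp (- kappa * ?s) / exp (- \<alpha> * ?s)"
      by (simp add: exp_diff[symmetric] algebra_simps)
    then show ?thesis unfolding slope_def n exp_gp_haz[OF x] by (simp add: algebra_simps add_divide_distrib diff_divide_distrib)
  qed
  finally have D: "((\<lambda>x. ?K * (gp_haz \<alpha> x ^ n * exp (- kappa * gp_haz \<alpha> x)) - 1) has_real_derivative slope ?s) (at x)" .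
  have "eventually (\<lambda>y. 0 < 1 - \<alpha> * y) (nhds x)"
    using x by (intro order_tendstoD(1)[of _ "1 - \<alpha> * x"] tendsto_intros) (auto simp: filterlim_ident)
  then have "eventually (\<lambda>y. hfun \<alpha> k n y = ?K * (gp_haz \<alpha> y ^ n * exp (- kappa * gp_haz \<alpha> y)) - 1) (nhds x)"
    by eventually_elim (simp add: hfun_def ghat_eq k1 kappa_def)
  then show ?thesis using D by (subst DERIV_cong_ev[OF refl _ refl])
qed

lemma deriv_hfun: "0 < 1 - \<alpha> * x \<Longrightarrow> deriv (hfun \<alpha> k n) x = slope (gp_haz \<alpha> x)"
  by (rule DERIV_imp_deriv[OF DERIV_hfun])

lemma K_pos: "0 < real k ^ (n + 1) / fact n"
  using k2 by simp

lemma slope_pos: "0 < s \<Longrightarrow> s < crit \<Longrightarrow> 0 < slope s"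
  unfolding slope_def using kappa_ge k2
  by (intro mult_pos_pos) (auto simp: crit_def field_simps)

lemma slope_neg: "crit < s \<Longrightarrow> slope s < 0"
proof -
  assume s: "crit < s"
  have "0 < s" using crit_pos s by linarith
  moreover have "real n - kappa * s < 0" using s kappa_ge by (simp add: crit_def field_simps)
  ultimately have "0 < s" "real n - kappa * s < 0" by auto
  then show ?thesis unfolding slope_def using K_pos
    by (intro mult_pos_neg) auto
qed

lemma DERIV_slope:
  assumes "0 < s"
  shows "(slope has_real_derivative real k ^ (n + 1) / fact n * (exp ((\<alpha> - kappa) * s) * (s ^ (n - 1) * (curv s / s)))) (at s)"
proof -
  have p: "((\<lambda>s. s ^ (n - 1)) has_real_derivative (real n - 1) * s ^ (n - 1) / s) (at s)"
  proof (cases "n = 1")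
    case False
    then have "s ^ (n - 1) = s ^ (n - 1 - 1) * s" using n1 by (metis power_minus_mult diff_is_0_eq nle_le not_gr_zero)
    moreover have "((\<lambda>s. s ^ (n - 1)) has_real_derivative real (n - 1) * s ^ (n - 1 - 1)) (at s)"
      using DERIV_pow[of "n - 1" s] by (simp add: One_nat_def)
    ultimately show ?thesis
      by (elim DERIV_cong) (use assms n1 in \<open>simp add: of_nat_diff\<close>)
  qed simp
  show ?thesis
    unfolding slope_def[abs_def]
  proof (rule DERIV_cong[OF DERIV_cmult[OF DERIV_mult[OF _ DERIV_mult[OF p]]]])
    show "((\<lambda>s. exp ((\<alpha> - kappa) * s)) has_real_derivative exp ((\<alpha> - kappa) * s) * (\<alpha> - kappa)) (at s)"
      by (auto intro!: derivative_eq_intros)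
    show "((\<lambda>s. real n - kappa * s) has_real_derivative - kappa) (at s)"
      by (auto intro!: derivative_eq_intros)
    have "E * a * (P * N) + (c * P / s * N + - kappa * P) * E = E * (P * (((a * s + c) * N - kappa * s) / s))"
      for E a P N c :: real using assms by (simp add: field_simps)
    then show "real k ^ (n + 1) / fact n * (exp ((\<alpha> - kappa) * s) * (\<alpha> - kappa) * (s ^ (n - 1) * (real n - kappa * s)) +
        ((real n - 1) * s ^ (n - 1) / s * (real n - kappa * s) + - kappa * s ^ (n - 1)) * exp ((\<alpha> - kappa) * s)) =
        real k ^ (n + 1) / fact n * (exp ((\<alpha> - kappa) * s) * (s ^ (n - 1) * (curv s / s)))"
      unfolding curv_def by presburger
  qed
qed

lemma slope_cont: "0 < s \<Longrightarrow> isCont slope s"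
  by (rule DERIV_isCont[OF DERIV_slope])

lemma slope_increasing:
  assumes "0 < s" "s < t" "\<And>r. s < r \<Longrightarrow> r < t \<Longrightarrow> 0 < curv r"
  shows "slope s < slope t"
proof (rule DERIV_pos_imp_increasing_open[OF assms(2)])
  show "\<exists>y. (slope has_real_derivative y) (at r) \<and> 0 < y" if "s < r" "r < t" for r
  proof (intro exI conjI)
    show "(slope has_real_derivative real k ^ (n + 1) / fact n * (exp ((\<alpha> - kappa) * r) * (r ^ (n - 1) * (curv r / r)))) (at r)"
      using that assms(1) by (intro DERIV_slope) auto
    show "0 < real k ^ (n + 1) / fact n * (exp ((\<alpha> - kappa) * r) * (r ^ (n - 1) * (curv r / r)))"
      using assms(3)[OF that] that assms(1) by (intro mult_pos_pos K_pos divide_pos_pos exp_gt_zero zero_less_power) auto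
  qed
  show "continuous_on {s..t} slope"
    using assms(1) by (intro continuous_at_imp_continuous_on ballI slope_cont) auto
qed

lemma slope_decreasing:
  assumes "0 < s" "s < t" "\<And>r. s < r \<Longrightarrow> r < t \<Longrightarrow> curv r < 0"
  shows "slope t < slope s"
proof (rule DERIV_neg_imp_decreasing_open[OF assms(2)])
  show "\<exists>y. (slope has_real_derivative y) (at r) \<and> y < 0" if "s < r" "r < t" for r
  proof (intro exI conjI)
    show "(slope has_real_derivative real k ^ (n + 1) / fact n * (exp ((\<alpha> - kappa) * r) * (r ^ (n - 1) * (curv r / r)))) (at r)"
      using that assms(1) by (intro DERIV_slope) auto
    have "r ^ (n - 1) * (curv r / r) < 0"
      using assms(3)[OF that] that assms(1) by (intro mult_pos_neg divide_neg_pos) auto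
    then show "real k ^ (n + 1) / fact n * (exp ((\<alpha> - kappa) * r) * (r ^ (n - 1) * (curv r / r))) < 0"
      using K_pos by (simp only: mult_pos_neg exp_gt_zero)
  qed
  show "continuous_on {s..t} slope"
    using assms(1) by (intro continuous_at_imp_continuous_on ballI slope_cont) auto
qed

text \<open>For \<open>n = 1\<close>, \<open>curv s\<close> is \<open>s\<close> times
  \<open>(\<alpha> - kappa) * (1 - kappa * s) - kappa\<close>. As \<open>\<alpha> - kappa\<close> is
  at most \<open>kappa\<close> and \<open>1 - kappa * s\<close> lies between 0 and 1, this factor is
  not positive. So \<open>h\<close> is concave up to its maximum.\<close>

lemma curv_neg_case1:
  assumes "n = 1" "\<alpha> \<le> 2 * real k - 2" "0 < s" "s \<le> crit"
  shows "curv s \<le> 0"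
proof -
  have "crit = 1 / kappa" unfolding crit_def using assms(1) by simp
  then have s: "0 \<le> 1 - kappa * s" "1 - kappa * s \<le> 1"
    using mult_right_mono[OF assms(4), of kappa] assms(3) kappa_ge by (simp_all add: mult.commute)
  have "(\<alpha> - kappa) * (1 - kappa * s) \<le> kappa * (1 - kappa * s)"
    using assms(2) s by (intro mult_right_mono) (auto simp: kappa_def)
  also have "\<dots> \<le> kappa * 1" using s kappa_ge by (intro mult_left_mono) auto
  finally have "s * ((\<alpha> - kappa) * (1 - kappa * s)) \<le> s * kappa" using assms(3) by (intro mult_left_mono) auto
  then show ?thesis unfolding curv_def using assms(1) by (simp add: algebra_simps)
qed

text \<open>Divided by the positive \<open>s * (n - kappa * s)\<close>, \<open>curv\<close> becomes
  strictly decreasing on \<open>(0, crit)\<close>, so it changes sign at most once. It is negative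
  at \<open>crit\<close>; for \<open>n\<close> at least 2 it is positive at 0, which gives a zero,
  and for \<open>n = 1\<close> the zero is explicit.\<close>

lemma curv_case2:
  assumes "n \<ge> 2 \<or> (n = 1 \<and> \<alpha> > 2 * real k - 2)"
  obtains sb where "0 < sb" "sb < crit" "\<And>s. 0 < s \<Longrightarrow> s < sb \<Longrightarrow> 0 < curv s" "\<And>s. sb < s \<Longrightarrow> s \<le> crit \<Longrightarrow> curv s < 0"
proof -
  have cc: "curv crit < 0" using kappa_ge n1 by (simp add: curv_def crit_def)
  have "\<exists>sb. 0 < sb \<and> sb < crit \<and> curv sb = 0"
  proof (cases "n = 1")
    case True
    then have a: "kappa < \<alpha> - kappa" using assms by (auto simp: kappa_def)
    \<comment> \<open>The solution of \<open>(\<alpha> - kappa) * (1 - kappa * s) = kappa\<close>,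
      which remains after cancelling the zero of \<open>curv\<close> at 0.\<close>
    define sb where "sb = (\<alpha> - 2 * kappa) / ((\<alpha> - kappa) * kappa)"
    have "0 < (\<alpha> - kappa) * kappa" using a kappa_ge by (intro mult_pos_pos) auto
    then have "0 < sb" unfolding sb_def using a by simp
    moreover have "sb < crit"
    proof -
      have "(\<alpha> - 2 * kappa) / (\<alpha> - kappa) < 1" using a kappa_ge by (simp add: field_simps)
      then show ?thesis unfolding sb_def crit_def using True kappa_ge by (simp add: divide_strict_right_mono flip: divide_divide_eq_left)
    qed
    moreover have "curv sb = 0"
    proof -
      have "kappa * sb = (\<alpha> - 2 * kappa) / (\<alpha> - kappa)" unfolding sb_def using kappa_ge by simp
      then have "(\<alpha> - kappa) * (1 - kappa * sb) = kappa" using a kappa_ge by (simp add: field_simps)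
      then have "sb * ((\<alpha> - kappa) * (1 - kappa * sb)) = sb * kappa" by simp
      then show ?thesis unfolding curv_def using True by (simp add: algebra_simps)
    qed
    ultimately show ?thesis by blast
  next
    case False
    then have "0 < curv 0" using n1 by (simp add: curv_def)
    moreover have "continuous_on {0..crit} curv" unfolding curv_def[abs_def] by (intro continuous_intros)
    ultimately obtain sb where sb: "0 \<le> sb" "sb \<le> crit" "curv sb = 0"
      using IVT2'[of curv crit 0 0] cc crit_pos by force
    then have "sb \<noteq> 0" "sb \<noteq> crit" using \<open>0 < curv 0\<close> cc by auto
    with sb show ?thesis by (intro exI[of _ sb]) auto
  qed
  then obtain sb where sb: "0 < sb" "sb < crit" "curv sb = 0" by blast
  define \<psi> where "\<psi> s = \<alpha> - kappa + (real n - 1) / s - kappa / (real n - kappa * s)" for s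
  have cpsi: "curv s = s * (real n - kappa * s) * \<psi> s" and pos: "0 < s * (real n - kappa * s)"
    if "0 < s" "s < crit" for s
  proof -
    have p: "0 < real n - kappa * s" using that kappa_ge by (simp add: crit_def field_simps)
    then show "0 < s * (real n - kappa * s)" using that by simp
    have "s * N * (a + b / s - c / N) = (a * s + b) * N - c * s" if "N \<noteq> 0" for N a b c :: real
      using that \<open>0 < s\<close> by (simp add: field_simps)
    then show "curv s = s * (real n - kappa * s) * \<psi> s" using p unfolding curv_def \<psi>_def by force
  qed
  have anti: "\<psi> t < \<psi> s" if "0 < s" "s < t" "t < crit" for s t
  proof -
    have p: "0 < real n - kappa * t" using that kappa_ge by (simp add: crit_def field_simps)
    have "(real n - 1) / t \<le> (real n - 1) / s" using that n1 by (intro divide_left_mono) auto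
    moreover have "kappa / (real n - kappa * s) < kappa / (real n - kappa * t)"
    proof -
      have "kappa * s < kappa * t" using that kappa_ge by simp
      then show ?thesis using kappa_ge p by (intro divide_strict_left_mono mult_pos_pos) linarith+
    qed
    ultimately show ?thesis unfolding \<psi>_def by linarith
  qed
  have "\<psi> sb = 0" using cpsi[OF sb(1,2)] pos[OF sb(1,2)] sb(3) by (metis less_irrefl mult_eq_0_iff)
  show ?thesis
  proof (rule that[OF sb(1,2)])
    fix s assume "0 < s" "s < sb"
    then show "0 < curv s" using cpsi[of s] pos[of s] anti[of s sb] sb \<open>\<psi> sb = 0\<close> by simp
  next
    fix s assume s: "sb < s" "s \<le> crit"
    show "curv s < 0"
    proof (cases "s = crit")
      case False
      then have "s < crit" using s by simp
      then show ?thesis using cpsi[of s] pos[of s] anti[of sb s] sb s \<open>\<psi> sb = 0\<close> by (simp add: mult_pos_neg)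
    qed (use cc in simp)
  qed
qed

section \<open>Where the record density meets its tail average\<close>

definition tau :: "real \<Rightarrow> real" where
  "tau s = kappa * ((real k * s) ^ n / fact n) - (\<Sum>i<n. (real k * s) ^ i / fact i)"

definition tailavg :: "real \<Rightarrow> real" where
  "tailavg s = exp (- kappa * s) * (\<Sum>i\<le>n. (real k * s) ^ i / fact i)"

text \<open>At the zero of \<open>tau\<close>, \<open>h\<close> equals its own mean beyond that
  point. This is where a constant tail can be attached continuously.\<close>

lemma ghat_tau: "0 < 1 - \<alpha> * x \<Longrightarrow> ghat \<alpha> k n x = tailavg (gp_haz \<alpha> x) + exp (- kappa * gp_haz \<alpha> x) * tau (gp_haz \<alpha> x)"
proof -
  assume "0 < 1 - \<alpha> * x"
  then have "ghat \<alpha> k n x = exp (- kappa * gp_haz \<alpha> x) * (real k * ((real k * gp_haz \<alpha> x) ^ n / fact n))"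
    using k1 by (simp add: ghat_eq kappa_def power_mult_distrib power_add)
  moreover have "(\<Sum>i\<le>n. (real k * gp_haz \<alpha> x) ^ i / fact i) =
     (\<Sum>i<n. (real k * gp_haz \<alpha> x) ^ i / fact i) + (real k * gp_haz \<alpha> x) ^ n / fact n"
    by (simp add: lessThan_Suc_atMost[symmetric])
  moreover have "E * (S + Y) + E * ((K - 1) * Y - S) = E * (K * Y)" for E S Y K :: real
    by (simp add: algebra_simps)
  ultimately show ?thesis by (simp only: tailavg_def tau_def kappa_def)
qed

lemma Tfun_tau:
  assumes "0 < 1 - \<alpha> * x"
  shows "Tfun \<alpha> k n x = (1 - gp_cdf \<alpha> x) * (exp (- kappa * gp_haz \<alpha> x) * tau (gp_haz \<alpha> x))"
proof -
  have g: "ghat \<alpha> k i x = real k * (exp (- kappa * gp_haz \<alpha> x) * ((real k * gp_haz \<alpha> x) ^ i / fact i))" for i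
    using assms k1 by (simp add: ghat_eq kappa_def power_mult_distrib power_add)
  have "(\<Sum>i<n. ghat \<alpha> k i x) = real k * (exp (- kappa * gp_haz \<alpha> x) * (\<Sum>i<n. (real k * gp_haz \<alpha> x) ^ i / fact i))"
    unfolding g by (simp add: sum_distrib_left)
  then have "- (1 / real k) * (\<Sum>i<n. ghat \<alpha> k i x) + (1 - 1 / real k) * ghat \<alpha> k n x =
     exp (- kappa * gp_haz \<alpha> x) * tau (gp_haz \<alpha> x)"
    unfolding g[of n] tau_def kappa_def using k2 by (simp add: field_simps)
  then show ?thesis unfolding Tfun_def by simp
qed

lemma tailavg_eq:
  assumes "0 < 1 - \<alpha> * x"
  shows "(gp_cdf \<alpha> x - Ghat \<alpha> k n x) / (1 - gp_cdf \<alpha> x) = tailavg (gp_haz \<alpha> x) - 1"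
    "gp_cdf \<alpha> x - Ghat \<alpha> k n x = (1 - gp_cdf \<alpha> x) * (tailavg (gp_haz \<alpha> x) - 1)"
proof -
  let ?s = "gp_haz \<alpha> x"
  have "exp (- real k * ?s) = exp (- ?s) * exp (- kappa * ?s)"
    by (simp add: exp_add[symmetric] kappa_def algebra_simps)
  then show *: "gp_cdf \<alpha> x - Ghat \<alpha> k n x = (1 - gp_cdf \<alpha> x) * (tailavg ?s - 1)"
    using assms by (simp add: Ghat_eq gp_cdf_eq tailavg_def algebra_simps)
  show "(gp_cdf \<alpha> x - Ghat \<alpha> k n x) / (1 - gp_cdf \<alpha> x) = tailavg ?s - 1"
    unfolding * using gp_cdf_less_1[OF assms] by simp
qed

text \<open>Since \<open>kappa * (k * crit) = k * n\<close>, the bound passes from \<open>m\<close>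
  to \<open>m + 1\<close>: a further summand raises the factor \<open>kappa\<close> to
  \<open>k\<close>, and \<open>k * (m + 1)\<close> is at most \<open>k * n\<close>.\<close>

lemma tau_crit: "0 < tau crit"
proof -
  let ?x = "real k * crit"
  have x: "kappa * ?x = real k * real n" using kappa_ge by (simp add: crit_def)
  have xp: "0 < ?x" using k2 crit_pos by simp
  have "(\<Sum>i<m. ?x ^ i / fact i) < kappa * (?x ^ m / fact m)" if "m \<le> n" for m
    using that
  proof (induction m)
    case 0 then show ?case using kappa_ge by simp
  next
    case (Suc m)
    have "(\<Sum>i<Suc m. ?x ^ i / fact i) < kappa * (?x ^ m / fact m) + ?x ^ m / fact m"
      using Suc by simp
    also have "\<dots> = real k * (?x ^ m / fact m)" unfolding kappa_def left_diff_distrib by simp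
    also have "\<dots> = (real k * real (Suc m)) * (?x ^ m / fact (Suc m))" by (simp add: fact_Suc del: of_nat_Suc)
    also have "\<dots> \<le> (real k * real n) * (?x ^ m / fact (Suc m))"
      using Suc.prems xp by (intro mult_right_mono mult_left_mono) auto
    also have "\<dots> = kappa * (?x ^ Suc m / fact (Suc m))" unfolding x[symmetric] by simp
    finally show ?case .
  qed
  from this[of n] show ?thesis by (simp add: tau_def)
qed

text \<open>After division by \<open>s ^ n\<close> a constant minus a positive combination of
  negative powers of \<open>s\<close> remains. Hence \<open>tau\<close> changes sign at most once,
  from negative to positive.\<close>

lemma tau_scaled_mono:
  assumes "0 < s" "s < t"
  shows "tau s / s ^ n < tau t / t ^ n"
proof -
  have e: "tau s / s ^ n = kappa * (real k ^ n / fact n) - (\<Sum>i<n. real k ^ i / fact i * (1 / s ^ (n - i)))" if s: "0 < s" for s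
  proof -
    have "(real k * s) ^ i / fact i / s ^ n = real k ^ i / fact i * (1 / s ^ (n - i))" if "i < n" for i
    proof -
      have "s ^ n = s ^ i * s ^ (n - i)" using that by (simp add: power_add[symmetric])
      then show ?thesis using s by (simp add: power_mult_distrib field_simps)
    qed
    then show ?thesis unfolding tau_def diff_divide_distrib sum_divide_distrib
      using s by (simp add: power_mult_distrib)
  qed
  have "(\<Sum>i<n. real k ^ i / fact i * (1 / t ^ (n - i))) < (\<Sum>i<n. real k ^ i / fact i * (1 / s ^ (n - i)))"
  proof (rule sum_strict_mono)
    fix i assume "i \<in> {..<n}"
    then have "s ^ (n - i) < t ^ (n - i)" using assms by (intro power_strict_mono) auto
    then have "1 / t ^ (n - i) < 1 / s ^ (n - i)" using assms by (intro divide_strict_left_mono) auto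
    then show "real k ^ i / fact i * (1 / t ^ (n - i)) < real k ^ i / fact i * (1 / s ^ (n - i))"
      using k2 by (intro mult_strict_left_mono) auto
  qed (use n1 in \<open>auto simp: lessThan_empty_iff\<close>)
  then show ?thesis using e[of s] e[of t] assms by simp
qed

lemma tau_zero:
  obtains s0 where "0 < s0" "s0 < crit" "tau s0 = 0" "\<And>s. 0 \<le> s \<Longrightarrow> s < s0 \<Longrightarrow> tau s < 0" "\<And>s. s0 < s \<Longrightarrow> 0 < tau s"
proof -
  have t0: "tau 0 = - 1"
  proof -
    have "(\<Sum>i<n. (real k * 0) ^ i / fact i) = (\<Sum>i<n. if i = 0 then 1 else 0 :: real)"
      by (intro sum.cong) auto
    then show ?thesis using n1 by (simp add: tau_def)
  qed
  have "continuous_on {0..crit} tau" unfolding tau_def[abs_def] by (intro continuous_intros) auto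
  then obtain s0 where s0: "0 \<le> s0" "s0 \<le> crit" "tau s0 = 0"
    using IVT'[of tau 0 0 crit] t0 tau_crit crit_pos by force
  then have p: "0 < s0" "s0 < crit" using t0 tau_crit by (auto simp: less_le)
  show ?thesis
  proof (rule that[OF p s0(3)])
    fix s assume "0 \<le> s" "s < s0"
    then show "tau s < 0" using tau_scaled_mono[of s s0] t0 s0(3)
      by (cases "s = 0") (auto simp: divide_less_0_iff)
  next
    fix s assume "s0 < s"
    then show "0 < tau s" using tau_scaled_mono[of s0 s] p s0(3) by (auto simp: zero_less_divide_iff)
  qed
qed

text \<open>The tail average increases exactly while it exceeds \<open>ghat\<close>, that is, while
  \<open>tau\<close> is negative.\<close>

lemma DERIV_tailavg: "(tailavg has_real_derivative - (exp (- kappa * s) * tau s)) (at s)"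
proof -
  have "((\<lambda>s. \<Sum>i\<le>m. (real k * s) ^ i / fact i) has_real_derivative real k * (\<Sum>i<m. (real k * s) ^ i / fact i)) (at s)" for m
  proof (induction m)
    case (Suc m)
    have d: "((\<lambda>s. (real k * s) ^ Suc m / fact (Suc m)) has_real_derivative (real (Suc m) * (real k * s) ^ m * real k) / fact (Suc m)) (at s)"
      by (auto intro!: derivative_eq_intros simp del: power_Suc of_nat_Suc fact_Suc)
    have "(real (Suc m) * (real k * s) ^ m * real k) / fact (Suc m) = real k * ((real k * s) ^ m / fact m)"
      by (simp add: fact_Suc del: of_nat_Suc)
    with DERIV_add[OF Suc d] show ?case by (simp add: distrib_left del: power_Suc fact_Suc of_nat_Suc)
  qed simp
  note S = this[of n]
  have "(tailavg has_real_derivative exp (- kappa * s) * (- kappa) * (\<Sum>i\<le>n. (real k * s) ^ i / fact i)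
     + exp (- kappa * s) * (real k * (\<Sum>i<n. (real k * s) ^ i / fact i))) (at s)"
    unfolding tailavg_def[abs_def]
  proof (rule DERIV_cong[OF DERIV_mult[OF _ S]])
    show "((\<lambda>s. exp (- kappa * s)) has_real_derivative exp (- kappa * s) * (- kappa)) (at s)"
      by (auto intro!: derivative_eq_intros)
  qed (simp only: mult_ac)
  moreover have "(\<Sum>i\<le>n. (real k * s) ^ i / fact i) = (\<Sum>i<n. (real k * s) ^ i / fact i) + (real k * s) ^ n / fact n"
    by (simp add: lessThan_Suc_atMost[symmetric])
  then have "exp (- kappa * s) * (- kappa) * (\<Sum>i\<le>n. (real k * s) ^ i / fact i)
     + exp (- kappa * s) * (real k * (\<Sum>i<n. (real k * s) ^ i / fact i)) = - (exp (- kappa * s) * tau s)"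
  proof -
    have "E * (- (K - 1)) * (S + Y) + E * (K * S) = - (E * ((K - 1) * Y - S))" for E S Y K :: real
      by (simp add: algebra_simps)
    then show ?thesis using \<open>(\<Sum>i\<le>n. (real k * s) ^ i / fact i) = (\<Sum>i<n. (real k * s) ^ i / fact i) + (real k * s) ^ n / fact n\<close>
      unfolding tau_def kappa_def by presburger
  qed
  ultimately show ?thesis by simp
qed

lemma tailavg_0: "tailavg 0 = 1"
proof -
  have "(\<Sum>i\<le>n. (real k * 0) ^ i / fact i) = (\<Sum>i\<le>n. if i = 0 then 1 else 0 :: real)"
    by (intro sum.cong) auto
  then show ?thesis by (simp add: tailavg_def)
qed

lemma tailavg_tendsto: "(tailavg \<longlongrightarrow> 0) at_top"
proof -
  have "((\<lambda>s. \<Sum>i\<le>n. real k ^ i / fact i * (s ^ i * exp (- kappa * s))) \<longlongrightarrow> (\<Sum>i\<le>n. real k ^ i / fact i * 0)) at_top"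
    using kappa_ge by (intro tendsto_intros tendsto_power_mult_exp) auto
  moreover have "tailavg = (\<lambda>s. \<Sum>i\<le>n. real k ^ i / fact i * (s ^ i * exp (- kappa * s)))"
    by (simp add: fun_eq_iff tailavg_def sum_distrib_left power_mult_distrib mult_ac)
  ultimately show ?thesis by (simp only: mult_zero_right sum.neutral_const)
qed

text \<open>The zero of \<open>W - G\<close> beyond the maximum of the tail average.\<close>

lemma tailavg_shape:
  assumes s0: "0 < s0" "\<And>s. 0 \<le> s \<Longrightarrow> s < s0 \<Longrightarrow> tau s < 0" "\<And>s. s0 < s \<Longrightarrow> 0 < tau s"
  obtains s1 where "s0 < s1" "tailavg s1 = 1" "\<And>s. 0 < s \<Longrightarrow> s < s1 \<Longrightarrow> 1 < tailavg s"
proof -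
  have cont: "continuous_on A tailavg" for A
    by (intro continuous_at_imp_continuous_on ballI DERIV_isCont[OF DERIV_tailavg])
  have inc: "tailavg s < tailavg t" if "0 \<le> s" "s < t" "t \<le> s0" for s t
  proof (rule DERIV_pos_imp_increasing_open[OF that(2) _ cont])
    fix r assume "s < r" "r < t"
    then have "tau r < 0" using s0(2) that by simp
    then show "\<exists>y. (tailavg has_real_derivative y) (at r) \<and> 0 < y"
      using DERIV_tailavg[of r] by (intro exI conjI) (auto simp: mult_pos_neg)
  qed
  have dec: "tailavg t < tailavg s" if "s0 \<le> s" "s < t" for s t
  proof (rule DERIV_neg_imp_decreasing_open[OF that(2) _ cont])
    fix r assume "s < r" "r < t"
    then have "0 < tau r" using s0(3) that by simp
    then show "\<exists>y. (tailavg has_real_derivative y) (at r) \<and> y < 0"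
      using DERIV_tailavg[of r] by (intro exI conjI) auto
  qed
  have g1: "1 < tailavg s" if "0 < s" "s \<le> s0" for s using inc[of 0 s] that tailavg_0 by simp
  have "eventually (\<lambda>s. tailavg s < 1) at_top"
    using order_tendstoD(2)[OF tailavg_tendsto, of 1] by simp
  then have "eventually (\<lambda>s. tailavg s < 1 \<and> s0 < s) at_top"
    using eventually_gt_at_top[of s0] by (rule eventually_conj)
  then obtain s2 where s2: "tailavg s2 < 1" "s0 < s2"
    using eventually_happens'[OF trivial_limit_at_top_linorder] by blast
  then obtain s1 where s1: "s0 \<le> s1" "s1 \<le> s2" "tailavg s1 = 1"
    using IVT2'[of tailavg s2 1 s0] g1[of s0] s0(1) cont by force
  then have "s0 \<noteq> s1" using g1[of s0] s0(1) by auto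
  then have "s0 < s1" using s1 by simp
  moreover have "1 < tailavg s" if "0 < s" "s < s1" for s
    using g1[of s] dec[of s s1] s1 that by (cases "s \<le> s0") auto
  ultimately show ?thesis using that s1(3) by blast
qed

end

section \<open>Integrals with respect to the generalized Pareto measure\<close>

context
  fixes \<alpha> :: real
begin

interpretation gp: prob_space "gp_meas \<alpha>"
  by (rule prob_space_gp_meas)

abbreviation gp_E :: "(real \<Rightarrow> real) \<Rightarrow> real" where
  "gp_E f \<equiv> integral\<^sup>L (gp_meas \<alpha>) f"

lemma gp_dom_below: "y \<in> gp_dom \<alpha> \<Longrightarrow> 0 \<le> x \<Longrightarrow> x \<le> y \<Longrightarrow> x \<in> gp_dom \<alpha>"
  using gp_pos_below[of x y \<alpha>] by (simp add: gp_dom_iff)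

lemma continuous_on_gp_cdf: "y \<in> gp_dom \<alpha> \<Longrightarrow> continuous_on {0..y} (gp_cdf \<alpha>)"
  using gp_dom_below[of y] by (intro continuous_at_imp_continuous_on ballI isCont_gp_cdf) (auto simp: gp_dom_iff)

lemma continuous_on_Ghat: "y \<in> gp_dom \<alpha> \<Longrightarrow> 1 \<le> k \<Longrightarrow> continuous_on {0..y} (Ghat \<alpha> k n)"
  using gp_dom_below[of y] by (intro continuous_at_imp_continuous_on ballI isCont_Ghat) (auto simp: gp_dom_iff)

lemma continuous_on_ghat: "y \<in> gp_dom \<alpha> \<Longrightarrow> continuous_on {0..y} (ghat \<alpha> k n)"
  using gp_dom_below[of y] by (intro continuous_at_imp_continuous_on ballI isCont_ghat) (auto simp: gp_dom_iff)

lemma gp_E_cdf: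
  assumes "y \<in> gp_dom \<alpha>" "0 \<le> a" "a \<le> y"
  shows "gp_E (indicator {a<..y}) = gp_cdf \<alpha> y - gp_cdf \<alpha> a"
proof -
  have "gp_E (\<lambda>x. indicator {a<..y} x * 1) = gp_cdf \<alpha> y - gp_cdf \<alpha> a"
    by (rule gp_meas_FTC(2))
      (use assms gp_pos_below[of _ y \<alpha>] in \<open>auto simp: gp_dom_iff intro: DERIV_subset[OF DERIV_gp_cdf]\<close>)
  then show ?thesis by simp
qed

lemma gp_E_split:
  fixes f :: "real \<Rightarrow> real"
  assumes f: "integrable (gp_meas \<alpha>) f" and y: "0 \<le> y"
  shows "gp_E f = gp_E (\<lambda>x. indicator {0<..y} x * f x) + gp_E (\<lambda>x. indicator {y<..} x * f x)"
proof -
  have i: "integrable (gp_meas \<alpha>) (\<lambda>x. indicator A x * f x)" if "A \<in> sets borel" for A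
    using integrable_mult_indicator[OF _ f, of A] that by simp
  have "gp_E f = gp_E (\<lambda>x. indicator {0<..y} x * f x + indicator {y<..} x * f x)"
    using f AE_gp_meas[of \<alpha>] y by (intro integral_cong_AE) (auto elim!: eventually_mono simp: indicator_def gp_int_iff)
  then show ?thesis using i by simp
qed

lemma gp_E_cdf_tail:
  assumes "y \<in> gp_dom \<alpha>"
  shows "gp_E (indicator {y<..}) = 1 - gp_cdf \<alpha> y"
  using gp_E_split[of "\<lambda>_. 1" y] gp_E_cdf[OF assms, of 0] assms gp.prob_space by (simp add: gp_dom_iff)

lemma gp_E_rec_dens:
  fixes f :: "real \<Rightarrow> real"
  assumes [measurable]: "f \<in> borel_measurable borel"
  shows "integral\<^sup>L unif f = gp_E (\<lambda>x. f (gp_cdf \<alpha> x))"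
    and "integrable unif f \<longleftrightarrow> integrable (gp_meas \<alpha>) (\<lambda>x. f (gp_cdf \<alpha> x))"
  using integral_distr[of "gp_cdf \<alpha>" "gp_meas \<alpha>" borel f] integrable_distr_eq[of "gp_cdf \<alpha>" "gp_meas \<alpha>" borel f]
  unfolding distr_gp_cdf by simp_all

lemma gp_ghat_integrable: "2 \<le> k \<Longrightarrow> integrable (gp_meas \<alpha>) (ghat \<alpha> k n)"
  using gp_int_subset_dom by (intro integrable_gp_meas_bounded[of _ _ "real k ^ (n + 1)"] ghat_bounded) auto

lemma gp_E_ghat_total:
  assumes "2 \<le> k"
  shows "gp_E (ghat \<alpha> k n) = 1"
proof -
  have m: "rec_dens k n \<in> borel_measurable borel" unfolding rec_dens_def[abs_def] by measurable
  have "ennreal (integral\<^sup>L unif (rec_dens k n)) = (\<integral>\<^sup>+u. ennreal (rec_dens k n u) \<partial>unif)"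
    using gp_ghat_integrable[OF assms, of n] gp_E_rec_dens(2)[OF m] 
    by (intro nn_integral_eq_integral[symmetric] eventually_mono[OF AE_unif]) (auto simp: ghat_def[abs_def] intro: rec_dens_nonneg)
  also have "\<dots> = 1" using assms by (intro nn_integral_rec_dens) auto
  finally have "integral\<^sup>L unif (rec_dens k n) = 1"
    by (metis ennreal_1 ennreal_eq_1 enn2real_1 enn2real_ennreal ennreal_neg le_cases zero_neq_one)
  then show ?thesis using gp_E_rec_dens(1)[OF m] by (simp add: ghat_def[abs_def])
qed

lemma gp_E_ghat:
  assumes "y \<in> gp_dom \<alpha>" "0 \<le> a" "a \<le> y" "1 \<le> k"
  shows "gp_E (\<lambda>x. indicator {a<..y} x * ghat \<alpha> k n x) = Ghat \<alpha> k n y - Ghat \<alpha> k n a"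
  by (rule gp_meas_FTC(2))
    (use assms gp_pos_below[of _ y \<alpha>] in \<open>auto simp: gp_dom_iff intro: DERIV_subset[OF DERIV_Ghat]
       intro!: continuous_on_subset[OF continuous_on_ghat[OF assms(1)]]\<close>)

lemma gp_E_ghat_tail:
  assumes "y \<in> gp_dom \<alpha>" "2 \<le> k"
  shows "gp_E (\<lambda>x. indicator {y<..} x * ghat \<alpha> k n x) = 1 - Ghat \<alpha> k n y"
  using gp_E_split[OF gp_ghat_integrable[OF assms(2)], of y n] gp_E_ghat[OF assms(1), of 0 k n] gp_E_ghat_total[OF assms(2)] assms
  by (simp add: gp_dom_iff)

lemma DERIV_integral_upto:
  fixes f :: "real \<Rightarrow> real"
  assumes "continuous_on {0..y} f" "0 \<le> x" "x \<le> y"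
  shows "((\<lambda>t. integral {0..t} f) has_real_derivative f x) (at x within {0..y})"
  using integral_has_real_derivative[OF assms(1)] assms by simp

text \<open>Integration by parts: the integral of \<open>W\<close> is the mean of the positive part
  of \<open>y - x\<close>. In \<open>gp_E_intW2\<close> and \<open>gp_E_intG\<close> the same is
  done for its square and with the weight \<open>ghat\<close>.\<close>

lemma gp_E_intW:
  assumes y: "y \<in> gp_dom \<alpha>"
  shows "gp_E (\<lambda>x. indicator {0<..y} x * (y - x)) = intW \<alpha> y"
proof -
  let ?\<Phi> = "\<lambda>x. (y - x) * gp_cdf \<alpha> x + integral {0..x} (gp_cdf \<alpha>)"
  have "gp_E (\<lambda>x. indicator {0<..y} x * (y - x)) = ?\<Phi> y - ?\<Phi> 0"
  proof (rule gp_meas_FTC(2))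
    fix x assume x: "0 \<le> x" "x \<le> y"
    have "(?\<Phi> has_real_derivative ((-1) * gp_cdf \<alpha> x + gp_dens \<alpha> x * (y - x)) + gp_cdf \<alpha> x) (at x within {0..y})"
      by (intro DERIV_add DERIV_mult DERIV_integral_upto[OF continuous_on_gp_cdf[OF y] x] DERIV_subset[OF DERIV_gp_cdf])
        (use gp_dom_below[OF y x] in \<open>auto simp: gp_dom_iff intro!: derivative_eq_intros\<close>)
    then show "(?\<Phi> has_real_derivative (y - x) * gp_dens \<alpha> x) (at x within {0..y})" by (simp add: mult.commute)
  qed (use y in \<open>auto simp: gp_dom_iff intro!: continuous_intros\<close>)
  then show ?thesis by (simp add: intW_def)
qed

lemma intW_mult_minus:
  assumes y: "y \<in> gp_dom \<alpha>"
  shows "integral {0..y} (\<lambda>x. (y - x) * gp_cdf \<alpha> x) = y * intW \<alpha> y - intxW \<alpha> y"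
proof -
  have c: "continuous_on {0..y} (gp_cdf \<alpha>)" by (rule continuous_on_gp_cdf[OF y])
  have "integral {0..y} (\<lambda>x. y * gp_cdf \<alpha> x - x * gp_cdf \<alpha> x) = integral {0..y} (\<lambda>x. y * gp_cdf \<alpha> x) - integral {0..y} (\<lambda>x. x * gp_cdf \<alpha> x)"
    by (intro Henstock_Kurzweil_Integration.integral_diff integrable_continuous_real continuous_intros c)
  then show ?thesis by (simp add: intW_def intxW_def left_diff_distrib)
qed

lemma gp_E_intW2:
  assumes y: "y \<in> gp_dom \<alpha>"
  shows "gp_E (\<lambda>x. indicator {0<..y} x * (y - x)\<^sup>2) = 2 * (y * intW \<alpha> y - intxW \<alpha> y)"
proof -
  let ?\<Phi> = "\<lambda>x. (y - x)\<^sup>2 * gp_cdf \<alpha> x + 2 * integral {0..x} (\<lambda>x. (y - x) * gp_cdf \<alpha> x)"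
  have "gp_E (\<lambda>x. indicator {0<..y} x * (y - x)\<^sup>2) = ?\<Phi> y - ?\<Phi> 0"
  proof (rule gp_meas_FTC(2))
    fix x assume x: "0 \<le> x" "x \<le> y"
    have c: "continuous_on {0..y} (\<lambda>x. (y - x) * gp_cdf \<alpha> x)"
      by (intro continuous_intros continuous_on_gp_cdf[OF y])
    have "(?\<Phi> has_real_derivative ((- 2 * (y - x)) * gp_cdf \<alpha> x + gp_dens \<alpha> x * (y - x)\<^sup>2) + 2 * ((y - x) * gp_cdf \<alpha> x)) (at x within {0..y})"
      by (intro DERIV_add DERIV_mult DERIV_cmult DERIV_integral_upto[OF c x] DERIV_subset[OF DERIV_gp_cdf])
        (use gp_dom_below[OF y x] in \<open>auto simp: gp_dom_iff intro!: derivative_eq_intros\<close>)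
    then show "(?\<Phi> has_real_derivative (y - x)\<^sup>2 * gp_dens \<alpha> x) (at x within {0..y})" by (simp add: mult.commute algebra_simps)
  qed (use y in \<open>auto simp: gp_dom_iff intro!: continuous_intros\<close>)
  then show ?thesis using intW_mult_minus[OF y] by simp
qed

lemma gp_E_intG:
  assumes y: "y \<in> gp_dom \<alpha>" and k: "1 \<le> k"
  shows "gp_E (\<lambda>x. indicator {0<..y} x * (ghat \<alpha> k n x * (y - x))) = intG \<alpha> k n y"
proof -
  let ?\<Phi> = "\<lambda>x. (y - x) * Ghat \<alpha> k n x + integral {0..x} (Ghat \<alpha> k n)"
  have "gp_E (\<lambda>x. indicator {0<..y} x * (ghat \<alpha> k n x * (y - x))) = ?\<Phi> y - ?\<Phi> 0"
  proof (rule gp_meas_FTC(2))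
    fix x assume x: "0 \<le> x" "x \<le> y"
    have "(?\<Phi> has_real_derivative ((-1) * Ghat \<alpha> k n x + (ghat \<alpha> k n x * gp_dens \<alpha> x) * (y - x)) + Ghat \<alpha> k n x) (at x within {0..y})"
      by (intro DERIV_add DERIV_mult DERIV_integral_upto[OF continuous_on_Ghat[OF y k] x] DERIV_subset[OF DERIV_Ghat])
        (use gp_dom_below[OF y x] k in \<open>auto simp: gp_dom_iff intro!: derivative_eq_intros\<close>)
    then show "(?\<Phi> has_real_derivative ghat \<alpha> k n x * (y - x) * gp_dens \<alpha> x) (at x within {0..y})" by (simp add: mult_ac)
  qed (use y in \<open>auto simp: gp_dom_iff intro!: continuous_intros continuous_on_ghat\<close>)
  then show ?thesis by (simp add: intG_def)
qed

text \<open>Squaring doubles \<open>n\<close> and the exponent \<open>k - 1\<close>, so up to a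
  constant the square is again a record density, with parameters \<open>2 * k - 1\<close> and
  \<open>2 * n\<close>. This is the origin of the constants in \<open>B0\<close> and
  \<open>B1\<close>.\<close>

lemma rec_dens_square:
  assumes "1 \<le> k"
  shows "(rec_dens k n u)\<^sup>2 = real k ^ (2 * (n + 1)) * fact (2 * n) / ((fact n)\<^sup>2 * (2 * real k - 1) ^ (2 * n + 1))
     * rec_dens (2 * k - 1) (2 * n) u"
proof -
  have k: "real (2 * k - 1) = 2 * real k - 1" "2 * k - 1 - 1 = 2 * (k - 1)" using assms by (auto simp: of_nat_diff)
  have p: "(x ^ m)\<^sup>2 = x ^ (2 * m)" for x :: real and m
    unfolding power_mult[symmetric] by (simp only: mult.commute)
  have *: "A / F\<^sup>2 * B * C = A * G / (F\<^sup>2 * P) * (P / G * B * C)" if "P \<noteq> 0" "G \<noteq> 0" for A B C F G P :: real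
    using that by simp
  show ?thesis
    unfolding rec_dens_def power_mult_distrib power_divide p k
    by (rule *) (use assms in auto)
qed

lemma gp_E_ghat2:
  assumes "y \<in> gp_dom \<alpha>" "0 \<le> a" "a \<le> y" "2 \<le> k"
  shows "gp_E (\<lambda>x. indicator {a<..y} x * (ghat \<alpha> k n x)\<^sup>2) =
     real k ^ (2 * (n + 1)) * fact (2 * n) / ((fact n)\<^sup>2 * (2 * real k - 1) ^ (2 * n + 1))
       * (Ghat \<alpha> (2 * k - 1) (2 * n) y - Ghat \<alpha> (2 * k - 1) (2 * n) a)"
proof -
  let ?c = "real k ^ (2 * (n + 1)) * fact (2 * n) / ((fact n)\<^sup>2 * (2 * real k - 1) ^ (2 * n + 1))"
  have "(ghat \<alpha> k n x)\<^sup>2 = ?c * ghat \<alpha> (2 * k - 1) (2 * n) x" for x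
    using assms unfolding ghat_def by (intro rec_dens_square) auto
  then have "gp_E (\<lambda>x. indicator {a<..y} x * (ghat \<alpha> k n x)\<^sup>2) = gp_E (\<lambda>x. ?c * (indicator {a<..y} x * ghat \<alpha> (2 * k - 1) (2 * n) x))"
    by (intro Bochner_Integration.integral_cong) (simp_all only: mult_ac)
  then show ?thesis using gp_E_ghat[OF assms(1-3), of "2 * k - 1" "2 * n"] assms(4) by simp
qed

text \<open>A nonempty open interval has positive mass; this turns almost sure identities into
  contradictions at a point.\<close>

lemma gp_AE_ex:
  assumes "AE x in gp_meas \<alpha>. P x" "a < b" "{a<..<b} \<subseteq> gp_int \<alpha>"
  shows "\<exists>x\<in>{a<..<b}. P x"
proof (rule ccontr)
  assume no: "\<not> ?thesis"
  have "AE x in lborel. x \<in> gp_int \<alpha> \<longrightarrow> P x"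
  proof -
    have "AE x in lborel. 0 < ennreal (indicator (gp_int \<alpha>) x * gp_dens \<alpha> x) \<longrightarrow> P x"
      using assms(1) unfolding gp_meas_def by (subst (asm) AE_density) auto
    then show ?thesis by eventually_elim (auto simp: gp_int_iff gp_dens_pos)
  qed
  then have "AE x in lborel. x \<notin> {a<..<b}" by eventually_elim (use no assms(3) in auto)
  then have "emeasure lborel {a<..<b} = 0" by (subst (asm) AE_iff_measurable[of "{a<..<b}"]) auto
  then show False using assms(2) by simp
qed

lemma AE_gp_neq: "AE x in gp_meas \<alpha>. x \<noteq> a"
  unfolding gp_meas_def using AE_lborel_singleton[of a]
  by (subst AE_density) (auto elim!: eventually_mono)

lemma gp_E_pos:
  fixes f :: "real \<Rightarrow> real"
  assumes "integrable (gp_meas \<alpha>) f" "AE x in gp_meas \<alpha>. 0 \<le> f x" "a < b" "{a<..<b} \<subseteq> gp_int \<alpha>"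
    and "\<And>x. a < x \<Longrightarrow> x < b \<Longrightarrow> 0 < f x"
  shows "0 < gp_E f"
proof -
  have "0 \<le> gp_E f" using assms(2) by (rule integral_nonneg_AE)
  moreover have "gp_E f \<noteq> 0"
  proof
    assume "gp_E f = 0"
    then have "AE x in gp_meas \<alpha>. f x = 0"
      using integral_nonneg_eq_0_iff_AE[OF assms(1,2)] by simp
    then obtain x where "x \<in> {a<..<b}" "f x = 0" using gp_AE_ex assms(3,4) by blast
    then show False using assms(5)[of x] by auto
  qed
  ultimately show ?thesis by simp
qed

lemma gp_Ioo_subset: "y \<in> gp_dom \<alpha> \<Longrightarrow> 0 \<le> a \<Longrightarrow> {a<..<y} \<subseteq> gp_int \<alpha>"
  using gp_dom_below[of y] by (auto simp: gp_int_iff gp_dom_iff)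

lemma gp_integrable_poly:
  fixes f :: "real \<Rightarrow> real"
  assumes "y \<in> gp_dom \<alpha>" "f \<in> borel_measurable borel" "continuous_on {0..y} f"
  shows "integrable (gp_meas \<alpha>) (\<lambda>x. indicator {0<..y} x * f x)"
proof -
  have "compact (f ` {0..y})" using assms(3) by (intro compact_continuous_image) auto
  from compact_imp_bounded[OF this] obtain B where "\<And>x. x \<in> {0..y} \<Longrightarrow> norm (f x) \<le> B"
    unfolding bounded_iff by (metis imageI)
  then show ?thesis
    using assms(2) by (intro integrable_gp_meas_bounded[of _ _ "max B 0"]) (auto simp: indicator_def le_max_iff_disj)
qed

lemma intW_pos:
  assumes "y \<in> gp_int \<alpha>"
  shows "0 < intW \<alpha> y"
proof -
  have y: "y \<in> gp_dom \<alpha>" "0 < y" using assms by (auto simp: gp_int_iff gp_dom_iff)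
  show ?thesis unfolding gp_E_intW[OF y(1), symmetric]
  proof (rule gp_E_pos[of _ 0 y, OF _ AE_I2])
    show "{0<..<y} \<subseteq> gp_int \<alpha>" by (rule gp_Ioo_subset[OF y(1)]) simp
  qed (use y in \<open>auto intro!: gp_integrable_poly continuous_intros mult_nonneg_nonneg split: split_indicator\<close>)
qed

lemma intW2_pos:
  assumes "y \<in> gp_int \<alpha>"
  shows "0 < y * intW \<alpha> y - intxW \<alpha> y"
proof -
  have y: "y \<in> gp_dom \<alpha>" "0 < y" using assms by (auto simp: gp_int_iff gp_dom_iff)
  have "0 < gp_E (\<lambda>x. indicator {0<..y} x * (y - x)\<^sup>2)"
  proof (rule gp_E_pos[of _ 0 y, OF _ AE_I2])
    show "{0<..<y} \<subseteq> gp_int \<alpha>" by (rule gp_Ioo_subset[OF y(1)]) simp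
  qed (use y in \<open>auto intro!: gp_integrable_poly continuous_intros mult_nonneg_nonneg split: split_indicator\<close>)
  then show ?thesis unfolding gp_E_intW2[OF y(1)] by simp
qed

lemma continuous_on_intW: "y \<in> gp_dom \<alpha> \<Longrightarrow> continuous_on {0..y} (intW \<alpha>)"
  unfolding intW_def[abs_def] by (intro indefinite_integral_continuous_1 integrable_continuous_real continuous_on_gp_cdf)

lemma continuous_on_intxW: "y \<in> gp_dom \<alpha> \<Longrightarrow> continuous_on {0..y} (intxW \<alpha>)"
  unfolding intxW_def[abs_def] by (intro indefinite_integral_continuous_1 integrable_continuous_real continuous_on_gp_cdf continuous_intros)

lemma continuous_on_intG: "y \<in> gp_dom \<alpha> \<Longrightarrow> 1 \<le> k \<Longrightarrow> continuous_on {0..y} (intG \<alpha> k n)"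
  unfolding intG_def[abs_def] by (intro indefinite_integral_continuous_1 integrable_continuous_real continuous_on_Ghat)

section \<open>Sign changes\<close>

lemma gp_E_nonpos: "(\<And>x. f x \<le> 0) \<Longrightarrow> gp_E f \<le> 0"
  using integral_nonneg_AE[where M="gp_meas \<alpha>" and f="\<lambda>x. - f x"] by simp

lemma gp_E_sign_zero:
  fixes r :: "real \<Rightarrow> real"
  assumes "integrable (gp_meas \<alpha>) (\<lambda>x. indicator K x * r x)" "gp_E (\<lambda>x. indicator K x * r x) = 0"
    and "AE x in gp_meas \<alpha>. x \<in> K \<longrightarrow> 0 \<le> r x"
  shows "AE x in gp_meas \<alpha>. x \<in> K \<longrightarrow> r x = 0"
proof -
  have "AE x in gp_meas \<alpha>. 0 \<le> indicator K x * r x"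
    using assms(3) by eventually_elim (auto simp: indicator_def)
  then have "AE x in gp_meas \<alpha>. indicator K x * r x = 0"
    using integral_nonneg_eq_0_iff_AE[OF assms(1)] assms(2) by simp
  then show ?thesis by eventually_elim (auto simp: indicator_def)
qed

lemma gp_E_zero_mult:
  fixes r q :: "real \<Rightarrow> real"
  assumes "AE x in gp_meas \<alpha>. x \<in> K \<longrightarrow> r x = 0"
  shows "gp_E (\<lambda>x. indicator K x * (r x * q x)) = 0"
  by (rule integral_eq_zero_AE) (use assms in eventually_elim, auto simp: indicator_def)

text \<open>As \<open>r\<close> has mean 0 on \<open>K\<close>, a constant may be subtracted from
  \<open>q\<close>. One that lies between the values of \<open>q\<close> off \<open>S\<close> and
  those on \<open>S\<close> makes the integrand nonpositive everywhere. In the equality case a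
  strictly increasing \<open>q\<close> takes this constant at most once.\<close>

lemma gp_E_one_sign_change:
  fixes r q :: "real \<Rightarrow> real"
  assumes S: "S \<subseteq> K" "\<And>x y. x \<in> S \<Longrightarrow> y \<in> K \<Longrightarrow> x < y \<Longrightarrow> y \<in> S"
    and r: "\<And>x. x \<in> S \<Longrightarrow> r x \<le> 0" "\<And>x. x \<in> K - S \<Longrightarrow> 0 \<le> r x"
    and int: "integrable (gp_meas \<alpha>) (\<lambda>x. indicator K x * r x)" "integrable (gp_meas \<alpha>) (\<lambda>x. indicator K x * (r x * q x))"
    and zero: "gp_E (\<lambda>x. indicator K x * r x) = 0" and q: "mono_on K q"
  shows "gp_E (\<lambda>x. indicator K x * (r x * q x)) \<le> 0"
    and "strict_mono_on K q \<Longrightarrow> 0 \<le> gp_E (\<lambda>x. indicator K x * (r x * q x)) \<Longrightarrow> AE x in gp_meas \<alpha>. x \<in> K \<longrightarrow> r x = 0"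
proof -
  have "gp_E (\<lambda>x. indicator K x * (r x * q x)) \<le> 0 \<and>
    (strict_mono_on K q \<longrightarrow> 0 \<le> gp_E (\<lambda>x. indicator K x * (r x * q x)) \<longrightarrow> (AE x in gp_meas \<alpha>. x \<in> K \<longrightarrow> r x = 0))"
  proof (cases "S = {} \<or> S = K")
    case True
    then have "AE x in gp_meas \<alpha>. x \<in> K \<longrightarrow> r x = 0"
    proof
      assume "S = {}"
      then show ?thesis using r by (intro gp_E_sign_zero[OF int(1) zero]) auto
    next
      assume "S = K"
      then have "AE x in gp_meas \<alpha>. x \<in> K \<longrightarrow> - r x = 0"
        using r int(1) zero by (intro gp_E_sign_zero) auto
      then show ?thesis by eventually_elim auto
    qed
    then show ?thesis using gp_E_zero_mult[of K r q] by simp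
  next
    case False
    then obtain s0 x0 where s0: "s0 \<in> S" and x0: "x0 \<in> K - S" using S(1) by blast
    have less: "x < s" if "x \<in> K - S" "s \<in> S" for x s
      using S(2)[of s x] that by (metis DiffD1 DiffD2 linorder_less_linear)
    have qle: "q x \<le> q s" if "x \<in> K - S" "s \<in> S" for x s
      using q less[OF that] that S(1) by (auto simp: mono_on_def)
    define c where "c = Sup (q ` (K - S))"
    have bdd: "bdd_above (q ` (K - S))" using qle[OF _ s0] by (intro bdd_aboveI2[of _ _ "q s0"])
    have c1: "q x \<le> c" if "x \<in> K - S" for x unfolding c_def using bdd that by (intro cSup_upper) auto
    have c2: "c \<le> q s" if "s \<in> S" for s unfolding c_def using qle[OF _ that] x0 by (intro cSup_least) auto
    have nonpos: "indicator K x * (r x * (q x - c)) \<le> 0" for x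
      using c1[of x] c2[of x] r[of x] S(1)
      by (cases "x \<in> S"; cases "x \<in> K") (auto simp: indicator_def mult_le_0_iff)
    have e: "(\<lambda>x. indicator K x * (r x * (q x - c))) = (\<lambda>x. indicator K x * (r x * q x) - c * (indicator K x * r x))"
      by (auto simp: algebra_simps)
    have i: "integrable (gp_meas \<alpha>) (\<lambda>x. indicator K x * (r x * (q x - c)))"
      unfolding e using int by simp
    have eq: "gp_E (\<lambda>x. indicator K x * (r x * (q x - c))) = gp_E (\<lambda>x. indicator K x * (r x * q x))"
      unfolding e using int zero by simp
    have le: "gp_E (\<lambda>x. indicator K x * (r x * q x)) \<le> 0"
      unfolding eq[symmetric] using nonpos by (rule gp_E_nonpos)
    moreover have "AE x in gp_meas \<alpha>. x \<in> K \<longrightarrow> r x = 0"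
      if sm: "strict_mono_on K q" and ge: "0 \<le> gp_E (\<lambda>x. indicator K x * (r x * q x))"
    proof -
      have 0: "gp_E (\<lambda>x. - (indicator K x * (r x * (q x - c)))) = 0" using le ge eq by simp
      have "AE x in gp_meas \<alpha>. - (indicator K x * (r x * (q x - c))) = 0"
        using integral_nonneg_eq_0_iff_AE[of "gp_meas \<alpha>" "\<lambda>x. - (indicator K x * (r x * (q x - c)))"] i nonpos 0 by simp
      moreover have "AE x in gp_meas \<alpha>. x \<in> K \<longrightarrow> q x \<noteq> c"
      proof (cases "\<exists>a\<in>K. q a = c")
        case True
        then obtain a where a: "a \<in> K" "q a = c" by blast
        then have "q x \<noteq> c" if "x \<in> K" "x \<noteq> a" for x
          using strict_mono_on_eqD[OF sm, of x a] that by auto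
        then show ?thesis using AE_gp_neq[of a] by (auto elim!: eventually_mono)
      qed auto
      ultimately show ?thesis by eventually_elim (auto simp: indicator_def)
    qed
    ultimately show ?thesis by blast
  qed
  then show "gp_E (\<lambda>x. indicator K x * (r x * q x)) \<le> 0"
    "strict_mono_on K q \<Longrightarrow> 0 \<le> gp_E (\<lambda>x. indicator K x * (r x * q x)) \<Longrightarrow> AE x in gp_meas \<alpha>. x \<in> K \<longrightarrow> r x = 0"
    by blast+
qed

lemma concave_three_points:
  fixes q :: "real \<Rightarrow> real"
  assumes "concave_on K q" "u \<in> K" "w \<in> K" "u < v" "v < w"
  shows "q u * (w - v) + q w * (v - u) \<le> q v * (w - u)"
proof -
  define t where "t = (v - u) / (w - u)"
  have t: "0 \<le> t" "t \<le> 1" using assms by (auto simp: t_def)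
  have tw: "t * (w - u) = v - u" using assms by (simp add: t_def)
  then have v: "(1 - t) * u + t * w = v" by (simp add: algebra_simps)
  have "(1 - t) * q u + t * q w \<le> q v"
    using concave_onD[OF assms(1) t assms(2,3)] v by simp
  then have "((1 - t) * q u + t * q w) * (w - u) \<le> q v * (w - u)"
    using assms by (intro mult_right_mono) auto
  moreover have "((1 - t) * q u + t * q w) * (w - u) = q u * (w - u - t * (w - u)) + q w * (t * (w - u))"
    by (simp add: algebra_simps)
  then have "((1 - t) * q u + t * q w) * (w - u) = q u * (w - v) + q w * (v - u)"
    unfolding tw by simp
  ultimately show ?thesis by simp
qed

text \<open>Provides an affine function whose difference from \<open>q\<close> changes sign at two
  prescribed points. Affinity is expressed through \<open>l 0\<close> and \<open>l 1\<close>, so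
  that no coefficients have to be exported.\<close>

lemma concave_secant:
  fixes q :: "real \<Rightarrow> real"
  assumes q: "concave_on K q" and z: "z1 \<in> K" "z2 \<in> K" "z1 < z2"
  obtains l where "\<And>x. l x = l 0 + (l 1 - l 0) * x"
    "\<And>x. x \<in> K \<Longrightarrow> x \<le> z1 \<or> z2 \<le> x \<Longrightarrow> q x \<le> l x" "\<And>x. z1 \<le> x \<Longrightarrow> x \<le> z2 \<Longrightarrow> l x \<le> q x"
proof -
  define m where "m = (q z2 - q z1) / (z2 - z1)"
  have m: "m * (z2 - z1) = q z2 - q z1" using z by (simp add: m_def)
  define l where "l x = q z1 + m * (x - z1)" for x
  have l: "l x * (z2 - z1) = q z1 * (z2 - x) + q z2 * (x - z1)" for x
  proof -
    have "l x * (z2 - z1) = q z1 * (z2 - z1) + (m * (z2 - z1)) * (x - z1)" by (simp add: l_def algebra_simps)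
    also have "\<dots> = q z1 * (z2 - x) + q z2 * (x - z1)" unfolding m by (simp add: algebra_simps)
    finally show ?thesis .
  qed
  have d: "0 < z2 - z1" using z by simp
  show ?thesis
  proof (rule that[of l])
    fix x
    show "l x = l 0 + (l 1 - l 0) * x" by (simp add: l_def algebra_simps)
  next
    fix x assume x: "x \<in> K" "x \<le> z1 \<or> z2 \<le> x"
    consider "x = z1" | "x = z2" | "x < z1" | "z2 < x" using x by linarith
    then have "q x * (z2 - z1) \<le> l x * (z2 - z1)"
    proof cases
      case 3
      then show ?thesis unfolding l using concave_three_points[OF q x(1) z(2) 3 z(3)] by (simp add: algebra_simps)
    next
      case 4
      then show ?thesis unfolding l using concave_three_points[OF q z(1) x(1) z(3) 4] by (simp add: algebra_simps)
    qed (simp_all add: l)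
    then show "q x \<le> l x" using d by simp
  next
    fix x assume x: "z1 \<le> x" "x \<le> z2"
    consider "x = z1" | "x = z2" | "z1 < x" "x < z2" using x by linarith
    then have "l x * (z2 - z1) \<le> q x * (z2 - z1)"
    proof cases
      case 3
      then show ?thesis unfolding l using concave_three_points[OF q z(1,2) 3] by simp
    qed (simp_all add: l)
    then show "l x \<le> q x" using d by simp
  qed
qed

text \<open>As \<open>r\<close> is orthogonal to affine functions, the chord of \<open>q\<close>
  over the interval where \<open>r\<close> is negative may be subtracted; the remainder has nowhere
  the same sign as \<open>r\<close>. If \<open>r\<close> is negative at no more than one point, or
  nonnegative on one side of the negative set only, the two moments force \<open>r = 0\<close>
  almost everywhere.\<close>

lemma gp_E_two_sign_changes:
  fixes r q :: "real \<Rightarrow> real"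
  assumes S: "\<And>x y z. x \<in> K \<Longrightarrow> y \<in> K \<Longrightarrow> z \<in> K \<Longrightarrow> x < y \<Longrightarrow> y < z \<Longrightarrow> r x < 0 \<Longrightarrow> r z < 0 \<Longrightarrow> r y < 0"
    and K: "is_interval K"
    and int: "integrable (gp_meas \<alpha>) (\<lambda>x. indicator K x * r x)" "integrable (gp_meas \<alpha>) (\<lambda>x. indicator K x * (r x * x))"
      "integrable (gp_meas \<alpha>) (\<lambda>x. indicator K x * (r x * q x))"
    and zero: "gp_E (\<lambda>x. indicator K x * r x) = 0" "gp_E (\<lambda>x. indicator K x * (r x * x)) = 0"
    and q: "concave_on K q"
  shows "gp_E (\<lambda>x. indicator K x * (r x * q x)) \<le> 0"
proof -
  let ?S = "{x\<in>K. r x < 0}"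
  let ?L = "{x\<in>K - ?S. \<exists>s\<in>?S. x < s}" and ?U = "{x\<in>K - ?S. \<exists>s\<in>?S. s < x}"
  have sm: "strict_mono_on K (\<lambda>x. x)" "mono_on K (\<lambda>x. x)" by (auto simp: monotone_on_def)
  have fin: ?thesis if "AE x in gp_meas \<alpha>. x \<in> K \<longrightarrow> r x = 0" using gp_E_zero_mult[OF that, of q] by simp
  show ?thesis
  proof (cases "\<exists>s1\<in>?S. \<exists>s2\<in>?S. s1 < s2")
    case False
    then have "\<exists>s. ?S \<subseteq> {s}" by (metis (no_types, lifting) insertI1 linorder_less_linear subsetI)
    then obtain s where s: "?S \<subseteq> {s}" by blast
    have "AE x in gp_meas \<alpha>. x \<in> K \<longrightarrow> 0 \<le> r x"
      using AE_gp_neq[of s] by eventually_elim (use s in auto)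
    then show ?thesis by (intro fin gp_E_sign_zero int(1) zero(1))
  next
    case True
    then obtain s1 s2 where s: "s1 \<in> ?S" "s2 \<in> ?S" "s1 < s2" by blast
    have part: "x \<in> ?L \<or> x \<in> ?U" if "x \<in> K" "x \<notin> ?S" for x
    proof -
      have "x \<noteq> s1" using that s by auto
      then consider "x < s1" | "s1 < x" by linarith
      then show ?thesis using that s(1) by cases blast+
    qed
    have disj: "x < t" if "x \<in> ?L" "t \<in> ?S" for x t
    proof (rule ccontr)
      assume "\<not> x < t"
      moreover have "x \<noteq> t" using that by auto
      ultimately have "t < x" by simp
      moreover from that(1) obtain t' where "t' \<in> ?S" "x < t'" by force
      ultimately show False using S[of t x t'] that by auto
    qed
    have disj': "t < x" if "x \<in> ?U" "t \<in> ?S" for x t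
    proof (rule ccontr)
      assume "\<not> t < x"
      moreover have "x \<noteq> t" using that by auto
      ultimately have "x < t" by simp
      moreover from that(1) obtain t' where "t' \<in> ?S" "t' < x" by force
      ultimately show False using S[of t' x t] that by auto
    qed
    show ?thesis
    proof (cases "?L = {} \<or> ?U = {}")
      case True
      then have "AE x in gp_meas \<alpha>. x \<in> K \<longrightarrow> r x = 0"
      proof
        assume L: "?L = {}"
        have "AE x in gp_meas \<alpha>. x \<in> K \<longrightarrow> - r x = 0"
        proof (rule gp_E_one_sign_change(2)[where q="\<lambda>x. x" and S="?U"])
          show "y \<in> ?U" if "x \<in> ?U" "y \<in> K" "x < y" for x y
          proof -
            obtain t where t: "t \<in> ?S" "t < x" using \<open>x \<in> ?U\<close> by blast
            then have "t < y" using that by simp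
            moreover have "y \<notin> ?S" using disj'[OF that(1), of y] that(3) by auto
            ultimately show ?thesis using t that by blast
          qed
          show "0 \<le> - r x" if "x \<in> K - ?U" for x
          proof -
            have "x \<in> ?S" using part[of x] that L by blast
            then show ?thesis by simp
          qed
          show "mono_on K (\<lambda>x. x)" "strict_mono_on K (\<lambda>x. x)" by (rule sm)+
        qed (use int zero in auto)
        then show ?thesis by eventually_elim auto
      next
        assume U: "?U = {}"
        show ?thesis
        proof (rule gp_E_one_sign_change(2)[where q="\<lambda>x. x" and S="?S"])
          show "y \<in> ?S" if "x \<in> ?S" "y \<in> K" "x < y" for x y
          proof (rule ccontr)
            assume "y \<notin> ?S"
            then have "y \<in> ?U" using that by blast
            with U show False by blast
          qed
          show "mono_on K (\<lambda>x. x)" "strict_mono_on K (\<lambda>x. x)" by (rule sm)+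
        qed (use int zero in auto)
      qed
      then show ?thesis by (rule fin)
    next
      case False
      then obtain l0 u0 where l0: "l0 \<in> ?L" and u0: "u0 \<in> ?U" by blast
      \<comment> \<open>The ends of the negative set. They belong to \<open>K\<close>, an interval
        with points on both sides of the negative set.\<close>
      define z1 z2 where "z1 = Sup ?L" and "z2 = Inf ?U"
      have bL: "bdd_above ?L" using disj[OF _ s(1)] by (intro bdd_aboveI[of _ s1]) (auto intro: less_imp_le)
      have bU: "bdd_below ?U" using disj'[OF _ s(1)] by (intro bdd_belowI[of _ s1]) (auto intro: less_imp_le)
      have z1S: "z1 \<le> t" if "t \<in> ?S" for t
        unfolding z1_def using l0 disj[OF _ that] by (intro cSup_least) (blast, blast intro: less_imp_le)
      have z2S: "t \<le> z2" if "t \<in> ?S" for t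
        unfolding z2_def using u0 disj'[OF _ that] by (intro cInf_greatest) (blast, blast intro: less_imp_le)
      have Lz: "x \<le> z1" if "x \<in> ?L" for x unfolding z1_def by (rule cSup_upper[OF that bL])
      have Uz: "z2 \<le> x" if "x \<in> ?U" for x unfolding z2_def by (rule cInf_lower[OF that bU])
      have "z1 \<in> K" using K l0 s(1) Lz[OF l0] z1S[OF s(1)] unfolding is_interval_1 by blast
      moreover have "z2 \<in> K" using K u0 s(1) Uz[OF u0] z2S[OF s(1)] unfolding is_interval_1 by blast
      moreover have "z1 < z2" using z1S[OF s(1)] z2S[OF s(2)] s(3) by linarith
      ultimately obtain l where l: "\<And>x. l x = l 0 + (l 1 - l 0) * x"
        "\<And>x. x \<in> K \<Longrightarrow> x \<le> z1 \<or> z2 \<le> x \<Longrightarrow> q x \<le> l x" "\<And>x. z1 \<le> x \<Longrightarrow> x \<le> z2 \<Longrightarrow> l x \<le> q x"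
        using concave_secant[OF q, of z1 z2] by metis
      have nonpos: "indicator K x * (r x * (q x - l x)) \<le> 0" for x
      proof (cases "x \<in> K")
        case True
        show ?thesis
        proof (cases "x \<in> ?S")
          case True
          then have "l x \<le> q x" using z1S z2S by (intro l(3)) auto
          then show ?thesis using True by (simp add: mult_nonpos_nonneg)
        next
          case False
          then have "x \<le> z1 \<or> z2 \<le> x" using part[OF True] Lz Uz by blast
          then have "q x \<le> l x" using l(2)[OF True] by blast
          moreover have "0 \<le> r x" using False True by auto
          ultimately show ?thesis using True by (simp add: mult_nonneg_nonpos)
        qed
      qed simp
      have e: "(\<lambda>x. indicator K x * (r x * (q x - l x))) = (\<lambda>x. indicator K x * (r x * q x) -
         (l 0 * (indicator K x * r x) + (l 1 - l 0) * (indicator K x * (r x * x))))"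
      proof
        fix x show "indicator K x * (r x * (q x - l x)) = indicator K x * (r x * q x) -
         (l 0 * (indicator K x * r x) + (l 1 - l 0) * (indicator K x * (r x * x)))"
          by (subst l(1)) (simp add: algebra_simps)
      qed
      have "gp_E (\<lambda>x. indicator K x * (r x * (q x - l x))) = gp_E (\<lambda>x. indicator K x * (r x * q x))"
        unfolding e using int zero by simp
      moreover have "gp_E (\<lambda>x. indicator K x * (r x * (q x - l x))) \<le> 0"
        using nonpos by (rule gp_E_nonpos)
      ultimately show ?thesis by simp
    qed
  qed
qed

end

lemma gp_integrable_mult_bounded:
  fixes f q :: "real \<Rightarrow> real"
  assumes q: "integrable (gp_meas \<alpha>) q" and [measurable]: "f \<in> borel_measurable borel"
    and f: "\<And>x. x \<in> gp_int \<alpha> \<Longrightarrow> \<bar>f x\<bar> \<le> B"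
  shows "integrable (gp_meas \<alpha>) (\<lambda>x. f x * q x)"
proof (rule Bochner_Integration.integrable_bound)
  show "integrable (gp_meas \<alpha>) (\<lambda>x. B * \<bar>q x\<bar>)" using q by simp
  show "(\<lambda>x. f x * q x) \<in> borel_measurable (gp_meas \<alpha>)" using borel_measurable_integrable[OF q] by measurable
  show "AE x in gp_meas \<alpha>. norm (f x * q x) \<le> norm (B * \<bar>q x\<bar>)"
    using AE_gp_meas
  proof eventually_elim
    case (elim x)
    then have "\<bar>f x\<bar> * \<bar>q x\<bar> \<le> B * \<bar>q x\<bar>" using f by (intro mult_right_mono) auto
    also have "\<dots> \<le> \<bar>B\<bar> * \<bar>q x\<bar>" by (intro mult_right_mono) auto
    finally show ?case by (simp add: abs_mult)
  qed
qed

lemma gp_square_integrable: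
  fixes q :: "real \<Rightarrow> real"
  assumes "q \<in> borel_measurable borel" "integrable (gp_meas \<alpha>) (\<lambda>x. (q x)\<^sup>2)"
  shows "integrable (gp_meas \<alpha>) q"
proof -
  interpret prob_space "gp_meas \<alpha>" by (rule prob_space_gp_meas)
  show ?thesis by (rule square_integrable_imp_integrable) (use assms in auto)
qed

lemma gp_E_cong:
  fixes f g :: "real \<Rightarrow> real"
  assumes "f \<in> borel_measurable borel" "g \<in> borel_measurable borel" "\<And>x. x \<in> gp_int \<alpha> \<Longrightarrow> f x = g x"
  shows "gp_E \<alpha> f = gp_E \<alpha> g"
  using assms by (intro integral_cong_AE eventually_mono[OF AE_gp_meas]) auto

context gp_record
begin

section \<open>Residuals beyond and before a point\<close>

lemma hfun_bounded: "x \<in> gp_int \<alpha> \<Longrightarrow> \<bar>hfun \<alpha> k n x\<bar> \<le> real k ^ (n + 1) + 1"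
proof -
  assume "x \<in> gp_int \<alpha>"
  then have "\<bar>ghat \<alpha> k n x\<bar> \<le> real k ^ (n + 1)" using gp_int_subset_dom by (intro ghat_bounded k2) auto
  then show ?thesis unfolding hfun_def by linarith
qed

lemma hfun_integrable: "integrable (gp_meas \<alpha>) (hfun \<alpha> k n)"
  by (rule integrable_gp_meas_bounded[OF measurable_hfun hfun_bounded])

lemma hfun_mean: "gp_E \<alpha> (hfun \<alpha> k n) = 0"
proof -
  interpret prob_space "gp_meas \<alpha>" by (rule prob_space_gp_meas)
  show ?thesis using gp_E_ghat_total[OF k2, of \<alpha> n] gp_ghat_integrable[OF k2, of \<alpha> n] prob_space
    unfolding hfun_def[abs_def] by simp
qed

definition cx :: real where "cx = gp_inv \<alpha> crit"

lemma cx_int: "cx \<in> gp_int \<alpha>" unfolding cx_def by (rule gp_inv_int[OF crit_pos])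

lemma gp_haz_le_crit: "x \<in> gp_dom \<alpha> \<Longrightarrow> gp_haz \<alpha> x < crit \<longleftrightarrow> x < cx" "x \<in> gp_dom \<alpha> \<Longrightarrow> crit < gp_haz \<alpha> x \<longleftrightarrow> cx < x"
  using gp_haz_less_iff[of x \<alpha> cx] gp_haz_less_iff[of cx \<alpha> x] cx_int gp_int_subset_dom by (auto simp: cx_def)

lemma hfun_less:
  assumes "0 \<le> x" "x < y" "y \<le> cx"
  shows "hfun \<alpha> k n x < hfun \<alpha> k n y"
proof (rule DERIV_pos_imp_increasing_open[OF assms(2)])
  have dom: "z \<in> gp_dom \<alpha>" if "0 \<le> z" "z \<le> cx" for z
    using gp_dom_below[of cx \<alpha> z] that cx_int gp_int_subset_dom by auto
  show "continuous_on {x..y} (hfun \<alpha> k n)"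
    using dom assms by (intro continuous_at_imp_continuous_on ballI isCont_hfun) (auto simp: gp_dom_iff)
  fix z assume z: "x < z" "z < y"
  then have d: "z \<in> gp_dom \<alpha>" using assms by (intro dom) auto
  then have "0 < gp_haz \<alpha> z" "gp_haz \<alpha> z < crit" using z assms gp_haz_pos[of z \<alpha>] gp_haz_le_crit(1)[of z] by (auto simp: gp_dom_iff)
  then show "\<exists>y. (hfun \<alpha> k n has_real_derivative y) (at z) \<and> 0 < y"
    using DERIV_hfun[of z] slope_pos d by (auto simp: gp_dom_iff)
qed

lemma hfun_greater:
  assumes "cx \<le> x" "x < y" "y \<in> gp_dom \<alpha>"
  shows "hfun \<alpha> k n y < hfun \<alpha> k n x"
proof (rule DERIV_neg_imp_decreasing_open[OF assms(2)])
  have c0: "0 < cx" using cx_int by (simp add: gp_int_iff)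
  have dom: "z \<in> gp_dom \<alpha>" if "cx \<le> z" "z \<le> y" for z
    using gp_dom_below[of y \<alpha> z] that c0 assms by auto
  show "continuous_on {x..y} (hfun \<alpha> k n)"
    using dom assms by (intro continuous_at_imp_continuous_on ballI isCont_hfun) (auto simp: gp_dom_iff)
  fix z assume z: "x < z" "z < y"
  then have d: "z \<in> gp_dom \<alpha>" using assms by (intro dom) auto
  then have "crit < gp_haz \<alpha> z" using z assms gp_haz_le_crit(2)[of z] by auto
  then show "\<exists>y. (hfun \<alpha> k n has_real_derivative y) (at z) \<and> y < 0"
    using DERIV_hfun[of z] slope_neg d by (auto simp: gp_dom_iff)
qed

definition tail_mean :: "real \<Rightarrow> real" where "tail_mean y = tailavg (gp_haz \<alpha> y) - 1"

lemma tail_mean_eq: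
  assumes "y \<in> gp_dom \<alpha>"
  shows "(gp_cdf \<alpha> y - Ghat \<alpha> k n y) / (1 - gp_cdf \<alpha> y) = tail_mean y"
    "gp_cdf \<alpha> y - Ghat \<alpha> k n y = (1 - gp_cdf \<alpha> y) * tail_mean y"
  using tailavg_eq[of y] assms by (auto simp: gp_dom_iff tail_mean_def)

lemma hfun_tail_mean:
  assumes "y \<in> gp_dom \<alpha>"
  shows "hfun \<alpha> k n y = tail_mean y + exp (- kappa * gp_haz \<alpha> y) * tau (gp_haz \<alpha> y)"
  using ghat_tau[of y] assms by (simp add: gp_dom_iff hfun_def tail_mean_def)

lemma tail_zero:
  assumes y: "y \<in> gp_dom \<alpha>"
  shows "gp_E \<alpha> (\<lambda>x. indicator {y<..} x * (hfun \<alpha> k n x - tail_mean y)) = 0"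
proof -
  interpret prob_space "gp_meas \<alpha>" by (rule prob_space_gp_meas)
  have i: "integrable (gp_meas \<alpha>) (\<lambda>x. indicator {y<..} x * ghat \<alpha> k n x)"
    using integrable_mult_indicator[OF _ gp_ghat_integrable[OF k2, of \<alpha> n], of "{y<..}"] by simp
  have e: "(\<lambda>x. indicator {y<..} x * (hfun \<alpha> k n x - tail_mean y)) =
     (\<lambda>x. indicator {y<..} x * ghat \<alpha> k n x - (1 + tail_mean y) * indicator {y<..} x)"
    by (auto simp: hfun_def algebra_simps)
  have "gp_E \<alpha> (\<lambda>x. indicator {y<..} x * (hfun \<alpha> k n x - tail_mean y)) =
     (1 - Ghat \<alpha> k n y) - (1 + tail_mean y) * (1 - gp_cdf \<alpha> y)"
    unfolding e using i gp_E_ghat_tail[OF y k2, of n] gp_E_cdf_tail[OF y] by (simp add: prob_eq_0 emeasure_eq_measure)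
  also have "\<dots> = 0" using tail_mean_eq(2)[OF y] by (simp add: algebra_simps)
  finally show ?thesis .
qed

text \<open>As \<open>tau\<close> is nonnegative, \<open>h y\<close> is at least the mean beyond
  \<open>y\<close>, and between \<open>y\<close> and \<open>cx\<close> \<open>h\<close> only grows.
  A negative residual thus occurs only where \<open>h\<close> already decreases, and then it
  persists.\<close>

lemma tail_sign:
  fixes q :: "real \<Rightarrow> real"
  assumes y: "y \<in> gp_int \<alpha>" and t: "0 \<le> tau (gp_haz \<alpha> y)"
    and q: "q \<in> borel_measurable borel" "integrable (gp_meas \<alpha>) q" "mono_on (gp_int \<alpha>) q"
  shows "gp_E \<alpha> (\<lambda>x. indicator {y<..} x * ((hfun \<alpha> k n x - tail_mean y) * q x)) \<le> 0"
proof -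
  have yd: "y \<in> gp_dom \<alpha>" using y gp_int_subset_dom by auto
  have y0: "0 < y" using y by (simp add: gp_int_iff)
  let ?r = "\<lambda>x. hfun \<alpha> k n x - tail_mean y" and ?K = "{y<..} \<inter> gp_int \<alpha>"
  let ?B = "real k ^ (n + 1) + 1 + \<bar>tail_mean y\<bar>"
  have hy: "tail_mean y \<le> hfun \<alpha> k n y" using hfun_tail_mean[OF yd] t by simp
  have b: "\<bar>indicator A x * ?r x\<bar> \<le> ?B" if "x \<in> gp_int \<alpha>" for x A
    using hfun_bounded[OF that] by (auto simp: indicator_def)
  have iK: "integrable (gp_meas \<alpha>) (\<lambda>x. indicator ?K x * ?r x)"
    by (rule integrable_gp_meas_bounded[OF _ b]) auto
  have iq: "integrable (gp_meas \<alpha>) (\<lambda>x. indicator ?K x * (?r x * q x))"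
    using gp_integrable_mult_bounded[OF q(2), of "\<lambda>x. indicator ?K x * ?r x", OF _ b] by (simp add: mult.assoc)
  have e: "gp_E \<alpha> (\<lambda>x. indicator {y<..} x * f x) = gp_E \<alpha> (\<lambda>x. indicator ?K x * f x)"
    if "f \<in> borel_measurable borel" for f :: "real \<Rightarrow> real"
    using that by (intro gp_E_cong) (auto simp: indicator_def)
  show ?thesis
  proof (subst e)
    show "(\<lambda>x. ?r x * q x) \<in> borel_measurable borel" using q(1) by measurable
    show "gp_E \<alpha> (\<lambda>x. indicator ?K x * (?r x * q x)) \<le> 0"
    proof (rule gp_E_one_sign_change(1)[where S="{x\<in>?K. ?r x < 0}"])
      show "gp_E \<alpha> (\<lambda>x. indicator ?K x * ?r x) = 0"
        using tail_zero[OF yd] e[of ?r] by simp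
      show "mono_on ?K q" using q(3) by (auto simp: mono_on_def)
      fix x z assume x: "x \<in> {x\<in>?K. ?r x < 0}" and z: "z \<in> ?K" "x < z"
      have "cx < x"
      proof (rule ccontr)
        assume "\<not> cx < x"
        then have "hfun \<alpha> k n y < hfun \<alpha> k n x" using x y0 by (intro hfun_less) auto
        then show False using x hy by simp
      qed
      then have "hfun \<alpha> k n z < hfun \<alpha> k n x" using z gp_int_subset_dom by (intro hfun_greater) auto
      then show "z \<in> {x\<in>?K. ?r x < 0}" using x z by auto
    qed (use iK iq in auto)
  qed
qed

text \<open>\<open>sb\<close> is the hazard at the inflection point of \<open>h\<close>. Curvature
  is prescribed only up to the maximum at \<open>crit\<close>; beyond it the decrease of
  \<open>h\<close> takes over.\<close>

definition infl :: "real \<Rightarrow> bool" where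
  "infl sb \<longleftrightarrow> 0 < sb \<and> sb < crit \<and> (\<forall>s. 0 < s \<longrightarrow> s < sb \<longrightarrow> 0 < curv s) \<and> (\<forall>s. sb < s \<longrightarrow> s \<le> crit \<longrightarrow> curv s < 0)"

lemma slope_mono_infl:
  assumes "infl sb" "0 < s" "s < t"
  shows "t \<le> sb \<Longrightarrow> slope s < slope t" "sb \<le> s \<Longrightarrow> t \<le> crit \<Longrightarrow> slope t < slope s"
proof -
  assume "t \<le> sb"
  then show "slope s < slope t" using assms unfolding infl_def
    by (intro slope_increasing) (auto intro: order_less_trans order_less_le_trans)
next
  assume "sb \<le> s" "t \<le> crit"
  then show "slope t < slope s" using assms unfolding infl_def
    by (intro slope_decreasing) (auto intro: order_le_less_trans)
qed

lemma hfun_convex: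
  assumes "infl sb"
  shows "convex_on {0<..gp_inv \<alpha> sb} (hfun \<alpha> k n)"
proof (rule convex_on_realI)
  have sb: "0 < sb" using assms by (simp add: infl_def)
  have dom: "x \<in> gp_int \<alpha> \<and> gp_haz \<alpha> x \<le> sb" if "x \<in> {0<..gp_inv \<alpha> sb}" for x
    using gp_dom_below[OF gp_inv_dom[of sb], of x] gp_haz_le_iff[of x \<alpha> "gp_inv \<alpha> sb"] gp_inv_dom[of sb \<alpha>] that sb
    by (auto simp: gp_int_iff gp_dom_iff)
  show "connected {0<..gp_inv \<alpha> sb}" by simp
  show "(hfun \<alpha> k n has_real_derivative slope (gp_haz \<alpha> x)) (at x)" if "x \<in> {0<..gp_inv \<alpha> sb}" for x
    using dom[OF that] by (intro DERIV_hfun) (auto simp: gp_int_iff)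
  show "slope (gp_haz \<alpha> x) \<le> slope (gp_haz \<alpha> y)"
    if "x \<in> {0<..gp_inv \<alpha> sb}" "y \<in> {0<..gp_inv \<alpha> sb}" "x \<le> y" for x y
    using dom[OF that(1)] dom[OF that(2)] that(3) slope_mono_infl(1)[OF assms, of "gp_haz \<alpha> x" "gp_haz \<alpha> y"]
      gp_haz_strict_mono[of x y \<alpha>] gp_haz_pos[of x \<alpha>]
    by (cases "x = y") (auto simp: gp_int_iff)
qed

lemma hfun_concave:
  assumes "infl sb"
  shows "concave_on {gp_inv \<alpha> sb..cx} (hfun \<alpha> k n)"
  unfolding concave_on_def
proof (rule convex_on_realI)
  have sb: "0 < sb" "sb < crit" using assms by (auto simp: infl_def)
  have b0: "0 < gp_inv \<alpha> sb" using gp_inv_int[OF sb(1), of \<alpha>] by (simp add: gp_int_iff)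
  have dom: "x \<in> gp_int \<alpha> \<and> sb \<le> gp_haz \<alpha> x \<and> gp_haz \<alpha> x \<le> crit" if "x \<in> {gp_inv \<alpha> sb..cx}" for x
  proof -
    have d: "x \<in> gp_dom \<alpha>" using gp_dom_below[of cx \<alpha> x] cx_int gp_int_subset_dom that b0 by auto
    then show ?thesis using gp_haz_le_iff[of x \<alpha> cx] gp_haz_le_iff[of "gp_inv \<alpha> sb" \<alpha> x] gp_inv_dom[of sb \<alpha>] cx_int gp_int_subset_dom that sb b0
      by (auto simp: gp_int_iff gp_dom_iff cx_def)
  qed
  show "connected {gp_inv \<alpha> sb..cx}" by simp
  show "((\<lambda>x. - hfun \<alpha> k n x) has_real_derivative - slope (gp_haz \<alpha> x)) (at x)" if "x \<in> {gp_inv \<alpha> sb..cx}" for x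
    using dom[OF that] by (intro DERIV_minus DERIV_hfun) (auto simp: gp_int_iff)
  show "- slope (gp_haz \<alpha> x) \<le> - slope (gp_haz \<alpha> y)"
    if "x \<in> {gp_inv \<alpha> sb..cx}" "y \<in> {gp_inv \<alpha> sb..cx}" "x \<le> y" for x y
    using dom[OF that(1)] dom[OF that(2)] that(3) slope_mono_infl(2)[OF assms, of "gp_haz \<alpha> x" "gp_haz \<alpha> y"]
      gp_haz_strict_mono[of x y \<alpha>] gp_haz_pos[of x \<alpha>]
    by (cases "x = y") (auto simp: gp_int_iff)
qed

text \<open>Subtracting a line preserves convexity before the inflection point and concavity from
  there to \<open>cx\<close>. On the convex part two negative values exclude a nonnegative one
  between them. From the inflection point on, a nonnegative value stays nonnegative up to
  \<open>y\<close>, because the line ends at or below \<open>h y\<close>.\<close>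

lemma residual_interval:
  assumes sb: "infl sb" and y: "y \<in> gp_int \<alpha>" and m: "0 \<le> m \<or> y \<le> cx" and v: "v \<le> hfun \<alpha> k n y"
    and r: "\<And>x. r x = hfun \<alpha> k n x - (v + m * (x - y))"
    and x: "x1 \<in> {0<..y}" "x2 \<in> {0<..y}" "x1 < x" "x < x2" "r x1 < 0" "r x2 < 0"
  shows "r x < 0"
proof (rule ccontr)
  let ?b = "gp_inv \<alpha> sb"
  assume neg: "\<not> r x < 0"
  have yd: "y \<in> gp_dom \<alpha>" using y gp_int_subset_dom by auto
  have b0: "0 < ?b" "?b < cx" using sb gp_inv_int[of sb \<alpha>] strict_monoD[OF strict_mono_gp_inv, of sb crit \<alpha>]
    by (auto simp: gp_int_iff infl_def cx_def)
  have ry: "0 \<le> r y" using v by (simp add: r)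
  have conc: "r u * (w - t) + r w * (t - u) \<le> r t * (w - u)" if "?b \<le> u" "u < t" "t < w" "w \<le> cx" for u t w
    using concave_three_points[OF hfun_concave[OF sb], of u w t] that unfolding r by (auto simp: algebra_simps)
  have conv: "r t * (w - u) \<le> r u * (w - t) + r w * (t - u)" if "0 < u" "u < t" "t < w" "w \<le> ?b" for u t w
  proof -
    have "concave_on {0<..?b} (\<lambda>x. - hfun \<alpha> k n x)" using hfun_convex[OF sb] by (simp add: concave_on_def)
    then show ?thesis using concave_three_points[of "{0<..?b}" "\<lambda>x. - hfun \<alpha> k n x" u w t] that unfolding r by (auto simp: algebra_simps)
  qed
  \<comment> \<open>Past the maximum \<open>h\<close> is still above \<open>h y\<close>, while a
    line of nonnegative slope is at most \<open>v\<close> before \<open>y\<close>.\<close>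
  have beyond: "0 \<le> r z" if z: "cx \<le> z" "z \<le> y" for z
  proof (cases "z = y")
    case False
    then have "hfun \<alpha> k n y < hfun \<alpha> k n z" using z yd by (intro hfun_greater) auto
    moreover have "m * (z - y) \<le> 0" using z m False by (intro mult_nonneg_nonpos) auto
    ultimately show ?thesis using v by (simp add: r)
  qed (use ry in simp)
  have up: "0 \<le> r z" if u: "?b \<le> u" "0 \<le> r u" and z: "u < z" "z \<le> y" for u z
  proof (cases "cx \<le> z \<or> z = y")
    case True then show ?thesis using beyond z ry by auto
  next
    case False
    \<comment> \<open>Concavity reaches only to \<open>cx\<close>. At \<open>e\<close> the residual
      is nonnegative, by \<open>beyond\<close> or because \<open>e\<close> is the end point
      \<open>y\<close>.\<close>
    define e where "e = min y cx"
    have e: "z < e" "e \<le> cx" "0 \<le> r e" using False z beyond[of e] ry unfolding e_def by (auto simp: min_def)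
    have "0 \<le> r u * (e - z) + r e * (z - u)" using u z e by (intro add_nonneg_nonneg mult_nonneg_nonneg) auto
    also have "\<dots> \<le> r z * (e - u)" using u z e by (intro conc) auto
    finally show ?thesis using z e by (simp add: zero_le_mult_iff)
  qed
  show False
  proof (cases "?b \<le> x")
    case True then show False using up[of x x2] x neg by auto
  next
    case False
    \<comment> \<open>If \<open>r\<close> were negative again at \<open>w\<close>, convexity on the
      segment from \<open>x1\<close> to \<open>w\<close> would make it negative at
      \<open>x\<close>.\<close>
    have nonneg_w: "0 \<le> r w" if w: "x < w" "w \<le> ?b" for w
    proof (rule ccontr)
      assume "\<not> 0 \<le> r w"
      then have "r x1 * (w - x) + r w * (x - x1) < 0" using x w by (intro add_neg_neg mult_neg_pos) auto
      moreover have "0 \<le> r x * (w - x1)" using neg x w by (intro mult_nonneg_nonneg) auto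
      ultimately show False using conv[of x1 x w] x w by auto
    qed
    show False
    proof (cases "x2 \<le> ?b")
      case True then show False using nonneg_w[of x2] x by auto
    next
      case False
      then have "0 \<le> r ?b" using nonneg_w[of ?b] \<open>\<not> ?b \<le> x\<close> by auto
      then show False using up[of ?b x2] x False by auto
    qed
  qed
qed

lemma affine_cont: "continuous_on A (\<lambda>x::real. hfun \<alpha> k n x - (v + m * (x - y)))" if "A \<subseteq> {x. 0 < 1 - \<alpha> * x}"
  using that by (intro continuous_intros continuous_at_imp_continuous_on ballI isCont_hfun) auto

lemma head_bounded:
  assumes "y \<in> gp_dom \<alpha>"
  shows "\<exists>B. \<forall>x\<in>gp_int \<alpha>. \<bar>indicator {0<..y} x * (hfun \<alpha> k n x - (v + m * (x - y)))\<bar> \<le> B"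
proof (intro exI ballI)
  fix x assume x: "x \<in> gp_int \<alpha>"
  have "\<bar>m * (x - y)\<bar> \<le> \<bar>m\<bar> * y" if "0 < x" "x \<le> y" using that by (simp add: abs_mult mult_left_mono)
  then show "\<bar>indicator {0<..y} x * (hfun \<alpha> k n x - (v + m * (x - y)))\<bar> \<le> real k ^ (n + 1) + 1 + \<bar>v\<bar> + \<bar>m\<bar> * y"
    using hfun_bounded[OF x] assms by (auto simp: indicator_def gp_dom_iff)
qed

lemma head_integrals:
  fixes v m :: real
  assumes y: "y \<in> gp_dom \<alpha>"
  shows "gp_E \<alpha> (\<lambda>x. indicator {0<..y} x * (hfun \<alpha> k n x - (v + m * (x - y)))) =
      Ghat \<alpha> k n y - gp_cdf \<alpha> y - v * gp_cdf \<alpha> y + m * intW \<alpha> y"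
    and "gp_E \<alpha> (\<lambda>x. indicator {0<..y} x * ((hfun \<alpha> k n x - (v + m * (x - y))) * (y - x))) =
      intG \<alpha> k n y - intW \<alpha> y - v * intW \<alpha> y + 2 * m * (y * intW \<alpha> y - intxW \<alpha> y)"
proof -
  interpret prob_space "gp_meas \<alpha>" by (rule prob_space_gp_meas)
  have y0: "0 \<le> y" using y by (simp add: gp_dom_iff)
  note cg = continuous_on_ghat[OF y, of k n]
  have i: "integrable (gp_meas \<alpha>) (\<lambda>x. indicator {0<..y} x * ghat \<alpha> k n x)"
    "integrable (gp_meas \<alpha>) (\<lambda>x. indicator {0<..y} x * (ghat \<alpha> k n x * (y - x)))"
    "integrable (gp_meas \<alpha>) (\<lambda>x. indicator {0<..y} x * (y - x))"
    "integrable (gp_meas \<alpha>) (\<lambda>x. indicator {0<..y} x * (y - x)\<^sup>2)"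
    "integrable (gp_meas \<alpha>) (\<lambda>x. indicator {0<..y} x :: real)"
    by (auto intro!: gp_integrable_poly[OF y] continuous_intros cg simp: less_top[symmetric])
  note E = gp_E_ghat[OF y order_refl y0 k1, of n] gp_E_intG[OF y k1, of n] gp_E_intW[OF y] gp_E_intW2[OF y] gp_E_cdf[OF y order_refl y0]
  have "(\<lambda>x. indicator {0<..y} x * (hfun \<alpha> k n x - (v + m * (x - y)))) =
     (\<lambda>x. indicator {0<..y} x * ghat \<alpha> k n x - (1 + v) * indicator {0<..y} x + m * (indicator {0<..y} x * (y - x)))"
    by (auto simp: hfun_def algebra_simps)
  then have "gp_E \<alpha> (\<lambda>x. indicator {0<..y} x * (hfun \<alpha> k n x - (v + m * (x - y)))) =
     gp_E \<alpha> (\<lambda>x. indicator {0<..y} x * ghat \<alpha> k n x) - (1 + v) * gp_E \<alpha> (indicator {0<..y}) + m * gp_E \<alpha> (\<lambda>x. indicator {0<..y} x * (y - x))"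
    using i by (simp only: Bochner_Integration.integral_add Bochner_Integration.integral_diff Bochner_Integration.integrable_diff
       integrable_mult_right integral_mult_right_zero)
  then show "gp_E \<alpha> (\<lambda>x. indicator {0<..y} x * (hfun \<alpha> k n x - (v + m * (x - y)))) =
      Ghat \<alpha> k n y - gp_cdf \<alpha> y - v * gp_cdf \<alpha> y + m * intW \<alpha> y"
    unfolding E by (simp add: algebra_simps)
  have "(\<lambda>x. indicator {0<..y} x * ((hfun \<alpha> k n x - (v + m * (x - y))) * (y - x))) =
     (\<lambda>x. indicator {0<..y} x * (ghat \<alpha> k n x * (y - x)) - (1 + v) * (indicator {0<..y} x * (y - x)) + m * (indicator {0<..y} x * (y - x)\<^sup>2))"
    by (auto simp: hfun_def algebra_simps power2_eq_square)
  then have "gp_E \<alpha> (\<lambda>x. indicator {0<..y} x * ((hfun \<alpha> k n x - (v + m * (x - y))) * (y - x))) =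
     gp_E \<alpha> (\<lambda>x. indicator {0<..y} x * (ghat \<alpha> k n x * (y - x))) - (1 + v) * gp_E \<alpha> (\<lambda>x. indicator {0<..y} x * (y - x)) + m * gp_E \<alpha> (\<lambda>x. indicator {0<..y} x * (y - x)\<^sup>2)"
    using i by (simp only: Bochner_Integration.integral_add Bochner_Integration.integral_diff Bochner_Integration.integrable_diff
       integrable_mult_right integral_mult_right_zero)
  then show "gp_E \<alpha> (\<lambda>x. indicator {0<..y} x * ((hfun \<alpha> k n x - (v + m * (x - y))) * (y - x))) =
      intG \<alpha> k n y - intW \<alpha> y - v * intW \<alpha> y + 2 * m * (y * intW \<alpha> y - intxW \<alpha> y)"
    unfolding E by (simp add: algebra_simps)
qed

text \<open>The residual \<open>h x - (v + m * (x - y))\<close> is orthogonal to the affine functions on \<open>{0..y}\<close>.\<close>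

definition orth :: "real \<Rightarrow> real \<Rightarrow> real \<Rightarrow> bool" where
  "orth y v m \<longleftrightarrow> Ghat \<alpha> k n y - gp_cdf \<alpha> y - v * gp_cdf \<alpha> y + m * intW \<alpha> y = 0 \<and>
     intG \<alpha> k n y - intW \<alpha> y - v * intW \<alpha> y + 2 * m * (y * intW \<alpha> y - intxW \<alpha> y) = 0"

text \<open>Moments against \<open>x - a\<close> are reduced to the mean and the moment against
  \<open>y - x\<close>, which \<open>head_integrals\<close> evaluates.\<close>

lemma head_moments:
  assumes y: "y \<in> gp_dom \<alpha>" and r: "r = (\<lambda>x. hfun \<alpha> k n x - (v + m * (x - y)))"
  shows "integrable (gp_meas \<alpha>) (\<lambda>x. indicator {0<..y} x * r x)"
    "integrable (gp_meas \<alpha>) (\<lambda>x. indicator {0<..y} x * (r x * x))"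
    "gp_E \<alpha> (\<lambda>x. indicator {0<..y} x * (r x * (x - a))) = (y - a) * gp_E \<alpha> (\<lambda>x. indicator {0<..y} x * r x)
       - gp_E \<alpha> (\<lambda>x. indicator {0<..y} x * (r x * (y - x)))"
proof -
  have c: "continuous_on {0..y} r" unfolding r using gp_dom_below[OF y] by (intro affine_cont) (auto simp: gp_dom_iff)
  have m [measurable]: "r \<in> borel_measurable borel" unfolding r by measurable
  have i: "integrable (gp_meas \<alpha>) (\<lambda>x. indicator {0<..y} x * r x)"
    "integrable (gp_meas \<alpha>) (\<lambda>x. indicator {0<..y} x * (r x * x))"
    "integrable (gp_meas \<alpha>) (\<lambda>x. indicator {0<..y} x * (r x * (y - x)))"
    by (auto intro!: gp_integrable_poly[OF y] continuous_intros c)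
  then show "integrable (gp_meas \<alpha>) (\<lambda>x. indicator {0<..y} x * r x)"
    "integrable (gp_meas \<alpha>) (\<lambda>x. indicator {0<..y} x * (r x * x))" by auto
  have "(\<lambda>x. indicator {0<..y} x * (r x * (x - a))) = (\<lambda>x. (y - a) * (indicator {0<..y} x * r x) - indicator {0<..y} x * (r x * (y - x)))"
    by (auto simp: algebra_simps)
  then show "gp_E \<alpha> (\<lambda>x. indicator {0<..y} x * (r x * (x - a))) = (y - a) * gp_E \<alpha> (\<lambda>x. indicator {0<..y} x * r x)
       - gp_E \<alpha> (\<lambda>x. indicator {0<..y} x * (r x * (y - x)))"
    using i by simp
qed

lemma head_sign:
  fixes q :: "real \<Rightarrow> real"
  assumes sb: "infl sb" and y: "y \<in> gp_int \<alpha>" and m: "0 \<le> m \<or> y \<le> cx" and v: "v \<le> hfun \<alpha> k n y"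
    and orth: "orth y v m"
    and q: "q \<in> borel_measurable borel" "integrable (gp_meas \<alpha>) q" "concave_on (gp_int \<alpha>) q"
  shows "gp_E \<alpha> (\<lambda>x. indicator {0<..y} x * ((hfun \<alpha> k n x - (v + m * (x - y))) * q x)) \<le> 0"
proof -
  have yd: "y \<in> gp_dom \<alpha>" using y gp_int_subset_dom by auto
  define r where "r = (\<lambda>x. hfun \<alpha> k n x - (v + m * (x - y)))"
  have mr [measurable]: "r \<in> borel_measurable borel" unfolding r_def by measurable
  note M = head_moments[OF yd r_def]
  have z: "gp_E \<alpha> (\<lambda>x. indicator {0<..y} x * r x) = 0" "gp_E \<alpha> (\<lambda>x. indicator {0<..y} x * (r x * (y - x))) = 0"
    using orth unfolding r_def head_integrals[OF yd] orth_def by auto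
  have sub: "{0<..y} \<subseteq> gp_int \<alpha>" using gp_dom_below[OF yd] by (auto simp: gp_int_iff gp_dom_iff)
  obtain B where B: "\<And>x. x \<in> gp_int \<alpha> \<Longrightarrow> \<bar>indicator {0<..y} x * r x\<bar> \<le> B"
    using head_bounded[OF yd, of v m] unfolding r_def by blast
  have "gp_E \<alpha> (\<lambda>x. indicator {0<..y} x * (r x * q x)) \<le> 0"
  proof (rule gp_E_two_sign_changes)
    show "is_interval {0<..y}" by (simp add: is_interval_1)
    show "integrable (gp_meas \<alpha>) (\<lambda>x. indicator {0<..y} x * (r x * q x))"
      using gp_integrable_mult_bounded[OF q(2) _ B] by (simp add: mult.assoc)
    show "concave_on {0<..y} q" using q(3) sub convex_gp_int by (auto simp: concave_on_def intro: convex_on_subset)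
    show "gp_E \<alpha> (\<lambda>x. indicator {0<..y} x * (r x * x)) = 0" using M(3)[of 0] z by simp
    show "r x2 < 0" if "x1 \<in> {0<..y}" "x2 \<in> {0<..y}" "x3 \<in> {0<..y}" "x1 < x2" "x2 < x3" "r x1 < 0" "r x3 < 0" for x1 x2 x3
      using residual_interval[OF sb y m v, of r x1 x3 x2] that by (simp add: r_def)
  qed (use M z in auto)
  then show ?thesis by (simp add: r_def)
qed

end

section \<open>Positive integrals and the gluing of concave functions\<close>

lemma integral_pos_real:
  fixes f :: "real \<Rightarrow> real"
  assumes "continuous_on {0..y} f" "0 < y" "\<And>x. 0 < x \<Longrightarrow> x < y \<Longrightarrow> 0 < f x"
  shows "0 < integral {0..y} f"
proof -
  have "integral {0..0} f < integral {0..y} f"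
  proof (rule DERIV_pos_imp_increasing_open[OF assms(2)])
    fix x assume x: "0 < x" "x < y"
    then have "((\<lambda>t. integral {0..t} f) has_real_derivative f x) (at x within {0..y})"
      using DERIV_integral_upto[OF assms(1), of x] by simp
    then have "((\<lambda>t. integral {0..t} f) has_real_derivative f x) (at x)"
      using x by (simp add: at_within_Icc_at)
    then show "\<exists>d. ((\<lambda>t. integral {0..t} f) has_real_derivative d) (at x) \<and> 0 < d"
      using assms(3)[OF x] by blast
  next
    show "continuous_on {0..y} (\<lambda>t. integral {0..t} f)"
      by (intro indefinite_integral_continuous_1 integrable_continuous_real assms(1))
  qed
  then show ?thesis by simp
qed

text \<open>A common supporting line at the joint puts \<open>f y\<close> above every chord across
  \<open>y\<close>; a chord inequality at another point follows by combining this with concavity on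
  the side of that point. All chord inequalities are multiplied out to avoid division.\<close>

lemma concave_on_glue:
  fixes f :: "real \<Rightarrow> real"
  assumes I: "is_interval I" "y \<in> I" and left: "concave_on (I \<inter> {..y}) f" and right: "concave_on (I \<inter> {y..}) f"
    and sup: "\<And>x. x \<in> I \<Longrightarrow> f x \<le> f y + m * (x - y)"
  shows "concave_on I f"
  unfolding concave_on_def
proof (rule convex_on_linorderI)
  show "convex I" by (rule is_interval_convex[OF I(1)])
  fix t u w :: real
  assume t: "0 < t" "t < 1" and uw: "u \<in> I" "w \<in> I" "u < w"
  define z where "z = (1 - t) * u + t * w"
  have z: "z - u = t * (w - u)" "w - z = (1 - t) * (w - u)" by (simp_all add: z_def algebra_simps)
  have "0 < z - u" "0 < w - z" unfolding z using t uw by simp_all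
  then have zb: "u < z" "z < w" by auto
  have three: "f u * (w - z) + f w * (z - u) \<le> f z * (w - u)"
  proof -
    consider "w \<le> y" | "y \<le> u" | "u < y" "y < w" by linarith
    then show ?thesis
    proof cases
      case 1 then show ?thesis using uw zb by (intro concave_three_points[OF left]) auto
    next
      case 2 then show ?thesis using uw zb by (intro concave_three_points[OF right]) auto
    next
      case 3
      have fu: "f u \<le> f y + m * (u - y)" and fw: "f w \<le> f y + m * (w - y)" using sup uw by auto
      have mid: "f u * (w - y) + f w * (y - u) \<le> f y * (w - u)"
      proof -
        have "f u * (w - y) + f w * (y - u) \<le> (f y + m * (u - y)) * (w - y) + (f y + m * (w - y)) * (y - u)"
          using 3 by (intro add_mono mult_right_mono fu fw) auto
        also have "\<dots> = f y * (w - u)" by (simp add: algebra_simps)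
        finally show ?thesis .
      qed
      show ?thesis
      proof (cases z y rule: linorder_cases)
        case equal then show ?thesis using mid by simp
      next
        case less
        have c: "f u * (y - z) + f y * (z - u) \<le> f z * (y - u)"
          using uw zb less 3 I(2) by (intro concave_three_points[OF left]) auto
        have "(f u * (w - z) + f w * (z - u)) * (y - u) = (f u * (w - y) + f w * (y - u)) * (z - u) + f u * (y - z) * (w - u)"
          by (simp add: algebra_simps)
        also have "\<dots> \<le> (f y * (w - u)) * (z - u) + f u * (y - z) * (w - u)"
          using mid zb by (intro add_right_mono mult_right_mono) auto
        also have "\<dots> = (f u * (y - z) + f y * (z - u)) * (w - u)" by (simp add: algebra_simps)
        also have "\<dots> \<le> (f z * (y - u)) * (w - u)" using c uw by (intro mult_right_mono) auto
        finally have "(f u * (w - z) + f w * (z - u)) * (y - u) \<le> (f z * (w - u)) * (y - u)" by (simp add: mult_ac)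
        then show ?thesis using 3 by simp
      next
        case greater
        have c: "f y * (w - z) + f w * (z - y) \<le> f z * (w - y)"
          using uw zb greater 3 I(2) by (intro concave_three_points[OF right]) auto
        have "(f u * (w - z) + f w * (z - u)) * (w - y) = (f u * (w - y) + f w * (y - u)) * (w - z) + f w * (z - y) * (w - u)"
          by (simp add: algebra_simps)
        also have "\<dots> \<le> (f y * (w - u)) * (w - z) + f w * (z - y) * (w - u)"
          using mid zb by (intro add_right_mono mult_right_mono) auto
        also have "\<dots> = (f y * (w - z) + f w * (z - y)) * (w - u)" by (simp add: algebra_simps)
        also have "\<dots> \<le> (f z * (w - y)) * (w - u)" using c uw by (intro mult_right_mono) auto
        finally have "(f u * (w - z) + f w * (z - u)) * (w - y) \<le> (f z * (w - u)) * (w - y)" by (simp add: mult_ac)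
        then show ?thesis using 3 by simp
      qed
    qed
  qed
  have "f u * ((1 - t) * (w - u)) + f w * (t * (w - u)) \<le> f z * (w - u)" using three unfolding z .
  then have "((1 - t) * f u + t * f w) * (w - u) \<le> f z * (w - u)" by (simp add: algebra_simps)
  then have "(1 - t) * f u + t * f w \<le> f z" using uw by simp
  then show "- f ((1 - t) *\<^sub>R u + t *\<^sub>R w) \<le> (1 - t) * - f u + t * - f w"
    by (simp add: z_def)
qed

lemma concave_on_cong:
  fixes f g :: "real \<Rightarrow> real"
  assumes f: "concave_on S f" and eq: "\<And>x. x \<in> S \<Longrightarrow> f x = g x"
  shows "concave_on S g"
proof (rule concave_on_linorderI)
  show S: "convex S" using f by (rule concave_on_imp_convex)
  fix t x y :: real assume *: "0 < t" "t < 1" "x \<in> S" "y \<in> S" "x < y"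
  then have "(1 - t) * f x + t * f y \<le> f ((1 - t) *\<^sub>R x + t *\<^sub>R y)"
    using concave_onD[OF f, of t x y] by simp
  moreover have "(1 - t) *\<^sub>R x + t *\<^sub>R y \<in> S" using S * by (intro convexD) auto
  ultimately show "(1 - t) * g x + t * g y \<le> g ((1 - t) *\<^sub>R x + t *\<^sub>R y)"
    using eq * by simp
qed

lemma affine_concave: "convex I \<Longrightarrow> concave_on I (\<lambda>x::real. v + m * (x - y))"
proof -
  assume I: "convex I"
  have "(\<lambda>x::real. - (v + m * (x - y))) = (\<lambda>x. (m * y - v) + (- m) * x)" by (auto simp: algebra_simps)
  moreover have "convex_on I (\<lambda>x::real. (m * y - v) + (- m) * x)"
    using I by (intro convex_onI) (auto simp: algebra_simps simp flip: distrib_right)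
  ultimately show ?thesis unfolding concave_on_def by simp
qed

lemma is_interval_gp_int: "is_interval (gp_int \<alpha>)"
  using convex_gp_int[of \<alpha>] by (simp add: is_interval_convex_1)

context gp_record
begin

section \<open>Projections onto the cone of nondecreasing concave functions\<close>

text \<open>The variational inequality that characterizes \<open>p\<close> as the projection of \<open>h\<close> onto the cone \<open>C\<close>.\<close>

definition cert :: "((real \<Rightarrow> real) \<Rightarrow> bool) \<Rightarrow> (real \<Rightarrow> real) \<Rightarrow> bool" where
  "cert C p \<longleftrightarrow> p \<in> borel_measurable borel \<and> (\<exists>B. \<forall>x\<in>gp_int \<alpha>. \<bar>p x\<bar> \<le> B) \<and>
     gp_E \<alpha> (\<lambda>x. (hfun \<alpha> k n x - p x) * p x) = 0 \<and>
     (\<forall>q\<in>borel_measurable borel. integrable (gp_meas \<alpha>) (\<lambda>x. (q x)\<^sup>2) \<longrightarrow> C q \<longrightarrow>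
        gp_E \<alpha> (\<lambda>x. (hfun \<alpha> k n x - p x) * q x) \<le> 0)"

abbreviation iso :: "(real \<Rightarrow> real) \<Rightarrow> bool" where
  "iso q \<equiv> mono_on (gp_int \<alpha>) q"

abbreviation isoconc :: "(real \<Rightarrow> real) \<Rightarrow> bool" where
  "isoconc q \<equiv> mono_on (gp_int \<alpha>) q \<and> concave_on (gp_int \<alpha>) q"

text \<open>For \<open>y < \<beta>\<close> this is the function \<open>phi1\<close> and for \<open>y = \<beta>\<close> the function \<open>Pfun\<close>, if \<open>v\<close> and \<open>m\<close> are chosen
  accordingly; both are treated at once.\<close>

definition pw :: "real \<Rightarrow> real \<Rightarrow> real \<Rightarrow> real \<Rightarrow> real \<Rightarrow> real" where
  "pw y \<beta> v m x = (if x < y then v + m * (x - y) else if x < \<beta> then hfun \<alpha> k n x else tail_mean \<beta>)"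

text \<open>In the first case both joints of \<open>pw\<close> are continuous:
  \<open>tau = 0\<close> says that \<open>h \<beta>\<close> is the tail mean. In the second the
  middle piece is empty and the line ends at the tail mean, which is at most
  \<open>h y\<close>.\<close>

definition pw_ok :: "real \<Rightarrow> real \<Rightarrow> real \<Rightarrow> bool" where
  "pw_ok y \<beta> v \<longleftrightarrow> y \<in> gp_int \<alpha> \<and> \<beta> \<in> gp_int \<alpha> \<and>
     ((y < \<beta> \<and> v = hfun \<alpha> k n y \<and> tau (gp_haz \<alpha> \<beta>) = 0) \<or> (y = \<beta> \<and> v = tail_mean y \<and> 0 \<le> tau (gp_haz \<alpha> \<beta>)))"

lemma measurable_pw [measurable]: "pw y \<beta> v m \<in> borel_measurable borel"
  unfolding pw_def[abs_def] by measurable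

lemma pw_bounded: "pw_ok y \<beta> v \<Longrightarrow> \<exists>B. \<forall>x\<in>gp_int \<alpha>. \<bar>pw y \<beta> v m x\<bar> \<le> B"
proof (intro exI ballI)
  fix x assume ok: "pw_ok y \<beta> v" and x: "x \<in> gp_int \<alpha>"
  have "\<bar>m * (x - y)\<bar> \<le> \<bar>m\<bar> * \<bar>y\<bar>" if "x < y"
    unfolding abs_mult using that x by (intro mult_left_mono) (auto simp: gp_int_iff)
  then have "\<bar>v + m * (x - y)\<bar> \<le> \<bar>v\<bar> + \<bar>m\<bar> * \<bar>y\<bar>" if "x < y"
    using that abs_triangle_ineq[of v "m * (x - y)"] by (meson add_left_mono order_trans)
  moreover have "0 \<le> \<bar>m\<bar> * \<bar>y\<bar>" "0 \<le> real k ^ (n + 1)" by simp_all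
  ultimately show "\<bar>pw y \<beta> v m x\<bar> \<le> real k ^ (n + 1) + 1 + \<bar>v\<bar> + \<bar>m\<bar> * \<bar>y\<bar> + \<bar>tail_mean \<beta>\<bar>"
    unfolding pw_def using hfun_bounded[OF x] by (smt (verit))
qed

text \<open>The middle piece reproduces \<open>h\<close>, so only the pieces before \<open>y\<close>
  and beyond \<open>\<beta>\<close> remain.\<close>

lemma pw_residual:
  assumes ok: "pw_ok y \<beta> v" and x: "x \<in> gp_int \<alpha>"
  shows "hfun \<alpha> k n x - pw y \<beta> v m x = indicator {0<..y} x * (hfun \<alpha> k n x - (v + m * (x - y))) +
      indicator {\<beta><..} x * (hfun \<alpha> k n x - tail_mean \<beta>)"
proof -
  have "tail_mean \<beta> = hfun \<alpha> k n \<beta>" if "y < \<beta>"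
    using ok that hfun_tail_mean[of \<beta>] gp_int_subset_dom[of \<alpha>] by (auto simp: pw_ok_def)
  then show ?thesis using ok x unfolding pw_ok_def pw_def
    by (cases x y rule: linorder_cases; cases x \<beta> rule: linorder_cases) (auto simp: indicator_def gp_int_iff)
qed

lemma pw_E_residual:
  fixes q :: "real \<Rightarrow> real"
  assumes ok: "pw_ok y \<beta> v" and q: "q \<in> borel_measurable borel" "integrable (gp_meas \<alpha>) q"
  shows "gp_E \<alpha> (\<lambda>x. (hfun \<alpha> k n x - pw y \<beta> v m x) * q x) =
      gp_E \<alpha> (\<lambda>x. indicator {0<..y} x * ((hfun \<alpha> k n x - (v + m * (x - y))) * q x)) +
      gp_E \<alpha> (\<lambda>x. indicator {\<beta><..} x * ((hfun \<alpha> k n x - tail_mean \<beta>) * q x))"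
proof -
  have yd: "y \<in> gp_dom \<alpha>" using ok gp_int_subset_dom[of \<alpha>] by (auto simp: pw_ok_def)
  obtain B where B: "\<And>x. x \<in> gp_int \<alpha> \<Longrightarrow> \<bar>indicator {0<..y} x * (hfun \<alpha> k n x - (v + m * (x - y)))\<bar> \<le> B"
    using head_bounded[OF yd, of v m] by blast
  have i1: "integrable (gp_meas \<alpha>) (\<lambda>x. indicator {0<..y} x * ((hfun \<alpha> k n x - (v + m * (x - y))) * q x))"
    using gp_integrable_mult_bounded[OF q(2) _ B] by (simp add: mult.assoc)
  have b2: "\<bar>indicator {\<beta><..} x * (hfun \<alpha> k n x - tail_mean \<beta>)\<bar> \<le> real k ^ (n + 1) + 1 + \<bar>tail_mean \<beta>\<bar>" if "x \<in> gp_int \<alpha>" for x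
    using hfun_bounded[OF that] by (auto simp: indicator_def)
  have i2: "integrable (gp_meas \<alpha>) (\<lambda>x. indicator {\<beta><..} x * ((hfun \<alpha> k n x - tail_mean \<beta>) * q x))"
    using gp_integrable_mult_bounded[OF q(2) _ b2] by (simp add: mult.assoc)
  have "gp_E \<alpha> (\<lambda>x. (hfun \<alpha> k n x - pw y \<beta> v m x) * q x) =
     gp_E \<alpha> (\<lambda>x. indicator {0<..y} x * ((hfun \<alpha> k n x - (v + m * (x - y))) * q x) +
       indicator {\<beta><..} x * ((hfun \<alpha> k n x - tail_mean \<beta>) * q x))"
    using q(1) by (intro gp_E_cong) (auto simp: pw_residual[OF ok] distrib_right mult.assoc)
  then show ?thesis using i1 i2 by simp
qed

text \<open>Before \<open>y\<close> the residual is orthogonal to affine functions, and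
  \<open>pw\<close> is one of them; beyond \<open>\<beta>\<close> it has mean 0 and
  \<open>pw\<close> is constant. This is the orthogonality. The inequality is
  \<open>head_sign\<close> plus \<open>tail_sign\<close>.\<close>

lemma cert_pw:
  assumes sb: "infl sb" and ok: "pw_ok y \<beta> v" and m: "0 \<le> m \<or> y \<le> cx" and orth: "orth y v m"
  shows "cert isoconc (pw y \<beta> v m)"
  unfolding cert_def
proof (intro conjI ballI impI)
  show "pw y \<beta> v m \<in> borel_measurable borel" by (rule measurable_pw)
  show "\<exists>B. \<forall>x\<in>gp_int \<alpha>. \<bar>pw y \<beta> v m x\<bar> \<le> B" by (rule pw_bounded[OF ok])
  then obtain B where B: "\<And>x. x \<in> gp_int \<alpha> \<Longrightarrow> \<bar>pw y \<beta> v m x\<bar> \<le> B" by blast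
  have y: "y \<in> gp_int \<alpha>" "\<beta> \<in> gp_int \<alpha>" "y \<le> \<beta>" "0 \<le> tau (gp_haz \<alpha> \<beta>)" using ok by (auto simp: pw_ok_def)
  then have yd: "y \<in> gp_dom \<alpha>" "\<beta> \<in> gp_dom \<alpha>" using gp_int_subset_dom by auto
  have vh: "v \<le> hfun \<alpha> k n y" using ok hfun_tail_mean[OF yd(1)] by (auto simp: pw_ok_def)
  have ip: "integrable (gp_meas \<alpha>) (pw y \<beta> v m)" by (rule integrable_gp_meas_bounded[OF measurable_pw B])
  define r where "r = (\<lambda>x. hfun \<alpha> k n x - (v + m * (x - y)))"
  have z: "gp_E \<alpha> (\<lambda>x. indicator {0<..y} x * r x) = 0" "gp_E \<alpha> (\<lambda>x. indicator {0<..y} x * (r x * (y - x))) = 0"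
    using orth unfolding r_def head_integrals[OF yd(1)] orth_def by auto
  note M = head_moments[OF yd(1) r_def]
  have "gp_E \<alpha> (\<lambda>x. indicator {0<..y} x * ((hfun \<alpha> k n x - (v + m * (x - y))) * pw y \<beta> v m x)) =
      gp_E \<alpha> (\<lambda>x. v * (indicator {0<..y} x * r x) + m * (indicator {0<..y} x * (r x * (x - y))))"
  proof (rule gp_E_cong)
    fix x
    show "indicator {0<..y} x * ((hfun \<alpha> k n x - (v + m * (x - y))) * pw y \<beta> v m x) =
      v * (indicator {0<..y} x * r x) + m * (indicator {0<..y} x * (r x * (x - y)))"
    proof (cases "x \<in> {0<..y}")
      case True
      moreover have "pw y \<beta> v m y = v" using ok by (auto simp: pw_def pw_ok_def)
      ultimately have "pw y \<beta> v m x = v + m * (x - y)" by (cases "x = y") (auto simp: pw_def)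
      moreover have "i * (R * (v + m * d)) = v * (i * R) + m * (i * (R * d))" for i R v m d :: real
        by (simp add: algebra_simps)
      ultimately show ?thesis unfolding r_def by presburger
    qed simp
  qed (auto simp: r_def)
  also have "\<dots> = 0"
  proof -
    have i: "integrable (gp_meas \<alpha>) (\<lambda>x. indicator {0<..y} x * (r x * (x - y)))"
    proof -
      have "(\<lambda>x. indicator {0<..y} x * (r x * (x - y))) = (\<lambda>x. indicator {0<..y} x * (r x * x) - y * (indicator {0<..y} x * r x))"
        by (auto simp: algebra_simps)
      then show ?thesis using M(1,2) by simp
    qed
    then show ?thesis using M(1) M(3)[of y] z by simp
  qed
  finally have h1: "gp_E \<alpha> (\<lambda>x. indicator {0<..y} x * ((hfun \<alpha> k n x - (v + m * (x - y))) * pw y \<beta> v m x)) = 0" .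
  have "gp_E \<alpha> (\<lambda>x. indicator {\<beta><..} x * ((hfun \<alpha> k n x - tail_mean \<beta>) * pw y \<beta> v m x)) =
     gp_E \<alpha> (\<lambda>x. tail_mean \<beta> * (indicator {\<beta><..} x * (hfun \<alpha> k n x - tail_mean \<beta>)))"
    using y(3) by (intro gp_E_cong) (auto simp: pw_def indicator_def)
  then have h2: "gp_E \<alpha> (\<lambda>x. indicator {\<beta><..} x * ((hfun \<alpha> k n x - tail_mean \<beta>) * pw y \<beta> v m x)) = 0"
    using tail_zero[OF yd(2)] by simp
  show "gp_E \<alpha> (\<lambda>x. (hfun \<alpha> k n x - pw y \<beta> v m x) * pw y \<beta> v m x) = 0"
    unfolding pw_E_residual[OF ok measurable_pw ip] h1 h2 by simp
next
  fix q :: "real \<Rightarrow> real"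
  assume q: "q \<in> borel_measurable borel" "integrable (gp_meas \<alpha>) (\<lambda>x. (q x)\<^sup>2)" "isoconc q"
  have iq: "integrable (gp_meas \<alpha>) q" by (rule gp_square_integrable[OF q(1,2)])
  have y: "y \<in> gp_int \<alpha>" "\<beta> \<in> gp_int \<alpha>" "0 \<le> tau (gp_haz \<alpha> \<beta>)" using ok by (auto simp: pw_ok_def)
  have vh: "v \<le> hfun \<alpha> k n y" using ok hfun_tail_mean[of y] gp_int_subset_dom[of \<alpha>] by (auto simp: pw_ok_def)
  show "gp_E \<alpha> (\<lambda>x. (hfun \<alpha> k n x - pw y \<beta> v m x) * q x) \<le> 0"
    unfolding pw_E_residual[OF ok q(1) iq]
    using head_sign[OF sb y(1) m vh orth q(1) iq] tail_sign[OF y(2,3) q(1) iq] q(3) by auto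
qed

lemma gp_E_affine_square:
  assumes y: "y \<in> gp_dom \<alpha>"
  shows "gp_E \<alpha> (\<lambda>x. indicator {0<..y} x * (v + m * (x - y))\<^sup>2) =
     gp_cdf \<alpha> y * v\<^sup>2 - 2 * m * v * intW \<alpha> y + 2 * m\<^sup>2 * (y * intW \<alpha> y - intxW \<alpha> y)"
proof -
  interpret prob_space "gp_meas \<alpha>" by (rule prob_space_gp_meas)
  have y0: "0 \<le> y" using y by (simp add: gp_dom_iff)
  have i: "integrable (gp_meas \<alpha>) (\<lambda>x. indicator {0<..y} x * (y - x))"
    "integrable (gp_meas \<alpha>) (\<lambda>x. indicator {0<..y} x * (y - x)\<^sup>2)"
    "integrable (gp_meas \<alpha>) (\<lambda>x. indicator {0<..y} x :: real)"
    by (auto intro!: gp_integrable_poly[OF y] continuous_intros simp: less_top[symmetric])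
  have "(\<lambda>x. indicator {0<..y} x * (v + m * (x - y))\<^sup>2) =
     (\<lambda>x. v\<^sup>2 * indicator {0<..y} x - (2 * m * v) * (indicator {0<..y} x * (y - x)) + m\<^sup>2 * (indicator {0<..y} x * (y - x)\<^sup>2))"
    by (auto simp: algebra_simps power2_eq_square)
  then have "gp_E \<alpha> (\<lambda>x. indicator {0<..y} x * (v + m * (x - y))\<^sup>2) =
     v\<^sup>2 * gp_E \<alpha> (indicator {0<..y}) - (2 * m * v) * gp_E \<alpha> (\<lambda>x. indicator {0<..y} x * (y - x)) + m\<^sup>2 * gp_E \<alpha> (\<lambda>x. indicator {0<..y} x * (y - x)\<^sup>2)"
    using i by (simp only: Bochner_Integration.integral_add Bochner_Integration.integral_diff Bochner_Integration.integrable_diff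
       integrable_mult_right integral_mult_right_zero)
  then show ?thesis unfolding gp_E_intW[OF y] gp_E_intW2[OF y] gp_E_cdf[OF y order_refl y0] by simp
qed

text \<open>The expression is the variance of the positive part of \<open>y - x\<close>. Expanding
  the square of \<open>intW - (y - x)\<close> on \<open>(0, y]\<close> gives a lower bound, which
  \<open>W y < 1\<close> makes strict.\<close>

lemma variance_pos:
  assumes y: "y \<in> gp_int \<alpha>"
  shows "0 < 2 * y * intW \<alpha> y - 2 * intxW \<alpha> y - (intW \<alpha> y)\<^sup>2"
proof -
  have yd: "y \<in> gp_dom \<alpha>" using y gp_int_subset_dom by auto
  have "0 \<le> gp_E \<alpha> (\<lambda>x. indicator {0<..y} x * (intW \<alpha> y + 1 * (x - y))\<^sup>2)" by simp
  then have "0 \<le> gp_cdf \<alpha> y * (intW \<alpha> y)\<^sup>2 - 2 * (intW \<alpha> y)\<^sup>2 + 2 * (y * intW \<alpha> y - intxW \<alpha> y)"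
    unfolding gp_E_affine_square[OF yd] by (simp add: power2_eq_square)
  moreover have "gp_cdf \<alpha> y * (intW \<alpha> y)\<^sup>2 < 1 * (intW \<alpha> y)\<^sup>2"
    using gp_cdf_less_1[of \<alpha> y] intW_pos[OF y] y by (intro mult_strict_right_mono) (auto simp: gp_int_iff)
  ultimately show ?thesis by simp
qed

lemma hfun_square_integral:
  assumes "\<beta> \<in> gp_dom \<alpha>" "0 \<le> y" "y \<le> \<beta>"
  shows "gp_E \<alpha> (\<lambda>x. indicator {y<..\<beta>} x * (hfun \<alpha> k n x)\<^sup>2) =
     real k ^ (2 * (n + 1)) * fact (2 * n) / ((fact n)\<^sup>2 * (2 * real k - 1) ^ (2 * n + 1))
         * (Ghat \<alpha> (2 * k - 1) (2 * n) \<beta> - Ghat \<alpha> (2 * k - 1) (2 * n) y)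
     - 2 * (Ghat \<alpha> k n \<beta> - Ghat \<alpha> k n y) + (gp_cdf \<alpha> \<beta> - gp_cdf \<alpha> y)"
proof -
  interpret prob_space "gp_meas \<alpha>" by (rule prob_space_gp_meas)
  have ig: "integrable (gp_meas \<alpha>) (\<lambda>x. indicator {y<..\<beta>} x * ghat \<alpha> k n x)"
    using integrable_mult_indicator[OF _ gp_ghat_integrable[OF k2, of \<alpha> n], of "{y<..\<beta>}"] by simp
  have ig2: "integrable (gp_meas \<alpha>) (\<lambda>x. indicator {y<..\<beta>} x * (ghat \<alpha> k n x)\<^sup>2)"
  proof (rule integrable_gp_meas_bounded)
    show "\<bar>indicator {y<..\<beta>} x * (ghat \<alpha> k n x)\<^sup>2\<bar> \<le> (real k ^ (n + 1))\<^sup>2" if "x \<in> gp_int \<alpha>" for x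
      using ghat_bounded[OF k2, of x \<alpha> n] that gp_int_subset_dom power_mono[of "\<bar>ghat \<alpha> k n x\<bar>" "real k ^ (n + 1)" 2]
      by (auto simp: indicator_def)
  qed simp
  have i1: "integrable (gp_meas \<alpha>) (\<lambda>x. indicator {y<..\<beta>} x :: real)" by (simp add: less_top[symmetric])
  have "(\<lambda>x. indicator {y<..\<beta>} x * (hfun \<alpha> k n x)\<^sup>2) =
     (\<lambda>x. indicator {y<..\<beta>} x * (ghat \<alpha> k n x)\<^sup>2 - 2 * (indicator {y<..\<beta>} x * ghat \<alpha> k n x) + indicator {y<..\<beta>} x)"
    by (auto simp: hfun_def algebra_simps power2_eq_square)
  then have "gp_E \<alpha> (\<lambda>x. indicator {y<..\<beta>} x * (hfun \<alpha> k n x)\<^sup>2) =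
    gp_E \<alpha> (\<lambda>x. indicator {y<..\<beta>} x * (ghat \<alpha> k n x)\<^sup>2) - 2 * gp_E \<alpha> (\<lambda>x. indicator {y<..\<beta>} x * ghat \<alpha> k n x) + gp_E \<alpha> (indicator {y<..\<beta>})"
    using ig ig2 i1 by (simp only: Bochner_Integration.integral_add Bochner_Integration.integral_diff Bochner_Integration.integrable_diff
       integrable_mult_right integral_mult_right_zero)
  then show ?thesis unfolding gp_E_ghat2[OF assms k2] gp_E_ghat[OF assms k1] gp_E_cdf[OF assms] .
qed

lemma pw_norm:
  assumes ok: "pw_ok y \<beta> v"
  shows "gp_E \<alpha> (\<lambda>x. (pw y \<beta> v m x)\<^sup>2) =
     (gp_cdf \<alpha> y * v\<^sup>2 - 2 * m * v * intW \<alpha> y + 2 * m\<^sup>2 * (y * intW \<alpha> y - intxW \<alpha> y)) +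
     (real k ^ (2 * (n + 1)) * fact (2 * n) / ((fact n)\<^sup>2 * (2 * real k - 1) ^ (2 * n + 1))
         * (Ghat \<alpha> (2 * k - 1) (2 * n) \<beta> - Ghat \<alpha> (2 * k - 1) (2 * n) y)
     - 2 * (Ghat \<alpha> k n \<beta> - Ghat \<alpha> k n y) + (gp_cdf \<alpha> \<beta> - gp_cdf \<alpha> y)) +
     (1 - gp_cdf \<alpha> \<beta>) * (tail_mean \<beta>)\<^sup>2"
proof -
  interpret prob_space "gp_meas \<alpha>" by (rule prob_space_gp_meas)
  have y: "y \<in> gp_int \<alpha>" "\<beta> \<in> gp_int \<alpha>" "y \<le> \<beta>" using ok by (auto simp: pw_ok_def)
  then have yd: "y \<in> gp_dom \<alpha>" "\<beta> \<in> gp_dom \<alpha>" "0 < y" using gp_int_subset_dom by (auto simp: gp_int_iff gp_dom_iff)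
  have i: "integrable (gp_meas \<alpha>) (\<lambda>x. indicator {0<..y} x * (v + m * (x - y))\<^sup>2)"
    by (intro gp_integrable_poly[OF yd(1)] continuous_intros) auto
  have i2: "integrable (gp_meas \<alpha>) (\<lambda>x. indicator {y<..\<beta>} x * (hfun \<alpha> k n x)\<^sup>2)"
  proof (rule integrable_gp_meas_bounded)
    show "\<bar>indicator {y<..\<beta>} x * (hfun \<alpha> k n x)\<^sup>2\<bar> \<le> (real k ^ (n + 1) + 1)\<^sup>2" if "x \<in> gp_int \<alpha>" for x
      using hfun_bounded[OF that] power_mono[of "\<bar>hfun \<alpha> k n x\<bar>" "real k ^ (n + 1) + 1" 2] by (auto simp: indicator_def)
  qed simp
  have i3: "integrable (gp_meas \<alpha>) (\<lambda>x. (tail_mean \<beta>)\<^sup>2 * indicator {\<beta><..} x)" by (simp add: less_top[symmetric])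
  have "gp_E \<alpha> (\<lambda>x. (pw y \<beta> v m x)\<^sup>2) = gp_E \<alpha> (\<lambda>x. indicator {0<..y} x * (v + m * (x - y))\<^sup>2 +
     indicator {y<..\<beta>} x * (hfun \<alpha> k n x)\<^sup>2 + (tail_mean \<beta>)\<^sup>2 * indicator {\<beta><..} x)"
  proof (rule gp_E_cong)
    fix x assume "x \<in> gp_int \<alpha>"
    moreover have "tail_mean \<beta> = hfun \<alpha> k n \<beta>" if "y < \<beta>"
      using ok that hfun_tail_mean[OF yd(2)] by (auto simp: pw_ok_def)
    ultimately show "(pw y \<beta> v m x)\<^sup>2 = indicator {0<..y} x * (v + m * (x - y))\<^sup>2 +
     indicator {y<..\<beta>} x * (hfun \<alpha> k n x)\<^sup>2 + (tail_mean \<beta>)\<^sup>2 * indicator {\<beta><..} x"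
      using ok unfolding pw_ok_def pw_def
      by (cases x y rule: linorder_cases; cases x \<beta> rule: linorder_cases) (auto simp: indicator_def gp_int_iff)
  qed auto
  also have "\<dots> = gp_E \<alpha> (\<lambda>x. indicator {0<..y} x * (v + m * (x - y))\<^sup>2) +
     gp_E \<alpha> (\<lambda>x. indicator {y<..\<beta>} x * (hfun \<alpha> k n x)\<^sup>2) + (tail_mean \<beta>)\<^sup>2 * gp_E \<alpha> (indicator {\<beta><..})"
    using i i2 i3 by (simp only: Bochner_Integration.integral_add Bochner_Integration.integrable_add integral_mult_right_zero)
  finally show ?thesis
    unfolding gp_E_affine_square[OF yd(1)] gp_E_cdf_tail[OF yd(2)] hfun_square_integral[OF yd(2) less_imp_le[OF yd(3)] y(3)] by simp
qed

text \<open>The slopes decrease along the pieces: first \<open>m\<close>, then that of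
  \<open>h\<close> on its concave part, at most its value at \<open>y\<close> and so at most
  \<open>m\<close>, then 0. The pieces are glued at \<open>\<beta>\<close> with supporting slope 0
  and at \<open>y\<close> with supporting slope \<open>m\<close>.\<close>

lemma pw_mono_concave:
  assumes sb: "infl sb" and ok: "pw_ok y \<beta> v" and m: "0 \<le> m"
    and mid: "y < \<beta> \<Longrightarrow> \<beta> \<le> cx \<and> sb \<le> gp_haz \<alpha> y \<and> slope (gp_haz \<alpha> y) \<le> m"
  shows "mono_on {0..} (pw y \<beta> v m)" "concave_on (gp_int \<alpha>) (pw y \<beta> v m)"
proof -
  let ?p = "pw y \<beta> v m"
  have y: "y \<in> gp_int \<alpha>" "\<beta> \<in> gp_int \<alpha>" "y \<le> \<beta>" using ok by (auto simp: pw_ok_def)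
  then have yd: "y \<in> gp_dom \<alpha>" "\<beta> \<in> gp_dom \<alpha>" "0 < y" using gp_int_subset_dom by (auto simp: gp_int_iff gp_dom_iff)
  have py: "?p y = v" using ok by (auto simp: pw_def pw_ok_def)
  have hb: "tail_mean \<beta> = hfun \<alpha> k n \<beta>" if "y < \<beta>"
    using ok that hfun_tail_mean[OF yd(2)] by (auto simp: pw_ok_def)
  have pl: "?p x = v + m * (x - y)" if "x \<le> y" for x using that py by (cases "x = y") (auto simp: pw_def)
  have pm: "?p x = hfun \<alpha> k n x" if "y < \<beta>" "y \<le> x" "x \<le> \<beta>" for x
    using that hb by (auto simp: pw_def)
  have pr: "?p x = tail_mean \<beta>" if "\<beta> \<le> x" for x using that y(3) by (simp add: pw_def)
  have m1: "?p x \<le> ?p z" if "x \<le> z" "z \<le> y" for x z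
    using that m by (simp add: pl mult_left_mono)
  have m2: "?p x \<le> ?p z" if "y \<le> x" "x \<le> z" "z \<le> \<beta>" for x z
  proof (cases "y < \<beta> \<and> x < z")
    case True then show ?thesis using that mid yd hfun_less[of x z] by (simp add: pm)
  next
    case False then show ?thesis using that by (cases "x = z") auto
  qed
  have m3: "?p x \<le> ?p z" if "\<beta> \<le> x" "x \<le> z" for x z using that by (simp add: pr)
  have mono: "?p x \<le> ?p z" if "x \<le> z" for x z
  proof -
    consider "z \<le> y" | "x \<le> y" "y \<le> z" "z \<le> \<beta>" | "x \<le> y" "\<beta> \<le> z" | "y \<le> x" "z \<le> \<beta>" | "y \<le> x" "x \<le> \<beta>" "\<beta> \<le> z" | "\<beta> \<le> x"
      by linarith
    then show ?thesis
      using m1[of x z] m1[of x y] m2[of y z] m2[of y \<beta>] m3[of \<beta> z] m2[of x z] m2[of x \<beta>] m3[of x z] that y(3)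
      by cases auto
  qed
  then show "mono_on {0..} ?p" by (auto simp: mono_on_def)
  have ie: "is_interval (gp_int \<alpha> \<inter> {y..})"
    by (intro is_interval_Int is_interval_gp_int) (simp add: is_interval_1)
  show "concave_on (gp_int \<alpha>) ?p"
  proof (rule concave_on_glue[OF is_interval_gp_int y(1), where m=m])
    have cl: "convex (gp_int \<alpha> \<inter> {..y})" by (intro convex_Int convex_gp_int) simp
    have "concave_on (gp_int \<alpha> \<inter> {..y}) (\<lambda>x. v + m * (x - y))" by (rule affine_concave[OF cl])
    then show "concave_on (gp_int \<alpha> \<inter> {..y}) ?p"
      by (rule concave_on_cong) (auto simp: pl)
    show "concave_on (gp_int \<alpha> \<inter> {y..}) ?p"
    proof (rule concave_on_glue[OF ie, of \<beta> _ 0])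
      show "\<beta> \<in> gp_int \<alpha> \<inter> {y..}" using y by auto
      show "?p x \<le> ?p \<beta> + 0 * (x - \<beta>)" for x using mono[of x \<beta>] pr[of x] pr[of \<beta>] by (cases "x \<le> \<beta>") auto
      have e: "gp_int \<alpha> \<inter> {y..} \<inter> {..\<beta>} = {y..\<beta>}" using gp_dom_below[OF yd(2)] yd(3) by (auto simp: gp_int_iff gp_dom_iff)
      show "concave_on (gp_int \<alpha> \<inter> {y..} \<inter> {..\<beta>}) ?p"
      proof (cases "y < \<beta>")
        case True
        have "gp_inv \<alpha> sb \<le> y" using mid[OF True] gp_inv_haz[of \<alpha> y] strict_mono_less_eq[OF strict_mono_gp_inv, of \<alpha> sb "gp_haz \<alpha> y"] y
          by (simp add: gp_int_iff)
        then have "concave_on {y..\<beta>} (hfun \<alpha> k n)"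
        proof -
          have sub: "{y..\<beta>} \<subseteq> {gp_inv \<alpha> sb..cx}" using mid[OF True] \<open>gp_inv \<alpha> sb \<le> y\<close> by auto
          show ?thesis using hfun_concave[OF sb] unfolding concave_on_def
            by (rule convex_on_subset[OF _ sub]) simp
        qed
        then show ?thesis unfolding e by (rule concave_on_cong) (use pm[OF True] in auto)
      next
        case False
        then have "{y..\<beta>} = {y}" using y(3) by auto
        moreover have "concave_on {y} ?p"
          by (rule concave_on_cong[OF affine_concave[of "{y}" "?p y" 0 y]]) auto
        ultimately show ?thesis unfolding e by (simp only:)
      qed
      have "convex (gp_int \<alpha> \<inter> {y..} \<inter> {\<beta>..})" by (intro convex_Int convex_gp_int) simp_all
      from affine_concave[OF this, of "tail_mean \<beta>" 0 0]
      show "concave_on (gp_int \<alpha> \<inter> {y..} \<inter> {\<beta>..}) ?p"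
        by (rule concave_on_cong) (auto simp: pr)
    qed
    fix x assume x: "x \<in> gp_int \<alpha>"
    \<comment> \<open>The line continued beyond \<open>y\<close> stays above \<open>h\<close>: by
      the mean value theorem the increment of \<open>h\<close> has a slope below that at
      \<open>y\<close>.\<close>
    have tang: "hfun \<alpha> k n z \<le> v + m * (z - y)" if z: "y < z" "z \<le> \<beta>" for z
    proof -
      have lt: "y < \<beta>" using z by simp
      have d: "u \<in> gp_dom \<alpha>" if "y \<le> u" "u \<le> \<beta>" for u using gp_dom_below[OF yd(2), of u] that yd by auto
      obtain u where u: "y < u" "u < z" "hfun \<alpha> k n z - hfun \<alpha> k n y = (z - y) * slope (gp_haz \<alpha> u)"
        using MVT2[of y z "hfun \<alpha> k n" "\<lambda>x. slope (gp_haz \<alpha> x)"] z DERIV_hfun d by (auto simp: gp_dom_iff)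
      have "u \<in> gp_dom \<alpha>" using u z by (intro d) auto
      moreover have "u < cx" using u z mid[OF lt] by auto
      ultimately have hz: "gp_haz \<alpha> y < gp_haz \<alpha> u" "gp_haz \<alpha> u < crit"
        using gp_haz_le_crit(1)[of u] gp_haz_less_iff[of y \<alpha> u] u yd by auto
      have "slope (gp_haz \<alpha> u) < slope (gp_haz \<alpha> y)"
        using slope_mono_infl(2)[OF sb, of "gp_haz \<alpha> y" "gp_haz \<alpha> u"] hz mid[OF lt] gp_haz_pos[of y \<alpha>] y by (auto simp: gp_int_iff)
      then have "(z - y) * slope (gp_haz \<alpha> u) \<le> (z - y) * m" using mid[OF lt] z by (intro mult_left_mono) auto
      moreover have "v = hfun \<alpha> k n y" using ok lt by (auto simp: pw_ok_def)
      ultimately show ?thesis using u(3) by (simp add: mult.commute)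
    qed
    consider "x \<le> y" | "y < x" "x \<le> \<beta>" | "y < x" "\<beta> < x" by linarith
    then show "?p x \<le> ?p y + m * (x - y)"
    proof cases
      case 1 then show ?thesis by (simp add: pl)
    next
      case 2 then show ?thesis using tang[of x] pm[of x] py by simp
    next
      case 3
      show ?thesis
      proof (cases "y < \<beta>")
        case True
        have "m * (\<beta> - y) \<le> m * (x - y)" using 3 m by (intro mult_left_mono) auto
        then show ?thesis using tang[OF True order_refl] hb[OF True] pr[of x] py 3 by simp
      next
        case False
        then have "v = tail_mean \<beta>" using ok by (auto simp: pw_ok_def)
        moreover have "0 \<le> m * (x - y)" using m 3 by (intro mult_nonneg_nonneg) auto
        ultimately show ?thesis using pr[of x] py 3 by simp
      qed
    qed
  qed
qed

section \<open>Existence of the parameters\<close>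

lemma lam_den:
  assumes "y \<in> gp_int \<alpha>"
  shows "lam \<alpha> k n y * (2 * (y * intW \<alpha> y - intxW \<alpha> y)) = ghat \<alpha> k n y * intW \<alpha> y - intG \<alpha> k n y"
  using intW2_pos[OF assms] unfolding lam_def by (simp add: field_simps)

text \<open>With \<open>v = h y\<close> the second equation of \<open>orth\<close> is solved for the
  slope by \<open>lam\<close>, and the first becomes \<open>Zfun = 0\<close>.\<close>

lemma orth_Zfun:
  assumes "y \<in> gp_int \<alpha>" "Zfun \<alpha> k n y = 0"
  shows "orth y (hfun \<alpha> k n y) (lam \<alpha> k n y)"
  using lam_den[OF assms(1)] assms(2) unfolding orth_def Zfun_def hfun_def by (auto simp: algebra_simps)

text \<open>As \<open>h\<close> has total mean 0, taking the tail mean for \<open>v\<close> makes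
  the first equation of \<open>orth\<close> force the slope \<open>tail_mean y / intW y\<close>.
  Then \<open>eq\<close> is the second equation multiplied by \<open>intW\<close>.\<close>

lemma orth_tail:
  assumes y: "y \<in> gp_int \<alpha>"
    and eq: "tail_mean y * (2 * y * intW \<alpha> y - 2 * intxW \<alpha> y - (intW \<alpha> y)\<^sup>2) = intW \<alpha> y * (intW \<alpha> y - intG \<alpha> k n y)"
  shows "orth y (tail_mean y) (tail_mean y / intW \<alpha> y)"
  unfolding orth_def
proof
  have yd: "y \<in> gp_dom \<alpha>" using y gp_int_subset_dom by auto
  have w: "0 < intW \<alpha> y" by (rule intW_pos[OF y])
  show "Ghat \<alpha> k n y - gp_cdf \<alpha> y - tail_mean y * gp_cdf \<alpha> y + tail_mean y / intW \<alpha> y * intW \<alpha> y = 0"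
    using tail_mean_eq(2)[OF yd] w by (simp add: algebra_simps)
  have "(intG \<alpha> k n y - intW \<alpha> y - tail_mean y * intW \<alpha> y + 2 * (tail_mean y / intW \<alpha> y) * (y * intW \<alpha> y - intxW \<alpha> y)) * intW \<alpha> y
    = (intG \<alpha> k n y - intW \<alpha> y) * intW \<alpha> y - tail_mean y * (intW \<alpha> y)\<^sup>2 + 2 * (tail_mean y / intW \<alpha> y * intW \<alpha> y) * (y * intW \<alpha> y - intxW \<alpha> y)"
  proof -
    have "(a - w - A * w + 2 * m * P) * w = (a - w) * w - A * w\<^sup>2 + 2 * (m * w) * P" for a w A m P :: real
      by (simp add: algebra_simps power2_eq_square)
    then show ?thesis .
  qed
  also have "\<dots> = 0"
  proof -
    have "tail_mean y / intW \<alpha> y * intW \<alpha> y = tail_mean y" using w by simp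
    show ?thesis unfolding \<open>tail_mean y / intW \<alpha> y * intW \<alpha> y = tail_mean y\<close>
      using eq by (simp add: algebra_simps)
  qed
  finally show "intG \<alpha> k n y - intW \<alpha> y - tail_mean y * intW \<alpha> y + 2 * (tail_mean y / intW \<alpha> y) * (y * intW \<alpha> y - intxW \<alpha> y) = 0"
    using w by simp
qed

text \<open>The slope \<open>s\<close> gives the residual of the line through
  \<open>(y, h y)\<close> mean 0, and \<open>Zfun\<close> equals \<open>(lam - s) * intW\<close>,
  which has the sign of the first moment of this residual. A residual that is first nonnegative and
  then negative has a negative first moment.\<close>

lemma Zfun_neg_if_one_sign_change:
  assumes y: "y \<in> gp_int \<alpha>"
    and s: "s * intW \<alpha> y = gp_cdf \<alpha> y * ghat \<alpha> k n y - Ghat \<alpha> k n y"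
    and r: "\<And>x. r x = hfun \<alpha> k n x - (hfun \<alpha> k n y + s * (x - y))"
    and up: "\<And>x z. 0 < x \<Longrightarrow> x < z \<Longrightarrow> z < y \<Longrightarrow> r x < 0 \<Longrightarrow> r z < 0"
    and ex: "0 < x0" "x0 < y" "r x0 < 0"
  shows "Zfun \<alpha> k n y < 0"
proof (rule ccontr)
  assume nn: "\<not> Zfun \<alpha> k n y < 0"
  have yd: "y \<in> gp_dom \<alpha>" using y gp_int_subset_dom by auto
  have rr: "r = (\<lambda>x. hfun \<alpha> k n x - (hfun \<alpha> k n y + s * (x - y)))" using r by auto
  have m [measurable]: "r \<in> borel_measurable borel" unfolding rr by measurable
  note M = head_moments[OF yd rr]
  have z: "gp_E \<alpha> (\<lambda>x. indicator {0<..y} x * r x) = 0"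
    unfolding rr head_integrals[OF yd] using s by (simp add: hfun_def algebra_simps)
  have E1: "gp_E \<alpha> (\<lambda>x. indicator {0<..y} x * (r x * (y - x))) = intG \<alpha> k n y - ghat \<alpha> k n y * intW \<alpha> y + s * (2 * (y * intW \<alpha> y - intxW \<alpha> y))"
    unfolding rr head_integrals[OF yd] by (simp add: hfun_def algebra_simps)
  have "gp_E \<alpha> (\<lambda>x. indicator {0<..y} x * (r x * x)) = (lam \<alpha> k n y - s) * (2 * (y * intW \<alpha> y - intxW \<alpha> y))"
    using M(3)[of 0] z E1 lam_den[OF y] by (simp add: algebra_simps)
  moreover have "0 \<le> lam \<alpha> k n y - s"
  proof -
    have "0 \<le> (lam \<alpha> k n y - s) * intW \<alpha> y" using nn s unfolding Zfun_def by (simp add: algebra_simps)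
    then show ?thesis using intW_pos[OF y] by (simp add: zero_le_mult_iff)
  qed
  ultimately have ge: "0 \<le> gp_E \<alpha> (\<lambda>x. indicator {0<..y} x * (r x * x))"
    using intW2_pos[OF y] by simp
  \<comment> \<open>The residual is 0 at \<open>y\<close>; leaving \<open>y\<close> out makes the
    negative set closed upwards.\<close>
  let ?K = "{0<..<y}"
  have e: "gp_E \<alpha> (\<lambda>x. indicator ?K x * f x) = gp_E \<alpha> (\<lambda>x. indicator {0<..y} x * f x)"
    and ei: "integrable (gp_meas \<alpha>) (\<lambda>x. indicator {0<..y} x * f x) \<Longrightarrow> integrable (gp_meas \<alpha>) (\<lambda>x. indicator ?K x * f x)"
    if "f \<in> borel_measurable borel" for f :: "real \<Rightarrow> real"
  proof -
    have ae: "AE x in gp_meas \<alpha>. indicator {0<..y} x * f x = indicator ?K x * f x"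
      using AE_gp_neq[of y \<alpha>] by eventually_elim (auto simp: indicator_def)
    show "gp_E \<alpha> (\<lambda>x. indicator ?K x * f x) = gp_E \<alpha> (\<lambda>x. indicator {0<..y} x * f x)"
      using ae that by (intro integral_cong_AE) (auto elim!: eventually_mono)
    show "integrable (gp_meas \<alpha>) (\<lambda>x. indicator ?K x * f x)" if "integrable (gp_meas \<alpha>) (\<lambda>x. indicator {0<..y} x * f x)"
      using integrable_cong_AE_imp[OF that _ ae] \<open>f \<in> borel_measurable borel\<close> by simp
  qed
  have "AE x in gp_meas \<alpha>. x \<in> ?K \<longrightarrow> r x = 0"
  proof (rule gp_E_one_sign_change(2)[where S="{x\<in>?K. r x < 0}" and q="\<lambda>x. x"])
    show "mono_on ?K (\<lambda>x. x)" "strict_mono_on ?K (\<lambda>x. x)" by (auto simp: monotone_on_def)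
    show "integrable (gp_meas \<alpha>) (\<lambda>x. indicator ?K x * r x)" by (intro ei M) simp
    show "integrable (gp_meas \<alpha>) (\<lambda>x. indicator ?K x * (r x * x))" by (intro ei M) simp
    show "gp_E \<alpha> (\<lambda>x. indicator ?K x * r x) = 0" using e[of r] z by simp
    show "0 \<le> gp_E \<alpha> (\<lambda>x. indicator ?K x * (r x * x))" using e[of "\<lambda>x. r x * x"] ge by simp
  qed (use up in auto)
  moreover have "{x0<..<y} \<subseteq> gp_int \<alpha>" using ex by (intro gp_Ioo_subset[OF yd]) auto
  ultimately obtain x where "x \<in> {x0<..<y}" "x \<in> ?K \<longrightarrow> r x = 0" using gp_AE_ex ex(2) by blast
  then show False using up[of x0 x] ex by auto
qed

lemma hfun_strictly_convex:
  assumes "infl sb"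
  shows "strictly_convex_on {0<..<gp_inv \<alpha> sb} (hfun \<alpha> k n)"
proof (rule strictly_convex_onI_deriv)
  have sb: "0 < sb" using assms by (simp add: infl_def)
  have dom: "x \<in> gp_int \<alpha> \<and> gp_haz \<alpha> x \<le> sb" if "x \<in> {0<..<gp_inv \<alpha> sb}" for x
    using gp_dom_below[OF gp_inv_dom[of sb], of x] gp_haz_le_iff[of x \<alpha> "gp_inv \<alpha> sb"] gp_inv_dom[of sb \<alpha>] that sb
    by (auto simp: gp_int_iff gp_dom_iff)
  show "is_interval {0<..<gp_inv \<alpha> sb}" by (simp add: is_interval_1)
  show "(hfun \<alpha> k n has_real_derivative slope (gp_haz \<alpha> x)) (at x)" if "x \<in> {0<..<gp_inv \<alpha> sb}" for x
    using dom[OF that] by (intro DERIV_hfun) (auto simp: gp_int_iff)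
  show "strict_mono_on {0<..<gp_inv \<alpha> sb} (\<lambda>x. slope (gp_haz \<alpha> x))"
  proof (rule strict_mono_onI)
    fix x y assume "x \<in> {0<..<gp_inv \<alpha> sb}" "y \<in> {0<..<gp_inv \<alpha> sb}" "x < y"
    then show "slope (gp_haz \<alpha> x) < slope (gp_haz \<alpha> y)"
      using dom[of x] dom[of y] slope_mono_infl(1)[OF assms, of "gp_haz \<alpha> x" "gp_haz \<alpha> y"]
        gp_haz_strict_mono[of x y \<alpha>] gp_haz_pos[of x \<alpha>] by (auto simp: gp_int_iff)
  qed
qed

text \<open>The residual is convex up to \<open>y\<close> and 0 at \<open>y\<close>, so a negative
  value persists up to \<open>y\<close>. It is negative somewhere: otherwise mean 0 would make it
  vanish almost everywhere, and \<open>h\<close> would contain collinear points, against strict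
  convexity.\<close>

lemma Zfun_neg_convex:
  assumes sb: "infl sb" and y: "y \<in> gp_int \<alpha>" "gp_haz \<alpha> y \<le> sb"
  shows "Zfun \<alpha> k n y < 0"
proof -
  have yd: "y \<in> gp_dom \<alpha>" "0 < y" using y gp_int_subset_dom by (auto simp: gp_int_iff gp_dom_iff)
  have yb: "y \<le> gp_inv \<alpha> sb"
    using y gp_inv_haz[of \<alpha> y] strict_mono_less_eq[OF strict_mono_gp_inv, of \<alpha> "gp_haz \<alpha> y" sb] by (simp add: gp_int_iff)
  define s where "s = (gp_cdf \<alpha> y * ghat \<alpha> k n y - Ghat \<alpha> k n y) / intW \<alpha> y"
  have s: "s * intW \<alpha> y = gp_cdf \<alpha> y * ghat \<alpha> k n y - Ghat \<alpha> k n y" using intW_pos[OF y(1)] by (simp add: s_def)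
  define r where "r = (\<lambda>x. hfun \<alpha> k n x - (hfun \<alpha> k n y + s * (x - y)))"
  have m [measurable]: "r \<in> borel_measurable borel" unfolding r_def by measurable
  have up: "r z < 0" if "0 < x" "x < z" "z < y" "r x < 0" for x z
  proof -
    have "concave_on {0<..gp_inv \<alpha> sb} (\<lambda>x. - hfun \<alpha> k n x)" using hfun_convex[OF sb] by (simp add: concave_on_def)
    then have "r z * (y - x) \<le> r x * (y - z) + r y * (z - x)"
      using concave_three_points[of "{0<..gp_inv \<alpha> sb}" "\<lambda>x. - hfun \<alpha> k n x" x y z] that yb unfolding r_def by (auto simp: algebra_simps)
    also have "\<dots> < 0" using that by (simp add: r_def mult_neg_pos)
    finally show ?thesis using that by (simp add: mult_less_0_iff)
  qed
  have "\<exists>x. 0 < x \<and> x < y \<and> r x < 0"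
  proof (rule ccontr)
    assume no: "\<not> ?thesis"
    have ry: "r y = 0" by (simp add: r_def)
    have "gp_E \<alpha> (\<lambda>x. indicator {0<..y} x * r x) = 0"
      unfolding r_def head_integrals[OF yd(1)] using s by (simp add: hfun_def algebra_simps)
    moreover have "0 \<le> r x" if "x \<in> {0<..y}" for x using no ry that by (cases "x = y") force+
    ultimately have ae: "AE x in gp_meas \<alpha>. x \<in> {0<..y} \<longrightarrow> r x = 0"
      using head_moments(1)[OF yd(1) r_def] by (intro gp_E_sign_zero) auto
    have pick: "\<exists>x\<in>{a<..<b}. r x = 0" if ab: "0 \<le> a" "a < b" "b \<le> y" for a b
    proof -
      have "b \<in> gp_dom \<alpha>" using gp_dom_below[OF yd(1), of b] ab by auto
      then have "\<exists>x\<in>{a<..<b}. x \<in> {0<..y} \<longrightarrow> r x = 0"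
        by (intro gp_AE_ex[OF ae ab(2)] gp_Ioo_subset ab(1))
      then obtain x where "x \<in> {a<..<b}" "x \<in> {0<..y} \<longrightarrow> r x = 0" by blast
      then show ?thesis using ab by auto
    qed
    obtain x1 where x1: "0 < x1" "x1 < y / 2" "r x1 = 0" using pick[of 0 "y / 2"] yd(2) by auto
    obtain x3 where x3: "y / 2 < x3" "x3 < y" "r x3 = 0" using pick[of "y / 2" y] yd(2) by auto
    define z where "z = (1 - 1 / 2) * x1 + 1 / 2 * x3"
    have "hfun \<alpha> k n z < (1 - 1 / 2) * hfun \<alpha> k n x1 + 1 / 2 * hfun \<alpha> k n x3"
      using hfun_strictly_convex[OF sb] x1 x3 yb unfolding strictly_convex_on_def z_def
      by (elim ballE[where x=x1] ballE[where x=x3] allE[where x="1/2"]) auto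
    moreover have "hfun \<alpha> k n x1 = hfun \<alpha> k n y + s * (x1 - y)" "hfun \<alpha> k n x3 = hfun \<alpha> k n y + s * (x3 - y)"
      using x1(3) x3(3) by (auto simp: r_def)
    ultimately have "r z < 0" unfolding r_def z_def by (simp add: algebra_simps)
    moreover have "0 < z" "z < y" using x1 x3 by (auto simp: z_def)
    ultimately show False using no by blast
  qed
  then obtain x0 where "0 < x0" "x0 < y" "r x0 < 0" by blast
  from Zfun_neg_if_one_sign_change[where r=r, OF y(1) s _ up this] show ?thesis by (simp add: r_def)
qed

text \<open>If the line were flatter than \<open>h\<close> at \<open>y\<close>, concavity would keep
  \<open>h\<close> below it from the inflection point to \<open>y\<close>. As the negative set is an
  interval, the residual would then change sign only once, whence \<open>Zfun < 0\<close>.\<close>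

lemma Yfun_nonneg_if_Zfun_zero:
  assumes sb: "infl sb" and y: "y \<in> gp_int \<alpha>" "sb < gp_haz \<alpha> y" "gp_haz \<alpha> y \<le> crit" and Z: "Zfun \<alpha> k n y = 0"
  shows "slope (gp_haz \<alpha> y) \<le> lam \<alpha> k n y"
proof (rule ccontr)
  assume lt: "\<not> slope (gp_haz \<alpha> y) \<le> lam \<alpha> k n y"
  let ?s = "lam \<alpha> k n y" and ?b = "gp_inv \<alpha> sb"
  have yd: "y \<in> gp_dom \<alpha>" "0 < y" using y gp_int_subset_dom by (auto simp: gp_int_iff gp_dom_iff)
  have s: "?s * intW \<alpha> y = gp_cdf \<alpha> y * ghat \<alpha> k n y - Ghat \<alpha> k n y" using Z by (simp add: Zfun_def)
  have ycx: "y \<le> cx" using y(3) gp_haz_le_crit(2)[OF yd(1)] by (simp add: not_less[symmetric])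
  have b: "0 < ?b" "?b < y"
    using gp_inv_int[of sb \<alpha>] sb y gp_inv_haz[of \<alpha> y] strict_mono_less[OF strict_mono_gp_inv, of \<alpha> sb "gp_haz \<alpha> y"]
    by (auto simp: gp_int_iff infl_def)
  define r where "r = (\<lambda>x. hfun \<alpha> k n x - (hfun \<alpha> k n y + ?s * (x - y)))"
  have near: "r x < 0" if x: "?b \<le> x" "x < y" for x
  proof -
    have d: "u \<in> gp_dom \<alpha>" if "x \<le> u" "u \<le> y" for u using gp_dom_below[OF yd(1), of u] that x b by auto
    obtain u where u: "x < u" "u < y" "hfun \<alpha> k n y - hfun \<alpha> k n x = (y - x) * slope (gp_haz \<alpha> u)"
      using MVT2[of x y "hfun \<alpha> k n" "\<lambda>x. slope (gp_haz \<alpha> x)"] x DERIV_hfun d by (auto simp: gp_dom_iff)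
    have ud: "u \<in> gp_dom \<alpha>" using u by (intro d) auto
    have "sb < gp_haz \<alpha> u" using gp_haz_less_iff[of ?b \<alpha> u] gp_inv_dom[of sb \<alpha>] ud u x sb by (auto simp: infl_def)
    then have "slope (gp_haz \<alpha> y) < slope (gp_haz \<alpha> u)"
      using gp_haz_less_iff[OF ud yd(1)] u y sb by (intro slope_mono_infl(2)[OF sb]) (auto simp: infl_def)
    then have "(y - x) * ?s < (y - x) * slope (gp_haz \<alpha> u)" using lt x by (intro mult_strict_left_mono) auto
    then show ?thesis unfolding r_def using u(3) by (simp add: algebra_simps)
  qed
  have "Zfun \<alpha> k n y < 0"
  proof (rule Zfun_neg_if_one_sign_change[OF y(1) s])
    show "r x = hfun \<alpha> k n x - (hfun \<alpha> k n y + ?s * (x - y))" for x by (simp add: r_def)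
    show "0 < ?b" "?b < y" "r ?b < 0" using b near[of ?b] by auto
    fix x z assume *: "0 < x" "x < z" "z < y" "r x < 0"
    show "r z < 0"
    proof (cases "?b \<le> z")
      case False
      show ?thesis
        by (rule residual_interval[OF sb y(1), where m="?s" and v="hfun \<alpha> k n y" and ?x1.0=x and ?x2.0="?b"])
          (use * False ycx b near[of ?b] in \<open>auto simp: r_def\<close>)
    qed (use near * in auto)
  qed
  with Z show False by simp
qed

text \<open>The intermediate value theorem for the defect \<open>E\<close> of the equation of
  \<open>Zset\<close>, between \<open>\<beta>\<close> and the point \<open>y1\<close> where the tail
  mean vanishes. \<open>E\<close> is positive at \<open>y1\<close>, and at \<open>\<beta>\<close> it
  is a positive multiple of \<open>Zfun\<close>. If that were positive, \<open>Zfun\<close>,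
  negative at the inflection point, would vanish in between, where the slope condition holds
  automatically, against \<open>none\<close>.\<close>

lemma existence:
  assumes sb: "infl sb" and s0: "0 < s0" "s0 < crit" "tau s0 = 0" "\<And>s. 0 \<le> s \<Longrightarrow> s < s0 \<Longrightarrow> tau s < 0" "\<And>s. s0 < s \<Longrightarrow> 0 < tau s"
    and none: "\<And>y. gp_inv \<alpha> sb < y \<Longrightarrow> y < gp_inv \<alpha> s0 \<Longrightarrow> slope (gp_haz \<alpha> y) \<le> lam \<alpha> k n y \<Longrightarrow> Zfun \<alpha> k n y \<noteq> 0"
  obtains y where "gp_inv \<alpha> s0 \<le> y" "y \<in> gp_int \<alpha>" "0 < tail_mean y"
    "tail_mean y * (2 * y * intW \<alpha> y - 2 * intxW \<alpha> y - (intW \<alpha> y)\<^sup>2) = intW \<alpha> y * (intW \<alpha> y - intG \<alpha> k n y)"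
proof -
  let ?\<beta> = "gp_inv \<alpha> s0"
  obtain s1 where s1: "s0 < s1" "tailavg s1 = 1" "\<And>s. 0 < s \<Longrightarrow> s < s1 \<Longrightarrow> 1 < tailavg s"
    using tailavg_shape[OF s0(1,4,5)] by blast
  define y1 where "y1 = gp_inv \<alpha> s1"
  have b: "?\<beta> \<in> gp_int \<alpha>" "?\<beta> \<in> gp_dom \<alpha>" "0 < ?\<beta>" and y1: "y1 \<in> gp_int \<alpha>" "y1 \<in> gp_dom \<alpha>" "?\<beta> < y1"
    using gp_inv_int[of s0 \<alpha>] gp_inv_int[of s1 \<alpha>] s0 s1 gp_int_subset_dom strict_mono_less[OF strict_mono_gp_inv, of \<alpha> s0 s1]
    by (auto simp: y1_def gp_int_iff gp_dom_iff)
  define D where "D y = 2 * y * intW \<alpha> y - 2 * intxW \<alpha> y - (intW \<alpha> y)\<^sup>2" for y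
  define E where "E y = intW \<alpha> y * (intW \<alpha> y - intG \<alpha> k n y) - tail_mean y * D y" for y
  have ch: "continuous_on {0..y} (gp_haz \<alpha>)" if "y \<in> gp_dom \<alpha>" for y
    using gp_dom_below[OF that] by (intro continuous_at_imp_continuous_on ballI DERIV_isCont[OF DERIV_gp_haz]) (auto simp: gp_dom_iff)
  have cW: "continuous_on {0..y1} (intW \<alpha>)" "continuous_on {0..y1} (intxW \<alpha>)" "continuous_on {0..y1} (intG \<alpha> k n)"
    by (rule continuous_on_intW[OF y1(2)] continuous_on_intxW[OF y1(2)] continuous_on_intG[OF y1(2) k1])+
  have ct: "continuous_on {0..y1} tail_mean"
  proof -
    have "continuous_on UNIV tailavg" by (intro continuous_at_imp_continuous_on ballI DERIV_isCont[OF DERIV_tailavg])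
    then have "continuous_on (gp_haz \<alpha> ` {0..y1}) tailavg" by (rule continuous_on_subset) simp
    from continuous_on_compose[OF ch[OF y1(2)] this] show ?thesis
      unfolding tail_mean_def[abs_def] o_def by (intro continuous_intros) auto
  qed
  have cE: "continuous_on {?\<beta>..y1} E"
    unfolding E_def D_def using b by (intro continuous_intros continuous_on_subset[OF cW(1)] continuous_on_subset[OF cW(2)]
      continuous_on_subset[OF cW(3)] continuous_on_subset[OF ct]) auto
  have E1: "0 < E y1"
  proof -
    have "tail_mean y1 = 0" using s1(2) by (simp add: tail_mean_def y1_def)
    moreover have "intW \<alpha> y1 - intG \<alpha> k n y1 = integral {0..y1} (\<lambda>x. gp_cdf \<alpha> x - Ghat \<alpha> k n x)"
      unfolding intW_def intG_def
      by (intro Henstock_Kurzweil_Integration.integral_diff[symmetric] integrable_continuous_real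
        continuous_on_gp_cdf[OF y1(2)] continuous_on_Ghat[OF y1(2) k1])
    moreover have "0 < integral {0..y1} (\<lambda>x. gp_cdf \<alpha> x - Ghat \<alpha> k n x)"
    proof (rule integral_pos_real)
      show "continuous_on {0..y1} (\<lambda>x. gp_cdf \<alpha> x - Ghat \<alpha> k n x)"
        by (intro continuous_intros continuous_on_gp_cdf[OF y1(2)] continuous_on_Ghat[OF y1(2) k1])
      show "0 < y1" using b y1 by simp
      fix x assume x: "0 < x" "x < y1"
      then have xd: "x \<in> gp_dom \<alpha>" using gp_dom_below[OF y1(2), of x] by simp
      then have "0 < gp_haz \<alpha> x" "gp_haz \<alpha> x < s1"
        using gp_haz_pos[of x \<alpha>] gp_haz_less_iff[OF xd y1(2)] x by (auto simp: gp_dom_iff y1_def)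
      then have "0 < tail_mean x" using s1(3) by (simp add: tail_mean_def)
      then show "0 < gp_cdf \<alpha> x - Ghat \<alpha> k n x"
        unfolding tail_mean_eq(2)[OF xd] using gp_cdf_less_1[of \<alpha> x] xd by (simp add: gp_dom_iff)
    qed
    ultimately show ?thesis unfolding E_def using intW_pos[OF y1(1)] by simp
  qed
  \<comment> \<open>At \<open>\<beta>\<close> the tail mean is \<open>h \<beta>\<close>, so here the
    two families of lines have the same end point.\<close>
  have Eb: "E ?\<beta> = Zfun \<alpha> k n ?\<beta> * (2 * (?\<beta> * intW \<alpha> ?\<beta> - intxW \<alpha> ?\<beta>))"
  proof -
    have A: "tail_mean ?\<beta> = ghat \<alpha> k n ?\<beta> - 1" using hfun_tail_mean[OF b(2)] s0(3) by (simp add: hfun_def)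
    have G: "Ghat \<alpha> k n ?\<beta> - gp_cdf \<alpha> ?\<beta> * ghat \<alpha> k n ?\<beta> = 1 - ghat \<alpha> k n ?\<beta>"
      using tail_mean_eq(2)[OF b(2)] unfolding A by (simp add: algebra_simps)
    have "Zfun \<alpha> k n ?\<beta> * (2 * (?\<beta> * intW \<alpha> ?\<beta> - intxW \<alpha> ?\<beta>)) =
      (1 - ghat \<alpha> k n ?\<beta>) * (2 * (?\<beta> * intW \<alpha> ?\<beta> - intxW \<alpha> ?\<beta>)) + (lam \<alpha> k n ?\<beta> * (2 * (?\<beta> * intW \<alpha> ?\<beta> - intxW \<alpha> ?\<beta>))) * intW \<alpha> ?\<beta>"
      unfolding Zfun_def G by (simp add: algebra_simps)
    then show ?thesis unfolding E_def D_def A lam_den[OF b(1)] by (simp add: algebra_simps power2_eq_square)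
  qed
  have "E ?\<beta> \<le> 0"
  proof (rule ccontr)
    assume "\<not> E ?\<beta> \<le> 0"
    then have Zb: "0 < Zfun \<alpha> k n ?\<beta>" unfolding Eb using intW2_pos[OF b(1)] by (simp add: not_le zero_less_mult_iff)
    \<comment> \<open>On the convex part \<open>Zfun\<close> is negative, so \<open>\<beta>\<close>
      lies beyond the inflection point.\<close>
    then have lt: "sb < s0" using Zfun_neg_convex[OF sb b(1)] by force
    let ?b = "gp_inv \<alpha> sb"
    have bb: "?b \<in> gp_int \<alpha>" "0 < ?b" "?b < ?\<beta>"
      using sb gp_inv_int[of sb \<alpha>] strict_mono_less[OF strict_mono_gp_inv, of \<alpha> sb s0] lt by (auto simp: infl_def gp_int_iff)
    have Zn: "Zfun \<alpha> k n ?b < 0" by (rule Zfun_neg_convex[OF sb bb(1)]) simp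
    have den: "2 * y * intW \<alpha> y - 2 * intxW \<alpha> y \<noteq> 0" if "y \<in> {?b..?\<beta>}" for y
    proof -
      have "y \<in> gp_int \<alpha>" using gp_dom_below[OF b(2), of y] bb that by (auto simp: gp_int_iff gp_dom_iff)
      then show ?thesis using intW2_pos[of y \<alpha>] by simp
    qed
    have sub: "{?b..?\<beta>} \<subseteq> {0..y1}" using bb y1 by auto
    have cZ: "continuous_on {?b..?\<beta>} (Zfun \<alpha> k n)"
      unfolding Zfun_def[abs_def] lam_def
      by (intro continuous_intros continuous_on_subset[OF cW(1) sub] continuous_on_subset[OF cW(2) sub] continuous_on_subset[OF cW(3) sub]
          continuous_on_subset[OF continuous_on_ghat[OF y1(2)] sub] continuous_on_subset[OF continuous_on_gp_cdf[OF y1(2)] sub]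
          continuous_on_subset[OF continuous_on_Ghat[OF y1(2) k1] sub]) (use den in auto)
    obtain y where y: "?b \<le> y" "y \<le> ?\<beta>" "Zfun \<alpha> k n y = 0"
      using IVT'[of "Zfun \<alpha> k n" ?b 0 ?\<beta>] Zn Zb bb cZ by auto
    then have y': "?b < y" "y < ?\<beta>" using Zn Zb by (auto simp: less_le)
    have yi: "y \<in> gp_int \<alpha>" using gp_dom_below[OF b(2), of y] bb y by (auto simp: gp_int_iff gp_dom_iff)
    then have yd: "y \<in> gp_dom \<alpha>" using gp_int_subset_dom by auto
    have "sb < gp_haz \<alpha> y" "gp_haz \<alpha> y < s0"
      using gp_haz_less_iff[of ?b \<alpha> y] gp_haz_less_iff[of y \<alpha> ?\<beta>] bb b yd y' gp_int_subset_dom[of \<alpha>] by auto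
    then have "slope (gp_haz \<alpha> y) \<le> lam \<alpha> k n y"
      using s0(2) by (intro Yfun_nonneg_if_Zfun_zero[OF sb yi _ _ y(3)]) auto
    with none[OF y'] y(3) show False by blast
  qed
  then obtain y where y: "?\<beta> \<le> y" "y \<le> y1" "E y = 0"
    using IVT'[of E ?\<beta> 0 y1] E1 y1 cE by auto
  then have "y \<noteq> y1" using E1 by auto
  then have lt: "y < y1" using y by simp
  have yd: "y \<in> gp_dom \<alpha>" using gp_dom_below[OF y1(2), of y] y b by auto
  have yi: "y \<in> gp_int \<alpha>" using yd y b by (auto simp: gp_int_iff gp_dom_iff)
  have "0 < gp_haz \<alpha> y" "gp_haz \<alpha> y < s1" using gp_haz_pos[of y \<alpha>] yi gp_haz_less_iff[OF yd y1(2)] lt by (auto simp: gp_int_iff y1_def)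
  then have "0 < tail_mean y" using s1(3) by (simp add: tail_mean_def)
  then show ?thesis using that[of y] y yi by (simp add: E_def D_def)
qed

end

lemma concave_on_affine_image:
  fixes f :: "real \<Rightarrow> real"
  assumes f: "concave_on S f" and a: "0 \<le> a"
  shows "concave_on S (\<lambda>x. a * f x + b)"
proof (rule concave_on_linorderI)
  show S: "convex S" using f by (rule concave_on_imp_convex)
  fix t x y :: real assume *: "0 < t" "t < 1" "x \<in> S" "y \<in> S" "x < y"
  then have "(1 - t) * f x + t * f y \<le> f ((1 - t) *\<^sub>R x + t *\<^sub>R y)"
    using concave_onD[OF f, of t x y] by simp
  then have "a * ((1 - t) * f x + t * f y) \<le> a * f ((1 - t) *\<^sub>R x + t *\<^sub>R y)" using a by (rule mult_left_mono)
  then show "(1 - t) * (a * f x + b) + t * (a * f y + b) \<le> a * f ((1 - t) *\<^sub>R x + t *\<^sub>R y) + b"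
    by (simp add: algebra_simps)
qed

section \<open>The weighted space and projections\<close>

lemma gp_dom_insert: "gp_dom \<alpha> = insert 0 (gp_int \<alpha>)" "0 \<notin> gp_int \<alpha>"
  by (auto simp: gp_dom_iff gp_int_iff)

text \<open>Membership constrains \<open>f\<close> only on the domain. Multiplying by the indicator
  of the interior gives a Borel function on the line with the same weighted integrals.\<close>

lemma gp_L2_D:
  assumes "f \<in> gp_L2 \<alpha>"
  shows "(\<lambda>x. indicator (gp_int \<alpha>) x * f x) \<in> borel_measurable borel"
    "integrable (gp_meas \<alpha>) (\<lambda>x. (indicator (gp_int \<alpha>) x * f x)\<^sup>2)"
proof -
  have m: "(\<lambda>x. indicator (gp_dom \<alpha>) x * f x) \<in> borel_measurable borel"
    using assms unfolding gp_L2_def set_borel_measurable_def by simp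
  have "(\<lambda>x. indicator (gp_int \<alpha>) x * f x) = (\<lambda>x. indicator (gp_int \<alpha>) x * (indicator (gp_dom \<alpha>) x * f x))"
    using gp_dom_insert[of \<alpha>] by (intro ext) (auto split: split_indicator)
  also have "\<dots> \<in> borel_measurable borel" using m by measurable
  finally show b: "(\<lambda>x. indicator (gp_int \<alpha>) x * f x) \<in> borel_measurable borel" .
  have i: "integrable lborel (\<lambda>x. indicator (gp_dom \<alpha>) x * (\<bar>f x\<bar>\<^sup>2 * gp_dens \<alpha> x))"
    using assms unfolding gp_L2_def set_integrable_def by simp
  have "integrable lborel (\<lambda>x. indicator (gp_int \<alpha>) x * gp_dens \<alpha> x * (indicator (gp_int \<alpha>) x * f x)\<^sup>2)"
  proof (rule integrable_cong_AE_imp[OF i])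
    show "(\<lambda>x. indicator (gp_int \<alpha>) x * gp_dens \<alpha> x * (indicator (gp_int \<alpha>) x * f x)\<^sup>2) \<in> borel_measurable lborel"
      using b by measurable
    show "AE x in lborel. indicator (gp_dom \<alpha>) x * (\<bar>f x\<bar>\<^sup>2 * gp_dens \<alpha> x) = indicator (gp_int \<alpha>) x * gp_dens \<alpha> x * (indicator (gp_int \<alpha>) x * f x)\<^sup>2"
      using AE_lborel_singleton[of 0] by eventually_elim (auto simp: gp_dom_insert indicator_def)
  qed
  then show "integrable (gp_meas \<alpha>) (\<lambda>x. (indicator (gp_int \<alpha>) x * f x)\<^sup>2)"
    using b by (subst integrable_gp_meas_iff) auto
qed

lemma gp_norm_eq:
  assumes g [measurable]: "g \<in> borel_measurable borel" and fg: "\<And>x. x \<in> gp_int \<alpha> \<Longrightarrow> f x = g x"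
  shows "gp_norm \<alpha> f = sqrt (gp_E \<alpha> (\<lambda>x. (g x)\<^sup>2))"
proof -
  let ?G = "\<lambda>x. indicator (gp_int \<alpha>) x * gp_dens \<alpha> x * (g x)\<^sup>2"
  have eq: "indicator (gp_dom \<alpha>) x *\<^sub>R (\<bar>f x\<bar>\<^sup>2 * gp_dens \<alpha> x) = ?G x + indicator {0} x * ((f 0)\<^sup>2 * gp_dens \<alpha> 0)" for x
    using fg[of x] gp_dom_insert[of \<alpha>] by (cases "x = 0"; cases "x \<in> gp_int \<alpha>") auto
  have "(LINT x:gp_dom \<alpha>|lborel. \<bar>f x\<bar>\<^sup>2 * gp_dens \<alpha> x) = (\<integral>x. ?G x + indicator {0} x * ((f 0)\<^sup>2 * gp_dens \<alpha> 0) \<partial>lborel)"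
    unfolding set_lebesgue_integral_def eq ..
  also have "\<dots> = (\<integral>x. ?G x \<partial>lborel)"
    by (intro integral_cong_AE eventually_mono[OF AE_lborel_singleton[of 0]]) auto
  also have "\<dots> = gp_E \<alpha> (\<lambda>x. (g x)\<^sup>2)" by (subst integral_gp_meas) auto
  finally show ?thesis unfolding gp_norm_def by simp
qed

lemma gp_L2_bounded:
  assumes [measurable]: "p \<in> borel_measurable borel" and b: "\<And>x. x \<in> gp_int \<alpha> \<Longrightarrow> \<bar>p x\<bar> \<le> B"
  shows "p \<in> gp_L2 \<alpha>"
proof -
  have "integrable (gp_meas \<alpha>) (\<lambda>x. (p x)\<^sup>2)"
  proof (rule integrable_gp_meas_bounded)
    show "\<bar>(p x)\<^sup>2\<bar> \<le> B\<^sup>2" if "x \<in> gp_int \<alpha>" for x using power_mono[OF b[OF that], of 2] by simp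
  qed simp
  then have i: "integrable lborel (\<lambda>x. indicator (gp_int \<alpha>) x * gp_dens \<alpha> x * (p x)\<^sup>2)"
    by (subst (asm) integrable_gp_meas_iff) auto
  have gd: "gp_dom \<alpha> \<in> sets borel" unfolding gp_dom_insert by simp
  have "integrable lborel (\<lambda>x. indicator (gp_dom \<alpha>) x * (\<bar>p x\<bar>\<^sup>2 * gp_dens \<alpha> x))"
  proof (rule integrable_cong_AE_imp[OF i])
    show "(\<lambda>x. indicator (gp_dom \<alpha>) x * (\<bar>p x\<bar>\<^sup>2 * gp_dens \<alpha> x)) \<in> borel_measurable lborel" using gd by measurable
    show "AE x in lborel. indicator (gp_int \<alpha>) x * gp_dens \<alpha> x * (p x)\<^sup>2 = indicator (gp_dom \<alpha>) x * (\<bar>p x\<bar>\<^sup>2 * gp_dens \<alpha> x)"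
      using AE_lborel_singleton[of 0] by eventually_elim (auto simp: gp_dom_insert indicator_def)
  qed
  moreover have "(\<lambda>x. indicator (gp_dom \<alpha>) x * p x) \<in> borel_measurable lborel" using gd by measurable
  ultimately show ?thesis unfolding gp_L2_def set_integrable_def set_borel_measurable_def by simp
qed

lemma gp_integrable_product:
  fixes f g :: "real \<Rightarrow> real"
  assumes [measurable]: "f \<in> borel_measurable borel" "g \<in> borel_measurable borel"
    and i: "integrable (gp_meas \<alpha>) (\<lambda>x. (f x)\<^sup>2)" "integrable (gp_meas \<alpha>) (\<lambda>x. (g x)\<^sup>2)"
  shows "integrable (gp_meas \<alpha>) (\<lambda>x. f x * g x)"
proof (rule Bochner_Integration.integrable_bound)
  show "integrable (gp_meas \<alpha>) (\<lambda>x. (f x)\<^sup>2 + (g x)\<^sup>2)" using i by simp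
  show "AE x in gp_meas \<alpha>. norm (f x * g x) \<le> norm ((f x)\<^sup>2 + (g x)\<^sup>2)"
  proof (rule AE_I2)
    fix x
    have "0 \<le> (\<bar>f x\<bar> - \<bar>g x\<bar>)\<^sup>2" by simp
    then have "2 * (\<bar>f x\<bar> * \<bar>g x\<bar>) \<le> (f x)\<^sup>2 + (g x)\<^sup>2" by (simp add: power2_diff)
    moreover have "0 \<le> \<bar>f x\<bar> * \<bar>g x\<bar>" by simp
    ultimately have "\<bar>f x\<bar> * \<bar>g x\<bar> \<le> (f x)\<^sup>2 + (g x)\<^sup>2" by linarith
    then show "norm (f x * g x) \<le> norm ((f x)\<^sup>2 + (g x)\<^sup>2)" by (simp add: abs_mult)
  qed
qed simp

context gp_record
begin

lemma cert_bounded: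
  assumes "cert C p"
  shows "p \<in> borel_measurable borel" "integrable (gp_meas \<alpha>) p" "integrable (gp_meas \<alpha>) (\<lambda>x. (p x)\<^sup>2)"
    "integrable (gp_meas \<alpha>) (\<lambda>x. hfun \<alpha> k n x * p x)" "p \<in> gp_L2 \<alpha>"
proof -
  obtain B where m [measurable]: "p \<in> borel_measurable borel" and B: "\<And>x. x \<in> gp_int \<alpha> \<Longrightarrow> \<bar>p x\<bar> \<le> B"
    using assms unfolding cert_def by blast
  show "p \<in> borel_measurable borel" by fact
  show i: "integrable (gp_meas \<alpha>) p" by (rule integrable_gp_meas_bounded[OF m B])
  show "integrable (gp_meas \<alpha>) (\<lambda>x. (p x)\<^sup>2)"
    using gp_integrable_mult_bounded[OF i m B] by (simp add: power2_eq_square)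
  show "integrable (gp_meas \<alpha>) (\<lambda>x. hfun \<alpha> k n x * p x)"
    by (rule gp_integrable_mult_bounded[OF i measurable_hfun hfun_bounded])
  show "p \<in> gp_L2 \<alpha>" by (rule gp_L2_bounded[OF m B])
qed

lemma hfun_square_integrable: "integrable (gp_meas \<alpha>) (\<lambda>x. (hfun \<alpha> k n x)\<^sup>2)"
  using gp_integrable_mult_bounded[OF hfun_integrable measurable_hfun hfun_bounded] by (simp add: power2_eq_square)

lemma cert_inner:
  assumes "cert C p"
  shows "gp_E \<alpha> (\<lambda>x. hfun \<alpha> k n x * p x) = gp_E \<alpha> (\<lambda>x. (p x)\<^sup>2)"
proof -
  have "gp_E \<alpha> (\<lambda>x. (hfun \<alpha> k n x - p x) * p x) = gp_E \<alpha> (\<lambda>x. hfun \<alpha> k n x * p x - (p x)\<^sup>2)"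
    by (simp add: algebra_simps power2_eq_square)
  then show ?thesis using cert_bounded[OF assms] assms by (simp add: cert_def)
qed

text \<open>Test with the constants 1 and -1; \<open>h\<close> itself has mean 0.\<close>

lemma cert_mean:
  assumes c: "cert C p" and C: "\<And>a. C (\<lambda>_. a)"
  shows "gp_E \<alpha> p = 0"
proof -
  interpret prob_space "gp_meas \<alpha>" by (rule prob_space_gp_meas)
  have "gp_E \<alpha> (\<lambda>x. (hfun \<alpha> k n x - p x) * a) \<le> 0" for a
  proof -
    have "(\<lambda>_. a) \<in> borel_measurable borel" "integrable (gp_meas \<alpha>) (\<lambda>x. a\<^sup>2)" by simp_all
    moreover have "\<forall>q\<in>borel_measurable borel. integrable (gp_meas \<alpha>) (\<lambda>x. (q x)\<^sup>2) \<longrightarrow> C q \<longrightarrow>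
        gp_E \<alpha> (\<lambda>x. (hfun \<alpha> k n x - p x) * q x) \<le> 0" using c unfolding cert_def by blast
    ultimately show ?thesis using C[of a] by (elim ballE[where x="\<lambda>_. a"]) auto
  qed
  from this[of 1] this[of "-1"] show ?thesis
    using cert_bounded(2)[OF c] hfun_integrable hfun_mean by simp
qed

lemma iso_const: "iso (\<lambda>_. a)" by (simp add: monotone_on_def)

lemma isoconc_const: "isoconc (\<lambda>_. a)"
  using affine_concave[OF convex_gp_int[of \<alpha>], of a 0 0] by (simp add: monotone_on_def)

text \<open>By the variational inequality the squared distance from \<open>h\<close> to
  \<open>q\<close> is at least that from \<open>h\<close> to \<open>p\<close> plus that from
  \<open>p\<close> to \<open>q\<close>. Hence \<open>p\<close> is nearest, and any other nearest
  element agrees with it almost everywhere. Both are concave on an open interval, hence continuous,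
  and so agree at each of its points.\<close>

lemma cert_projection:
  assumes c: "cert isoconc p" and p: "isoconc p"
  shows "p \<in> gp_cone \<alpha>" "is_gp_projection \<alpha> (hfun \<alpha> k n) p"
    "\<And>p'. is_gp_projection \<alpha> (hfun \<alpha> k n) p' \<Longrightarrow> x \<in> gp_int \<alpha> \<Longrightarrow> p' x = p x"
proof -
  note [measurable] = cert_bounded(1)[OF c]
  show cone: "p \<in> gp_cone \<alpha>" using cert_bounded(5)[OF c] p by (simp add: gp_cone_def)
  have np: "gp_norm \<alpha> (\<lambda>x. hfun \<alpha> k n x - p x) = sqrt (gp_E \<alpha> (\<lambda>x. (hfun \<alpha> k n x - p x)\<^sup>2))"
    by (rule gp_norm_eq) auto
  have ihp: "integrable (gp_meas \<alpha>) (\<lambda>x. (hfun \<alpha> k n x - p x)\<^sup>2)"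
  proof -
    have "(\<lambda>x. (hfun \<alpha> k n x - p x)\<^sup>2) = (\<lambda>x. (hfun \<alpha> k n x)\<^sup>2 - 2 * (hfun \<alpha> k n x * p x) + (p x)\<^sup>2)"
      by (auto simp: power2_eq_square algebra_simps)
    then show ?thesis using hfun_square_integrable cert_bounded[OF c] by simp
  qed
  have key: "gp_E \<alpha> (\<lambda>x. (hfun \<alpha> k n x - p x)\<^sup>2) + gp_E \<alpha> (\<lambda>x. (p x - indicator (gp_int \<alpha>) x * q x)\<^sup>2) \<le>
      gp_E \<alpha> (\<lambda>x. (hfun \<alpha> k n x - indicator (gp_int \<alpha>) x * q x)\<^sup>2)"
    "integrable (gp_meas \<alpha>) (\<lambda>x. (p x - indicator (gp_int \<alpha>) x * q x)\<^sup>2)"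
    "gp_norm \<alpha> (\<lambda>x. hfun \<alpha> k n x - q x) = sqrt (gp_E \<alpha> (\<lambda>x. (hfun \<alpha> k n x - indicator (gp_int \<alpha>) x * q x)\<^sup>2))"
    if q: "q \<in> gp_cone \<alpha>" for q
  proof -
    define q' where "q' = (\<lambda>x. indicator (gp_int \<alpha>) x * q x)"
    have q': "q' \<in> borel_measurable borel" "integrable (gp_meas \<alpha>) (\<lambda>x. (q' x)\<^sup>2)"
      using gp_L2_D[of q \<alpha>] q unfolding q'_def gp_cone_def by auto
    note [measurable] = q'(1)
    have qi: "q' x = q x" if "x \<in> gp_int \<alpha>" for x using that by (simp add: q'_def)
    have "isoconc q'"
      using q qi concave_on_cong[of "gp_int \<alpha>" q q'] by (auto simp: gp_cone_def mono_on_def)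
    then have le: "gp_E \<alpha> (\<lambda>x. (hfun \<alpha> k n x - p x) * q' x) \<le> 0" using c q' unfolding cert_def by blast
    have ipq: "integrable (gp_meas \<alpha>) (\<lambda>x. p x * q' x)" by (intro gp_integrable_product cert_bounded[OF c] q')
    have ihq: "integrable (gp_meas \<alpha>) (\<lambda>x. hfun \<alpha> k n x * q' x)" by (intro gp_integrable_product q' hfun_square_integrable measurable_hfun)
    have i2: "integrable (gp_meas \<alpha>) (\<lambda>x. (p x - q' x)\<^sup>2)"
    proof -
      have "(\<lambda>x. (p x - q' x)\<^sup>2) = (\<lambda>x. (p x)\<^sup>2 - 2 * (p x * q' x) + (q' x)\<^sup>2)" by (auto simp: power2_eq_square algebra_simps)
      then show ?thesis using ipq q' cert_bounded[OF c] by simp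
    qed
    have i3: "integrable (gp_meas \<alpha>) (\<lambda>x. (hfun \<alpha> k n x - p x) * p x)" "integrable (gp_meas \<alpha>) (\<lambda>x. (hfun \<alpha> k n x - p x) * q' x)"
      using ipq ihq cert_bounded(3,4)[OF c] by (simp_all add: left_diff_distrib power2_eq_square)
    have "(\<lambda>x. (hfun \<alpha> k n x - q' x)\<^sup>2) = (\<lambda>x. (hfun \<alpha> k n x - p x)\<^sup>2 + (p x - q' x)\<^sup>2 +
       2 * ((hfun \<alpha> k n x - p x) * p x) - 2 * ((hfun \<alpha> k n x - p x) * q' x))"
      by (auto simp: power2_eq_square algebra_simps)
    then have "gp_E \<alpha> (\<lambda>x. (hfun \<alpha> k n x - q' x)\<^sup>2) = gp_E \<alpha> (\<lambda>x. (hfun \<alpha> k n x - p x)\<^sup>2) + gp_E \<alpha> (\<lambda>x. (p x - q' x)\<^sup>2) +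
       2 * gp_E \<alpha> (\<lambda>x. (hfun \<alpha> k n x - p x) * p x) - 2 * gp_E \<alpha> (\<lambda>x. (hfun \<alpha> k n x - p x) * q' x)"
      using ihp i2 i3 by simp
    moreover have "gp_E \<alpha> (\<lambda>x. (hfun \<alpha> k n x - p x) * p x) = 0" using c by (simp add: cert_def)
    ultimately show "gp_E \<alpha> (\<lambda>x. (hfun \<alpha> k n x - p x)\<^sup>2) + gp_E \<alpha> (\<lambda>x. (p x - indicator (gp_int \<alpha>) x * q x)\<^sup>2) \<le>
      gp_E \<alpha> (\<lambda>x. (hfun \<alpha> k n x - indicator (gp_int \<alpha>) x * q x)\<^sup>2)"
      using le unfolding q'_def by simp
    show "integrable (gp_meas \<alpha>) (\<lambda>x. (p x - indicator (gp_int \<alpha>) x * q x)\<^sup>2)" using i2 unfolding q'_def .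
    show "gp_norm \<alpha> (\<lambda>x. hfun \<alpha> k n x - q x) = sqrt (gp_E \<alpha> (\<lambda>x. (hfun \<alpha> k n x - indicator (gp_int \<alpha>) x * q x)\<^sup>2))"
      using q'(1) unfolding q'_def by (intro gp_norm_eq) auto
  qed
  show "is_gp_projection \<alpha> (hfun \<alpha> k n) p"
    unfolding is_gp_projection_def
  proof (intro conjI ballI cone)
    fix q assume q: "q \<in> gp_cone \<alpha>"
    have "0 \<le> gp_E \<alpha> (\<lambda>x. (p x - indicator (gp_int \<alpha>) x * q x)\<^sup>2)" by simp
    then show "gp_norm \<alpha> (\<lambda>x. hfun \<alpha> k n x - p x) \<le> gp_norm \<alpha> (\<lambda>x. hfun \<alpha> k n x - q x)"
      unfolding np key(3)[OF q] using key(1)[OF q] by (intro real_sqrt_le_mono) linarith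
  qed
  fix p' assume P: "is_gp_projection \<alpha> (hfun \<alpha> k n) p'" and x: "x \<in> gp_int \<alpha>"
  have q: "p' \<in> gp_cone \<alpha>" using P by (simp add: is_gp_projection_def)
  have "gp_norm \<alpha> (\<lambda>x. hfun \<alpha> k n x - p' x) \<le> gp_norm \<alpha> (\<lambda>x. hfun \<alpha> k n x - p x)"
    using P cone by (simp add: is_gp_projection_def)
  then have "gp_E \<alpha> (\<lambda>x. (hfun \<alpha> k n x - indicator (gp_int \<alpha>) x * p' x)\<^sup>2) \<le> gp_E \<alpha> (\<lambda>x. (hfun \<alpha> k n x - p x)\<^sup>2)"
    unfolding np key(3)[OF q] by simp
  moreover have "0 \<le> gp_E \<alpha> (\<lambda>x. (p x - indicator (gp_int \<alpha>) x * p' x)\<^sup>2)" by simp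
  ultimately have "gp_E \<alpha> (\<lambda>x. (p x - indicator (gp_int \<alpha>) x * p' x)\<^sup>2) = 0" using key(1)[OF q] by linarith
  then have "AE x in gp_meas \<alpha>. (p x - indicator (gp_int \<alpha>) x * p' x)\<^sup>2 = 0"
    using integral_nonneg_eq_0_iff_AE[OF key(2)[OF q]] by simp
  then have ae: "AE x in gp_meas \<alpha>. x \<in> gp_int \<alpha> \<longrightarrow> p x = p' x" by eventually_elim auto
  have "continuous_on (gp_int \<alpha>) (\<lambda>x. - p x)" "continuous_on (gp_int \<alpha>) (\<lambda>x. - p' x)"
    using p q unfolding gp_cone_def concave_on_def by (auto intro!: convex_on_continuous open_gp_int)
  then have cont: "continuous_on (gp_int \<alpha>) (\<lambda>x. p x - p' x)"
    using continuous_on_diff[of "gp_int \<alpha>" "\<lambda>x. - p' x" "\<lambda>x. - p x"] by simp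
  show "p' x = p x"
  proof (rule ccontr)
    assume ne: "p' x \<noteq> p x"
    have "isCont (\<lambda>x. p x - p' x) x" using cont x open_gp_int by (simp add: continuous_on_eq_continuous_at)
    then have "((\<lambda>x. p x - p' x) \<longlongrightarrow> p x - p' x) (nhds x)" using tendsto_at_iff_tendsto_nhds[of "\<lambda>x. p x - p' x" x] by (simp add: isCont_def)
    then have "eventually (\<lambda>z. p z - p' z \<noteq> 0) (nhds x)"
      using ne by (intro tendsto_imp_eventually_ne) auto
    moreover have "eventually (\<lambda>z. z \<in> gp_int \<alpha>) (nhds x)" using x open_gp_int by (rule eventually_nhds_in_open[rotated])
    ultimately have "eventually (\<lambda>z. p z - p' z \<noteq> 0 \<and> z \<in> gp_int \<alpha>) (nhds x)" by (rule eventually_conj)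
    then obtain e where e: "0 < e" "\<And>z. dist z x < e \<Longrightarrow> p z - p' z \<noteq> 0 \<and> z \<in> gp_int \<alpha>"
      unfolding eventually_nhds_metric by blast
    have "{x<..<x + e} \<subseteq> gp_int \<alpha>" using e by (auto simp: dist_real_def)
    then obtain z where "z \<in> {x<..<x + e}" "z \<in> gp_int \<alpha> \<longrightarrow> p z = p' z"
      using gp_AE_ex[OF ae, of x "x + e"] e(1) by auto
    then show False using e(2)[of z] by (auto simp: dist_real_def)
  qed
qed

section \<open>Expectations of records\<close>

context
  fixes M :: "'a measure" and X :: "nat \<Rightarrow> 'a \<Rightarrow> real" and F :: "real \<Rightarrow> real" and D :: "real measure"
    and \<mu> \<sigma> :: real
  assumes X: "iid_sequence M X F" and D: "real_distribution D" "F = cdf D"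
    and flat: "\<And>u v w. 0 < u \<Longrightarrow> u < v \<Longrightarrow> v < 1 \<Longrightarrow> quantile F u = quantile F v \<Longrightarrow> u \<le> w \<Longrightarrow> w < 1 \<Longrightarrow> quantile F w = quantile F u"
    and mv: "has_mean_variance M (X 1) \<mu> (\<sigma>\<^sup>2)" and \<sigma>: "0 < \<sigma>"
begin

text \<open>Cut off so as to be Borel on the whole line; the uniform law does not charge the
  complement of \<open>(0, 1)\<close>.\<close>

definition qf :: "real \<Rightarrow> real" where
  "qf u = (if 0 < u \<and> u < 1 then quantile F u else 0)"

text \<open>The standardized quantile function transported to the weighted space, where it has norm
  1.\<close>

definition std :: "real \<Rightarrow> real" where
  "std x = (qf (gp_cdf \<alpha> x) - \<mu>) / \<sigma>"

lemma measurable_qf [measurable]: "qf \<in> borel_measurable borel"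
  using measurable_quantile[OF D] unfolding qf_def[abs_def] .

lemma measurable_std [measurable]: "std \<in> borel_measurable borel"
  unfolding std_def[abs_def] by measurable

lemma std_eq: "x \<in> gp_int \<alpha> \<Longrightarrow> std x = (quantile F (gp_cdf \<alpha> x) - \<mu>) / \<sigma>"
  using gp_cdf_pos[of x \<alpha>] gp_cdf_less_1[of \<alpha> x] by (simp add: std_def qf_def gp_int_iff)

lemma qf_law:
  fixes f :: "real \<Rightarrow> real"
  assumes [measurable]: "f \<in> borel_measurable borel"
  shows "integral\<^sup>L M (\<lambda>\<omega>. f (X 1 \<omega>)) = gp_E \<alpha> (\<lambda>x. f (qf (gp_cdf \<alpha> x)))"
    and "integrable M (\<lambda>\<omega>. f (X 1 \<omega>)) \<longleftrightarrow> integrable (gp_meas \<alpha>) (\<lambda>x. f (qf (gp_cdf \<alpha> x)))"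
proof -
  have law: "X 1 \<in> borel_measurable M" "distr M borel (X 1) = D"
    by (rule record_law(3,4)[OF X D k1 mono_on_quantile[OF D] measurable_quantile[OF D] distr_quantile[OF D]]; rule flat; assumption)+
  have qd: "distr unif borel qf = D" using distr_quantile[OF D] unfolding qf_def[abs_def] .
  have qm: "qf \<in> borel_measurable unif" by simp
  have "integral\<^sup>L M (\<lambda>\<omega>. f (X 1 \<omega>)) = integral\<^sup>L D f"
    unfolding law(2)[symmetric] by (rule integral_distr[symmetric, OF law(1)]) simp
  also have "\<dots> = integral\<^sup>L unif (\<lambda>u. f (qf u))" unfolding qd[symmetric] by (rule integral_distr[OF qm]) simp
  also have "\<dots> = gp_E \<alpha> (\<lambda>x. f (qf (gp_cdf \<alpha> x)))" by (rule gp_E_rec_dens) measurable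
  finally show "integral\<^sup>L M (\<lambda>\<omega>. f (X 1 \<omega>)) = gp_E \<alpha> (\<lambda>x. f (qf (gp_cdf \<alpha> x)))" .
  have "integrable M (\<lambda>\<omega>. f (X 1 \<omega>)) \<longleftrightarrow> integrable D f"
    unfolding law(2)[symmetric] by (rule integrable_distr_eq[symmetric, OF law(1)]) simp
  also have "\<dots> \<longleftrightarrow> integrable unif (\<lambda>u. f (qf u))" unfolding qd[symmetric] by (rule integrable_distr_eq[OF qm]) simp
  also have "\<dots> \<longleftrightarrow> integrable (gp_meas \<alpha>) (\<lambda>x. f (qf (gp_cdf \<alpha> x)))" by (rule gp_E_rec_dens) measurable
  finally show "integrable M (\<lambda>\<omega>. f (X 1 \<omega>)) \<longleftrightarrow> integrable (gp_meas \<alpha>) (\<lambda>x. f (qf (gp_cdf \<alpha> x)))" .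
qed

lemma std_moments:
  "integrable (gp_meas \<alpha>) (\<lambda>x. qf (gp_cdf \<alpha> x))" "gp_E \<alpha> (\<lambda>x. qf (gp_cdf \<alpha> x)) = \<mu>"
  "integrable (gp_meas \<alpha>) std" "integrable (gp_meas \<alpha>) (\<lambda>x. (std x)\<^sup>2)" "gp_E \<alpha> (\<lambda>x. (std x)\<^sup>2) = 1"
proof -
  interpret gp: prob_space "gp_meas \<alpha>" by (rule prob_space_gp_meas)
  have mv': "integrable M (X 1)" "integrable M (\<lambda>\<omega>. (X 1 \<omega>)\<^sup>2)" "integral\<^sup>L M (X 1) = \<mu>" "integral\<^sup>L M (\<lambda>\<omega>. (X 1 \<omega> - \<mu>)\<^sup>2) = \<sigma>\<^sup>2"
    using mv by (auto simp: has_mean_variance_def)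
  show i: "integrable (gp_meas \<alpha>) (\<lambda>x. qf (gp_cdf \<alpha> x))" using qf_law(2)[of "\<lambda>x. x"] mv'(1) by simp
  show e: "gp_E \<alpha> (\<lambda>x. qf (gp_cdf \<alpha> x)) = \<mu>" using qf_law(1)[of "\<lambda>x. x"] mv'(3) by simp
  have i2: "integrable (gp_meas \<alpha>) (\<lambda>x. (qf (gp_cdf \<alpha> x))\<^sup>2)" using qf_law(2)[of "\<lambda>x. x\<^sup>2"] mv'(2) by simp
  have e2: "gp_E \<alpha> (\<lambda>x. (qf (gp_cdf \<alpha> x) - \<mu>)\<^sup>2) = \<sigma>\<^sup>2" using qf_law(1)[of "\<lambda>x. (x - \<mu>)\<^sup>2"] mv'(4) by simp
  have s2: "(\<lambda>x. (std x)\<^sup>2) = (\<lambda>x. (qf (gp_cdf \<alpha> x) - \<mu>)\<^sup>2 / \<sigma>\<^sup>2)"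
    by (auto simp: std_def power_divide)
  have "(\<lambda>x. (qf (gp_cdf \<alpha> x) - \<mu>)\<^sup>2) = (\<lambda>x. (qf (gp_cdf \<alpha> x))\<^sup>2 - 2 * \<mu> * qf (gp_cdf \<alpha> x) + \<mu>\<^sup>2)"
    by (auto simp: power2_eq_square algebra_simps)
  then have i3: "integrable (gp_meas \<alpha>) (\<lambda>x. (qf (gp_cdf \<alpha> x) - \<mu>)\<^sup>2)" using i i2 by simp
  show "integrable (gp_meas \<alpha>) std" unfolding std_def[abs_def] using i by simp
  show "integrable (gp_meas \<alpha>) (\<lambda>x. (std x)\<^sup>2)" unfolding s2 using i3 by simp
  show "gp_E \<alpha> (\<lambda>x. (std x)\<^sup>2) = 1" unfolding s2 using e2 \<sigma> by simp
qed

text \<open>The expectation integrates the quantile function against \<open>ghat\<close>.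
  Subtracting the mean \<open>\<mu>\<close> replaces \<open>ghat\<close> by \<open>h\<close>, and as
  \<open>h\<close> has mean 0, the quantile function may be centred as well.\<close>

lemma record_expectation:
  "integrable M (\<lambda>\<omega>. record_value k n (\<lambda>i. X i \<omega>))"
  "standardized_record M X k n \<mu> \<sigma> = gp_E \<alpha> (\<lambda>x. hfun \<alpha> k n x * std x)"
proof -
  obtain n' where n': "n = Suc n'" using n1 by (cases n) auto
  interpret M: prob_space M using X unfolding iid_sequence_def by blast
  have law: "(\<lambda>\<omega>. record_value k n (\<lambda>i. X i \<omega>)) \<in> borel_measurable M"
    "distr M borel (\<lambda>\<omega>. record_value k n (\<lambda>i. X i \<omega>)) = distr (density unif (\<lambda>u. ennreal (rec_dens k n u))) borel qf"
    unfolding n' qf_def[abs_def]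
    by (rule record_law(1,2)[OF X D k1 mono_on_quantile[OF D] measurable_quantile[OF D] distr_quantile[OF D]]; rule flat; assumption)+
  note law2 = law(2)
  have dm: "rec_dens k n \<in> borel_measurable borel" unfolding rec_dens_def[abs_def] by measurable
  have nn: "AE u in unif. 0 \<le> rec_dens k n u"
    by (rule eventually_mono[OF AE_unif]) (auto intro: rec_dens_nonneg)
  have qm: "qf \<in> borel_measurable (density unif (\<lambda>u. ennreal (rec_dens k n u)))" by simp
  have ig: "integrable (gp_meas \<alpha>) (\<lambda>x. ghat \<alpha> k n x * qf (gp_cdf \<alpha> x))"
    using gp_int_subset_dom[of \<alpha>]
    by (intro gp_integrable_mult_bounded[OF std_moments(1) measurable_ghat ghat_bounded[OF k2]]) auto
  have g: "(\<lambda>u. rec_dens k n u *\<^sub>R qf u) \<in> borel_measurable borel" using dm by measurable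
  have "integrable M (\<lambda>\<omega>. record_value k n (\<lambda>i. X i \<omega>)) \<longleftrightarrow> integrable (distr M borel (\<lambda>\<omega>. record_value k n (\<lambda>i. X i \<omega>))) (\<lambda>x. x)"
    by (rule integrable_distr_eq[symmetric, OF law(1)]) simp
  also have "\<dots> \<longleftrightarrow> integrable (density unif (\<lambda>u. ennreal (rec_dens k n u))) qf"
    unfolding law2 by (rule integrable_distr_eq[OF qm]) simp
  also have "\<dots> \<longleftrightarrow> integrable unif (\<lambda>u. rec_dens k n u *\<^sub>R qf u)"
    using dm nn by (intro integrable_density) (simp_all add: measurable_cong_sets[OF sets_unif refl])
  also have "\<dots> \<longleftrightarrow> integrable (gp_meas \<alpha>) (\<lambda>x. ghat \<alpha> k n x * qf (gp_cdf \<alpha> x))"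
    using gp_E_rec_dens(2)[OF g] by (simp add: ghat_def)
  finally show ir: "integrable M (\<lambda>\<omega>. record_value k n (\<lambda>i. X i \<omega>))" using ig by simp
  have "integral\<^sup>L M (\<lambda>\<omega>. record_value k n (\<lambda>i. X i \<omega>)) = integral\<^sup>L (distr M borel (\<lambda>\<omega>. record_value k n (\<lambda>i. X i \<omega>))) (\<lambda>x. x)"
    by (rule integral_distr[symmetric, OF law(1)]) simp
  also have "\<dots> = integral\<^sup>L (density unif (\<lambda>u. ennreal (rec_dens k n u))) qf"
    unfolding law2 by (rule integral_distr[OF qm]) simp
  also have "\<dots> = integral\<^sup>L unif (\<lambda>u. rec_dens k n u *\<^sub>R qf u)"
    using dm nn by (intro integral_density) (simp_all add: measurable_cong_sets[OF sets_unif refl])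
  also have "\<dots> = gp_E \<alpha> (\<lambda>x. ghat \<alpha> k n x * qf (gp_cdf \<alpha> x))"
    using gp_E_rec_dens(1)[OF g] by (simp add: ghat_def)
  finally have er: "integral\<^sup>L M (\<lambda>\<omega>. record_value k n (\<lambda>i. X i \<omega>)) = gp_E \<alpha> (\<lambda>x. ghat \<alpha> k n x * qf (gp_cdf \<alpha> x))" .
  have "standardized_record M X k n \<mu> \<sigma> = (integral\<^sup>L M (\<lambda>\<omega>. record_value k n (\<lambda>i. X i \<omega>)) - \<mu>) / \<sigma>"
    unfolding standardized_record_def using ir by (simp add: M.prob_space)
  also have "\<dots> = gp_E \<alpha> (\<lambda>x. hfun \<alpha> k n x * std x)"
  proof -
    have "(\<lambda>x. hfun \<alpha> k n x * std x) = (\<lambda>x. (ghat \<alpha> k n x * qf (gp_cdf \<alpha> x) - qf (gp_cdf \<alpha> x) - \<mu> * hfun \<alpha> k n x) / \<sigma>)"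
      by (auto simp: std_def hfun_def algebra_simps)
    then show ?thesis using ig std_moments(1,2) hfun_integrable hfun_mean er by simp
  qed
  finally show "standardized_record M X k n \<mu> \<sigma> = gp_E \<alpha> (\<lambda>x. hfun \<alpha> k n x * std x)" .
qed

text \<open>The inner product of \<open>std\<close> with \<open>h\<close> is at most that with
  \<open>p\<close>, hence at most \<open>B\<close> by Cauchy-Schwarz. If \<open>std\<close> is
  \<open>p / B\<close>, then \<open>cert_inner\<close> gives the value \<open>B\<close>
  directly.\<close>

lemma record_bound:
  assumes c: "cert C p" and B: "gp_E \<alpha> (\<lambda>x. (p x)\<^sup>2) = B\<^sup>2" "0 < B"
  shows "C std \<Longrightarrow> standardized_record M X k n \<mu> \<sigma> \<le> B"
    "(\<And>x. x \<in> gp_int \<alpha> \<Longrightarrow> quantile F (gp_cdf \<alpha> x) = \<sigma> / B * p x + \<mu>) \<Longrightarrow> standardized_record M X k n \<mu> \<sigma> = B"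
proof -
  note P = cert_bounded[OF c]
  note [measurable] = P(1)
  have ips: "integrable (gp_meas \<alpha>) (\<lambda>x. p x * std x)"
    by (intro gp_integrable_product P std_moments(4) measurable_std)
  have ihs: "integrable (gp_meas \<alpha>) (\<lambda>x. hfun \<alpha> k n x * std x)"
    by (intro gp_integrable_product measurable_hfun hfun_square_integrable std_moments(4) measurable_std)
  {
    assume "C std"
    then have "gp_E \<alpha> (\<lambda>x. (hfun \<alpha> k n x - p x) * std x) \<le> 0"
      using c measurable_std std_moments(4) unfolding cert_def by blast
    then have 1: "gp_E \<alpha> (\<lambda>x. hfun \<alpha> k n x * std x) \<le> gp_E \<alpha> (\<lambda>x. p x * std x)"
      using ips ihs by (simp add: left_diff_distrib)
    \<comment> \<open>Cauchy-Schwarz by expanding a square, as \<open>std\<close> and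
      \<open>p / B\<close> both have norm 1.\<close>
    have "(\<lambda>x. (std x - p x / B)\<^sup>2) = (\<lambda>x. (std x)\<^sup>2 - 2 / B * (p x * std x) + (p x)\<^sup>2 / B\<^sup>2)"
      by (auto simp: power2_eq_square algebra_simps)
    then have "gp_E \<alpha> (\<lambda>x. (std x - p x / B)\<^sup>2) = 1 - 2 / B * gp_E \<alpha> (\<lambda>x. p x * std x) + 1"
      using ips P(3) std_moments(4,5) B by simp
    moreover have "0 \<le> gp_E \<alpha> (\<lambda>x. (std x - p x / B)\<^sup>2)" by simp
    ultimately have "gp_E \<alpha> (\<lambda>x. p x * std x) \<le> B" proof -
      assume "gp_E \<alpha> (\<lambda>x. (std x - p x / B)\<^sup>2) = 1 - 2 / B * gp_E \<alpha> (\<lambda>x. p x * std x) + 1"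
        "0 \<le> gp_E \<alpha> (\<lambda>x. (std x - p x / B)\<^sup>2)"
      then have "2 / B * gp_E \<alpha> (\<lambda>x. p x * std x) \<le> 2" by linarith
      then show ?thesis using B(2) by (simp add: field_simps)
    qed
    with 1 show "standardized_record M X k n \<mu> \<sigma> \<le> B" unfolding record_expectation(2) by simp
  }
  assume eq: "\<And>x. x \<in> gp_int \<alpha> \<Longrightarrow> quantile F (gp_cdf \<alpha> x) = \<sigma> / B * p x + \<mu>"
  have "gp_E \<alpha> (\<lambda>x. hfun \<alpha> k n x * std x) = gp_E \<alpha> (\<lambda>x. (hfun \<alpha> k n x * p x) / B)"
    using \<sigma> by (intro gp_E_cong) (auto simp: std_eq eq)
  also have "\<dots> = B" using cert_inner[OF c] B by (simp add: power2_eq_square)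
  finally show "standardized_record M X k n \<mu> \<sigma> = B" unfolding record_expectation(2) .
qed

lemma std_iso: "iso std"
proof (rule mono_onI)
  fix x y assume xy: "x \<in> gp_int \<alpha>" "y \<in> gp_int \<alpha>" "x \<le> y"
  have "gp_cdf \<alpha> x \<le> gp_cdf \<alpha> y" using gp_cdf_le_iff[of x \<alpha> y] xy gp_int_subset_dom[of \<alpha>] by auto
  then have "quantile F (gp_cdf \<alpha> x) \<le> quantile F (gp_cdf \<alpha> y)"
    using mono_on_quantile[OF D] gp_cdf_pos[OF xy(1)] gp_cdf_pos[OF xy(2)] gp_cdf_less_1[of \<alpha> x] gp_cdf_less_1[of \<alpha> y] xy
    by (auto simp: mono_on_def gp_int_iff)
  then show "std x \<le> std y" using xy \<sigma> by (simp add: std_eq divide_right_mono)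
qed

lemma std_isoconc: "concave_on (gp_int \<alpha>) (quantile F \<circ> gp_cdf \<alpha>) \<Longrightarrow> isoconc std"
proof (intro conjI std_iso)
  assume "concave_on (gp_int \<alpha>) (quantile F \<circ> gp_cdf \<alpha>)"
  then have "concave_on (gp_int \<alpha>) (\<lambda>x. 1 / \<sigma> * (quantile F \<circ> gp_cdf \<alpha>) x + (- \<mu> / \<sigma>))"
    by (rule concave_on_affine_image) (use \<sigma> in simp)
  then show "concave_on (gp_int \<alpha>) std"
    by (rule concave_on_cong) (simp add: std_eq diff_divide_distrib)
qed

end

end

text \<open>A nondecreasing concave function that is flat between two points is constant from there
  on. The arguments are carried by \<open>X\<close> to the scale on which the quantile function is
  concave.\<close>

lemma IGFR_flat:
  assumes D: "real_distribution D" "F = cdf D" and conc: "concave_on (gp_int \<alpha>) (quantile F \<circ> gp_cdf \<alpha>)"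
    and uv: "0 < u" "u < v" "v < 1" "quantile F u = quantile F v" "u \<le> w" "w < 1"
  shows "quantile F w = quantile F u"
proof (cases "w \<le> v")
  case True
  moreover have "0 < w" using uv by simp
  ultimately have "quantile F u \<le> quantile F w" "quantile F w \<le> quantile F v"
    using uv by (intro mono_onD[OF mono_on_quantile[OF D]]; simp)+
  then show ?thesis using uv(4) by simp
next
  case False
  define X where "X t = gp_inv \<alpha> (- ln (1 - t))" for t
  have X: "X t \<in> gp_int \<alpha>" "gp_cdf \<alpha> (X t) = t" if "0 < t" "t < 1" for t
    using that gp_inv_int[of "- ln (1 - t)" \<alpha>] gp_cdf_inv[of t \<alpha>] by (auto simp: X_def)
  have lt: "X s < X t" if "0 < s" "s < t" "t < 1" for s t
    unfolding X_def using that by (intro strict_monoD[OF strict_mono_gp_inv]) simp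
  have ww: "v < w" using False by simp
  have l: "X u < X v" "X v < X w" using uv ww by (auto intro: lt)
  have "quantile F u * (X w - X v) + quantile F w * (X v - X u) \<le> quantile F v * (X w - X u)"
    using concave_three_points[OF conc X(1)[of u] X(1)[of w] l] X(2)[of u] X(2)[of v] X(2)[of w] uv ww by simp
  then have "quantile F w * (X v - X u) \<le> quantile F u * (X v - X u)"
    unfolding uv(4) by (simp add: algebra_simps)
  then have "quantile F w \<le> quantile F u" using l by simp
  moreover have "quantile F u \<le> quantile F w"
    using uv by (intro mono_onD[OF mono_on_quantile[OF D]]; simp)
  ultimately show ?thesis by simp
qed

context gp_record
begin

text \<open>The quantile function is prescribed: take the law of \<open>\<psi>\<close> of a uniform
  variable, with \<open>\<psi>\<close> the rescaled \<open>p\<close> read through \<open>W\<close>.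
  Mean 0 and norm \<open>B\<close> of \<open>p\<close> yield the mean and variance. Strict increase
  up to \<open>\<beta>\<close> and constancy afterwards yield the flatness condition for
  records.\<close>

lemma attained:
  assumes c: "cert C p" and C: "\<And>a. C (\<lambda>_. a)" and B: "gp_E \<alpha> (\<lambda>x. (p x)\<^sup>2) = B\<^sup>2" "0 < B" and \<sigma>: "0 < \<sigma>"
    and mono: "mono_on {0..} p" and \<beta>: "\<beta> \<in> gp_int \<alpha>" and const: "\<And>x. \<beta> \<le> x \<Longrightarrow> p x = p \<beta>"
    and cont: "continuous_on {0..\<beta>} p"
    and flat: "\<And>x y. 0 \<le> x \<Longrightarrow> x < y \<Longrightarrow> y \<le> \<beta> \<Longrightarrow> p x < p y"
  shows "bound_attained UNIV (gp_supp \<alpha>) \<alpha> k n \<mu> \<sigma> B p"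
    "concave_on (gp_int \<alpha>) p \<Longrightarrow> bound_attained (IGFR \<alpha>) (gp_supp \<alpha>) \<alpha> k n \<mu> \<sigma> B p"
proof -
  have bd: "\<beta> \<in> gp_dom \<alpha>" "0 < \<beta>" using \<beta> by (auto simp: gp_int_iff gp_dom_iff)
  define u0 where "u0 = gp_cdf \<alpha> \<beta>"
  have u0: "0 < u0" "u0 < 1" using gp_cdf_pos[OF \<beta>] gp_cdf_less_1[of \<alpha> \<beta>] \<beta> by (auto simp: u0_def gp_int_iff)
  \<comment> \<open>The inverse of \<open>W\<close>, clamped to \<open>[0, \<beta>]\<close>. This
    makes \<open>\<psi>\<close> monotone and continuous on the whole line, as
    \<open>quantile_distr_unif\<close> requires, and agrees with \<open>p\<close> because
    \<open>p\<close> is constant beyond \<open>\<beta>\<close>.\<close>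
  define T where "T u = gp_inv \<alpha> (- ln (1 - max 0 (min u u0)))" for u
  define \<psi> where "\<psi> u = \<sigma> / B * p (T u) + \<mu>" for u
  have T01: "0 \<le> T u" "T u \<le> \<beta>" for u
  proof -
    have "0 \<le> - ln (1 - max 0 (min u u0))" using u0 by simp
    then show "0 \<le> T u" unfolding T_def using strict_mono_less_eq[OF strict_mono_gp_inv, of \<alpha> 0] by fastforce
    have "- ln (1 - max 0 (min u u0)) \<le> - ln (1 - u0)" using u0 by simp
    then have "T u \<le> gp_inv \<alpha> (- ln (1 - u0))" unfolding T_def using strict_mono_less_eq[OF strict_mono_gp_inv] by blast
    then show "T u \<le> \<beta>" unfolding u0_def using gp_inv_cdf[of \<alpha> \<beta>] \<beta> by (simp add: gp_int_iff)
  qed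
  have Tmono: "T u \<le> T v" if "u \<le> v" for u v
  proof -
    have "- ln (1 - max 0 (min u u0)) \<le> - ln (1 - max 0 (min v u0))" using u0 that by auto
    then show ?thesis unfolding T_def using strict_mono_less_eq[OF strict_mono_gp_inv] by blast
  qed
  have T: "T (gp_cdf \<alpha> x) = min x \<beta>" if x: "x \<in> gp_dom \<alpha>" for x
  proof -
    have m: "min x \<beta> \<in> gp_dom \<alpha>" using x bd by (auto simp: min_def)
    have "min (gp_cdf \<alpha> x) u0 = gp_cdf \<alpha> (min x \<beta>)"
      using gp_cdf_le_iff[OF x bd(1)] by (auto simp: u0_def min_def)
    then have "max 0 (min (gp_cdf \<alpha> x) u0) = gp_cdf \<alpha> (min x \<beta>)" using gp_cdf_nonneg[OF m] by simp
    then show ?thesis unfolding T_def using gp_inv_cdf[of \<alpha> "min x \<beta>"] m by (simp add: gp_dom_iff)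
  qed
  have \<psi>W: "\<psi> (gp_cdf \<alpha> x) = \<sigma> / B * p x + \<mu>" if "x \<in> gp_dom \<alpha>" for x
    unfolding \<psi>_def T[OF that] using const[of x] by (auto simp: min_def)
  have sB: "0 < \<sigma> / B" using \<sigma> B by simp
  have m\<psi>: "mono \<psi>"
  proof (rule monoI)
    fix u v :: real assume "u \<le> v"
    then have "p (T u) \<le> p (T v)" using mono Tmono T01(1) by (auto simp: mono_on_def)
    then have "\<sigma> / B * p (T u) \<le> \<sigma> / B * p (T v)" using sB by (intro mult_left_mono) auto
    then show "\<psi> u \<le> \<psi> v" unfolding \<psi>_def by (rule add_right_mono)
  qed
  have cT: "continuous_on UNIV T"
  proof -
    have "continuous_on UNIV (\<lambda>u. - ln (1 - max 0 (min u u0)))"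
      using u0 by (intro continuous_intros) (auto simp: max_def min_def)
    moreover have "continuous_on UNIV (gp_inv \<alpha>)" by (intro continuous_at_imp_continuous_on ballI isCont_gp_inv)
    ultimately show ?thesis unfolding T_def[abs_def]
      using continuous_on_compose2[of UNIV "gp_inv \<alpha>" UNIV "\<lambda>u. - ln (1 - max 0 (min u u0))"] by blast
  qed
  have c\<psi>: "continuous_on UNIV \<psi>"
    unfolding \<psi>_def[abs_def] using T01 by (intro continuous_intros continuous_on_compose2[OF cont cT]) auto
  have mb: "\<psi> \<in> borel_measurable borel" by (rule borel_measurable_continuous_onI[OF c\<psi>])
  then have mu: "\<psi> \<in> borel_measurable unif" by (simp add: measurable_cong_sets[OF sets_unif refl])
  define D where "D = distr unif borel \<psi>"
  have rd: "real_distribution D" unfolding D_def by (rule real_distribution_distr_unif[OF mb])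
  define F where "F = cdf D"
  have Q: "quantile F u = \<psi> u" if "0 \<le> u" "u \<le> 1" for u
    unfolding F_def D_def by (rule quantile_distr_unif[OF m\<psi> c\<psi> that])
  have QW: "quantile F (gp_cdf \<alpha> x) = \<sigma> / B * p x + \<mu>" if "x \<in> gp_dom \<alpha>" for x
    using Q[of "gp_cdf \<alpha> x"] gp_cdf_nonneg[OF that] gp_cdf_less_1[of \<alpha> x] \<psi>W[OF that] that by (simp add: gp_dom_iff)
  have ext: "extremal_on (gp_supp \<alpha>) \<alpha> \<mu> \<sigma> B p F"
    unfolding extremal_on_def
  proof
    fix x assume x: "x \<in> gp_supp \<alpha>"
    show "quantile F (gp_cdf \<alpha> x) = \<sigma> / B * p x + \<mu>"
    proof (cases "x \<in> gp_dom \<alpha>")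
      \<comment> \<open>Only a finite right end of the support is left, where \<open>W\<close> is
        1.\<close>
      case False
      then have e: "gp_end \<alpha> = ereal x" "0 \<le> x" using x by (auto simp: gp_supp_def gp_dom_def)
      then have a: "0 < \<alpha>" "x = 1 / \<alpha>" by (auto simp: gp_end_def split: if_splits)
      then have W: "gp_cdf \<alpha> x = 1" by (simp add: gp_cdf_def)
      have "T 1 = \<beta>" using T[OF bd(1)] u0 unfolding T_def u0_def[symmetric] by simp
      moreover have "\<beta> \<le> x" using less_gp_end_iff[of \<beta> \<alpha>] bd e \<beta> by (auto simp: gp_int_def)
      ultimately show ?thesis unfolding W using Q[of 1] const[of x] by (simp add: \<psi>_def)
    qed (rule QW)
  qed
  let ?N = "Pi\<^sub>M {1..} (\<lambda>_::nat. D)" and ?Y = "\<lambda>(i::nat) (x :: nat \<Rightarrow> real). x i"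
  have iid: "iid_sequence ?N ?Y F" unfolding F_def by (rule iid_sequence_PiM[OF rd])
  interpret D: real_distribution D by (rule rd)
  interpret gp: prob_space "gp_meas \<alpha>" by (rule prob_space_gp_meas)
  note P = cert_bounded[OF c]
  note [measurable] = P(1)
  have law: "integral\<^sup>L ?N (\<lambda>x. f (x 1)) = gp_E \<alpha> (\<lambda>x. f (\<sigma> / B * p x + \<mu>))"
    "integrable ?N (\<lambda>x. f (x 1)) \<longleftrightarrow> integrable (gp_meas \<alpha>) (\<lambda>x. f (\<sigma> / B * p x + \<mu>))"
    if f [measurable]: "f \<in> borel_measurable borel" for f :: "real \<Rightarrow> real"
  proof -
    have pd: "prob_space D" by (rule D.prob_space_axioms)
    have d: "distr ?N D (\<lambda>x. x 1) = D" using pd by (intro distr_PiM_component) auto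
    have m1: "(\<lambda>x. x 1) \<in> measurable ?N D" by (intro measurable_component_singleton) auto
    have fD: "f \<in> borel_measurable D" by simp
    have e: "AE x in gp_meas \<alpha>. f (\<psi> (gp_cdf \<alpha> x)) = f (\<sigma> / B * p x + \<mu>)"
      using AE_gp_meas by eventually_elim (use gp_int_subset_dom[of \<alpha>] in \<open>auto simp: \<psi>W\<close>)
    have mfp: "(\<lambda>u. f (\<psi> u)) \<in> borel_measurable borel" using mb by measurable
    have m2: "(\<lambda>x. f (\<psi> (gp_cdf \<alpha> x))) \<in> borel_measurable (gp_meas \<alpha>)" using mfp by measurable
    have m3: "(\<lambda>x. f (\<sigma> / B * p x + \<mu>)) \<in> borel_measurable (gp_meas \<alpha>)" by measurable
    have "integral\<^sup>L ?N (\<lambda>x. f (x 1)) = integral\<^sup>L D f" using integral_distr[OF m1 fD] d by simp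
    also have "\<dots> = integral\<^sup>L unif (\<lambda>u. f (\<psi> u))" unfolding D_def by (rule integral_distr[OF mu f])
    also have "\<dots> = gp_E \<alpha> (\<lambda>x. f (\<psi> (gp_cdf \<alpha> x)))" by (rule gp_E_rec_dens(1)[OF mfp])
    also have "\<dots> = gp_E \<alpha> (\<lambda>x. f (\<sigma> / B * p x + \<mu>))" by (rule integral_cong_AE[OF m2 m3 e])
    finally show "integral\<^sup>L ?N (\<lambda>x. f (x 1)) = gp_E \<alpha> (\<lambda>x. f (\<sigma> / B * p x + \<mu>))" .
    have "integrable ?N (\<lambda>x. f (x 1)) \<longleftrightarrow> integrable D f" using integrable_distr_eq[OF m1 fD] d by simp
    also have "\<dots> \<longleftrightarrow> integrable unif (\<lambda>u. f (\<psi> u))" unfolding D_def by (rule integrable_distr_eq[OF mu f])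
    also have "\<dots> \<longleftrightarrow> integrable (gp_meas \<alpha>) (\<lambda>x. f (\<psi> (gp_cdf \<alpha> x)))" by (rule gp_E_rec_dens(2)[OF mfp])
    also have "\<dots> \<longleftrightarrow> integrable (gp_meas \<alpha>) (\<lambda>x. f (\<sigma> / B * p x + \<mu>))" by (rule integrable_cong_AE[OF m2 m3 e])
    finally show "integrable ?N (\<lambda>x. f (x 1)) \<longleftrightarrow> integrable (gp_meas \<alpha>) (\<lambda>x. f (\<sigma> / B * p x + \<mu>))" .
  qed
  have mv: "has_mean_variance ?N (?Y 1) \<mu> (\<sigma>\<^sup>2)"
  proof -
    have p0: "gp_E \<alpha> p = 0" by (rule cert_mean[OF c]) (rule C)
    have e1: "integral\<^sup>L ?N (\<lambda>x. x 1) = \<mu>" using law(1)[of "\<lambda>x. x"] P(2) p0 gp.prob_space by simp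
    have s: "(\<lambda>x. (\<sigma> / B * p x + \<mu>)\<^sup>2) = (\<lambda>x. (\<sigma> / B)\<^sup>2 * (p x)\<^sup>2 + 2 * (\<sigma> / B) * \<mu> * p x + \<mu>\<^sup>2)"
      by (auto simp: power2_eq_square algebra_simps)
    have i2: "integrable (gp_meas \<alpha>) (\<lambda>x. (\<sigma> / B * p x + \<mu>)\<^sup>2)" unfolding s using P(2,3) by simp
    have "integral\<^sup>L ?N (\<lambda>x. (x 1 - \<mu>)\<^sup>2) = gp_E \<alpha> (\<lambda>x. (\<sigma> / B)\<^sup>2 * (p x)\<^sup>2)"
    proof -
      have "(\<lambda>x. (x - \<mu>)\<^sup>2) \<in> borel_measurable borel" by measurable
      from law(1)[OF this] show ?thesis by (simp only: add_diff_cancel_right' power_mult_distrib)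
    qed
    also have "\<dots> = \<sigma>\<^sup>2" using B by (simp add: power_divide)
    finally have "integral\<^sup>L ?N (\<lambda>x. (x 1 - \<mu>)\<^sup>2) = \<sigma>\<^sup>2" .
    then show ?thesis unfolding has_mean_variance_def
      using e1 i2 law(2)[of "\<lambda>x. x"] law(2)[of "\<lambda>x. x\<^sup>2"] P(2) by simp
  qed
  \<comment> \<open>By strict increase before \<open>\<beta>\<close>, equal values of
    \<open>p\<close> at different arguments occur only from \<open>\<beta>\<close> on.\<close>
  have fl: "quantile F w = quantile F u"
    if "0 < u" "u < v" "v < 1" "quantile F u = quantile F v" "u \<le> w" "w < 1" for u v w
  proof -
    define X where "X t = gp_inv \<alpha> (- ln (1 - t))" for t
    have X: "X t \<in> gp_dom \<alpha>" "gp_cdf \<alpha> (X t) = t" if "0 < t" "t < 1" for t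
      using that gp_inv_dom[of "- ln (1 - t)" \<alpha>] gp_cdf_inv[of t \<alpha>] by (auto simp: X_def)
    have lt: "X s < X t" if "0 < s" "s < t" "t < 1" for s t
      unfolding X_def using that by (intro strict_monoD[OF strict_mono_gp_inv]) simp
    have QX: "quantile F t = \<sigma> / B * p (X t) + \<mu>" if "0 < t" "t < 1" for t
      using QW[OF X(1)[OF that]] X(2)[OF that] by simp
    have e: "p (X u) = p (X v)" using QX[of u] QX[of v] that sB B(2) \<sigma> by auto
    have "\<beta> \<le> X u"
    proof (rule ccontr)
      assume "\<not> \<beta> \<le> X u"
      moreover have "0 \<le> X u" using X(1)[of u] that by (simp add: gp_dom_iff)
      moreover have "X u < X v" using that by (intro lt) auto
      ultimately have "p (X u) < p (min (X v) \<beta>)" by (intro flat) auto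
      moreover have "p (min (X v) \<beta>) = p (X v)" using const[of "X v"] by (auto simp: min_def)
      ultimately show False using e by simp
    qed
    moreover have "X u \<le> X w" using lt[of u w] that by (cases "u = w") auto
    ultimately have "p (X w) = p (X u)" using const[of "X u"] const[of "X w"] by simp
    then show ?thesis using QX[of w] QX[of u] that by simp
  qed
  have Fc: "F = cdf D" by (simp add: F_def)
  have ir: "integrable ?N (\<lambda>\<omega>. record_value k n (\<lambda>i. ?Y i \<omega>))"
    by (rule record_expectation(1)[OF iid rd Fc _ mv \<sigma>]) (rule fl)
  have eq: "standardized_record ?N ?Y k n \<mu> \<sigma> = B"
  proof (rule record_bound(2)[OF iid rd Fc _ mv \<sigma> c B])
    show "quantile F (gp_cdf \<alpha> x) = \<sigma> / B * p x + \<mu>" if "x \<in> gp_int \<alpha>" for x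
      using QW[of x] that gp_int_subset_dom[of \<alpha>] by blast
  qed (rule fl)
  have body: "\<exists>(N :: (nat \<Rightarrow> real) measure) Y.
        iid_sequence N Y F \<and> has_mean_variance N (Y 1) \<mu> (\<sigma>\<^sup>2) \<and> extremal_on (gp_supp \<alpha>) \<alpha> \<mu> \<sigma> B p F \<and>
        integrable N (\<lambda>\<omega>. record_value k n (\<lambda>i. Y i \<omega>)) \<and> standardized_record N Y k n \<mu> \<sigma> = B"
    by (rule exI[of _ ?N], rule exI[of _ ?Y]) (intro conjI iid mv ext ir eq)
  show "bound_attained UNIV (gp_supp \<alpha>) \<alpha> k n \<mu> \<sigma> B p"
    unfolding bound_attained_def using body by (intro bexI[of _ F]) auto
  assume cp: "concave_on (gp_int \<alpha>) p"
  have "F \<in> IGFR \<alpha>"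
    unfolding IGFR_def
  proof (intro CollectI conjI exI[of _ D] rd Fc)
    have "concave_on (gp_int \<alpha>) (\<lambda>x. \<sigma> / B * p x + \<mu>)" using sB cp by (intro concave_on_affine_image) auto
    then show "concave_on (gp_int \<alpha>) (quantile F \<circ> gp_cdf \<alpha>)"
      by (rule concave_on_cong) (use QW gp_int_subset_dom[of \<alpha>] in auto)
  qed
  then show "bound_attained (IGFR \<alpha>) (gp_supp \<alpha>) \<alpha> k n \<mu> \<sigma> B p"
    unfolding bound_attained_def using body by (intro bexI[of _ F]) auto
qed

end

lemma bound_attained_subset:
  assumes "bound_attained \<F> S \<alpha> k n \<mu> \<sigma> B \<phi>" "S' \<subseteq> S" "\<And>x. x \<in> S' \<Longrightarrow> \<phi>' x = \<phi> x"
  shows "bound_attained \<F> S' \<alpha> k n \<mu> \<sigma> B \<phi>'"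
proof -
  have "extremal_on S \<alpha> \<mu> \<sigma> B \<phi> F \<Longrightarrow> extremal_on S' \<alpha> \<mu> \<sigma> B \<phi>' F" for F
    using assms(2,3) unfolding extremal_on_def by auto
  then show ?thesis using assms(1) unfolding bound_attained_def by blast
qed

lemma gp_dom_subset_supp: "gp_dom \<alpha> \<subseteq> gp_supp \<alpha>"
  by (auto simp: gp_dom_def gp_supp_def)

context gp_record
begin

lemma norm_pos_if_tail_pos:
  assumes c: "cert C p" and \<beta>: "\<beta> \<in> gp_int \<alpha>" and p: "\<And>x. \<beta> < x \<Longrightarrow> p x = a" and a: "a \<noteq> 0"
  shows "0 < gp_E \<alpha> (\<lambda>x. (p x)\<^sup>2)"
proof (rule gp_E_pos[OF cert_bounded(3)[OF c]])
  have b: "0 < 1 - \<alpha> * \<beta>" "0 < \<beta>" using \<beta> by (auto simp: gp_int_iff)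
  show "\<beta> < gp_inv \<alpha> (gp_haz \<alpha> \<beta> + 1)"
    using strict_monoD[OF strict_mono_gp_inv, of "gp_haz \<alpha> \<beta>" "gp_haz \<alpha> \<beta> + 1" \<alpha>] gp_inv_haz[OF b(1)] by simp
  show "{\<beta><..<gp_inv \<alpha> (gp_haz \<alpha> \<beta> + 1)} \<subseteq> gp_int \<alpha>"
    using gp_haz_pos[OF b(2,1)] b(2) by (intro gp_Ioo_subset gp_inv_dom) auto
qed (use p a in auto)

section \<open>The projection onto the cone of nondecreasing functions\<close>

text \<open>At the zero of \<open>T\<close> the final constant is the mean of \<open>h\<close>
  beyond \<open>\<beta>\<close>; the result is then the isotonic regression of
  \<open>h\<close>.\<close>

definition cap :: "real \<Rightarrow> real \<Rightarrow> real" where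
  "cap \<beta> x = (if x < \<beta> then hfun \<alpha> k n x else hfun \<alpha> k n \<beta>)"

lemma measurable_cap [measurable]: "cap \<beta> \<in> borel_measurable borel"
  unfolding cap_def[abs_def] by measurable

context
  fixes \<beta> :: real
  assumes \<beta>: "\<beta> \<in> gp_int \<alpha>" "\<beta> \<le> cx" and tau0: "tau (gp_haz \<alpha> \<beta>) = 0"
begin

lemma cap_tail: "hfun \<alpha> k n \<beta> = tail_mean \<beta>"
  using hfun_tail_mean[of \<beta>] \<beta> tau0 gp_int_subset_dom[of \<alpha>] by auto

lemma cap_residual: "hfun \<alpha> k n x - cap \<beta> x = indicator {\<beta><..} x * (hfun \<alpha> k n x - tail_mean \<beta>)"
  using cap_tail by (cases x \<beta> rule: linorder_cases) (auto simp: cap_def)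

text \<open>The residual lives beyond \<open>\<beta>\<close>, where \<open>tail_sign\<close> handles
  arbitrary nondecreasing test functions.\<close>

lemma cert_cap: "cert iso (cap \<beta>)"
  unfolding cert_def
proof (intro conjI ballI impI)
  have bd: "\<beta> \<in> gp_dom \<alpha>" using \<beta> gp_int_subset_dom by auto
  show "cap \<beta> \<in> borel_measurable borel" by (rule measurable_cap)
  show "\<exists>B. \<forall>x\<in>gp_int \<alpha>. \<bar>cap \<beta> x\<bar> \<le> B"
    using hfun_bounded \<beta> by (intro exI[of _ "real k ^ (n + 1) + 1"]) (auto simp: cap_def)
  have "(\<lambda>x. (hfun \<alpha> k n x - cap \<beta> x) * cap \<beta> x) =
     (\<lambda>x. tail_mean \<beta> * (indicator {\<beta><..} x * (hfun \<alpha> k n x - tail_mean \<beta>)))"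
    unfolding cap_residual using cap_tail by (auto simp: cap_def split: split_indicator)
  then show "gp_E \<alpha> (\<lambda>x. (hfun \<alpha> k n x - cap \<beta> x) * cap \<beta> x) = 0" using tail_zero[OF bd] by simp
  fix q :: "real \<Rightarrow> real"
  assume q: "q \<in> borel_measurable borel" "integrable (gp_meas \<alpha>) (\<lambda>x. (q x)\<^sup>2)" "iso q"
  show "gp_E \<alpha> (\<lambda>x. (hfun \<alpha> k n x - cap \<beta> x) * q x) \<le> 0"
    unfolding cap_residual mult.assoc
    using tail_sign[OF \<beta>(1) _ q(1) gp_square_integrable[OF q(1,2)] q(3)] tau0 by simp
qed

lemma cap_norm:
  "gp_E \<alpha> (\<lambda>x. (cap \<beta> x)\<^sup>2) =
     real k ^ (2 * (n + 1)) * fact (2 * n) / ((fact n)\<^sup>2 * (2 * real k - 1) ^ (2 * n + 1)) * Ghat \<alpha> (2 * k - 1) (2 * n) \<beta>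
     - 2 * Ghat \<alpha> k n \<beta> + gp_cdf \<alpha> \<beta> + (1 - gp_cdf \<alpha> \<beta>) * (hfun \<alpha> k n \<beta>)\<^sup>2"
proof -
  interpret prob_space "gp_meas \<alpha>" by (rule prob_space_gp_meas)
  have bd: "\<beta> \<in> gp_dom \<alpha>" "0 \<le> \<beta>" using \<beta> by (auto simp: gp_int_iff gp_dom_iff)
  have i: "integrable (gp_meas \<alpha>) (\<lambda>x. (cap \<beta> x)\<^sup>2)" by (rule cert_bounded(3)[OF cert_cap])
  have "gp_E \<alpha> (\<lambda>x. indicator {0<..\<beta>} x * (cap \<beta> x)\<^sup>2) = gp_E \<alpha> (\<lambda>x. indicator {0<..\<beta>} x * (hfun \<alpha> k n x)\<^sup>2)"
    by (intro Bochner_Integration.integral_cong refl) (auto simp: cap_def split: split_indicator)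
  moreover have "gp_E \<alpha> (\<lambda>x. indicator {\<beta><..} x * (cap \<beta> x)\<^sup>2) = gp_E \<alpha> (\<lambda>x. (hfun \<alpha> k n \<beta>)\<^sup>2 * indicator {\<beta><..} x)"
    by (intro Bochner_Integration.integral_cong refl) (auto simp: cap_def split: split_indicator)
  ultimately show ?thesis
    using gp_E_split[OF i bd(2)] hfun_square_integral[OF bd(1) order_refl bd(2)] gp_E_cdf_tail[OF bd(1)] by simp
qed

lemma cap_less: "0 \<le> x \<Longrightarrow> x < y \<Longrightarrow> y \<le> \<beta> \<Longrightarrow> cap \<beta> x < cap \<beta> y"
  using hfun_less[of x y] \<beta> by (auto simp: cap_def)

lemma cap_mono: "mono_on {0..} (cap \<beta>)"
proof (rule mono_onI)
  fix x y :: real assume "x \<in> {0..}" "y \<in> {0..}" "x \<le> y"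
  then show "cap \<beta> x \<le> cap \<beta> y"
    using cap_less[of x "min y \<beta>"] by (cases "x < min y \<beta>") (auto simp: cap_def min_def split: if_splits)
qed

lemma cap_cont: "continuous_on {0..\<beta>} (cap \<beta>)"
proof -
  have "continuous_on {0..\<beta>} (hfun \<alpha> k n)"
    using gp_dom_below[of \<beta> \<alpha>] \<beta> gp_int_subset_dom[of \<alpha>]
    by (intro continuous_at_imp_continuous_on ballI isCont_hfun) (auto simp: gp_dom_iff)
  then show ?thesis by (subst continuous_on_cong[OF refl, of _ _ "hfun \<alpha> k n"]) (auto simp: cap_def)
qed

text \<open>In this range of \<open>\<alpha>\<close> the slope of \<open>h\<close> decreases all the
  way to its maximum, and the cap continues it with slope 0.\<close>

lemma cap_concave:
  assumes n: "n = 1" "\<alpha> \<le> 2 * real k - 2"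
  shows "concave_on (gp_int \<alpha>) (cap \<beta>)"
proof (rule concave_on_glue[OF is_interval_gp_int \<beta>(1), where m=0])
  have bd: "\<beta> \<in> gp_dom \<alpha>" "0 < \<beta>" using \<beta> by (auto simp: gp_int_iff gp_dom_iff)
  have e: "gp_int \<alpha> \<inter> {..\<beta>} = {0<..\<beta>}" using gp_dom_below[OF bd(1)] by (auto simp: gp_int_iff gp_dom_iff)
  have "concave_on {0<..\<beta>} (hfun \<alpha> k n)"
    unfolding concave_on_def
  proof (rule convex_on_realI)
    have dom: "x \<in> gp_int \<alpha> \<and> 0 < gp_haz \<alpha> x \<and> gp_haz \<alpha> x \<le> crit" if x: "x \<in> {0<..\<beta>}" for x
      using x[folded e] gp_haz_pos[of x \<alpha>] gp_haz_le_crit(2)[of x] \<beta>(2) gp_int_subset_dom[of \<alpha>] by (auto simp: gp_int_iff not_less[symmetric])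
    show "((\<lambda>x. - hfun \<alpha> k n x) has_real_derivative - slope (gp_haz \<alpha> x)) (at x)" if "x \<in> {0<..\<beta>}" for x
      using dom[OF that] by (intro DERIV_minus DERIV_hfun) (auto simp: gp_int_iff)
    fix x y assume xy: "x \<in> {0<..\<beta>}" "y \<in> {0<..\<beta>}" "x \<le> y"
    have le: "gp_haz \<alpha> x \<le> gp_haz \<alpha> y" using gp_haz_le_iff[of x \<alpha> y] dom[OF xy(1)] dom[OF xy(2)] xy gp_int_subset_dom[of \<alpha>] by auto
    have "slope (gp_haz \<alpha> y) \<le> slope (gp_haz \<alpha> x)"
    proof (rule DERIV_nonpos_imp_nonincreasing[OF le])
      fix s assume s: "gp_haz \<alpha> x \<le> s" "s \<le> gp_haz \<alpha> y"
      then have "0 < s" "curv s \<le> 0" using dom[OF xy(1)] dom[OF xy(2)] by (auto intro: curv_neg_case1[OF n])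
      then have "real k ^ (n + 1) / fact n * (exp ((\<alpha> - kappa) * s) * (s ^ (n - 1) * (curv s / s))) \<le> 0"
        using K_pos by (intro mult_nonneg_nonpos divide_nonpos_pos) auto
      then show "\<exists>y. (slope has_real_derivative y) (at s) \<and> y \<le> 0" using DERIV_slope[OF \<open>0 < s\<close>] by blast
    qed
    then show "- slope (gp_haz \<alpha> x) \<le> - slope (gp_haz \<alpha> y)" by simp
  qed simp
  then show "concave_on (gp_int \<alpha> \<inter> {..\<beta>}) (cap \<beta>)"
    unfolding e by (rule concave_on_cong) (auto simp: cap_def)
  have "convex (gp_int \<alpha> \<inter> {\<beta>..})" by (intro convex_Int convex_gp_int) simp
  from affine_concave[OF this, of "hfun \<alpha> k n \<beta>" 0 0]
  show "concave_on (gp_int \<alpha> \<inter> {\<beta>..}) (cap \<beta>)" by (rule concave_on_cong) (auto simp: cap_def)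
  show "cap \<beta> x \<le> cap \<beta> \<beta> + 0 * (x - \<beta>)" if "x \<in> gp_int \<alpha>" for x
    using cap_less[of x \<beta>] that by (cases "x < \<beta>") (auto simp: cap_def gp_int_iff)
qed

end

lemma tail_mean_pos:
  assumes s0: "0 < s0" "\<And>s. 0 \<le> s \<Longrightarrow> s < s0 \<Longrightarrow> tau s < 0" "\<And>s. s0 < s \<Longrightarrow> 0 < tau s"
  shows "0 < tail_mean (gp_inv \<alpha> s0)"
proof -
  obtain s1 where "s0 < s1" "\<And>s. 0 < s \<Longrightarrow> s < s1 \<Longrightarrow> 1 < tailavg s"
    using tailavg_shape[OF s0] by blast
  then show ?thesis using s0(1) by (simp add: tail_mean_def)
qed

text \<open>Supplies the hypotheses of \<open>attained\<close>.\<close>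

lemma pw_regular:
  assumes ok: "pw_ok y \<beta> v" and m: "0 < m" and mid: "y < \<beta> \<Longrightarrow> \<beta> \<le> cx"
  shows "continuous_on {0..\<beta>} (pw y \<beta> v m)"
    "\<And>x z. 0 \<le> x \<Longrightarrow> x < z \<Longrightarrow> z \<le> \<beta> \<Longrightarrow> pw y \<beta> v m x < pw y \<beta> v m z"
    "\<And>x. \<beta> \<le> x \<Longrightarrow> pw y \<beta> v m x = pw y \<beta> v m \<beta>"
proof -
  let ?p = "pw y \<beta> v m"
  have y: "y \<in> gp_int \<alpha>" "\<beta> \<in> gp_int \<alpha>" "y \<le> \<beta>" using ok by (auto simp: pw_ok_def)
  then have yd: "y \<in> gp_dom \<alpha>" "\<beta> \<in> gp_dom \<alpha>" "0 < y" by (auto simp: gp_int_iff gp_dom_iff)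
  have py: "?p y = v" using ok by (auto simp: pw_def pw_ok_def)
  have hb: "tail_mean \<beta> = hfun \<alpha> k n \<beta>" if "y < \<beta>"
    using ok that hfun_tail_mean[OF yd(2)] by (auto simp: pw_ok_def)
  have pl: "?p x = v + m * (x - y)" if "x \<le> y" for x using that py by (cases "x = y") (auto simp: pw_def)
  have pm: "?p x = hfun \<alpha> k n x" if "y < \<beta>" "y \<le> x" "x \<le> \<beta>" for x
    using that hb by (auto simp: pw_def)
  show "?p x = ?p \<beta>" if "\<beta> \<le> x" for x using that y(3) by (auto simp: pw_def)
  have m1: "?p x < ?p z" if "x < z" "z \<le> y" for x z
    using that m by (simp add: pl)
  have m2: "?p x < ?p z" if "y \<le> x" "x < z" "z \<le> \<beta>" for x z
    using hfun_less[of x z] mid that yd(3) by (simp add: pm)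
  show "?p x < ?p z" if "0 \<le> x" "x < z" "z \<le> \<beta>" for x z
  proof -
    consider "z \<le> y" | "y \<le> x" | "x < y" "y < z" by linarith
    then show ?thesis using m1[of x z] m2[of x z] m1[of x y] m2[of y z] that by cases auto
  qed
  have "continuous_on ({0..y} \<union> {y..\<beta>}) ?p"
  proof (rule continuous_on_closed_Un)
    have "continuous_on {0..y} (\<lambda>x. v + m * (x - y))" by (intro continuous_intros)
    then show "continuous_on {0..y} ?p" by (subst continuous_on_cong[OF refl pl]) auto
    show "continuous_on {y..\<beta>} ?p"
    proof (cases "y < \<beta>")
      case True
      have "continuous_on {y..\<beta>} (hfun \<alpha> k n)"
        using gp_dom_below[OF yd(2)] yd(3) by (intro continuous_at_imp_continuous_on ballI isCont_hfun) (auto simp: gp_dom_iff)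
      then show ?thesis by (subst continuous_on_cong[OF refl pm[OF True]]) auto
    next
      case False
      then have "{y..\<beta>} = {y}" using y(3) by auto
      then show ?thesis by (simp only: continuous_on_sing)
    qed
  qed auto
  moreover have "{0..y} \<union> {y..\<beta>} = {0..\<beta>}" using yd(3) y(3) by auto
  ultimately show "continuous_on {0..\<beta>} ?p" by simp
qed

section \<open>The bounds\<close>

context
  fixes M :: "'a measure" and X :: "nat \<Rightarrow> 'a \<Rightarrow> real" and F :: "real \<Rightarrow> real" and \<mu> \<sigma> :: real
  assumes IG: "F \<in> IGFR \<alpha>" and X: "iid_sequence M X F"
    and mv: "has_mean_variance M (X 1) \<mu> (\<sigma>\<^sup>2)" and \<sigma>: "0 < \<sigma>"
begin

lemma record_integrable: "integrable M (\<lambda>\<omega>. record_value k n (\<lambda>i. X i \<omega>))"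
proof -
  obtain D where D: "real_distribution D" "F = cdf D" "concave_on (gp_int \<alpha>) (quantile F \<circ> gp_cdf \<alpha>)"
    using IG unfolding IGFR_def by blast
  note flat = IGFR_flat[OF D]
  show ?thesis by (rule record_expectation(1)[OF X D(1,2) _ mv \<sigma>]) (rule flat)
qed

lemma bound_iso_isoconc:
  assumes c: "cert C p" and C: "C = iso \<or> C = isoconc" and B: "gp_E \<alpha> (\<lambda>x. (p x)\<^sup>2) = B\<^sup>2" "0 < B"
  shows "standardized_record M X k n \<mu> \<sigma> \<le> B"
    and "gp_int \<alpha> \<subseteq> S \<Longrightarrow> extremal_on S \<alpha> \<mu> \<sigma> B p F \<Longrightarrow> standardized_record M X k n \<mu> \<sigma> = B"
proof -
  obtain D where D: "real_distribution D" "F = cdf D" "concave_on (gp_int \<alpha>) (quantile F \<circ> gp_cdf \<alpha>)"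
    using IG unfolding IGFR_def by blast
  note flat = IGFR_flat[OF D]
  have i: "iso (std F \<mu> \<sigma>)" by (rule std_iso[OF X D(1,2) _ mv \<sigma>]) (rule flat)
  have ic: "isoconc (std F \<mu> \<sigma>)" by (rule std_isoconc[OF X D(1,2) _ mv \<sigma> D(3)]) (rule flat)
  have Cs: "C (std F \<mu> \<sigma>)" using C i ic by auto
  show "standardized_record M X k n \<mu> \<sigma> \<le> B"
    by (rule record_bound(1)[OF X D(1,2) _ mv \<sigma> c B Cs]) (rule flat)
  assume S: "gp_int \<alpha> \<subseteq> S" and e: "extremal_on S \<alpha> \<mu> \<sigma> B p F"
  show "standardized_record M X k n \<mu> \<sigma> = B"
  proof (rule record_bound(2)[OF X D(1,2) _ mv \<sigma> c B])
    show "quantile F (gp_cdf \<alpha> x) = \<sigma> / B * p x + \<mu>" if "x \<in> gp_int \<alpha>" for x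
      using e S that unfolding extremal_on_def by auto
  qed (rule flat)
qed

lemma gp_int_subset_supp: "gp_int \<alpha> \<subseteq> gp_supp \<alpha>"
  using gp_int_subset_dom gp_dom_subset_supp by blast

text \<open>Quantile functions are nondecreasing on the scale of \<open>W\<close>, so projecting
  onto the larger cone already bounds the record. Concavity of \<open>cap\<close> enters only in the
  last claim, where the extremal law has to be IGFR.\<close>

lemma case_one:
  assumes n: "n = 1"
  defines "\<beta> \<equiv> beta0 \<alpha> k"
  shows "standardized_record M X k 1 \<mu> \<sigma> \<le> B0 \<alpha> k \<beta>"
    "extremal_on (gp_supp \<alpha>) \<alpha> \<mu> \<sigma> (B0 \<alpha> k \<beta>) (phi0 \<alpha> k \<beta>) F \<Longrightarrow> standardized_record M X k 1 \<mu> \<sigma> = B0 \<alpha> k \<beta>"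
    "bound_attained UNIV (gp_supp \<alpha>) \<alpha> k 1 \<mu> \<sigma> (B0 \<alpha> k \<beta>) (phi0 \<alpha> k \<beta>)"
    "\<alpha> \<le> 2 * real k - 2 \<Longrightarrow> bound_attained (IGFR \<alpha>) (gp_supp \<alpha>) \<alpha> k 1 \<mu> \<sigma> (B0 \<alpha> k \<beta>) (phi0 \<alpha> k \<beta>)"
proof -
  have be: "\<beta> = gp_inv \<alpha> (1 / (real k * kappa))" by (simp add: \<beta>_def beta0_def gp_inv_def kappa_def)
  obtain s0 where s0: "0 < s0" "s0 < crit" "tau s0 = 0" "\<And>s. 0 \<le> s \<Longrightarrow> s < s0 \<Longrightarrow> tau s < 0" "\<And>s. s0 < s \<Longrightarrow> 0 < tau s"
    using tau_zero by blast
  \<comment> \<open>For \<open>n = 1\<close> \<open>tau\<close> is affine in the hazard, so its zero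
    is explicit: it is the hazard of \<open>beta0\<close>.\<close>
  have "{..<n} = {0}" using n by auto
  then have "tau s = kappa * (real k * s) - 1" for s unfolding tau_def using n by simp
  from this[of s0] have "s0 * (real k * kappa) = 1" using s0(3) by (simp add: algebra_simps)
  then have "s0 = 1 / (real k * kappa)" using kappa_ge k2 by (simp add: eq_divide_eq)
  then have bs: "\<beta> = gp_inv \<alpha> s0" using be by simp
  have bi: "\<beta> \<in> gp_int \<alpha>" unfolding bs by (rule gp_inv_int[OF s0(1)])
  have bc: "\<beta> \<le> cx" unfolding bs cx_def by (rule less_imp_le[OF strict_monoD[OF strict_mono_gp_inv s0(2)]])
  have bt: "tau (gp_haz \<alpha> \<beta>) = 0" using s0(3) by (simp add: bs)
  have ph: "phi0 \<alpha> k \<beta> = cap \<beta>" unfolding phi0_def[abs_def] cap_def[abs_def] hfun_def unfolding n by auto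
  note c = cert_cap[OF bi bc bt]
  have pos: "0 < gp_E \<alpha> (\<lambda>x. (cap \<beta> x)\<^sup>2)"
  proof (rule norm_pos_if_tail_pos[OF c bi])
    show "hfun \<alpha> k n \<beta> \<noteq> 0" using tail_mean_pos[OF s0(1,4,5)] cap_tail[OF bi bc bt] unfolding bs by simp
  qed (simp add: cap_def)
  have B: "B0 \<alpha> k \<beta> = sqrt (gp_E \<alpha> (\<lambda>x. (cap \<beta> x)\<^sup>2))"
  proof -
    have "2 * (1 + 1) = (4::nat)" "2 * 1 + 1 = (3::nat)" "2 * 1 = (2::nat)" "fact 2 = (2::real)" "fact 1 = (1::real)"
      by (simp_all add: fact_numeral)
    then show ?thesis unfolding B0_def cap_norm[OF bi bc bt] unfolding n hfun_def by (simp add: mult.commute)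
  qed
  then have B2: "gp_E \<alpha> (\<lambda>x. (cap \<beta> x)\<^sup>2) = (B0 \<alpha> k \<beta>)\<^sup>2" "0 < B0 \<alpha> k \<beta>" using pos by simp_all
  show "standardized_record M X k 1 \<mu> \<sigma> \<le> B0 \<alpha> k \<beta>"
    using bound_iso_isoconc(1)[OF c _ B2] n by simp
  show "standardized_record M X k 1 \<mu> \<sigma> = B0 \<alpha> k \<beta>" if "extremal_on (gp_supp \<alpha>) \<alpha> \<mu> \<sigma> (B0 \<alpha> k \<beta>) (phi0 \<alpha> k \<beta>) F"
    using bound_iso_isoconc(2)[OF c _ B2 gp_int_subset_supp] that n unfolding ph by simp
  have const: "cap \<beta> x = cap \<beta> \<beta>" if "\<beta> \<le> x" for x using that by (simp add: cap_def)
  have "bound_attained UNIV (gp_supp \<alpha>) \<alpha> k n \<mu> \<sigma> (B0 \<alpha> k \<beta>) (cap \<beta>)"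
    by (rule attained(1)[OF c _ B2 \<sigma> cap_mono[OF bi bc bt] bi const cap_cont[OF bi bc bt] cap_less[OF bi bc bt]]) (rule iso_const)
  then show "bound_attained UNIV (gp_supp \<alpha>) \<alpha> k 1 \<mu> \<sigma> (B0 \<alpha> k \<beta>) (phi0 \<alpha> k \<beta>)" unfolding ph n .
  assume "\<alpha> \<le> 2 * real k - 2"
  then have conc: "concave_on (gp_int \<alpha>) (cap \<beta>)" by (rule cap_concave[OF bi bc bt n])
  have "bound_attained (IGFR \<alpha>) (gp_supp \<alpha>) \<alpha> k n \<mu> \<sigma> (B0 \<alpha> k \<beta>) (cap \<beta>)"
    by (rule attained(2)[OF c _ B2 \<sigma> cap_mono[OF bi bc bt] bi const cap_cont[OF bi bc bt] cap_less[OF bi bc bt] conc]) (rule iso_const)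
  then show "bound_attained (IGFR \<alpha>) (gp_supp \<alpha>) \<alpha> k 1 \<mu> \<sigma> (B0 \<alpha> k \<beta>) (phi0 \<alpha> k \<beta>)" unfolding ph n .
qed

text \<open>The common conclusion of both alternatives: \<open>y < \<beta>\<close> gives the
  three-piece function and \<open>y = \<beta>\<close> the two-piece function.\<close>

lemma pw_conclusion:
  assumes sb: "infl sb" and ok: "pw_ok y \<beta> v" and m: "0 < m" and orth: "orth y v m"
    and mid: "y < \<beta> \<Longrightarrow> \<beta> \<le> cx \<and> sb \<le> gp_haz \<alpha> y \<and> slope (gp_haz \<alpha> y) \<le> m" and pos: "tail_mean \<beta> \<noteq> 0"
  defines "B \<equiv> sqrt (gp_E \<alpha> (\<lambda>x. (pw y \<beta> v m x)\<^sup>2))"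
  shows "isoconc (pw y \<beta> v m)" "cert isoconc (pw y \<beta> v m)" "0 < B" "standardized_record M X k n \<mu> \<sigma> \<le> B"
    "extremal_on (gp_dom \<alpha>) \<alpha> \<mu> \<sigma> B (pw y \<beta> v m) F \<Longrightarrow> standardized_record M X k n \<mu> \<sigma> = B"
    "bound_attained (IGFR \<alpha>) (gp_dom \<alpha>) \<alpha> k n \<mu> \<sigma> B (pw y \<beta> v m)"
proof -
  have mc: "mono_on {0..} (pw y \<beta> v m)" "concave_on (gp_int \<alpha>) (pw y \<beta> v m)"
    by (rule pw_mono_concave[OF sb ok less_imp_le[OF m]], erule mid)+
  show ic: "isoconc (pw y \<beta> v m)" using mc by (auto simp: mono_on_def gp_int_iff)
  show c: "cert isoconc (pw y \<beta> v m)" using m by (intro cert_pw[OF sb ok _ orth]) simp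
  have bi: "\<beta> \<in> gp_int \<alpha>" "y \<le> \<beta>" using ok by (auto simp: pw_ok_def)
  have "0 < gp_E \<alpha> (\<lambda>x. (pw y \<beta> v m x)\<^sup>2)"
    by (rule norm_pos_if_tail_pos[OF c bi(1) _ pos]) (use bi in \<open>simp add: pw_def\<close>)
  then have B: "gp_E \<alpha> (\<lambda>x. (pw y \<beta> v m x)\<^sup>2) = B\<^sup>2" "0 < B" by (simp_all add: B_def)
  show "0 < B" by fact
  show "standardized_record M X k n \<mu> \<sigma> \<le> B" by (rule bound_iso_isoconc(1)[OF c _ B]) simp
  show "standardized_record M X k n \<mu> \<sigma> = B" if "extremal_on (gp_dom \<alpha>) \<alpha> \<mu> \<sigma> B (pw y \<beta> v m) F"
    by (rule bound_iso_isoconc(2)[OF c _ B gp_int_subset_dom that]) simp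
  have mid': "y < \<beta> \<Longrightarrow> \<beta> \<le> cx" using mid by blast
  have reg: "continuous_on {0..\<beta>} (pw y \<beta> v m)"
    by (rule pw_regular(1)[OF ok m]) (rule mid')
  have less: "pw y \<beta> v m x < pw y \<beta> v m z" if "0 \<le> x" "x < z" "z \<le> \<beta>" for x z
    by (rule pw_regular(2)[OF ok m _ that]) (rule mid')
  have const: "pw y \<beta> v m x = pw y \<beta> v m \<beta>" if "\<beta> \<le> x" for x
    by (rule pw_regular(3)[OF ok m _ that]) (rule mid')
  have "bound_attained (IGFR \<alpha>) (gp_supp \<alpha>) \<alpha> k n \<mu> \<sigma> B (pw y \<beta> v m)"
    by (rule attained(2)[OF c _ B \<sigma> mc(1) bi(1) const reg less mc(2)]) (rule isoconc_const)
  then show "bound_attained (IGFR \<alpha>) (gp_dom \<alpha>) \<alpha> k n \<mu> \<sigma> B (pw y \<beta> v m)"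
    by (rule bound_attained_subset[OF _ gp_dom_subset_supp]) simp
qed

lemma shape_points_infl:
  assumes sb: "infl sb"
  shows "shape_points \<alpha> k n (gp_inv \<alpha> sb) cx"
proof -
  have s: "0 < sb" "sb < crit" using sb by (auto simp: infl_def)
  have b: "0 < gp_inv \<alpha> sb" "gp_inv \<alpha> sb < cx"
    using gp_inv_int[OF s(1), of \<alpha>] strict_monoD[OF strict_mono_gp_inv s(2), of \<alpha>] by (auto simp: gp_int_iff cx_def)
  have c: "0 < cx" "ereal cx < gp_end \<alpha>" using cx_int by (auto simp: gp_int_def)
  have dom: "x \<in> gp_int \<alpha> \<and> sb < gp_haz \<alpha> x \<and> gp_haz \<alpha> x < crit" if "x \<in> {gp_inv \<alpha> sb<..<cx}" for x
  proof -
    have d: "x \<in> gp_dom \<alpha>" using gp_dom_below[of cx \<alpha> x] cx_int gp_int_subset_dom[of \<alpha>] that b by auto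
    have "gp_inv \<alpha> sb \<in> gp_dom \<alpha>" using s by (intro gp_inv_dom) simp
    then show ?thesis
      using gp_haz_less_iff[of "gp_inv \<alpha> sb" \<alpha> x] gp_haz_le_crit(1)[OF d] that d b by (auto simp: gp_int_iff gp_dom_iff)
  qed
  have "strictly_concave_on {gp_inv \<alpha> sb<..<cx} (hfun \<alpha> k n)"
    unfolding strictly_concave_on_def
  proof (rule strictly_convex_onI_deriv)
    show "is_interval {gp_inv \<alpha> sb<..<cx}" by (simp add: is_interval_1)
    show "((\<lambda>x. - hfun \<alpha> k n x) has_real_derivative - slope (gp_haz \<alpha> x)) (at x)" if "x \<in> {gp_inv \<alpha> sb<..<cx}" for x
      using dom[OF that] by (intro DERIV_minus DERIV_hfun) (auto simp: gp_int_iff)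
    show "strict_mono_on {gp_inv \<alpha> sb<..<cx} (\<lambda>x. - slope (gp_haz \<alpha> x))"
    proof (rule strict_mono_onI)
      fix x y assume "x \<in> {gp_inv \<alpha> sb<..<cx}" "y \<in> {gp_inv \<alpha> sb<..<cx}" "x < y"
      then show "- slope (gp_haz \<alpha> x) < - slope (gp_haz \<alpha> y)"
        using dom[of x] dom[of y] slope_mono_infl(2)[OF sb, of "gp_haz \<alpha> x" "gp_haz \<alpha> y"]
          gp_haz_strict_mono[of x y \<alpha>] gp_haz_pos[of x \<alpha>] by (auto simp: gp_int_iff)
    qed
  qed
  moreover have "strict_antimono_on {x. cx < x \<and> ereal x < gp_end \<alpha>} (hfun \<alpha> k n)"
  proof (rule monotone_onI)
    fix x y assume "x \<in> {x. cx < x \<and> ereal x < gp_end \<alpha>}" "y \<in> {x. cx < x \<and> ereal x < gp_end \<alpha>}" "x < y"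
    then show "hfun \<alpha> k n y < hfun \<alpha> k n x" using c by (intro hfun_greater) (auto simp: gp_dom_def)
  qed
  moreover have "strict_mono_on {0<..<gp_inv \<alpha> sb} (hfun \<alpha> k n)" "strict_mono_on {gp_inv \<alpha> sb<..<cx} (hfun \<alpha> k n)"
    using b by (auto intro!: strict_mono_onI hfun_less)
  ultimately show ?thesis unfolding shape_points_def using b c hfun_strictly_convex[OF sb] by auto
qed

text \<open>The infimum has to belong to \<open>Yset\<close>. Every element of \<open>Yset\<close>
  yields the projection, which is unique; two elements would make \<open>h\<close> affine between
  them, against its strict concavity there. So \<open>Yset\<close> is a singleton.\<close>

lemma case_two_A:
  assumes sb: "infl sb" and s0: "0 < s0" "s0 < crit" "tau s0 = 0" "\<And>s. 0 \<le> s \<Longrightarrow> s < s0 \<Longrightarrow> tau s < 0" "\<And>s. s0 < s \<Longrightarrow> 0 < tau s"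
    and ne: "Yset \<alpha> k n (gp_inv \<alpha> sb) (gp_inv \<alpha> s0) \<noteq> {}"
  defines "\<beta> \<equiv> gp_inv \<alpha> s0"
  defines "y \<equiv> Inf (Yset \<alpha> k n (gp_inv \<alpha> sb) \<beta>)"
  shows "standardized_record M X k n \<mu> \<sigma> \<le> B1 \<alpha> k n y \<beta>"
    "extremal_on (gp_dom \<alpha>) \<alpha> \<mu> \<sigma> (B1 \<alpha> k n y \<beta>) (phi1 \<alpha> k n y \<beta>) F \<Longrightarrow> standardized_record M X k n \<mu> \<sigma> = B1 \<alpha> k n y \<beta>"
    "bound_attained (IGFR \<alpha>) (gp_dom \<alpha>) \<alpha> k n \<mu> \<sigma> (B1 \<alpha> k n y \<beta>) (phi1 \<alpha> k n y \<beta>)"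
proof -
  let ?b = "gp_inv \<alpha> sb" and ?Y = "Yset \<alpha> k n (gp_inv \<alpha> sb) \<beta>"
  have bi: "\<beta> \<in> gp_int \<alpha>" unfolding \<beta>_def by (rule gp_inv_int[OF s0(1)])
  then have bd: "\<beta> \<in> gp_dom \<alpha>" using gp_int_subset_dom by auto
  have bc: "\<beta> < cx" unfolding \<beta>_def cx_def by (rule strict_monoD[OF strict_mono_gp_inv s0(2)])
  have hb: "gp_haz \<alpha> \<beta> = s0" by (simp add: \<beta>_def)
  have b0: "0 < ?b" using sb gp_inv_int[of sb \<alpha>] by (auto simp: gp_int_iff infl_def)
  have tp: "tail_mean \<beta> \<noteq> 0" using tail_mean_pos[OF s0(1,4,5)] unfolding \<beta>_def by simp
  have hbt: "hfun \<alpha> k n \<beta> = tail_mean \<beta>" using hfun_tail_mean[OF bd] s0(3) hb by simp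
  have elem: "pw_ok z \<beta> (hfun \<alpha> k n z)" "0 < lam \<alpha> k n z" "orth z (hfun \<alpha> k n z) (lam \<alpha> k n z)"
    "z < \<beta> \<Longrightarrow> \<beta> \<le> cx \<and> sb \<le> gp_haz \<alpha> z \<and> slope (gp_haz \<alpha> z) \<le> lam \<alpha> k n z" "?b < z" "z < \<beta>"
    if "z \<in> ?Y" for z
  proof -
    show z: "?b < z" "z < \<beta>" using that by (auto simp: Yset_def)
    have zi: "z \<in> gp_int \<alpha>" using gp_dom_below[OF bd, of z] z b0 by (auto simp: gp_int_iff gp_dom_iff)
    then have zd: "z \<in> gp_dom \<alpha>" using gp_int_subset_dom by auto
    show "pw_ok z \<beta> (hfun \<alpha> k n z)" using zi bi z s0(3) hb by (simp add: pw_ok_def)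
    show "orth z (hfun \<alpha> k n z) (lam \<alpha> k n z)" using that by (intro orth_Zfun zi) (simp add: Yset_def)
    have sl: "slope (gp_haz \<alpha> z) \<le> lam \<alpha> k n z"
      using that deriv_hfun[of z] zi by (simp add: Yset_def Yfun_def gp_int_iff)
    have "0 < gp_haz \<alpha> z" "gp_haz \<alpha> z < crit" using gp_haz_pos[of z \<alpha>] zi gp_haz_le_crit(1)[OF zd] z bc by (auto simp: gp_int_iff)
    then have "0 < slope (gp_haz \<alpha> z)" by (rule slope_pos)
    then show "0 < lam \<alpha> k n z" using sl by simp
    have "sb < gp_haz \<alpha> z" using gp_haz_less_iff[of ?b \<alpha> z] gp_inv_dom[of sb \<alpha>] zd z sb by (auto simp: infl_def)
    then show "\<beta> \<le> cx \<and> sb \<le> gp_haz \<alpha> z \<and> slope (gp_haz \<alpha> z) \<le> lam \<alpha> k n z" using bc sl by simp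
  qed
  let ?p = "\<lambda>z. pw z \<beta> (hfun \<alpha> k n z) (lam \<alpha> k n z)"
  have C: "isoconc (?p z)" "cert isoconc (?p z)" if "z \<in> ?Y" for z
    using pw_conclusion(1,2)[OF sb elem(1,2,3)[OF that] elem(4)[OF that] tp] by blast+
  have nolt: False if z: "z1 \<in> ?Y" "z2 \<in> ?Y" "z1 < z2" for z1 z2
  proof -
    \<comment> \<open>A quarter of the gap: \<open>z1 + d\<close>, \<open>z1 + 2 * d\<close> and
      \<open>z1 + 3 * d\<close> are equally spaced strictly inside it, and strict concavity is
      tested there.\<close>
    define d where "d = (z2 - z1) / 4"
    have "0 < d" using z(3) by (simp add: d_def)
    moreover have "z2 = z1 + 4 * d" by (simp add: d_def diff_divide_distrib)
    ultimately have d: "0 < d" "z2 = z1 + 4 * d" by blast+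
    have eq: "?p z1 x = ?p z2 x" if "x \<in> gp_int \<alpha>" for x
      using cert_projection(3)[OF C(2)[OF z(2)] C(1)[OF z(2)] cert_projection(2)[OF C(2)[OF z(1)] C(1)[OF z(1)]] that] .
    have aff: "hfun \<alpha> k n x = hfun \<alpha> k n z2 + lam \<alpha> k n z2 * (x - z2)" if "z1 < x" "x < z2" for x
    proof -
      have "x \<in> gp_int \<alpha>" using gp_dom_below[OF bd, of x] that elem(5)[OF z(1)] elem(6)[OF z(2)] b0 by (auto simp: gp_int_iff gp_dom_iff)
      from eq[OF this] show ?thesis using that elem(6)[OF z(2)] by (simp add: pw_def)
    qed
    have "strictly_convex_on {?b<..<cx} (\<lambda>x. - hfun \<alpha> k n x)"
      using shape_points_infl[OF sb] by (simp add: shape_points_def strictly_concave_on_def)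
    moreover have "z1 + d \<in> {?b<..<cx}" "z1 + 3 * d \<in> {?b<..<cx}" using elem(5)[OF z(1)] elem(6)[OF z(2)] d bc by auto
    ultimately have "- hfun \<alpha> k n ((1 - 1 / 2) * (z1 + d) + 1 / 2 * (z1 + 3 * d)) < (1 - 1 / 2) * - hfun \<alpha> k n (z1 + d) + 1 / 2 * - hfun \<alpha> k n (z1 + 3 * d)"
      using d(1) unfolding strictly_convex_on_def by (elim ballE[where x="z1 + d"] ballE[where x="z1 + 3 * d"] allE[where x="1/2"]) auto
    moreover have "(1 - 1 / 2) * (z1 + d) + 1 / 2 * (z1 + 3 * d) = z1 + 2 * d" by (simp add: field_simps)
    ultimately have "- hfun \<alpha> k n (z1 + 2 * d) < 1 / 2 * - hfun \<alpha> k n (z1 + d) + 1 / 2 * - hfun \<alpha> k n (z1 + 3 * d)" by simp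
    then show False using aff[of "z1 + d"] aff[of "z1 + 2 * d"] aff[of "z1 + 3 * d"] d by (simp add: algebra_simps)
  qed
  obtain z where z: "z \<in> ?Y" using ne unfolding \<beta>_def by blast
  have "w = z" if "w \<in> ?Y" for w using nolt[OF that z] nolt[OF z that] by (cases w z rule: linorder_cases) auto
  then have "?Y = {z}" using z by blast
  then have yz: "y = z" by (simp add: y_def)
  note E = elem[OF z, folded yz]
  note R = pw_conclusion[OF sb E(1,2,3) E(4) tp]
  have yi: "y \<in> gp_int \<alpha>" using E(1) by (simp add: pw_ok_def)
  have ph: "phi1 \<alpha> k n y \<beta> = ?p y"
    using hbt by (auto simp: phi1_def[abs_def] pw_def[abs_def] hfun_def)
  have B: "B1 \<alpha> k n y \<beta> = sqrt (gp_E \<alpha> (\<lambda>x. (?p y x)\<^sup>2))"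
    unfolding B1_def pw_norm[OF E(1)] hbt[symmetric] by (rule arg_cong[where f=sqrt]) (simp add: hfun_def)
  show "standardized_record M X k n \<mu> \<sigma> \<le> B1 \<alpha> k n y \<beta>"
    "extremal_on (gp_dom \<alpha>) \<alpha> \<mu> \<sigma> (B1 \<alpha> k n y \<beta>) (phi1 \<alpha> k n y \<beta>) F \<Longrightarrow> standardized_record M X k n \<mu> \<sigma> = B1 \<alpha> k n y \<beta>"
    "bound_attained (IGFR \<alpha>) (gp_dom \<alpha>) \<alpha> k n \<mu> \<sigma> (B1 \<alpha> k n y \<beta>) (phi1 \<alpha> k n y \<beta>)"
    unfolding B ph using R(4,5,6) by blast+
qed

lemma Pfun_pw:
  assumes "y \<in> gp_dom \<alpha>"
  shows "Pfun \<alpha> k n y = pw y y (tail_mean y) (tail_mean y / intW \<alpha> y)"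
  unfolding Pfun_def[abs_def] pw_def[abs_def] tail_mean_eq(1)[OF assms] by (auto simp: distrib_left)

text \<open>\<open>existence\<close> supplies an element of \<open>Zset\<close> whose
  \<open>Pfun\<close> is the projection. Another element with \<open>Pfun\<close> in the cone would
  satisfy the same variational inequality and give the same function, which determines its break
  point. Hence the maximiser is unique.\<close>

lemma case_two_B:
  assumes sb: "infl sb" and s0: "0 < s0" "s0 < crit" "tau s0 = 0" "\<And>s. 0 \<le> s \<Longrightarrow> s < s0 \<Longrightarrow> tau s < 0" "\<And>s. s0 < s \<Longrightarrow> 0 < tau s"
    and none: "\<not> (sb < s0 \<and> Yset \<alpha> k n (gp_inv \<alpha> sb) (gp_inv \<alpha> s0) \<noteq> {})"
  defines "\<beta> \<equiv> gp_inv \<alpha> s0"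
  shows "\<forall>y. \<beta> \<le> y \<and> ereal y < gp_end \<alpha> \<longrightarrow>
       (gp_norm \<alpha> (Pfun \<alpha> k n y))\<^sup>2 =
         ((gp_cdf \<alpha> y - Ghat \<alpha> k n y) / ((1 - gp_cdf \<alpha> y) * intW \<alpha> y))\<^sup>2 *
         (2 * y * intW \<alpha> y - 2 * intxW \<alpha> y - (intW \<alpha> y)\<^sup>2)"
    "Zset \<alpha> k n \<beta> \<noteq> {}"
    "\<exists>y\<in>Zset \<alpha> k n \<beta>. Pfun \<alpha> k n y \<in> gp_cone \<alpha> \<and>
       (\<forall>z\<in>Zset \<alpha> k n \<beta>. Pfun \<alpha> k n z \<in> gp_cone \<alpha> \<and> z \<noteq> y \<longrightarrow>
          gp_norm \<alpha> (Pfun \<alpha> k n z) < gp_norm \<alpha> (Pfun \<alpha> k n y)) \<and>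
       is_gp_projection \<alpha> (hfun \<alpha> k n) (Pfun \<alpha> k n y) \<and>
       (\<forall>p. is_gp_projection \<alpha> (hfun \<alpha> k n) p \<longrightarrow> (\<forall>x\<in>gp_int \<alpha>. p x = Pfun \<alpha> k n y x)) \<and>
       B2 \<alpha> k n y = gp_norm \<alpha> (Pfun \<alpha> k n y) \<and>
       standardized_record M X k n \<mu> \<sigma> \<le> B2 \<alpha> k n y \<and>
       (extremal_on (gp_dom \<alpha>) \<alpha> \<mu> \<sigma> (B2 \<alpha> k n y) (Pfun \<alpha> k n y) F \<longrightarrow>
          standardized_record M X k n \<mu> \<sigma> = B2 \<alpha> k n y) \<and>
       bound_attained (IGFR \<alpha>) (gp_dom \<alpha>) \<alpha> k n \<mu> \<sigma> (B2 \<alpha> k n y) (Pfun \<alpha> k n y)"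
proof -
  have bi: "\<beta> \<in> gp_int \<alpha>" unfolding \<beta>_def by (rule gp_inv_int[OF s0(1)])
  have mem: "y \<in> gp_int \<alpha>" "y \<in> gp_dom \<alpha>" "0 \<le> tau (gp_haz \<alpha> y)" "pw_ok y y (tail_mean y)"
    if "\<beta> \<le> y" "ereal y < gp_end \<alpha>" for y
  proof -
    show yi: "y \<in> gp_int \<alpha>" using that bi by (auto simp: gp_int_def)
    then show yd: "y \<in> gp_dom \<alpha>" using gp_int_subset_dom by auto
    have "s0 \<le> gp_haz \<alpha> y" using gp_haz_le_iff[of \<beta> \<alpha> y] bi yd that gp_int_subset_dom[of \<alpha>] by (auto simp: \<beta>_def)
    then show t: "0 \<le> tau (gp_haz \<alpha> y)" using s0(3,5) by (cases "s0 = gp_haz \<alpha> y") (auto intro: less_imp_le)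
    show "pw_ok y y (tail_mean y)" using yi t by (simp add: pw_ok_def)
  qed
  have norm: "gp_norm \<alpha> (Pfun \<alpha> k n y) = sqrt (gp_E \<alpha> (\<lambda>x. (pw y y (tail_mean y) (tail_mean y / intW \<alpha> y) x)\<^sup>2))"
    "gp_E \<alpha> (\<lambda>x. (pw y y (tail_mean y) (tail_mean y / intW \<alpha> y) x)\<^sup>2) =
       (tail_mean y / intW \<alpha> y)\<^sup>2 * (2 * y * intW \<alpha> y - 2 * intxW \<alpha> y - (intW \<alpha> y)\<^sup>2)"
    "(gp_cdf \<alpha> y - Ghat \<alpha> k n y) / ((1 - gp_cdf \<alpha> y) * intW \<alpha> y) = tail_mean y / intW \<alpha> y"
    if y: "\<beta> \<le> y" "ereal y < gp_end \<alpha>" for y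
  proof -
    note mem = mem[OF y]
    have w: "0 < intW \<alpha> y" by (rule intW_pos[OF mem(1)])
    show "gp_norm \<alpha> (Pfun \<alpha> k n y) = sqrt (gp_E \<alpha> (\<lambda>x. (pw y y (tail_mean y) (tail_mean y / intW \<alpha> y) x)\<^sup>2))"
      by (intro gp_norm_eq measurable_pw) (simp add: Pfun_pw[OF mem(2)])
    have "W * A\<^sup>2 - 2 * (A / w) * A * w + 2 * (A / w)\<^sup>2 * (y * w - z) + (1 - W) * A\<^sup>2 = (A / w)\<^sup>2 * (2 * y * w - 2 * z - w\<^sup>2)"
      if "0 < w" for W A w z :: real
    proof -
      have 1: "(A / w) * w = A" and 2: "(A / w)\<^sup>2 * w\<^sup>2 = A\<^sup>2" using that by (simp_all add: power_divide)
      have "(A / w)\<^sup>2 * (2 * y * w - 2 * z - w\<^sup>2) = 2 * (A / w)\<^sup>2 * (y * w - z) - (A / w)\<^sup>2 * w\<^sup>2" by (simp add: algebra_simps)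
      moreover have "2 * (A / w) * A * w = 2 * A * ((A / w) * w)" by simp
      ultimately show ?thesis unfolding 1 2 by (simp add: algebra_simps power2_eq_square)
    qed
    then show "gp_E \<alpha> (\<lambda>x. (pw y y (tail_mean y) (tail_mean y / intW \<alpha> y) x)\<^sup>2) =
       (tail_mean y / intW \<alpha> y)\<^sup>2 * (2 * y * intW \<alpha> y - 2 * intxW \<alpha> y - (intW \<alpha> y)\<^sup>2)"
      unfolding pw_norm[OF mem(4)] using w by simp
    show "(gp_cdf \<alpha> y - Ghat \<alpha> k n y) / ((1 - gp_cdf \<alpha> y) * intW \<alpha> y) = tail_mean y / intW \<alpha> y"
      unfolding divide_divide_eq_left[symmetric] tail_mean_eq(1)[OF mem(2)] ..
  qed
  show "\<forall>y. \<beta> \<le> y \<and> ereal y < gp_end \<alpha> \<longrightarrow>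
       (gp_norm \<alpha> (Pfun \<alpha> k n y))\<^sup>2 =
         ((gp_cdf \<alpha> y - Ghat \<alpha> k n y) / ((1 - gp_cdf \<alpha> y) * intW \<alpha> y))\<^sup>2 *
         (2 * y * intW \<alpha> y - 2 * intxW \<alpha> y - (intW \<alpha> y)\<^sup>2)"
  proof (intro allI impI)
    fix y assume "\<beta> \<le> y \<and> ereal y < gp_end \<alpha>"
    then have y: "\<beta> \<le> y" "ereal y < gp_end \<alpha>" by auto
    have "0 \<le> gp_E \<alpha> (\<lambda>x. (pw y y (tail_mean y) (tail_mean y / intW \<alpha> y) x)\<^sup>2)" by simp
    then show "(gp_norm \<alpha> (Pfun \<alpha> k n y))\<^sup>2 =
         ((gp_cdf \<alpha> y - Ghat \<alpha> k n y) / ((1 - gp_cdf \<alpha> y) * intW \<alpha> y))\<^sup>2 *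
         (2 * y * intW \<alpha> y - 2 * intxW \<alpha> y - (intW \<alpha> y)\<^sup>2)"
      unfolding norm(1)[OF y] norm(3)[OF y] norm(2)[OF y] by (rule real_sqrt_pow2)
  qed
  have Zeq: "y \<in> Zset \<alpha> k n \<beta> \<longleftrightarrow> \<beta> \<le> y \<and> ereal y < gp_end \<alpha> \<and>
      tail_mean y * (2 * y * intW \<alpha> y - 2 * intxW \<alpha> y - (intW \<alpha> y)\<^sup>2) = intW \<alpha> y * (intW \<alpha> y - intG \<alpha> k n y)" for y
  proof (cases "\<beta> \<le> y \<and> ereal y < gp_end \<alpha>")
    case True
    then have y: "\<beta> \<le> y" "ereal y < gp_end \<alpha>" by auto
    note mem = mem[OF y]
    let ?D = "2 * y * intW \<alpha> y - 2 * intxW \<alpha> y - (intW \<alpha> y)\<^sup>2"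
    have D: "0 < ?D" by (rule variance_pos[OF mem(1)])
    have De: "(2 * y - intW \<alpha> y) * intW \<alpha> y - 2 * intxW \<alpha> y = ?D" by (simp add: algebra_simps power2_eq_square)
    have W: "0 < 1 - gp_cdf \<alpha> y" using gp_cdf_less_1[of \<alpha> y] mem(1) by (simp add: gp_int_iff)
    have G: "Ghat \<alpha> k n y = gp_cdf \<alpha> y - (1 - gp_cdf \<alpha> y) * tail_mean y" using tail_mean_eq(2)[OF mem(2)] by simp
    have "g - w * t = g - w * q \<longleftrightarrow> t = q" if "0 < w" for g w t q :: real using that by simp
    note id = this[OF W]
    have "(Ghat \<alpha> k n y = gp_cdf \<alpha> y - (1 - gp_cdf \<alpha> y) * (intW \<alpha> y * (intW \<alpha> y - intG \<alpha> k n y) / ?D)) \<longleftrightarrow>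
       tail_mean y = intW \<alpha> y * (intW \<alpha> y - intG \<alpha> k n y) / ?D" unfolding G by (rule id)
    also have "\<dots> \<longleftrightarrow> tail_mean y * ?D = intW \<alpha> y * (intW \<alpha> y - intG \<alpha> k n y)" using D by (simp add: eq_divide_eq)
    finally show ?thesis unfolding Zset_def mem_Collect_eq De using True by simp
  qed (auto simp: Zset_def)
  obtain y where y: "\<beta> \<le> y" "y \<in> gp_int \<alpha>" "0 < tail_mean y"
    "tail_mean y * (2 * y * intW \<alpha> y - 2 * intxW \<alpha> y - (intW \<alpha> y)\<^sup>2) = intW \<alpha> y * (intW \<alpha> y - intG \<alpha> k n y)"
  proof (rule existence[OF sb s0(1,2,3)])
    fix z assume z: "gp_inv \<alpha> sb < z" "z < gp_inv \<alpha> s0" "slope (gp_haz \<alpha> z) \<le> lam \<alpha> k n z"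
    show "Zfun \<alpha> k n z \<noteq> 0"
    proof
      assume Z: "Zfun \<alpha> k n z = 0"
      have lt: "sb < s0" using z strict_mono_less[OF strict_mono_gp_inv, of \<alpha> sb s0] by simp
      have "0 < gp_inv \<alpha> sb" using sb gp_inv_int[of sb \<alpha>] by (auto simp: gp_int_iff infl_def)
      then have "z \<in> gp_dom \<alpha>" using gp_dom_below[of \<beta> \<alpha> z] bi gp_int_subset_dom[of \<alpha>] z by (auto simp: \<beta>_def)
      then have "z \<in> Yset \<alpha> k n (gp_inv \<alpha> sb) (gp_inv \<alpha> s0)"
        using z Z deriv_hfun[of z] by (simp add: Yset_def Yfun_def gp_dom_iff)
      then show False using none lt by blast
    qed
  qed (use s0(4,5) \<beta>_def in auto)
  have ye: "ereal y < gp_end \<alpha>" using y(2) by (simp add: gp_int_def)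
  have yZ: "y \<in> Zset \<alpha> k n \<beta>" using Zeq y ye by blast
  then show "Zset \<alpha> k n \<beta> \<noteq> {}" by blast
  note my = mem[OF y(1) ye]
  have w: "0 < intW \<alpha> y" by (rule intW_pos[OF y(2)])
  have m: "0 < tail_mean y / intW \<alpha> y" using y(3) w by simp
  let ?p = "\<lambda>z. pw z z (tail_mean z) (tail_mean z / intW \<alpha> z)"
  note R = pw_conclusion[OF sb my(4) m orth_tail[OF y(2,4)]]
  have tne: "tail_mean y \<noteq> 0" using y(3) by simp
  have R': "isoconc (?p y)" "cert isoconc (?p y)" "standardized_record M X k n \<mu> \<sigma> \<le> gp_norm \<alpha> (Pfun \<alpha> k n y)"
    "extremal_on (gp_dom \<alpha>) \<alpha> \<mu> \<sigma> (gp_norm \<alpha> (Pfun \<alpha> k n y)) (?p y) F \<Longrightarrow> standardized_record M X k n \<mu> \<sigma> = gp_norm \<alpha> (Pfun \<alpha> k n y)"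
    "bound_attained (IGFR \<alpha>) (gp_dom \<alpha>) \<alpha> k n \<mu> \<sigma> (gp_norm \<alpha> (Pfun \<alpha> k n y)) (?p y)"
    unfolding norm(1)[OF y(1) ye] using R(1,2,4,5,6) tne by auto
  note P = cert_projection[OF R'(2,1)]
  have B2: "B2 \<alpha> k n y = gp_norm \<alpha> (Pfun \<alpha> k n y)"
    unfolding norm(1)[OF y(1) ye] norm(2)[OF y(1) ye] B2_def norm(3)[OF y(1) ye] using m by (simp only: real_sqrt_mult real_sqrt_abs abs_of_pos)
  have uniq: "z = y" if z: "z \<in> Zset \<alpha> k n \<beta>" "Pfun \<alpha> k n z \<in> gp_cone \<alpha>" for z
  proof -
    have z': "\<beta> \<le> z" "ereal z < gp_end \<alpha>"
      "tail_mean z * (2 * z * intW \<alpha> z - 2 * intxW \<alpha> z - (intW \<alpha> z)\<^sup>2) = intW \<alpha> z * (intW \<alpha> z - intG \<alpha> k n z)"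
      using z(1) Zeq by auto
    note mz = mem[OF z'(1,2)]
    have pz: "Pfun \<alpha> k n z = ?p z" by (rule Pfun_pw[OF mz(2)])
    have z0: "0 < z" using mz(1) by (simp add: gp_int_iff)
    have ic: "isoconc (?p z)" using z(2) unfolding pz gp_cone_def by simp
    \<comment> \<open>Comparing the values at \<open>z / 2\<close> and at \<open>z\<close> turns
      monotonicity into a nonnegative slope.\<close>
    have "z / 2 \<in> gp_int \<alpha>" using gp_dom_below[OF mz(2), of "z / 2"] z0 by (simp add: gp_int_iff gp_dom_iff)
    then have "?p z (z / 2) \<le> ?p z z" using ic mz(1) z0 by (auto simp: mono_on_def)
    then have "tail_mean z / intW \<alpha> z * (z / 2 - z) \<le> 0" using z0 by (simp add: pw_def)
    then have m0: "0 \<le> tail_mean z / intW \<alpha> z" using z0 unfolding mult_le_0_iff by linarith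
    have cz: "cert isoconc (?p z)" using m0 by (intro cert_pw[OF sb mz(4) _ orth_tail[OF mz(1) z'(3)]]) simp
    have eq: "?p z x = ?p y x" if "x \<in> gp_int \<alpha>" for x
      using P(3)[OF cert_projection(2)[OF cz ic] that] .
    \<comment> \<open>From both break points on the functions are constant, so their tail means
      agree.\<close>
    have mx: "max y z \<in> gp_int \<alpha>" using y(2) mz(1) by (auto simp: max_def)
    have A: "tail_mean z = tail_mean y" using eq[OF mx] by (simp add: pw_def)
    have mzp: "0 < tail_mean z / intW \<alpha> z" using y(3) intW_pos[OF mz(1)] unfolding A by simp
    show "z = y"
    proof (rule ccontr)
      assume ne: "z \<noteq> y"
      define lo where "lo = min y z"
      have lo: "lo \<in> gp_int \<alpha>" "lo < max y z" using y(2) mz(1) ne by (auto simp: lo_def min_def)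
      have "?p y lo = ?p y (max y z) \<or> ?p z lo = ?p z (max y z)" by (auto simp: lo_def pw_def min_def max_def)
      then have "?p y lo = ?p y (max y z)" "?p z lo = ?p z (max y z)" using eq[OF lo(1)] eq[OF mx] by auto
      moreover have "?p z lo < ?p z (max y z) \<or> ?p y lo < ?p y (max y z)"
      proof (cases "y < z")
        case True
        then have "?p z lo < tail_mean z" using mult_pos_neg[OF mzp, of "y - z"] by (simp add: pw_def lo_def)
        then show ?thesis using True by (simp add: pw_def)
      next
        case False
        then have lt: "z < y" using ne by simp
        then have "?p y lo < tail_mean y" using mult_pos_neg[OF m, of "z - y"] by (simp add: pw_def lo_def)
        then show ?thesis using lt by (simp add: pw_def)
      qed
      ultimately show False by linarith
    qed
  qed
  have py: "Pfun \<alpha> k n y = ?p y" by (rule Pfun_pw[OF my(2)])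
  show "\<exists>y\<in>Zset \<alpha> k n \<beta>. Pfun \<alpha> k n y \<in> gp_cone \<alpha> \<and>
       (\<forall>z\<in>Zset \<alpha> k n \<beta>. Pfun \<alpha> k n z \<in> gp_cone \<alpha> \<and> z \<noteq> y \<longrightarrow>
          gp_norm \<alpha> (Pfun \<alpha> k n z) < gp_norm \<alpha> (Pfun \<alpha> k n y)) \<and>
       is_gp_projection \<alpha> (hfun \<alpha> k n) (Pfun \<alpha> k n y) \<and>
       (\<forall>p. is_gp_projection \<alpha> (hfun \<alpha> k n) p \<longrightarrow> (\<forall>x\<in>gp_int \<alpha>. p x = Pfun \<alpha> k n y x)) \<and>
       B2 \<alpha> k n y = gp_norm \<alpha> (Pfun \<alpha> k n y) \<and>
       standardized_record M X k n \<mu> \<sigma> \<le> B2 \<alpha> k n y \<and>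
       (extremal_on (gp_dom \<alpha>) \<alpha> \<mu> \<sigma> (B2 \<alpha> k n y) (Pfun \<alpha> k n y) F \<longrightarrow>
          standardized_record M X k n \<mu> \<sigma> = B2 \<alpha> k n y) \<and>
       bound_attained (IGFR \<alpha>) (gp_dom \<alpha>) \<alpha> k n \<mu> \<sigma> (B2 \<alpha> k n y) (Pfun \<alpha> k n y)"
  proof (intro bexI[OF _ yZ] conjI)
    show "Pfun \<alpha> k n y \<in> gp_cone \<alpha>" unfolding py by (rule P(1))
    \<comment> \<open>By \<open>uniq\<close> there is no competitor, so the strict inequality holds
      vacuously.\<close>
    show "\<forall>z\<in>Zset \<alpha> k n \<beta>. Pfun \<alpha> k n z \<in> gp_cone \<alpha> \<and> z \<noteq> y \<longrightarrow>
          gp_norm \<alpha> (Pfun \<alpha> k n z) < gp_norm \<alpha> (Pfun \<alpha> k n y)" using uniq by blast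
    show "is_gp_projection \<alpha> (hfun \<alpha> k n) (Pfun \<alpha> k n y)" unfolding py by (rule P(2))
    show "\<forall>p. is_gp_projection \<alpha> (hfun \<alpha> k n) p \<longrightarrow> (\<forall>x\<in>gp_int \<alpha>. p x = Pfun \<alpha> k n y x)" unfolding py using P(3) by blast
    show "B2 \<alpha> k n y = gp_norm \<alpha> (Pfun \<alpha> k n y)" by (rule B2)
    show "standardized_record M X k n \<mu> \<sigma> \<le> B2 \<alpha> k n y" unfolding B2 by (rule R'(3))
    show "extremal_on (gp_dom \<alpha>) \<alpha> \<mu> \<sigma> (B2 \<alpha> k n y) (Pfun \<alpha> k n y) F \<longrightarrow> standardized_record M X k n \<mu> \<sigma> = B2 \<alpha> k n y"
      using R'(4) unfolding B2 py by blast
    show "bound_attained (IGFR \<alpha>) (gp_dom \<alpha>) \<alpha> k n \<mu> \<sigma> (B2 \<alpha> k n y) (Pfun \<alpha> k n y)"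
      using R'(5) unfolding B2 py .
  qed
qed

end

end

text \<open>The points \<open>b\<close>, \<open>c\<close> and \<open>\<beta>\<close> are bound
  existentially together with the conditions that determine them. A projection is determined only up
  to its value at 0, hence its comparison with \<open>Pfun\<close> on \<open>gp_int\<close>.\<close>

theorem proposition4:
  fixes \<alpha> \<mu> \<sigma> :: real and k n :: nat
    and F :: "real \<Rightarrow> real" and M :: "'a measure" and X :: "nat \<Rightarrow> 'a \<Rightarrow> real"
  assumes "\<alpha> > - 1 / 2" and "k \<ge> 2" and "n \<ge> 1"
    and "F \<in> IGFR \<alpha>"
    and "iid_sequence M X F"
    and "has_mean_variance M (X 1) \<mu> (\<sigma>\<^sup>2)" and "\<sigma> > 0"
  shows
    "integrable M (\<lambda>\<omega>. record_value k n (\<lambda>i. X i \<omega>)) \<and>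
     (n = 1 \<and> (\<alpha> \<le> 0 \<or> 0 < \<alpha> \<and> \<alpha> \<le> 2 * real k - 1) \<longrightarrow>
        (let B = B0 \<alpha> k (beta0 \<alpha> k); \<phi> = phi0 \<alpha> k (beta0 \<alpha> k) in
           standardized_record M X k 1 \<mu> \<sigma> \<le> B \<and>
           (extremal_on (gp_supp \<alpha>) \<alpha> \<mu> \<sigma> B \<phi> F \<longrightarrow> standardized_record M X k 1 \<mu> \<sigma> = B) \<and>
           bound_attained UNIV (gp_supp \<alpha>) \<alpha> k 1 \<mu> \<sigma> B \<phi> \<and>
           (\<alpha> \<le> 2 * real k - 2 \<longrightarrow> bound_attained (IGFR \<alpha>) (gp_supp \<alpha>) \<alpha> k 1 \<mu> \<sigma> B \<phi>))) \<and>
     ((\<alpha> \<le> 0 \<and> n \<ge> 2) \<or> (\<alpha> > 0 \<and> n = 1 \<and> real k < \<alpha> / 2 + 1) \<or> (\<alpha> > 0 \<and> n \<ge> 2) \<longrightarrow>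
        (\<exists>b c \<beta>. shape_points \<alpha> k n b c \<and>
           \<beta> \<in> {0<..<c} \<and> Tfun \<alpha> k n \<beta> = 0 \<and> (\<forall>\<beta>'\<in>{0<..<c}. Tfun \<alpha> k n \<beta>' = 0 \<longrightarrow> \<beta>' = \<beta>) \<and>
           (if Tfun \<alpha> k n b < 0 \<and> Yset \<alpha> k n b \<beta> \<noteq> {} then
              (let y = Inf (Yset \<alpha> k n b \<beta>); B = B1 \<alpha> k n y \<beta>; \<phi> = phi1 \<alpha> k n y \<beta> in
                 standardized_record M X k n \<mu> \<sigma> \<le> B \<and>
                 (extremal_on (gp_dom \<alpha>) \<alpha> \<mu> \<sigma> B \<phi> F \<longrightarrow> standardized_record M X k n \<mu> \<sigma> = B) \<and>
                 bound_attained (IGFR \<alpha>) (gp_dom \<alpha>) \<alpha> k n \<mu> \<sigma> B \<phi>)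
            else
              (\<forall>y. \<beta> \<le> y \<and> ereal y < gp_end \<alpha> \<longrightarrow>
                 (gp_norm \<alpha> (Pfun \<alpha> k n y))\<^sup>2 =
                   ((gp_cdf \<alpha> y - Ghat \<alpha> k n y) / ((1 - gp_cdf \<alpha> y) * intW \<alpha> y))\<^sup>2 *
                   (2 * y * intW \<alpha> y - 2 * intxW \<alpha> y - (intW \<alpha> y)\<^sup>2)) \<and>
              Zset \<alpha> k n \<beta> \<noteq> {} \<and>
              (\<exists>y\<in>Zset \<alpha> k n \<beta>. Pfun \<alpha> k n y \<in> gp_cone \<alpha> \<and>
                 (\<forall>z\<in>Zset \<alpha> k n \<beta>. Pfun \<alpha> k n z \<in> gp_cone \<alpha> \<and> z \<noteq> y \<longrightarrow>
                    gp_norm \<alpha> (Pfun \<alpha> k n z) < gp_norm \<alpha> (Pfun \<alpha> k n y)) \<and>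
                 is_gp_projection \<alpha> (hfun \<alpha> k n) (Pfun \<alpha> k n y) \<and>
                 (\<forall>p. is_gp_projection \<alpha> (hfun \<alpha> k n) p \<longrightarrow> (\<forall>x\<in>gp_int \<alpha>. p x = Pfun \<alpha> k n y x)) \<and>
                 B2 \<alpha> k n y = gp_norm \<alpha> (Pfun \<alpha> k n y) \<and>
                 standardized_record M X k n \<mu> \<sigma> \<le> B2 \<alpha> k n y \<and>
                 (extremal_on (gp_dom \<alpha>) \<alpha> \<mu> \<sigma> (B2 \<alpha> k n y) (Pfun \<alpha> k n y) F \<longrightarrow>
                    standardized_record M X k n \<mu> \<sigma> = B2 \<alpha> k n y) \<and>
                 bound_attained (IGFR \<alpha>) (gp_dom \<alpha>) \<alpha> k n \<mu> \<sigma> (B2 \<alpha> k n y) (Pfun \<alpha> k n y)))))"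
  (is "_ \<and> (_ \<longrightarrow> ?one) \<and> (_ \<longrightarrow> (\<exists>b c \<beta>. ?two b c \<beta>))")
proof -
  interpret R: gp_record \<alpha> k n by standard (use assms in auto)
  note data = assms(4) assms(5) assms(6) assms(7)
  have I: "integrable M (\<lambda>\<omega>. record_value k n (\<lambda>i. X i \<omega>))" by (rule R.record_integrable[OF data])
  have one: ?one if "n = 1"
    using R.case_one[OF data that] by (simp only: Let_def) blast
  have two: "\<exists>b c \<beta>. ?two b c \<beta>"
    if "(\<alpha> \<le> 0 \<and> n \<ge> 2) \<or> (\<alpha> > 0 \<and> n = 1 \<and> real k < \<alpha> / 2 + 1) \<or> (\<alpha> > 0 \<and> n \<ge> 2)"
  proof -
    have "n \<ge> 2 \<or> (n = 1 \<and> \<alpha> > 2 * real k - 2)" using that by auto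
    from R.curv_case2[OF this] obtain sb where sb: "R.infl sb" unfolding R.infl_def by metis
    obtain s0 where s0: "0 < s0" "s0 < R.crit" "R.tau s0 = 0" "\<And>s. 0 \<le> s \<Longrightarrow> s < s0 \<Longrightarrow> R.tau s < 0" "\<And>s. s0 < s \<Longrightarrow> 0 < R.tau s"
      using R.tau_zero by blast
    let ?b = "gp_inv \<alpha> sb" and ?\<beta> = "gp_inv \<alpha> s0"
    have cd: "R.cx \<in> gp_dom \<alpha>" using R.cx_int gp_int_subset_dom by auto
    have bc: "?\<beta> \<in> {0<..<R.cx}"
      using gp_inv_int[OF s0(1), of \<alpha>] strict_monoD[OF strict_mono_gp_inv s0(2), of \<alpha>] by (auto simp: R.cx_def gp_int_iff)
    have T: "Tfun \<alpha> k n x = (1 - gp_cdf \<alpha> x) * (exp (- R.kappa * gp_haz \<alpha> x) * R.tau (gp_haz \<alpha> x))" "0 < 1 - gp_cdf \<alpha> x"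
      if "x \<in> gp_dom \<alpha>" for x
      using R.Tfun_tau[of x] gp_cdf_less_1[of \<alpha> x] that by (auto simp: gp_dom_iff)
    have T0: "Tfun \<alpha> k n ?\<beta> = 0" using T(1)[of ?\<beta>] gp_inv_dom[of s0 \<alpha>] s0 by simp
    have Tu: "\<beta>' = ?\<beta>" if b: "\<beta>' \<in> {0<..<R.cx}" "Tfun \<alpha> k n \<beta>' = 0" for \<beta>'
    proof -
      have d: "\<beta>' \<in> gp_dom \<alpha>" using gp_dom_below[OF cd, of \<beta>'] b by auto
      have "R.tau (gp_haz \<alpha> \<beta>') = 0" using T[OF d] b(2) by simp
      then have "gp_haz \<alpha> \<beta>' = s0" using s0(4)[of "gp_haz \<alpha> \<beta>'"] s0(5)[of "gp_haz \<alpha> \<beta>'"] gp_haz_nonneg[OF d]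
        by (cases "gp_haz \<alpha> \<beta>'" s0 rule: linorder_cases) auto
      then show ?thesis using gp_inv_haz[of \<alpha> \<beta>'] d by (auto simp: gp_dom_iff)
    qed
    have sp: "0 < sb" using sb by (simp add: R.infl_def)
    \<comment> \<open>\<open>T\<close> is negative at \<open>b\<close> exactly when \<open>b\<close>
      precedes \<open>\<beta>\<close>. This translates the case distinction of the theorem into the
      hypothesis of \<open>case_two_B\<close>.\<close>
    have Tb: "Tfun \<alpha> k n ?b < 0 \<longleftrightarrow> sb < s0"
    proof -
      have "?b \<in> gp_dom \<alpha>" using sp by (intro gp_inv_dom) simp
      from T[OF this] have "Tfun \<alpha> k n ?b < 0 \<longleftrightarrow> R.tau sb < 0" by (simp add: mult_less_0_iff)
      also have "\<dots> \<longleftrightarrow> sb < s0" using s0(3) s0(4)[of sb] s0(5)[of sb] sp by (cases sb s0 rule: linorder_cases) auto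
      finally show ?thesis .
    qed
    have TU: "\<forall>\<beta>'\<in>{0<..<R.cx}. Tfun \<alpha> k n \<beta>' = 0 \<longrightarrow> \<beta>' = ?\<beta>" using Tu by blast
    note shape = R.shape_points_infl[OF data sb] bc T0 TU
    have "?two ?b R.cx ?\<beta>"
    proof (cases "Tfun \<alpha> k n ?b < 0 \<and> Yset \<alpha> k n ?b ?\<beta> \<noteq> {}")
      case True
      note A = R.case_two_A[OF data sb s0(1,2,3) _ _ conjunct2[OF True]]
      show ?thesis unfolding if_P[OF True] Let_def
        by (intro conjI impI; (rule shape | (rule A; (rule s0 | assumption)+)))
    next
      case False
      then have "\<not> (sb < s0 \<and> Yset \<alpha> k n ?b ?\<beta> \<noteq> {})" using Tb by blast
      note B = R.case_two_B[OF data sb s0(1,2,3) _ _ this]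
      show ?thesis unfolding if_not_P[OF False]
        by (intro conjI; (rule shape | (rule B; (rule s0 | assumption)+)))
    qed
    then show ?thesis by blast
  qed
  show ?thesis
    by (rule conjI[OF I conjI[OF impI impI]], rule one, erule conjunct1, rule two)
qed

end
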